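(* For every SP $(A,S)$ there exist a trivial SP $(A_{\rm triv},S_{\rm triv})$ and a reduced SP $(A_{\rm red},S_{\rm red})$ such that $(A,S)$ is right-equivalent to the direct sum $(A_{\rm triv},S_{\rm triv})\oplus(A_{\rm red},S_{\rm red})$. Furthermore, the right-equivalence class of each of $(A_{\rm triv},S_{\rm triv})$ and $(A_{\rm red},S_{\rm red})$ is determined by the right-equivalence class of $(A,S)$.
   Context: Standing setup: strongly primitive weighted quivers $(Q,\mathbf d)$ (finite loop-free quiver, pairwise coprime positive integer weights $d_i$); $d=\operatorname{lcm}(d_i)$; $F$ a field with a primitive $d$-th root of unity; $E/F$ cyclic Galois of degree $d$; $F_i$ the degree-$d_i$ subextension, with fixed eigenbasis $\mathcal B_i$; $R=\bigoplus F_i$; arrow span $A=\bigoplus_{i,j}\bigoplus_{a:j\to i}F_i\otimes_FF_j$; complete path algebra $R\langle\langle A\rangle\rangle=\prod_{\ell\ge0}A^\ell$. Potentials: possibly infinite $F$-combinations of cyclic paths $\omega_0a_1\omega_1\cdots a_\ell\omega_\ell$; cyclic equivalence modulo the closure of the span of the differences $\omega_0a_1\omega_1\cdots a_\ell\omega_\ell-\omega_1a_2\cdots a_\ell\omega_\ell\omega_0a_1$; cyclic derivatives $\partial_a$. An SP is a pair $(A,S)$ with no two different terms of $S$ cyclically equivalent. A right-equivalence $(A,S)\to(A',S')$ (weighted quivers on the same vertices and weights) is an $R$-algebra isomorphism $\varphi:R\langle\langle A\rangle\rangle\to R\langle\langle A'\rangle\rangle$ (identity on $R$) with $\varphi(S)$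 cyclically equivalent to $S'$. $(A,S)$ is trivial if $S\in A^2$ and the $R$-$R$-bimodule generated by the $\partial_aS$ is $A$; reduced if the degree-2 component $S^{(2)}$ of $S$ is zero. The direct sum is $(A,S)\oplus(A',S')=(A\oplus A',S+S')$. *)

theory Defs
  imports Main "HOL-Library.Function_Algebras" "HOL-Computational_Algebra.Primes"
begin

definition is_subfield :: "'e::field set \<Rightarrow> bool" where
  "is_subfield K \<longleftrightarrow> 0 \<in> K \<and> 1 \<in> K \<and>
     (\<forall>x\<in>K. \<forall>y\<in>K. x + y \<in> K \<and> x - y \<in> K \<and> x * y \<in> K) \<and>
     (\<forall>x\<in>K. - x \<in> K \<and> inverse x \<in> K)"

definition is_basis :: "'e::field set \<Rightarrow> 'e set \<Rightarrow> 'e set \<Rightarrow> bool" where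
  "is_basis F K Bs \<longleftrightarrow> finite Bs \<and> Bs \<subseteq> K \<and>
     (\<forall>x\<in>K. \<exists>!l. (\<forall>c. l c \<in> F) \<and> (\<forall>c. c \<notin> Bs \<longrightarrow> l c = 0) \<and> x = (\<Sum>c\<in>Bs. l c * c))"

definition ext_deg :: "'e::field set \<Rightarrow> 'e set \<Rightarrow> nat \<Rightarrow> bool" where
  "ext_deg F K n \<longleftrightarrow> (\<exists>Bs. is_basis F K Bs \<and> card Bs = n)"

definition field_auts :: "'e::field set \<Rightarrow> ('e \<Rightarrow> 'e) set" where
  "field_auts F = {\<phi>. bij \<phi> \<and> (\<forall>x y. \<phi> (x + y) = \<phi> x + \<phi> y \<and> \<phi> (x * y) = \<phi> x * \<phi> y)
                      \<and> \<phi> 1 = 1 \<and> (\<forall>x\<in>F. \<phi> x = x)}"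

definition cyclic_galois :: "'e::field set \<Rightarrow> nat \<Rightarrow> bool" where
  "cyclic_galois F n \<longleftrightarrow> ext_deg F UNIV n \<and> finite (field_auts F) \<and> card (field_auts F) = n \<and>
     (\<exists>\<sigma>\<in>field_auts F. field_auts F = range (\<lambda>k. \<sigma> ^^ k))"

definition prim_root :: "'e::field set \<Rightarrow> 'e \<Rightarrow> nat \<Rightarrow> bool" where
  "prim_root F z n \<longleftrightarrow> z \<in> F \<and> z ^ n = 1 \<and> (\<forall>k. 0 < k \<longrightarrow> k < n \<longrightarrow> z ^ k \<noteq> 1)"

definition sp_setup :: "'e::field set \<Rightarrow> ('v::finite \<Rightarrow> nat) \<Rightarrow> ('v \<Rightarrow> 'e set) \<Rightarrow> ('v \<Rightarrow> 'e set) \<Rightarrow> bool" where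
  "sp_setup F d Fi B \<longleftrightarrow> is_subfield F \<and> (\<forall>v. 0 < d v) \<and> (\<forall>v w. v \<noteq> w \<longrightarrow> coprime (d v) (d w)) \<and>
     (\<exists>z. prim_root F z (Lcm (range d))) \<and> cyclic_galois F (Lcm (range d)) \<and>
     (\<forall>v. is_subfield (Fi v) \<and> F \<subseteq> Fi v \<and> ext_deg F (Fi v) (d v)) \<and>
     (\<forall>v. is_basis F (Fi v) (B v) \<and> (\<forall>\<phi>\<in>field_auts F. \<forall>b\<in>B v. \<exists>l\<in>F. \<phi> b = l * b))"

definition coord :: "'e::field set \<Rightarrow> 'e set \<Rightarrow> 'e \<Rightarrow> 'e \<Rightarrow> 'e" where
  "coord F Bs x = (THE l. (\<forall>c. l c \<in> F) \<and> (\<forall>c. c \<notin> Bs \<longrightarrow> l c = 0) \<and> x = (\<Sum>c\<in>Bs. l c * c))"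

record 'v wquiver =
  arrs :: "nat set"
  src :: "nat \<Rightarrow> 'v"
  tgt :: "nat \<Rightarrow> 'v"

definition wq :: "'v wquiver \<Rightarrow> bool" where
  "wq Q \<longleftrightarrow> finite (arrs Q) \<and> (\<forall>a\<in>arrs Q. src Q a \<noteq> tgt Q a)"

definition dsumQ :: "'v wquiver \<Rightarrow> 'v wquiver \<Rightarrow> 'v wquiver" where
  "dsumQ Q Q' = \<lparr>arrs = arrs Q \<union> arrs Q',
      src = (\<lambda>a. if a \<in> arrs Q then src Q a else src Q' a),
      tgt = (\<lambda>a. if a \<in> arrs Q then tgt Q a else tgt Q' a)\<rparr>"

text \<open>A basis path \<omega>0 a1 \<omega>1 ... al \<omega>l is encoded as (v0, \<omega>0, [(a1,\<omega>1),...,(al,\<omega>l)]),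
  a_k : v_k \<rightarrow> v_(k-1), \<omega>_k \<in> B v_k. Elements of R<<A>> are coefficient functions on basis paths.\<close>

type_synonym ('v,'e) bpath = "'v \<times> 'e \<times> (nat \<times> 'e) list"
type_synonym ('v,'e) pelt = "('v,'e) bpath \<Rightarrow> 'e"

fun vchain :: "'v wquiver \<Rightarrow> ('v \<Rightarrow> 'e set) \<Rightarrow> 'v \<Rightarrow> (nat \<times> 'e) list \<Rightarrow> bool" where
  "vchain Q B v [] = True"
| "vchain Q B v ((a,c) # L) = (a \<in> arrs Q \<and> tgt Q a = v \<and> c \<in> B (src Q a) \<and> vchain Q B (src Q a) L)"

fun achain :: "'v wquiver \<Rightarrow> 'v \<Rightarrow> nat list \<Rightarrow> bool" where
  "achain Q v [] = True"
| "achain Q v (a # L) = (a \<in> arrs Q \<and> tgt Q a = v \<and> achain Q (src Q a) L)"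

definition valid :: "'v wquiver \<Rightarrow> ('v \<Rightarrow> 'e set) \<Rightarrow> ('v,'e) bpath \<Rightarrow> bool" where
  "valid Q B p = (case p of (v, b, L) \<Rightarrow> b \<in> B v \<and> vchain Q B v L)"

definition plen :: "('v,'e) bpath \<Rightarrow> nat" where
  "plen p = length (snd (snd p))"

definition endv :: "'v wquiver \<Rightarrow> ('v,'e) bpath \<Rightarrow> 'v" where
  "endv Q p = (case p of (v, b, L) \<Rightarrow> if L = [] then v else src Q (fst (last L)))"

definition lastel :: "('v,'e) bpath \<Rightarrow> 'e" where
  "lastel p = (case p of (v, b, L) \<Rightarrow> if L = [] then b else snd (last L))"

definition is_cyclic :: "'v wquiver \<Rightarrow> ('v \<Rightarrow> 'e set) \<Rightarrow> ('v,'e) bpath \<Rightarrow> bool" where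
  "is_cyclic Q B p \<longleftrightarrow> valid Q B p \<and> plen p \<noteq> 0 \<and> endv Q p = fst p"

definition paths_len :: "'v wquiver \<Rightarrow> ('v \<Rightarrow> 'e set) \<Rightarrow> nat \<Rightarrow> ('v,'e) bpath set" where
  "paths_len Q B n = {p. valid Q B p \<and> plen p = n}"

definition PA :: "'v wquiver \<Rightarrow> 'e::field set \<Rightarrow> ('v \<Rightarrow> 'e set) \<Rightarrow> ('v,'e) pelt set" where
  "PA Q F B = {x. (\<forall>p. x p \<in> F) \<and> (\<forall>p. \<not> valid Q B p \<longrightarrow> x p = 0)}"

definition inR :: "('v,'e::field) pelt \<Rightarrow> bool" where
  "inR x \<longleftrightarrow> (\<forall>p. plen p \<noteq> 0 \<longrightarrow> x p = 0)"

definition catp :: "('v,'e) bpath \<Rightarrow> 'e \<Rightarrow> (nat \<times> 'e) list \<Rightarrow> ('v,'e) bpath" where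
  "catp p c L' = (case p of (v, b, L) \<Rightarrow>
     if L = [] then (v, c, L') else (v, b, butlast L @ [(fst (last L), c)] @ L'))"

definition mulcoef :: "'v wquiver \<Rightarrow> 'e::field set \<Rightarrow> ('v \<Rightarrow> 'e set) \<Rightarrow>
    ('v,'e) bpath \<Rightarrow> ('v,'e) bpath \<Rightarrow> ('v,'e) bpath \<Rightarrow> 'e" where
  "mulcoef Q F B p q r = (case q of (v', b', L') \<Rightarrow>
     if endv Q p = v' then
       (\<Sum>c\<in>B v'. if r = catp p c L' then coord F (B v') (lastel p * b') c else 0)
     else 0)"

definition pmult :: "'v wquiver \<Rightarrow> 'e::field set \<Rightarrow> ('v \<Rightarrow> 'e set) \<Rightarrow>
    ('v,'e) pelt \<Rightarrow> ('v,'e) pelt \<Rightarrow> ('v,'e) pelt" where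
  "pmult Q F B x y = (\<lambda>r. if valid Q B r then
      (\<Sum>k\<in>{0..plen r}. \<Sum>p\<in>paths_len Q B k. \<Sum>q\<in>paths_len Q B (plen r - k).
          x p * y q * mulcoef Q F B p q r)
     else 0)"

text \<open>The element \<omega>0 a1 \<omega>1 ... al \<omega>l for arbitrary \<omega>_k \<in> F_(v_k), expanded in basis paths.\<close>
definition tensel :: "'v wquiver \<Rightarrow> 'e::field set \<Rightarrow> ('v \<Rightarrow> 'e set) \<Rightarrow>
    'v \<Rightarrow> 'e \<Rightarrow> (nat \<times> 'e) list \<Rightarrow> ('v,'e) pelt" where
  "tensel Q F B v w0 L = (\<lambda>(u, c0, M).
     if u = v \<and> map fst M = map fst L \<and> c0 \<in> B v \<and> vchain Q B v M then
       coord F (B v) w0 c0 *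
       (\<Prod>k<length L. coord F (B (src Q (fst (L ! k)))) (snd (L ! k)) (snd (M ! k)))
     else 0)"

fun rot1 :: "'e::field \<times> (nat \<times> 'e) list \<Rightarrow> 'e \<times> (nat \<times> 'e) list" where
  "rot1 (w0, []) = (w0, [])"
| "rot1 (w0, (a1, w1) # R) =
     (if R = [] then (w1 * w0, [(a1, 1)])
      else (w1, butlast R @ [(fst (last R), snd (last R) * w0), (a1, 1)]))"

definition cycgens :: "'v wquiver \<Rightarrow> 'e::field set \<Rightarrow> ('v \<Rightarrow> 'e set) \<Rightarrow> ('v \<Rightarrow> 'e set) \<Rightarrow> ('v,'e) pelt set" where
  "cycgens Q F Fi B = {tensel Q F B v w0 L -
        tensel Q F B (src Q (fst (hd L))) (fst (rot1 (w0, L))) (snd (rot1 (w0, L))) | v w0 L.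
      L \<noteq> [] \<and> achain Q v (map fst L) \<and> src Q (fst (last L)) = v \<and> w0 \<in> Fi v \<and>
      (\<forall>k<length L. snd (L ! k) \<in> Fi (src Q (fst (L ! k))))}"

definition Fspan :: "'e::field set \<Rightarrow> ('v,'e) pelt set \<Rightarrow> ('v,'e) pelt set" where
  "Fspan F X = {sum_list (map (\<lambda>(c, x). (\<lambda>p. c * x p)) l) | l. set l \<subseteq> F \<times> X}"

definition madic_closure :: "('v,'e::field) pelt set \<Rightarrow> ('v,'e) pelt set" where
  "madic_closure X = {x. \<forall>n. \<exists>u\<in>X. \<forall>p. plen p < n \<longrightarrow> x p = u p}"

definition cyc_equiv :: "'v wquiver \<Rightarrow> 'e::field set \<Rightarrow> ('v \<Rightarrow> 'e set) \<Rightarrow> ('v \<Rightarrow> 'e set) \<Rightarrow>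
    ('v,'e) pelt \<Rightarrow> ('v,'e) pelt \<Rightarrow> bool" where
  "cyc_equiv Q F Fi B x y \<longleftrightarrow> x - y \<in> madic_closure (Fspan F (cycgens Q F Fi B))"

definition delta :: "('v,'e) bpath \<Rightarrow> ('v,'e::field) pelt" where
  "delta p = (\<lambda>q. if q = p then 1 else 0)"

definition is_potential :: "'v wquiver \<Rightarrow> 'e::field set \<Rightarrow> ('v \<Rightarrow> 'e set) \<Rightarrow> ('v,'e) pelt \<Rightarrow> bool" where
  "is_potential Q F B S \<longleftrightarrow> S \<in> PA Q F B \<and> (\<forall>p. S p \<noteq> 0 \<longrightarrow> is_cyclic Q B p)"

definition is_SP :: "'v wquiver \<Rightarrow> 'e::field set \<Rightarrow> ('v \<Rightarrow> 'e set) \<Rightarrow> ('v \<Rightarrow> 'e set) \<Rightarrow> ('v,'e) pelt \<Rightarrow> bool" where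
  "is_SP Q F Fi B S \<longleftrightarrow> wq Q \<and> is_potential Q F B S \<and>
     (\<forall>p q. S p \<noteq> 0 \<longrightarrow> S q \<noteq> 0 \<longrightarrow> p \<noteq> q \<longrightarrow>
        \<not> (\<exists>c\<in>F. c \<noteq> 0 \<and> cyc_equiv Q F Fi B (delta p) (\<lambda>r. c * delta q r)))"

definition cder_path :: "'v wquiver \<Rightarrow> 'e::field set \<Rightarrow> ('v \<Rightarrow> 'e set) \<Rightarrow> nat \<Rightarrow> ('v,'e) bpath \<Rightarrow> ('v,'e) pelt" where
  "cder_path Q F B a p = (case p of (v, b, L) \<Rightarrow>
     (\<Sum>k\<in>{1..length L}. if fst (L ! (k - 1)) = a then
        tensel Q F B (src Q a) (fst ((rot1 ^^ k) (b, L))) (butlast (snd ((rot1 ^^ k) (b, L))))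
      else 0))"

definition cder :: "'v wquiver \<Rightarrow> 'e::field set \<Rightarrow> ('v \<Rightarrow> 'e set) \<Rightarrow> nat \<Rightarrow> ('v,'e) pelt \<Rightarrow> ('v,'e) pelt" where
  "cder Q F B a S = (\<lambda>r. \<Sum>p\<in>paths_len Q B (plen r + 1). S p * cder_path Q F B a p r)"

definition bimod_gen :: "'v wquiver \<Rightarrow> 'e::field set \<Rightarrow> ('v \<Rightarrow> 'e set) \<Rightarrow> ('v,'e) pelt set \<Rightarrow> ('v,'e) pelt set" where
  "bimod_gen Q F B X = {sum_list (map (\<lambda>(r, x, r'). pmult Q F B (pmult Q F B r x) r') l) | l.
      set l \<subseteq> {r\<in>PA Q F B. inR r} \<times> X \<times> {r\<in>PA Q F B. inR r}}"

definition is_trivial :: "'v wquiver \<Rightarrow> 'e::field set \<Rightarrow> ('v \<Rightarrow> 'e set) \<Rightarrow> ('v,'e) pelt \<Rightarrow> bool" where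
  "is_trivial Q F B S \<longleftrightarrow> (\<forall>p. plen p \<noteq> 2 \<longrightarrow> S p = 0) \<and>
     bimod_gen Q F B {cder Q F B a S | a. a \<in> arrs Q} = {x\<in>PA Q F B. \<forall>p. plen p \<noteq> 1 \<longrightarrow> x p = 0}"

definition is_reduced :: "('v,'e::field) pelt \<Rightarrow> bool" where
  "is_reduced S \<longleftrightarrow> (\<forall>p. plen p = 2 \<longrightarrow> S p = 0)"

definition right_equiv :: "'e::field set \<Rightarrow> ('v \<Rightarrow> 'e set) \<Rightarrow> ('v \<Rightarrow> 'e set) \<Rightarrow>
    'v wquiver \<Rightarrow> ('v,'e) pelt \<Rightarrow> 'v wquiver \<Rightarrow> ('v,'e) pelt \<Rightarrow> bool" where
  "right_equiv F Fi B Q S Q' S' \<longleftrightarrow> (\<exists>\<phi>. bij_betw \<phi> (PA Q F B) (PA Q' F B) \<and>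
     (\<forall>x\<in>PA Q F B. \<forall>y\<in>PA Q F B. \<phi> (x + y) = \<phi> x + \<phi> y \<and>
         \<phi> (pmult Q F B x y) = pmult Q' F B (\<phi> x) (\<phi> y)) \<and>
     (\<forall>x\<in>PA Q F B. inR x \<longrightarrow> \<phi> x = x) \<and>
     cyc_equiv Q' F Fi B (\<phi> S) S')"

end

theory Submission
  imports Defs "HOL-Algebra.Finite_Extensions"
begin

text \<open>
  Existence. Because the weights are pairwise coprime and the quiver has no loops, each
  $F_i \otimes_F F_j$ with $i \neq j$ is a field, the compositum $F_i F_j$ inside $E$. Hence the degree-2
  part of a potential is, up to cyclic equivalence, a matrix over such fields, and pivoting by linear
  substitutions of arrows brings it to the form $q = \sum y z$ with disjoint pairs of arrows. Substituting
  $a \mapsto a + h_a$ on the paired arrows then removes all higher terms containing a paired arrow at once: the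
  condition on $h$ is a contracting fixed-point equation for the path-length filtration.

  Uniqueness. Let $\varphi$ be a right-equivalence between the two direct sums. Comparing quadratic parts shows
  that $\varphi$ and $\varphi^{-1}$ map trivial arrows to trivial arrows modulo paths of length 2. Therefore the
  diagonal blocks of the linear part are invertible, and the trivial block gives the equivalence of the trivial summands. For
  the reduced summands, compose $\varphi$ with an endomorphism of the target that kills, out of every opposite
  couple of trivial arrows, one arrow on the target side and the image of one arrow on the source side: it annihilates both
  trivial potentials, fixes the reduced arrows and is the projection modulo paths of length 2.
\<close>

section \<open>Coefficients and the path-length filtration\<close>

text \<open>Vertex field elements do not commute with arrows, so an arrow carries a tensor in F_i
  (x) F_j instead of a number. Read in E, tensors become numbers: linear parts of homomorphisms are
  matrices over E, degree-2 parts are symmetric matrices \<open>hat\<close>, and right-equivalences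
  act on them by congruence. Pivoting and the comparison of trivial parts are then linear algebra.
  No division by 2 occurs: the diagonal of \<open>hat\<close> vanishes because there are no loops,
  and an ordering of the vertices singles out one of two opposite arrows. The isomorphisms in
  \<open>right_equiv\<close> are not assumed continuous. Continuity comes from the absence of loops:
  the image of an arrow lies in a corner between different vertices and has no term of length 0.
  Infinite sums are handled by recursion on the first arrow of a path, where each step gains one
  degree; associativity, substitution, uniqueness of extensions and inversion all follow this
  pattern. \<open>is_SP\<close> forbids cyclically equivalent terms. Substitutions destroy this
  condition, so it is restored at the end by collecting each equivalence class on one
  representative.\<close>

lemma sum_fun_apply: "(\<Sum>i\<in>I. f i) x = (\<Sum>i\<in>I. f i x)"
  by (induction I rule: infinite_finite_induct) auto

definition sc :: "'e::field \<Rightarrow> ('v,'e) pelt \<Rightarrow> ('v,'e) pelt" where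
  "sc c x = (\<lambda>p. c * x p)"

text \<open>The \<open>n\<close>-th power of the arrow ideal, seen on coefficients. These are the
  neighbourhoods of 0 for the topology in which \<open>madic_closure\<close> is taken.\<close>

definition fil :: "nat \<Rightarrow> ('v,'e::field) pelt \<Rightarrow> bool" where
  "fil n x \<longleftrightarrow> (\<forall>p. plen p < n \<longrightarrow> x p = 0)"

text \<open>Left quotient: the part of $x$ beginning with the basis element $c$ followed by $a$, with that prefix removed.\<close>

definition sh :: "'v wquiver \<Rightarrow> nat \<Rightarrow> 'e \<Rightarrow> ('v,'e::field) pelt \<Rightarrow> ('v,'e) pelt" where
  "sh Q a c x = (\<lambda>(u,b,L). if u = src Q a then x (tgt Q a, c, (a,b) # L) else 0)"

lemma sh_apply: "sh Q a c x (u,b,L) = (if u = src Q a then x (tgt Q a, c, (a,b) # L) else 0)"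
  by (simp add: sh_def)

lemma plen_simps [simp]: "plen (v,c,L) = length L"
  by (simp add: plen_def)

lemma sc_apply [simp]: "sc c x p = c * x p"
  by (simp add: sc_def)

lemma sc_add: "sc c (x + y) = sc c x + sc c y"
  by (auto simp: fun_eq_iff algebra_simps)

lemma sc_diff: "sc c (x - y) = sc c x - sc c y"
  by (auto simp: fun_eq_iff algebra_simps)

lemma sc_sc: "sc c (sc e x) = sc (c * e) x"
  by (auto simp: fun_eq_iff algebra_simps)

lemma sc_1 [simp]: "sc 1 x = x"
  by (auto simp: fun_eq_iff)

lemma sc_0 [simp]: "sc 0 x = 0"
  by (auto simp: fun_eq_iff)

lemma sc_zero [simp]: "sc c 0 = 0"
  by (auto simp: fun_eq_iff)

lemma sc_sum: "sc c (\<Sum>i\<in>I. f i) = (\<Sum>i\<in>I. sc c (f i))"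
  by (auto simp: fun_eq_iff sum_fun_apply sum_distrib_left)

lemma filD: "fil n x \<Longrightarrow> plen p < n \<Longrightarrow> x p = 0"
  unfolding fil_def by blast

lemma filI: "(\<And>p. plen p < n \<Longrightarrow> x p = 0) \<Longrightarrow> fil n x"
  unfolding fil_def by blast

lemma fil_0 [simp]: "fil 0 x"
  by (simp add: fil_def)

lemma fil_zero [simp]: "fil n 0"
  by (simp add: fil_def)

lemma fil_add: "fil n x \<Longrightarrow> fil n y \<Longrightarrow> fil n (x + y)"
  by (simp add: fil_def)

lemma fil_diff: "fil n x \<Longrightarrow> fil n y \<Longrightarrow> fil n (x - y)"
  by (simp add: fil_def)

lemma fil_uminus: "fil n x \<Longrightarrow> fil n (- x)"
  by (simp add: fil_def)

lemma fil_sc: "fil n x \<Longrightarrow> fil n (sc c x)"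
  by (simp add: fil_def)

lemma fil_sum: "(\<And>i. i \<in> I \<Longrightarrow> fil n (f i)) \<Longrightarrow> fil n (\<Sum>i\<in>I. f i)"
  by (simp add: fil_def sum_fun_apply)

lemma fil_mono: "fil n x \<Longrightarrow> m \<le> n \<Longrightarrow> fil m x"
  by (simp add: fil_def)

text \<open>Separatedness of the filtration. Identities between infinite series are proved modulo
  every power of the arrow ideal and then pass through this lemma.\<close>

lemma fil_all_eq: "(\<And>n. fil n (x - y)) \<Longrightarrow> x = y"
  unfolding fil_def fun_eq_iff using lessI by fastforce

lemma fil_trans: "fil n (x - y) \<Longrightarrow> fil n (y - z) \<Longrightarrow> fil n (x - z)"
  by (simp add: fil_def)

lemma fil_sym: "fil n (x - y) \<Longrightarrow> fil n (y - x)"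
  by (simp add: fil_def)

lemma fil_sh: "fil (Suc n) x \<Longrightarrow> fil n (sh Q a c x)"
  by (auto simp: fil_def sh_def)

lemma sh_add: "sh Q a c (x + y) = sh Q a c x + sh Q a c y"
  by (auto simp: fun_eq_iff sh_def)

lemma sh_sc: "sh Q a c (sc k x) = sc k (sh Q a c x)"
  by (auto simp: fun_eq_iff sh_def)

section \<open>Coordinates in the vertex fields\<close>

locale sp_data =
  fixes F :: "'e::field set" and d :: "'v::finite \<Rightarrow> nat" and Fi B :: "'v \<Rightarrow> 'e set"
  assumes sp_setup: "sp_setup F d Fi B"
begin

abbreviation co :: "'v \<Rightarrow> 'e \<Rightarrow> 'e \<Rightarrow> 'e" where
  "co v w c \<equiv> coord F (B v) w c"

abbreviation mu :: "('v,'e) pelt \<Rightarrow> 'v wquiver \<Rightarrow> ('v,'e) pelt \<Rightarrow> ('v,'e) pelt"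
    ("(_ \<star>\<^bsub>_\<^esub> _)" [75,0,74] 74) where
  "x \<star>\<^bsub>Q\<^esub> y \<equiv> pmult Q F B x y"

lemma is_subfield_F: "is_subfield F"
  using sp_setup by (simp add: sp_setup_def)

lemma F_closed [simp, intro]:
  "0 \<in> F" "1 \<in> F" "x \<in> F \<Longrightarrow> y \<in> F \<Longrightarrow> x + y \<in> F" "x \<in> F \<Longrightarrow> y \<in> F \<Longrightarrow> x - y \<in> F"
  "x \<in> F \<Longrightarrow> y \<in> F \<Longrightarrow> x * y \<in> F" "x \<in> F \<Longrightarrow> - x \<in> F" "x \<in> F \<Longrightarrow> inverse x \<in> F"
  using is_subfield_F by (simp_all add: is_subfield_def)

lemma F_sum [intro]: "(\<And>i. i \<in> I \<Longrightarrow> f i \<in> F) \<Longrightarrow> (\<Sum>i\<in>I. f i) \<in> F"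
  by (induction I rule: infinite_finite_induct) auto

lemma F_prod [intro]: "(\<And>i. i \<in> I \<Longrightarrow> f i \<in> F) \<Longrightarrow> (\<Prod>i\<in>I. f i) \<in> F"
  by (induction I rule: infinite_finite_induct) auto

lemma is_subfield_Fi: "is_subfield (Fi v)"
  using sp_setup by (simp add: sp_setup_def)

lemma Fi_closed [simp, intro]:
  "0 \<in> Fi v" "1 \<in> Fi v" "x \<in> Fi v \<Longrightarrow> y \<in> Fi v \<Longrightarrow> x + y \<in> Fi v" "x \<in> Fi v \<Longrightarrow> y \<in> Fi v \<Longrightarrow> x - y \<in> Fi v"
  "x \<in> Fi v \<Longrightarrow> y \<in> Fi v \<Longrightarrow> x * y \<in> Fi v" "x \<in> Fi v \<Longrightarrow> - x \<in> Fi v" "x \<in> Fi v \<Longrightarrow> inverse x \<in> Fi v"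
  using is_subfield_Fi[of v] by (simp_all add: is_subfield_def)

lemma F_Fi: "x \<in> F \<Longrightarrow> x \<in> Fi v"
  using sp_setup by (auto simp: sp_setup_def)

lemma Fi_sum [intro]: "(\<And>i. i \<in> I \<Longrightarrow> f i \<in> Fi v) \<Longrightarrow> (\<Sum>i\<in>I. f i) \<in> Fi v"
  by (induction I rule: infinite_finite_induct) auto

lemma basis: "is_basis F (Fi v) (B v)"
  using sp_setup by (simp add: sp_setup_def)

lemma finite_B [simp, intro]: "finite (B v)"
  using basis by (simp add: is_basis_def)

lemma B_Fi [simp, intro]: "b \<in> B v \<Longrightarrow> b \<in> Fi v"
  using basis[of v] by (auto simp: is_basis_def)

lemma coord_props:
  assumes "w \<in> Fi v"
  shows "(\<forall>c. co v w c \<in> F) \<and> (\<forall>c. c \<notin> B v \<longrightarrow> co v w c = 0) \<and> w = (\<Sum>c\<in>B v. co v w c * c)"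
proof -
  have "\<exists>!l. (\<forall>c. l c \<in> F) \<and> (\<forall>c. c \<notin> B v \<longrightarrow> l c = 0) \<and> w = (\<Sum>c\<in>B v. l c * c)"
    using basis[of v] assms unfolding is_basis_def by simp
  from theI'[OF this] show ?thesis
    unfolding coord_def .
qed

lemma co_F [simp, intro]: "w \<in> Fi v \<Longrightarrow> co v w c \<in> F"
  using coord_props by simp

lemma co_out: "w \<in> Fi v \<Longrightarrow> c \<notin> B v \<Longrightarrow> co v w c = 0"
  using coord_props by simp

lemma co_sum: "w \<in> Fi v \<Longrightarrow> (\<Sum>c\<in>B v. co v w c * c) = w"
  using coord_props by metis

lemma co_unique:
  assumes "\<And>c. l c \<in> F" "\<And>c. c \<notin> B v \<Longrightarrow> l c = 0" "w = (\<Sum>c\<in>B v. l c * c)"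
  shows "co v w = l"
proof -
  have w: "w \<in> Fi v"
    unfolding assms(3) using assms(1) F_Fi by (intro Fi_sum Fi_closed(5)) auto
  have "\<exists>!l. (\<forall>c. l c \<in> F) \<and> (\<forall>c. c \<notin> B v \<longrightarrow> l c = 0) \<and> w = (\<Sum>c\<in>B v. l c * c)"
    using basis[of v] w unfolding is_basis_def by simp
  moreover have "(\<forall>c. l c \<in> F) \<and> (\<forall>c. c \<notin> B v \<longrightarrow> l c = 0) \<and> w = (\<Sum>c\<in>B v. l c * c)"
    using assms by simp
  ultimately show ?thesis
    unfolding coord_def
    by (rule the1_equality[where P = "\<lambda>l. (\<forall>c. l c \<in> F) \<and> (\<forall>c. c \<notin> B v \<longrightarrow> l c = 0) \<and> w = (\<Sum>c\<in>B v. l c * c)"])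
qed

lemma co_lin:
  assumes "\<And>i. i \<in> I \<Longrightarrow> f i \<in> F" "\<And>i. i \<in> I \<Longrightarrow> w i \<in> Fi v"
  shows "co v (\<Sum>i\<in>I. f i * w i) c = (\<Sum>i\<in>I. f i * co v (w i) c)"
proof -
  have "co v (\<Sum>i\<in>I. f i * w i) = (\<lambda>c. \<Sum>i\<in>I. f i * co v (w i) c)"
  proof (rule co_unique)
    fix c
    show "(\<Sum>i\<in>I. f i * co v (w i) c) \<in> F"
      using assms by (intro F_sum F_closed(5)) auto
    show "c \<notin> B v \<Longrightarrow> (\<Sum>i\<in>I. f i * co v (w i) c) = 0"
      using assms by (intro sum.neutral) (auto simp: co_out)
  next
    have "(\<Sum>i\<in>I. f i * w i) = (\<Sum>i\<in>I. f i * (\<Sum>c\<in>B v. co v (w i) c * c))"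
      using assms by (intro sum.cong refl) (simp add: co_sum)
    also have "\<dots> = (\<Sum>c\<in>B v. \<Sum>i\<in>I. f i * (co v (w i) c * c))"
      by (subst sum.swap) (simp add: sum_distrib_left)
    also have "\<dots> = (\<Sum>c\<in>B v. (\<Sum>i\<in>I. f i * co v (w i) c) * c)"
      by (simp add: sum_distrib_right mult.assoc)
    finally show "(\<Sum>i\<in>I. f i * w i) = (\<Sum>c\<in>B v. (\<Sum>i\<in>I. f i * co v (w i) c) * c)" .
  qed
  then show ?thesis by simp
qed

lemma co_scale: "f \<in> F \<Longrightarrow> w \<in> Fi v \<Longrightarrow> co v (f * w) c = f * co v w c"
  using co_lin[of "{()}" "\<lambda>_. f" "\<lambda>i. w" v c] by auto

lemma co_zero [simp]: "co v 0 c = 0"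
  using co_scale[of 0 0 v c] by simp

lemma co_basis:
  assumes "b \<in> B v" shows "co v b c = (if c = b then 1 else 0)"
proof -
  have "co v b = (\<lambda>c. if c = b then 1 else 0)"
    by (rule co_unique) (use assms in \<open>auto simp: if_distrib[of "\<lambda>x. x * _"] cong: if_cong\<close>)
  then show ?thesis by simp
qed

lemma co_expandl:
  assumes "w \<in> Fi v" "w' \<in> Fi v"
  shows "co v (w * w') c = (\<Sum>e\<in>B v. co v w e * co v (e * w') c)"
proof -
  have "w * w' = (\<Sum>e\<in>B v. co v w e * (e * w'))"
    by (subst co_sum[OF assms(1), symmetric]) (simp add: sum_distrib_right mult.assoc)
  then show ?thesis
    using co_lin[of "B v" "co v w" "\<lambda>e. e * w'"] assms by auto
qed

lemma co_expandr:
  assumes "w \<in> Fi v" "w' \<in> Fi v"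
  shows "co v (w * w') c = (\<Sum>e\<in>B v. co v w' e * co v (w * e) c)"
  using co_expandl[OF assms(2,1)] by (simp add: mult.commute)

lemma sum_co_basis: 
  assumes "c \<in> B v" shows "(\<Sum>e\<in>B v. g e * co v e c) = g c"
proof -
  have "(\<Sum>e\<in>B v. g e * co v e c) = (\<Sum>e\<in>B v. if e = c then g c else 0)"
    by (intro sum.cong refl) (auto simp: co_basis)
  then show ?thesis using assms by simp
qed

section \<open>Recursion of the product on the first arrow of a path\<close>

lemma valid_simps [simp]:
  "valid Q B (v,c,[]) \<longleftrightarrow> c \<in> B v"
  "valid Q B (v,c,(a,b)#L) \<longleftrightarrow> c \<in> B v \<and> a \<in> arrs Q \<and> tgt Q a = v \<and> valid Q B (src Q a, b, L)"
  by (auto simp: valid_def)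

lemma paths_len_0: "paths_len Q B 0 = (\<lambda>(v,c). (v,c,[])) ` (SIGMA v:UNIV. B v)"
  by (auto simp: paths_len_def image_iff)

lemma paths_len_Suc:
  "paths_len Q B (Suc n) = (\<lambda>((a,c),(u,b,L)). (tgt Q a,c,(a,b)#L)) `
     {((a,c),p). a \<in> arrs Q \<and> c \<in> B (tgt Q a) \<and> p \<in> paths_len Q B n \<and> fst p = src Q a}"
proof (intro equalityI subsetI)
  fix r assume r: "r \<in> paths_len Q B (Suc n)"
  obtain v c L where [simp]: "r = (v,c,L)" by (cases r)
  from r obtain a b L' where "L = (a,b)#L'" by (cases L) (auto simp: paths_len_def)
  with r show "r \<in> (\<lambda>((a,c),(u,b,L)). (tgt Q a,c,(a,b)#L)) `
     {((a,c),p). a \<in> arrs Q \<and> c \<in> B (tgt Q a) \<and> p \<in> paths_len Q B n \<and> fst p = src Q a}"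
    by (auto simp: paths_len_def image_iff intro!: exI[of _ "src Q a"])
qed (auto simp: paths_len_def)

lemma finite_paths_len: "finite (arrs Q) \<Longrightarrow> finite (paths_len Q B n)"
proof (induction n)
  case 0
  then show ?case by (auto simp: paths_len_0)
next
  case (Suc n)
  have "{((a,c),p). a \<in> arrs Q \<and> c \<in> B (tgt Q a) \<and> p \<in> paths_len Q B n \<and> fst p = src Q a}
     \<subseteq> (SIGMA a:arrs Q. B (tgt Q a)) \<times> paths_len Q B n" by auto
  then have "finite {((a,c),p). a \<in> arrs Q \<and> c \<in> B (tgt Q a) \<and> p \<in> paths_len Q B n \<and> fst p = src Q a}"
    by (rule finite_subset) (use Suc in auto)
  then show ?case unfolding paths_len_Suc by (rule finite_imageI)
qed

lemma mulcoef_Nil: 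
  "mulcoef Q F B (u,c1,[]) (u',c2,L') (v,c,L) = 
    (if u = v \<and> u' = v \<and> L' = L \<and> c \<in> B v then co v (c1 * c2) c else 0)"
proof -
  have "(\<Sum>c'\<in>B u'. if (v,c,L) = (u,c',L') then co u' (c1 * c2) c' else 0)
     = (\<Sum>c'\<in>B u'. if c' = c then (if u = v \<and> L' = L then co u' (c1 * c2) c else 0) else 0)"
    by (intro sum.cong refl) auto
  also have "\<dots> = (if u = v \<and> L' = L \<and> c \<in> B u' then co u' (c1 * c2) c else 0)"
    by simp
  finally have 1: "(\<Sum>c'\<in>B u'. if (v,c,L) = (u,c',L') then co u' (c1 * c2) c' else 0)
      = (if u = v \<and> L' = L \<and> c \<in> B u' then co u' (c1 * c2) c else 0)" .
  have "mulcoef Q F B (u,c1,[]) (u',c2,L') (v,c,L) =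
    (if u = u' then \<Sum>c'\<in>B u'. if (v,c,L) = (u,c',L') then co u' (c1 * c2) c' else 0 else 0)"
    unfolding mulcoef_def prod.case endv_def lastel_def catp_def by (simp only: simp_thms if_True)
  then show ?thesis unfolding 1 by auto
qed

lemma endv_Cons: "endv Q (v,c,(a,b)#L) = endv Q (src Q a,b,L)"
  by (auto simp: endv_def)

lemma endv_Nil [simp]: "endv Q (v,c,[]) = v"
  by (auto simp: endv_def)

lemma lastel_Cons: "lastel (v,c,(a,b)#L) = lastel (u,b,L)"
  by (auto simp: lastel_def)

lemma catp_Cons: "catp (v',c',(a',b')#P) e L' = (v,c,(a,b)#L) \<longleftrightarrow>
    v' = v \<and> c' = c \<and> a' = a \<and> catp (src Q a,b',P) e L' = (src Q a,b,L)"
  by (auto simp: catp_def)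

text \<open>Concatenation changes coefficients only at the junction of the two paths, so a first
  letter of the left factor can be cancelled against the first letter of the result.\<close>

lemma mulcoef_Cons:
  "mulcoef Q F B (v',c',(a',b')#P) q (v,c,(a,b)#L) =
     (if v' = v \<and> c' = c \<and> a' = a then mulcoef Q F B (src Q a,b',P) q (src Q a,b,L) else 0)"
proof (cases q)
  case (fields u e L')
  show ?thesis
    unfolding mulcoef_def fields eq_commute[of "(v,c,(a,b)#L)"] catp_Cons[where Q = Q] endv_Cons
      lastel_Cons[where u = "src Q a'"]
    by (auto simp: eq_commute[of "(src Q a,b,L)"])
qed

lemma mult_Nil:
  assumes "finite (arrs Q)"
  shows "(x \<star>\<^bsub>Q\<^esub> y) (v,c,[]) = (if c \<in> B v then (\<Sum>c1\<in>B v. \<Sum>c2\<in>B v. x (v,c1,[]) * y (v,c2,[]) * co v (c1 * c2) c) else 0)"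
proof (cases "c \<in> B v")
  case True
  have *: "(\<Sum>p\<in>paths_len Q B 0. g p) = (\<Sum>u\<in>UNIV. \<Sum>c1\<in>B u. g (u,c1,[]))" for g :: "_ \<Rightarrow> 'e"
    unfolding paths_len_0
    by (subst sum.reindex) (auto simp: inj_on_def sum.Sigma case_prod_unfold)
  have "(x \<star>\<^bsub>Q\<^esub> y) (v,c,[]) = (\<Sum>u\<in>UNIV. \<Sum>c1\<in>B u. \<Sum>u'\<in>UNIV. \<Sum>c2\<in>B u'.
      x (u,c1,[]) * y (u',c2,[]) * (if u = v \<and> u' = v then co v (c1 * c2) c else 0))"
    using True by (simp add: pmult_def * mulcoef_Nil)
  also have "\<dots> = (\<Sum>u\<in>UNIV. if u = v then \<Sum>c1\<in>B v. \<Sum>u'\<in>UNIV. if u' = v then \<Sum>c2\<in>B v.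
      x (v,c1,[]) * y (v,c2,[]) * co v (c1 * c2) c else 0 else 0)"
  proof (intro sum.cong refl)
    fix u
    have "(\<Sum>u'\<in>UNIV. \<Sum>c2\<in>B u'. x (v,c1,[]) * y (u',c2,[]) * (if u' = v then co v (c1 * c2) c else 0))
      = (\<Sum>u'\<in>UNIV. if u' = v then \<Sum>c2\<in>B v. x (v,c1,[]) * y (v,c2,[]) * co v (c1 * c2) c else 0)" for c1
      by (intro sum.cong refl) auto
    then show "(\<Sum>c1\<in>B u. \<Sum>u'\<in>UNIV. \<Sum>c2\<in>B u'.
      x (u,c1,[]) * y (u',c2,[]) * (if u = v \<and> u' = v then co v (c1 * c2) c else 0)) =
      (if u = v then \<Sum>c1\<in>B v. \<Sum>u'\<in>UNIV. if u' = v then \<Sum>c2\<in>B v.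
      x (v,c1,[]) * y (v,c2,[]) * co v (c1 * c2) c else 0 else 0)"
      by (cases "u = v") simp_all
  qed
  finally show ?thesis using True by simp
qed (simp add: pmult_def)

text \<open>Split the sum over the length \<open>k\<close> of the left factor. For
  \<open>k = 0\<close> it only multiplies into the leading coefficient, which gives the double sum;
  for \<open>k > 0\<close> it shares the prefix \<open>c\<close>, \<open>a\<close> with the result,
  and removing that prefix leaves a product with \<open>sh Q a c x\<close>. Later inductions use
  this recursion in place of the triple sum in \<open>pmult\<close>.\<close>

lemma mult_Cons:
  assumes fin: "finite (arrs Q)" and r: "valid Q B (v,c,(a,b)#L)"
  shows "(x \<star>\<^bsub>Q\<^esub> y) (v,c,(a,b)#L) =
    (\<Sum>c1\<in>B v. \<Sum>c2\<in>B v. x (v,c1,[]) * y (v,c2,(a,b)#L) * co v (c1 * c2) c)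
     + (sh Q a c x \<star>\<^bsub>Q\<^esub> y) (src Q a,b,L)"
proof -
  let ?r = "(v,c,(a,b)#L)" and ?r' = "(src Q a,b,L)" and ?n = "length L"
  let ?T = "\<lambda>k. \<Sum>p\<in>paths_len Q B k. \<Sum>q\<in>paths_len Q B (Suc ?n - k). x p * y q * mulcoef Q F B p q ?r"
  have *: "(\<Sum>p\<in>paths_len Q B 0. g p) = (\<Sum>u\<in>UNIV. \<Sum>c1\<in>B u. g (u,c1,[]))" for g :: "_ \<Rightarrow> 'e"
    unfolding paths_len_0
    by (subst sum.reindex) (auto simp: inj_on_def sum.Sigma case_prod_unfold)
  have "(x \<star>\<^bsub>Q\<^esub> y) ?r = (\<Sum>k\<in>{0..Suc ?n}. ?T k)"
    using r by (simp add: pmult_def)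
  also have "\<dots> = ?T 0 + (\<Sum>k\<in>{0..?n}. ?T (Suc k))"
    by (simp only: sum.atLeast0_atMost_Suc_shift comp_def)
  also have "?T 0 = (\<Sum>c1\<in>B v. \<Sum>c2\<in>B v. x (v,c1,[]) * y (v,c2,(a,b)#L) * co v (c1 * c2) c)"
  proof -
    have q: "(\<Sum>q\<in>paths_len Q B (Suc ?n). x (u,c1,[]) * y q * mulcoef Q F B (u,c1,[]) q ?r)
      = (if u = v then \<Sum>c2\<in>B v. x (v,c1,[]) * y (v,c2,(a,b)#L) * co v (c1 * c2) c else 0)" for u c1
    proof -
      have "(\<Sum>q\<in>paths_len Q B (Suc ?n). x (u,c1,[]) * y q * mulcoef Q F B (u,c1,[]) q ?r)
        = (\<Sum>q\<in>(\<lambda>c2. (v,c2,(a,b)#L)) ` B v. x (u,c1,[]) * y q * mulcoef Q F B (u,c1,[]) q ?r)"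
        using r finite_paths_len[OF fin]
        by (intro sum.mono_neutral_right) (auto simp: paths_len_def mulcoef_Nil split: if_splits)
      also have "\<dots> = (\<Sum>c2\<in>B v. x (u,c1,[]) * y (v,c2,(a,b)#L) * mulcoef Q F B (u,c1,[]) (v,c2,(a,b)#L) ?r)"
        by (subst sum.reindex) (auto simp: inj_on_def)
      also have "\<dots> = (if u = v then \<Sum>c2\<in>B v. x (v,c1,[]) * y (v,c2,(a,b)#L) * co v (c1 * c2) c else 0)"
        using r by (auto simp: mulcoef_Nil)
      finally show ?thesis .
    qed
    have "?T 0 = (\<Sum>u\<in>UNIV. if u = v then \<Sum>c1\<in>B v. \<Sum>c2\<in>B v. x (v,c1,[]) * y (v,c2,(a,b)#L) * co v (c1 * c2) c else 0)"
      unfolding * diff_zero q by (intro sum.cong refl) auto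
    then show ?thesis by simp
  qed
  also have "(\<Sum>k\<in>{0..?n}. ?T (Suc k)) = (sh Q a c x \<star>\<^bsub>Q\<^esub> y) ?r'"
  proof -
    have "?T (Suc k) = (\<Sum>p\<in>paths_len Q B k. \<Sum>q\<in>paths_len Q B (?n - k). sh Q a c x p * y q * mulcoef Q F B p q ?r')" for k
    proof -
      let ?P = "{p\<in>paths_len Q B k. fst p = src Q a}" and ?h = "\<lambda>(u,b,L). (v,c,(a,b)#L)"
      have "?T (Suc k) = (\<Sum>p\<in>?h ` ?P. \<Sum>q\<in>paths_len Q B (?n - k). x p * y q * mulcoef Q F B p q ?r)"
        unfolding diff_Suc_Suc
      proof (rule sum.mono_neutral_right)
        show "finite (paths_len Q B (Suc k))" using finite_paths_len[OF fin] .
        show "?h ` ?P \<subseteq> paths_len Q B (Suc k)" using r by (auto simp: paths_len_def)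
        show "\<forall>i\<in>paths_len Q B (Suc k) - ?h ` ?P.
           (\<Sum>q\<in>paths_len Q B (?n - k). x i * y q * mulcoef Q F B i q ?r) = 0"
        proof
          fix i assume i: "i \<in> paths_len Q B (Suc k) - ?h ` ?P"
          then have "i \<in> paths_len Q B (Suc k)" by blast
          then obtain a' c' b' P where ip: "i = (tgt Q a',c',(a',b')#P)" "valid Q B (src Q a',b',P)" "length P = k"
            unfolding paths_len_Suc by (auto simp: paths_len_def)
          have "\<not> (tgt Q a' = v \<and> c' = c \<and> a' = a)"
          proof
            assume "tgt Q a' = v \<and> c' = c \<and> a' = a"
            then have "i = ?h (src Q a,b',P)" "(src Q a,b',P) \<in> ?P" using ip by (auto simp: paths_len_def)
            then show False using i by blast
          qed
          then show "(\<Sum>q\<in>paths_len Q B (?n - k). x i * y q * mulcoef Q F B i q ?r) = 0"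
            unfolding ip(1) by (intro sum.neutral ballI) (auto simp: mulcoef_Cons)
        qed
      qed
      also have "\<dots> = (\<Sum>p\<in>?P. \<Sum>q\<in>paths_len Q B (?n - k). x (?h p) * y q * mulcoef Q F B (?h p) q ?r)"
        by (subst sum.reindex) (auto simp: inj_on_def)
      also have "\<dots> = (\<Sum>p\<in>?P. \<Sum>q\<in>paths_len Q B (?n - k). sh Q a c x p * y q * mulcoef Q F B p q ?r')"
        using r by (intro sum.cong refl) (auto simp: mulcoef_Cons sh_def)
      also have "\<dots> = (\<Sum>p\<in>paths_len Q B k. \<Sum>q\<in>paths_len Q B (?n - k). sh Q a c x p * y q * mulcoef Q F B p q ?r')"
        using finite_paths_len[OF fin]
        by (intro sum.mono_neutral_left) (auto simp: sh_def intro!: sum.neutral split: if_splits)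
      finally show ?thesis .
    qed
    then show ?thesis using r by (simp add: pmult_def)
  qed
  finally show ?thesis .
qed


section \<open>Multiplication\<close>

lemma mult_invalid: "\<not> valid Q B r \<Longrightarrow> (x \<star>\<^bsub>Q\<^esub> y) r = 0"
  by (simp add: pmult_def)

lemma mult_add_left: "(x + x') \<star>\<^bsub>Q\<^esub> y = x \<star>\<^bsub>Q\<^esub> y + x' \<star>\<^bsub>Q\<^esub> y"
  by (auto simp: fun_eq_iff pmult_def sum.distrib distrib_right)

lemma mult_add_right: "x \<star>\<^bsub>Q\<^esub> (y + y') = x \<star>\<^bsub>Q\<^esub> y + x \<star>\<^bsub>Q\<^esub> y'"
  by (auto simp: fun_eq_iff pmult_def sum.distrib distrib_right distrib_left)

lemma mult_sc_left: "sc c x \<star>\<^bsub>Q\<^esub> y = sc c (x \<star>\<^bsub>Q\<^esub> y)"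
  by (auto simp: fun_eq_iff pmult_def sum_distrib_left mult.assoc)

lemma mult_sc_right: "x \<star>\<^bsub>Q\<^esub> sc c y = sc c (x \<star>\<^bsub>Q\<^esub> y)"
  by (auto simp: fun_eq_iff pmult_def sum_distrib_left mult_ac)

lemma mult_zero_left [simp]: "0 \<star>\<^bsub>Q\<^esub> y = 0"
  by (auto simp: fun_eq_iff pmult_def)

lemma mult_zero_right [simp]: "y \<star>\<^bsub>Q\<^esub> 0 = 0"
  by (auto simp: fun_eq_iff pmult_def)

lemma mult_diff_left: "(x - x') \<star>\<^bsub>Q\<^esub> y = x \<star>\<^bsub>Q\<^esub> y - x' \<star>\<^bsub>Q\<^esub> y"
  using mult_add_left[of Q "x - x'" x' y] by (simp add: algebra_simps)

lemma mult_diff_right: "x \<star>\<^bsub>Q\<^esub> (y - y') = x \<star>\<^bsub>Q\<^esub> y - x \<star>\<^bsub>Q\<^esub> y'"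
  using mult_add_right[of Q x "y - y'" y'] by (simp add: algebra_simps)

lemma mult_sum_left: "(\<Sum>i\<in>I. f i) \<star>\<^bsub>Q\<^esub> y = (\<Sum>i\<in>I. f i \<star>\<^bsub>Q\<^esub> y)"
  by (induction I rule: infinite_finite_induct)
    (simp_all only: sum.infinite sum.empty sum.insert mult_zero_left mult_add_left simp_thms not_False_eq_True)

lemma mult_sum_right: "y \<star>\<^bsub>Q\<^esub> (\<Sum>i\<in>I. f i) = (\<Sum>i\<in>I. y \<star>\<^bsub>Q\<^esub> f i)"
  by (induction I rule: infinite_finite_induct)
    (simp_all only: sum.infinite sum.empty sum.insert mult_zero_right mult_add_right simp_thms not_False_eq_True)

lemma fil_mult:
  assumes "fil m x" "fil n y" shows "fil (m + n) (x \<star>\<^bsub>Q\<^esub> y)"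
  unfolding fil_def
proof (intro allI impI)
  fix r :: "('v,'e) bpath" assume r: "plen r < m + n"
  have "x p * y q = 0" if "k \<le> plen r" "p \<in> paths_len Q B k" "q \<in> paths_len Q B (plen r - k)" for k p q
  proof (cases "k < m")
    case True
    then have "x p = 0" using filD[OF assms(1), of p] that by (simp add: paths_len_def)
    then show ?thesis by simp
  next
    case False
    then have "plen r - k < n" using r that(1) by linarith
    then have "y q = 0" using filD[OF assms(2), of q] that by (simp add: paths_len_def)
    then show ?thesis by simp
  qed
  then show "(x \<star>\<^bsub>Q\<^esub> y) r = 0"
    by (auto simp: pmult_def intro!: sum.neutral)
qed

lemma fil_mult':
  assumes "fil m x" "fil n y" "k \<le> m + n" shows "fil k (x \<star>\<^bsub>Q\<^esub> y)"
  using fil_mult[OF assms(1,2)] assms(3) by (rule fil_mono)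

lemma fil_mult_left: "fil n y \<Longrightarrow> fil n (x \<star>\<^bsub>Q\<^esub> y)"
  using fil_mult[of 0 x n y] by simp

lemma fil_mult_right: "fil n x \<Longrightarrow> fil n (x \<star>\<^bsub>Q\<^esub> y)"
  using fil_mult[of n x 0 y] by simp

abbreviation PQ :: "'v wquiver \<Rightarrow> ('v,'e) pelt set" where
  "PQ Q \<equiv> PA Q F B"

lemma PA_F: "x \<in> PQ Q \<Longrightarrow> x p \<in> F"
  unfolding PA_def by blast

lemma PA_out: "x \<in> PQ Q \<Longrightarrow> \<not> valid Q B p \<Longrightarrow> x p = 0"
  unfolding PA_def by blast

lemma PA_zero [simp, intro]: "0 \<in> PQ Q"
  by (auto simp: PA_def)

lemma PA_add [simp, intro]: "x \<in> PQ Q \<Longrightarrow> y \<in> PQ Q \<Longrightarrow> x + y \<in> PQ Q"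
  by (auto simp: PA_def)

lemma PA_diff [simp, intro]: "x \<in> PQ Q \<Longrightarrow> y \<in> PQ Q \<Longrightarrow> x - y \<in> PQ Q"
  by (auto simp: PA_def)

lemma PA_uminus [simp, intro]: "x \<in> PQ Q \<Longrightarrow> - x \<in> PQ Q"
  by (auto simp: PA_def)

lemma PA_sc [simp, intro]: "x \<in> PQ Q \<Longrightarrow> c \<in> F \<Longrightarrow> sc c x \<in> PQ Q"
  by (auto simp: PA_def)

lemma PA_sum [intro]: "(\<And>i. i \<in> I \<Longrightarrow> f i \<in> PQ Q) \<Longrightarrow> (\<Sum>i\<in>I. f i) \<in> PQ Q"
  by (induction I rule: infinite_finite_induct) auto

lemma sh_PA [simp, intro]: "x \<in> PQ Q \<Longrightarrow> sh Q a c x \<in> PQ Q"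
proof -
  assume x: "x \<in> PQ Q"
  show ?thesis
    unfolding PA_def
  proof (intro CollectI conjI allI impI)
    fix p show "sh Q a c x p \<in> F"
      using PA_F[OF x] by (cases p) (auto simp: sh_def)
  next
    fix p assume p: "\<not> valid Q B p"
    obtain u b L where [simp]: "p = (u,b,L)" by (cases p)
    show "sh Q a c x p = 0"
      using p PA_out[OF x, of "(tgt Q a, c, (a,b)#L)"] by (auto simp: sh_def)
  qed
qed

lemma PA_mult [simp, intro]:
  assumes Q: "finite (arrs Q)" and x: "x \<in> PQ Q" and y: "y \<in> PQ Q"
  shows "x \<star>\<^bsub>Q\<^esub> y \<in> PQ Q"
proof -
  have "(x \<star>\<^bsub>Q\<^esub> y) (v,c,L) \<in> F" if "valid Q B (v,c,L)" "x \<in> PQ Q" for v c L x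
    using that
  proof (induction L arbitrary: v c x)
    case Nil
    then show ?case using y
      by (auto simp: mult_Nil[OF Q] PA_F intro!: F_sum F_closed(5))
  next
    case (Cons ab L)
    obtain a b where [simp]: "ab = (a,b)" by (cases ab)
    have "(\<Sum>c1\<in>B v. \<Sum>c2\<in>B v. x (v, c1, []) * y (v, c2, (a, b) # L) * co v (c1 * c2) c) \<in> F"
      using Cons y by (auto simp: PA_F intro!: F_sum F_closed(5))
    moreover have "(sh Q a c x \<star>\<^bsub>Q\<^esub> y) (src Q a,b,L) \<in> F"
      using Cons by auto
    ultimately show ?case using Cons.prems by (subst \<open>ab = (a,b)\<close>, subst mult_Cons[OF Q]) auto
  qed
  then show ?thesis
    using x F_closed(1) by (auto simp: PA_def mult_invalid) (metis mult_invalid F_closed(1))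
qed

lemma mult_fst:
  assumes Q: "finite (arrs Q)" and "\<And>p. fst p \<noteq> u \<Longrightarrow> x p = 0" and "fst r \<noteq> u"
  shows "(x \<star>\<^bsub>Q\<^esub> y) r = 0"
proof (cases "valid Q B r")
  case True
  obtain v c L where r: "r = (v,c,L)" by (cases r)
  show ?thesis
  proof (cases L)
    case Nil
    then show ?thesis using assms by (auto simp: r mult_Nil[OF Q])
  next
    case (Cons ab L')
    obtain a b where [simp]: "ab = (a,b)" by (cases ab)
    have "sh Q a c x = 0"
      using assms(2,3) True by (auto simp: r Cons sh_def fun_eq_iff)
    then show ?thesis using assms True mult_Cons[OF Q, of v c a b L' x y]
      by (auto simp: r Cons)
  qed
qed (simp add: mult_invalid)

text \<open>A twisted Leibniz rule for removing the first letter: either the length-0 part of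
  \<open>x\<close> is multiplied into \<open>y\<close>, which then supplies the first arrow, or the
  first arrow already comes from \<open>x\<close>.\<close>

lemma sh_mult:
  assumes Q: "finite (arrs Q)" and y: "y \<in> PQ Q" and a: "a \<in> arrs Q" and c: "c \<in> B (tgt Q a)"
  shows "sh Q a c (x \<star>\<^bsub>Q\<^esub> y) =
    (\<Sum>c2\<in>B (tgt Q a). sc (\<Sum>c1\<in>B (tgt Q a). x (tgt Q a,c1,[]) * co (tgt Q a) (c1 * c2) c) (sh Q a c2 y))
    + sh Q a c x \<star>\<^bsub>Q\<^esub> y"
proof
  fix r :: "('v,'e) bpath"
  obtain u b L where r: "r = (u,b,L)" by (cases r)
  let ?v = "tgt Q a"
  show "sh Q a c (x \<star>\<^bsub>Q\<^esub> y) r = ((\<Sum>c2\<in>B ?v. sc (\<Sum>c1\<in>B ?v. x (?v,c1,[]) * co ?v (c1 * c2) c) (sh Q a c2 y))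
    + sh Q a c x \<star>\<^bsub>Q\<^esub> y) r"
  proof (cases "u = src Q a")
    case False
    moreover have "(sh Q a c x \<star>\<^bsub>Q\<^esub> y) r = 0"
      by (rule mult_fst[OF Q, of "src Q a"]) (use False r in \<open>auto simp: sh_def\<close>)
    ultimately show ?thesis by (simp add: r sh_def sum_fun_apply)
  next
    case u: True
    show ?thesis
    proof (cases "valid Q B r")
      case True
      then have "sh Q a c (x \<star>\<^bsub>Q\<^esub> y) r = (\<Sum>c1\<in>B ?v. \<Sum>c2\<in>B ?v. x (?v,c1,[]) * y (?v,c2,(a,b)#L) * co ?v (c1 * c2) c)
         + (sh Q a c x \<star>\<^bsub>Q\<^esub> y) r"
        using a c u by (simp add: r sh_def[of Q a c "x \<star>\<^bsub>Q\<^esub> y"] mult_Cons[OF Q])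
      also have "(\<Sum>c1\<in>B ?v. \<Sum>c2\<in>B ?v. x (?v,c1,[]) * y (?v,c2,(a,b)#L) * co ?v (c1 * c2) c)
        = (\<Sum>c2\<in>B ?v. (\<Sum>c1\<in>B ?v. x (?v,c1,[]) * co ?v (c1 * c2) c) * y (?v,c2,(a,b)#L))"
        by (subst sum.swap, intro sum.cong refl) (simp add: sum_distrib_right sum_distrib_left mult_ac)
      finally show ?thesis
        using u by (simp add: sum_fun_apply r sh_def[of Q a _ y])
    next
      case False
      then have "\<not> valid Q B (?v,c2,(a,b)#L)" for c2 using u r by simp
      then show ?thesis
        using u PA_out[OF y, of "(?v,_,(a,b)#L)"] False
        by (simp add: sum_fun_apply r mult_invalid sh_def)
    qed
  qed
qed

text \<open>Associativity in the field at \<open>v\<close>, in structure constants: both sides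
  expand to a sum over the coordinates of triple products of basis elements.\<close>

lemma assoc_coef:
  fixes Xf Y Z :: "'e \<Rightarrow> 'e"
  shows "(\<Sum>c1\<in>B v. \<Sum>c2\<in>B v. (\<Sum>e1\<in>B v. \<Sum>e2\<in>B v. Xf e1 * Y e2 * co v (e1 * e2) c1) * Z c2 * co v (c1 * c2) c)
       = (\<Sum>c1\<in>B v. \<Sum>c2\<in>B v. Xf c1 * (\<Sum>e1\<in>B v. \<Sum>e2\<in>B v. Y e1 * Z e2 * co v (e1 * e2) c2) * co v (c1 * c2) c)"
    (is "?L = ?R")
proof -
  have "?L = (\<Sum>c1\<in>B v. \<Sum>c2\<in>B v. \<Sum>e1\<in>B v. \<Sum>e2\<in>B v. Xf e1 * Y e2 * Z c2 * (co v (e1 * e2) c1 * co v (c1 * c2) c))"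
    by (intro sum.cong refl) (simp add: sum_distrib_right sum_distrib_left mult_ac)
  also have "\<dots> = (\<Sum>c2\<in>B v. \<Sum>c1\<in>B v. \<Sum>e1\<in>B v. \<Sum>e2\<in>B v. Xf e1 * Y e2 * Z c2 * (co v (e1 * e2) c1 * co v (c1 * c2) c))"
    by (rule sum.swap)
  also have "\<dots> = (\<Sum>c2\<in>B v. \<Sum>e1\<in>B v. \<Sum>c1\<in>B v. \<Sum>e2\<in>B v. Xf e1 * Y e2 * Z c2 * (co v (e1 * e2) c1 * co v (c1 * c2) c))"
    by (intro sum.cong refl sum.swap)
  also have "\<dots> = (\<Sum>c2\<in>B v. \<Sum>e1\<in>B v. \<Sum>e2\<in>B v. \<Sum>c1\<in>B v. Xf e1 * Y e2 * Z c2 * (co v (e1 * e2) c1 * co v (c1 * c2) c))"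
    by (intro sum.cong refl sum.swap)
  also have "\<dots> = (\<Sum>c2\<in>B v. \<Sum>e1\<in>B v. \<Sum>e2\<in>B v. Xf e1 * Y e2 * Z c2 * co v (e1 * e2 * c2) c)"
    by (intro sum.cong refl, subst co_expandl) (auto simp: sum_distrib_left)
  also have "\<dots> = (\<Sum>e1\<in>B v. \<Sum>c2\<in>B v. \<Sum>e2\<in>B v. Xf e1 * Y e2 * Z c2 * co v (e1 * (e2 * c2)) c)"
    by (subst sum.swap) (simp add: mult.assoc)
  also have "\<dots> = (\<Sum>e1\<in>B v. \<Sum>e2\<in>B v. \<Sum>c2\<in>B v. Xf e1 * Y e2 * Z c2 * co v (e1 * (e2 * c2)) c)"
    by (intro sum.cong refl sum.swap)
  also have "\<dots> = (\<Sum>e1\<in>B v. \<Sum>e2\<in>B v. \<Sum>c2\<in>B v. \<Sum>c1\<in>B v. Xf e1 * Y e2 * Z c2 * (co v (e2 * c2) c1 * co v (e1 * c1) c))"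
    by (intro sum.cong refl, subst co_expandr) (auto simp: sum_distrib_left)
  also have "\<dots> = (\<Sum>e1\<in>B v. \<Sum>e2\<in>B v. \<Sum>c1\<in>B v. \<Sum>c2\<in>B v. Xf e1 * Y e2 * Z c2 * (co v (e2 * c2) c1 * co v (e1 * c1) c))"
    by (intro sum.cong refl sum.swap)
  also have "\<dots> = (\<Sum>e1\<in>B v. \<Sum>c1\<in>B v. \<Sum>e2\<in>B v. \<Sum>c2\<in>B v. Xf e1 * Y e2 * Z c2 * (co v (e2 * c2) c1 * co v (e1 * c1) c))"
    by (intro sum.cong refl sum.swap)
  also have "\<dots> = ?R"
    by (intro sum.cong refl) (simp add: sum_distrib_right sum_distrib_left mult_ac)
  finally show ?thesis .
qed

text \<open>Induction on the length of the path at which both sides are evaluated, with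
  \<open>x\<close> arbitrary because the recursion replaces \<open>x\<close> by
  \<open>sh Q a c x\<close>. What is left over at each stage is \<open>assoc_coef\<close> for the
  leading coefficient.\<close>

lemma mult_assoc:
  assumes Q: "finite (arrs Q)" and y: "y \<in> PQ Q" and z: "z \<in> PQ Q"
  shows "(x \<star>\<^bsub>Q\<^esub> y) \<star>\<^bsub>Q\<^esub> z = x \<star>\<^bsub>Q\<^esub> (y \<star>\<^bsub>Q\<^esub> z)"
proof -
  have "((x \<star>\<^bsub>Q\<^esub> y) \<star>\<^bsub>Q\<^esub> z) (v,c,L) = (x \<star>\<^bsub>Q\<^esub> (y \<star>\<^bsub>Q\<^esub> z)) (v,c,L)" if "valid Q B (v,c,L)" for v c L
    using that
  proof (induction L arbitrary: v c x)
    case Nil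
    then show ?case by (simp add: mult_Nil[OF Q] assoc_coef)
  next
    case (Cons ab L)
    obtain a b where ab [simp]: "ab = (a,b)" by (cases ab)
    have val: "valid Q B (v,c,(a,b)#L)" and c: "c \<in> B (tgt Q a)" and a: "a \<in> arrs Q"
      and v: "tgt Q a = v" and r': "valid Q B (src Q a,b,L)"
      using Cons.prems by auto
    let ?r' = "(src Q a,b,L)"
    have 1: "(sh Q a c (x \<star>\<^bsub>Q\<^esub> y) \<star>\<^bsub>Q\<^esub> z) ?r'
      = (\<Sum>c1\<in>B v. \<Sum>c2\<in>B v. x (v,c1,[]) * (sh Q a c2 y \<star>\<^bsub>Q\<^esub> z) ?r' * co v (c1 * c2) c)
        + (sh Q a c x \<star>\<^bsub>Q\<^esub> (y \<star>\<^bsub>Q\<^esub> z)) ?r'"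
    proof -
      have "(sh Q a c (x \<star>\<^bsub>Q\<^esub> y) \<star>\<^bsub>Q\<^esub> z) ?r'
        = (\<Sum>c2\<in>B v. (\<Sum>c1\<in>B v. x (v,c1,[]) * co v (c1 * c2) c) * (sh Q a c2 y \<star>\<^bsub>Q\<^esub> z) ?r')
          + (sh Q a c x \<star>\<^bsub>Q\<^esub> (y \<star>\<^bsub>Q\<^esub> z)) ?r'"
        unfolding sh_mult[OF Q y a c] mult_add_left mult_sum_left mult_sc_left v
          Cons.IH[OF r', symmetric] sum_fun_apply sc_apply plus_fun_apply ..
      also have "(\<Sum>c2\<in>B v. (\<Sum>c1\<in>B v. x (v,c1,[]) * co v (c1 * c2) c) * (sh Q a c2 y \<star>\<^bsub>Q\<^esub> z) ?r')
        = (\<Sum>c1\<in>B v. \<Sum>c2\<in>B v. x (v,c1,[]) * (sh Q a c2 y \<star>\<^bsub>Q\<^esub> z) ?r' * co v (c1 * c2) c)"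
        by (subst sum.swap, intro sum.cong refl) (simp add: sum_distrib_right sum_distrib_left mult_ac)
      finally show ?thesis .
    qed
    have "((x \<star>\<^bsub>Q\<^esub> y) \<star>\<^bsub>Q\<^esub> z) (v,c,(a,b)#L) =
      (\<Sum>c1\<in>B v. \<Sum>c2\<in>B v. (\<Sum>e1\<in>B v. \<Sum>e2\<in>B v. x (v,e1,[]) * y (v,e2,[]) * co v (e1 * e2) c1)
         * z (v,c2,(a,b)#L) * co v (c1 * c2) c)
      + ((\<Sum>c1\<in>B v. \<Sum>c2\<in>B v. x (v,c1,[]) * (sh Q a c2 y \<star>\<^bsub>Q\<^esub> z) ?r' * co v (c1 * c2) c)
        + (sh Q a c x \<star>\<^bsub>Q\<^esub> (y \<star>\<^bsub>Q\<^esub> z)) ?r')"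
      unfolding mult_Cons[OF Q val] 1 by (simp add: mult_Nil[OF Q])
    also have "\<dots> = (\<Sum>c1\<in>B v. \<Sum>c2\<in>B v. x (v,c1,[]) * (\<Sum>e1\<in>B v. \<Sum>e2\<in>B v. y (v,e1,[]) * z (v,e2,(a,b)#L) * co v (e1 * e2) c2)
         * co v (c1 * c2) c)
      + ((\<Sum>c1\<in>B v. \<Sum>c2\<in>B v. x (v,c1,[]) * (sh Q a c2 y \<star>\<^bsub>Q\<^esub> z) ?r' * co v (c1 * c2) c)
        + (sh Q a c x \<star>\<^bsub>Q\<^esub> (y \<star>\<^bsub>Q\<^esub> z)) ?r')"
      by (simp only: assoc_coef)
    also have "\<dots> = (\<Sum>c1\<in>B v. \<Sum>c2\<in>B v. x (v,c1,[]) * (y \<star>\<^bsub>Q\<^esub> z) (v,c2,(a,b)#L) * co v (c1 * c2) c)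
        + (sh Q a c x \<star>\<^bsub>Q\<^esub> (y \<star>\<^bsub>Q\<^esub> z)) ?r'"
    proof -
      have "(y \<star>\<^bsub>Q\<^esub> z) (v,c2,(a,b)#L) = (\<Sum>e1\<in>B v. \<Sum>e2\<in>B v. y (v,e1,[]) * z (v,e2,(a,b)#L) * co v (e1 * e2) c2)
        + (sh Q a c2 y \<star>\<^bsub>Q\<^esub> z) ?r'" if "c2 \<in> B v" for c2
        by (rule mult_Cons[OF Q]) (use val that in auto)
      then have "(\<Sum>c1\<in>B v. \<Sum>c2\<in>B v. x (v,c1,[]) * (y \<star>\<^bsub>Q\<^esub> z) (v,c2,(a,b)#L) * co v (c1 * c2) c)
        = (\<Sum>c1\<in>B v. \<Sum>c2\<in>B v. x (v,c1,[]) * (\<Sum>e1\<in>B v. \<Sum>e2\<in>B v. y (v,e1,[]) * z (v,e2,(a,b)#L) * co v (e1 * e2) c2) * co v (c1 * c2) c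
           + x (v,c1,[]) * (sh Q a c2 y \<star>\<^bsub>Q\<^esub> z) ?r' * co v (c1 * c2) c)"
        by (intro sum.cong refl) (simp add: algebra_simps)
      then show ?thesis by (simp add: sum.distrib)
    qed
    also have "\<dots> = (x \<star>\<^bsub>Q\<^esub> (y \<star>\<^bsub>Q\<^esub> z)) (v,c,(a,b)#L)"
      by (rule mult_Cons[OF Q val, symmetric])
    finally show ?case by simp
  qed
  then show ?thesis
    by (auto simp: fun_eq_iff) (metis mult_invalid)
qed

section \<open>Field elements and arrows inside the path algebra\<close>

definition re :: "'v \<Rightarrow> 'e \<Rightarrow> ('v,'e) pelt" where
  "re v w = (\<lambda>(u,b,L). if u = v \<and> L = [] then co v w b else 0)"

text \<open>The word 1 \<open>a\<close> 1. It is expanded in basis paths because 1 need not belong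
  to the chosen bases.\<close>

definition ar :: "'v wquiver \<Rightarrow> nat \<Rightarrow> ('v,'e) pelt" where
  "ar Q a = (\<lambda>(v,c,L). if v = tgt Q a \<and> map fst L = [a] then co v 1 c * co (src Q a) 1 (snd (hd L)) else 0)"

lemma re_apply: "re v w (u,b,L) = (if u = v \<and> L = [] then co v w b else 0)"
  by (simp add: re_def)

lemma re_PA [simp, intro]: "w \<in> Fi v \<Longrightarrow> re v w \<in> PQ Q"
  by (auto simp: PA_def re_def co_out valid_def)

lemma ar_PA [simp, intro]: "a \<in> arrs Q \<Longrightarrow> ar Q a \<in> PQ Q"
  unfolding PA_def
proof (intro CollectI conjI allI impI)
  fix p show "ar Q a p \<in> F" by (cases p) (auto simp: ar_def)
next
  fix p assume a: "a \<in> arrs Q" and p: "\<not> valid Q B p"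
  obtain v c L where [simp]: "p = (v,c,L)" by (cases p)
  show "ar Q a p = 0"
  proof (cases "v = tgt Q a \<and> map fst L = [a]")
    case True
    then obtain b where "L = [(a,b)]" by (cases L) auto
    then show ?thesis using p a True by (auto simp: ar_def co_out)
  qed (auto simp: ar_def)
qed

lemma inR_re [simp]: "inR (re v w)"
  by (auto simp: inR_def re_def plen_def)

lemma fil_ar [simp]: "fil (Suc 0) (ar Q a)"
  by (auto simp: fil_def ar_def plen_def)

lemma sh_re [simp]: "sh Q a c (re v w) = 0"
  by (auto simp: sh_def re_def fun_eq_iff)

lemma re_mult_apply:
  assumes Q: "finite (arrs Q)" and x: "x \<in> PQ Q" and w: "w \<in> Fi v"
  shows "(re v w \<star>\<^bsub>Q\<^esub> x) (u,c,L) = (if u = v then \<Sum>c2\<in>B v. co v (w * c2) c * x (v,c2,L) else 0)"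
proof -
  have *: "(\<Sum>c1\<in>B u. \<Sum>c2\<in>B u. re v w (u,c1,[]) * Xf c2 * co u (c1 * c2) c)
     = (if u = v then \<Sum>c2\<in>B v. co v (w * c2) c * Xf c2 else 0)" for Xf
  proof (cases "u = v")
    case True
    have "(\<Sum>c1\<in>B v. \<Sum>c2\<in>B v. re v w (v,c1,[]) * Xf c2 * co v (c1 * c2) c)
       = (\<Sum>c2\<in>B v. \<Sum>c1\<in>B v. co v w c1 * Xf c2 * co v (c1 * c2) c)"
      by (subst sum.swap) (simp add: re_def)
    also have "\<dots> = (\<Sum>c2\<in>B v. co v (w * c2) c * Xf c2)"
      by (intro sum.cong refl, subst co_expandl) (auto simp: w sum_distrib_left sum_distrib_right mult_ac)
    finally show ?thesis using True by simp
  qed (simp add: re_def)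
  show ?thesis
  proof (cases "valid Q B (u,c,L)")
    case True
    show ?thesis
    proof (cases L)
      case Nil
      then show ?thesis using True * by (simp add: mult_Nil[OF Q])
    next
      case (Cons ab L')
      obtain a b where [simp]: "ab = (a,b)" by (cases ab)
      show ?thesis using True mult_Cons[OF Q, of u c a b L' "re v w" x] *[of "\<lambda>c2. x (u,c2,(a,b)#L')"]
        by (auto simp: Cons)
    qed
  next
    case False
    have "co v (w * c2) c * x (v,c2,L) = 0" if "u = v" "c2 \<in> B v" for c2
    proof (cases "c \<in> B v")
      case True
      then have "\<not> valid Q B (v,c2,L)" using False that by (auto simp: valid_def)
      then show ?thesis using PA_out[OF x] by simp
    qed (use that w in \<open>auto simp: co_out\<close>)
    then show ?thesis using False by (auto simp: mult_invalid intro!: sum.neutral)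
  qed
qed

lemma re1_mult_apply:
  assumes Q: "finite (arrs Q)" and x: "x \<in> PQ Q"
  shows "(re v 1 \<star>\<^bsub>Q\<^esub> x) (u,c,L) = (if u = v then x (u,c,L) else 0)"
proof (cases "c \<in> B u")
  case True
  then show ?thesis
    using sum_co_basis[of c v "\<lambda>e. x (v,e,L)"]
    by (auto simp: re_mult_apply[OF Q x] mult.commute)
next
  case False
  then have "\<not> valid Q B (u,c,L)" by (auto simp: valid_def)
  then show ?thesis using PA_out[OF x, of "(u,c,L)"] by (auto simp: mult_invalid)
qed

lemma re_re:
  assumes "w \<in> Fi v" "w' \<in> Fi u" and Q: "finite (arrs Q)"
  shows "re v w \<star>\<^bsub>Q\<^esub> re u w' = (if u = v then re v (w * w') else 0)"
proof
  fix p :: "('v,'e) bpath"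
  obtain t c L where [simp]: "p = (t,c,L)" by (cases p)
  show "(re v w \<star>\<^bsub>Q\<^esub> re u w') p = (if u = v then re v (w * w') else 0) p"
    using assms co_expandr[of w v w' c]
    by (auto simp: re_mult_apply[OF Q re_PA] re_apply mult.commute intro!: sum.cong)
qed

lemma re_sc: "w \<in> Fi v \<Longrightarrow> c \<in> F \<Longrightarrow> re v (c * w) = sc c (re v w)"
  by (auto simp: re_def fun_eq_iff co_scale)

lemma re_sum: "(\<And>i. i \<in> I \<Longrightarrow> f i \<in> F) \<Longrightarrow> (\<And>i. i \<in> I \<Longrightarrow> w i \<in> Fi v) \<Longrightarrow>
   re v (\<Sum>i\<in>I. f i * w i) = (\<Sum>i\<in>I. sc (f i) (re v (w i)))"
  by (auto simp: re_def fun_eq_iff co_lin sum_fun_apply)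

lemma mult_re1_apply:
  assumes Q: "finite (arrs Q)" and x: "x \<in> PQ Q"
  shows "(x \<star>\<^bsub>Q\<^esub> re u 1) r = (if endv Q r = u then x r else 0)"
proof (cases "valid Q B r")
  case True
  have "(x \<star>\<^bsub>Q\<^esub> re u 1) (v,c,L) = (if endv Q (v,c,L) = u then x (v,c,L) else 0)"
    if "valid Q B (v,c,L)" "x \<in> PQ Q" for v c L x
    using that
  proof (induction L arbitrary: v c x)
    case Nil
    have "(x \<star>\<^bsub>Q\<^esub> re u 1) (v,c,[]) = (\<Sum>c1\<in>B v. \<Sum>c2\<in>B v. x (v,c1,[]) * re u 1 (v,c2,[]) * co v (c1 * c2) c)"
      using Nil by (simp add: mult_Nil[OF Q])
    also have "\<dots> = (if v = u then \<Sum>c1\<in>B v. x (v,c1,[]) * co v (c1 * 1) c else 0)"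
      using co_expandr[of _ v 1 c] by (auto simp: re_def sum_distrib_left mult_ac intro!: sum.cong)
    also have "\<dots> = (if v = u then x (v,c,[]) else 0)"
      using sum_co_basis[of c v "\<lambda>e. x (v,e,[])"] Nil by auto
    finally show ?case by simp
  next
    case (Cons ab L)
    obtain a b where ab [simp]: "ab = (a,b)" by (cases ab)
    show ?case using Cons.prems Cons.IH[of "src Q a" b "sh Q a c x"] 
      by (auto simp: mult_Cons[OF Q] endv_Cons re_apply sh_apply)
  qed
  then show ?thesis using True x by (cases r) auto
next
  case False
  then show ?thesis using PA_out[OF x] by (simp add: mult_invalid)
qed

lemma ar_mult_apply:
  assumes Q: "finite (arrs Q)" and x: "x \<in> PQ Q" and a: "a \<in> arrs Q"
  shows "(ar Q a \<star>\<^bsub>Q\<^esub> x) (v,c,L) = (case L of [] \<Rightarrow> 0 | (a',b) # L' \<Rightarrow>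
     if a' = a \<and> v = tgt Q a then co v 1 c * x (src Q a,b,L') else 0)"
proof (cases L)
  case Nil
  then show ?thesis by (cases "c \<in> B v") (simp_all add: mult_Nil[OF Q] ar_def)
next
  case (Cons ab L')
  obtain a' b where [simp]: "ab = (a',b)" by (cases ab)
  show ?thesis
  proof (cases "valid Q B (v,c,L)")
    case True
    have "sh Q a' c (ar Q a) = (if a' = a then sc (co (tgt Q a) 1 c) (re (src Q a) 1) else 0)"
      by (auto simp: fun_eq_iff sh_def ar_def re_def)
    then show ?thesis using True x
      by (auto simp: Cons mult_Cons[OF Q] ar_def[of Q a] mult_sc_left re1_mult_apply[OF Q])
  next
    case False
    have "a' = a \<and> v = tgt Q a \<Longrightarrow> co v 1 c * x (src Q a,b,L') = 0"
      using False PA_out[OF x, of "(src Q a,b,L')"] co_out[of 1 v c] a by (auto simp: Cons)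
    then show ?thesis using False by (auto simp: Cons mult_invalid)
  qed
qed

lemma re_ar_mult_apply:
  assumes Q: "finite (arrs Q)" and x: "x \<in> PQ Q" and a: "a \<in> arrs Q" and w: "w \<in> Fi (tgt Q a)"
  shows "(re (tgt Q a) w \<star>\<^bsub>Q\<^esub> ar Q a \<star>\<^bsub>Q\<^esub> x) (v,c,L) = (case L of [] \<Rightarrow> 0 | (a',b) # L' \<Rightarrow>
     if a' = a \<and> v = tgt Q a then co v w c * x (src Q a,b,L') else 0)"
proof -
  have "(\<Sum>c2\<in>B (tgt Q a). co (tgt Q a) 1 c2 * co (tgt Q a) (w * c2) c) = co (tgt Q a) w c"
    using co_expandr[of w "tgt Q a" 1 c] w by simp
  then have "(\<Sum>c2\<in>B (tgt Q a). co (tgt Q a) (w * c2) c * (co (tgt Q a) 1 c2 * Xf)) = co (tgt Q a) w c * Xf" for Xf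
    by (simp add: mult_ac flip: sum_distrib_left)
  then show ?thesis
    using assms by (auto simp: re_mult_apply ar_mult_apply split: list.split)
qed

definition rp :: "('v,'e) pelt \<Rightarrow> ('v,'e) pelt" where
  "rp x = (\<lambda>p. if plen p = 0 then x p else 0)"

lemma rp_PA [simp, intro]: "x \<in> PQ Q \<Longrightarrow> rp x \<in> PQ Q"
  by (auto simp: PA_def rp_def)

lemma inR_rp [simp]: "inR (rp x)"
  by (auto simp: inR_def rp_def)

text \<open>Sorting the terms by their first coefficient and first arrow. Applied under a
  homomorphism this becomes a recursion that gains one degree per step.\<close>

lemma decomp:
  assumes Q: "finite (arrs Q)" and x: "x \<in> PQ Q"
  shows "x = rp x + (\<Sum>a\<in>arrs Q. \<Sum>c\<in>B (tgt Q a). re (tgt Q a) c \<star>\<^bsub>Q\<^esub> ar Q a \<star>\<^bsub>Q\<^esub> sh Q a c x)"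
proof
  fix p :: "('v,'e) bpath"
  obtain v c L where p: "p = (v,c,L)" by (cases p)
  show "x p = (rp x + (\<Sum>a\<in>arrs Q. \<Sum>c\<in>B (tgt Q a). re (tgt Q a) c \<star>\<^bsub>Q\<^esub> ar Q a \<star>\<^bsub>Q\<^esub> sh Q a c x)) p"
  proof (cases L)
    case Nil
    then show ?thesis using x Q by (simp add: p sum_fun_apply re_ar_mult_apply rp_def)
  next
    case (Cons ab L')
    obtain a b where [simp]: "ab = (a,b)" by (cases ab)
    show ?thesis
    proof (cases "valid Q B p")
      case True
      then have a: "a \<in> arrs Q" "tgt Q a = v" "c \<in> B v" by (auto simp: p Cons)
      have "(\<Sum>a'\<in>arrs Q. \<Sum>c'\<in>B (tgt Q a'). re (tgt Q a') c' \<star>\<^bsub>Q\<^esub> ar Q a' \<star>\<^bsub>Q\<^esub> sh Q a' c' x) p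
        = (\<Sum>a'\<in>arrs Q. if a' = a then \<Sum>c'\<in>B v. x (v,c',(a,b)#L') * co v c' c else 0)"
        unfolding sum_fun_apply
        by (intro sum.cong refl) (use a x Q in \<open>auto simp: p Cons re_ar_mult_apply sh_apply intro!: sum.cong\<close>)
      also have "\<dots> = x p" using a Q by (simp add: sum_co_basis p Cons)
      finally show ?thesis by (simp add: rp_def p Cons)
    next
      case False
      then have "(re (tgt Q a) c \<star>\<^bsub>Q\<^esub> (ar Q a \<star>\<^bsub>Q\<^esub> sh Q a c x)) p = 0" for a c
        by (simp add: mult_invalid)
      then show ?thesis using False x by (simp add: PA_out rp_def sum_fun_apply)
    qed
  qed
qed

end

section \<open>Homomorphisms and substitution\<close>

text \<open>Otherwise simp turns every equation between elements of the path algebra into a pointwise one.\<close>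

declare plus_fun_apply [simp del] zero_fun_apply [simp del] minus_apply [simp del]
  uminus_apply [simp del] sc_apply [simp del]

lemmas pw = plus_fun_apply zero_fun_apply minus_apply uminus_apply sc_apply sum_fun_apply

context sp_data
begin

section \<open>Corners of the path algebra\<close>

lemma wq_finite: "wq Q \<Longrightarrow> finite (arrs Q)"
  by (simp add: wq_def)

lemma wq_loopfree: "wq Q \<Longrightarrow> a \<in> arrs Q \<Longrightarrow> tgt Q a \<noteq> src Q a"
  by (auto simp: wq_def)

definition Cor :: "'v wquiver \<Rightarrow> 'v \<Rightarrow> 'v \<Rightarrow> ('v,'e) pelt set" where
  "Cor Q i j = {x \<in> PQ Q. \<forall>p. x p \<noteq> 0 \<longrightarrow> fst p = i \<and> endv Q p = j}"

lemma Cor_PA: "x \<in> Cor Q i j \<Longrightarrow> x \<in> PQ Q"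
  by (simp add: Cor_def)

lemma Cor_supp: "x \<in> Cor Q i j \<Longrightarrow> x p \<noteq> 0 \<Longrightarrow> fst p = i \<and> endv Q p = j"
  unfolding Cor_def by blast

lemma CorI: "x \<in> PQ Q \<Longrightarrow> (\<And>p. x p \<noteq> 0 \<Longrightarrow> fst p = i \<and> endv Q p = j) \<Longrightarrow> x \<in> Cor Q i j"
  unfolding Cor_def by blast

text \<open>The description by vertex idempotents is the one that homomorphisms preserve, since they
  fix \<open>R\<close>; the description by supports is the one that limits and coefficient arguments
  use.\<close>

lemma Cor_iff:
  assumes Q: "finite (arrs Q)"
  shows "x \<in> Cor Q i j \<longleftrightarrow> x \<in> PQ Q \<and> re i 1 \<star>\<^bsub>Q\<^esub> x = x \<and> x \<star>\<^bsub>Q\<^esub> re j 1 = x"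
proof (intro iffI conjI)
  assume x: "x \<in> Cor Q i j"
  show "x \<in> PQ Q" using x by (rule Cor_PA)
  show "re i 1 \<star>\<^bsub>Q\<^esub> x = x"
  proof
    fix p :: "('v,'e) bpath"
    show "(re i 1 \<star>\<^bsub>Q\<^esub> x) p = x p"
      using Cor_supp[OF x, of p] Cor_PA[OF x] by (cases p) (auto simp: re1_mult_apply[OF Q])
  qed
  show "x \<star>\<^bsub>Q\<^esub> re j 1 = x"
  proof
    fix p :: "('v,'e) bpath"
    show "(x \<star>\<^bsub>Q\<^esub> re j 1) p = x p"
      using Cor_supp[OF x, of p] Cor_PA[OF x] by (auto simp: mult_re1_apply[OF Q])
  qed
next
  assume x: "x \<in> PQ Q \<and> re i 1 \<star>\<^bsub>Q\<^esub> x = x \<and> x \<star>\<^bsub>Q\<^esub> re j 1 = x"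
  show "x \<in> Cor Q i j"
  proof (rule CorI)
    show x': "x \<in> PQ Q" using x by simp
    fix p assume p: "x p \<noteq> 0"
    obtain v c L where pp: "p = (v,c,L)" by (cases p)
    have "(re i 1 \<star>\<^bsub>Q\<^esub> x) p \<noteq> 0" "(x \<star>\<^bsub>Q\<^esub> re j 1) p \<noteq> 0" using x p by simp_all
    then show "fst p = i \<and> endv Q p = j"
      unfolding pp re1_mult_apply[OF Q x'] mult_re1_apply[OF Q x'] by (auto split: if_splits)
  qed
qed

lemma Cor_zero [simp, intro]: "0 \<in> Cor Q i j"
  by (rule CorI) (auto simp: pw)

lemma Cor_add [intro]: "x \<in> Cor Q i j \<Longrightarrow> y \<in> Cor Q i j \<Longrightarrow> x + y \<in> Cor Q i j"
proof (rule CorI)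
  fix p assume xy: "x \<in> Cor Q i j" "y \<in> Cor Q i j" and "(x + y) p \<noteq> 0"
  then have "x p \<noteq> 0 \<or> y p \<noteq> 0" by (auto simp: pw)
  then show "fst p = i \<and> endv Q p = j" using Cor_supp xy by blast
qed (simp add: Cor_PA)

lemma Cor_sc [intro]: "x \<in> Cor Q i j \<Longrightarrow> c \<in> F \<Longrightarrow> sc c x \<in> Cor Q i j"
  by (rule CorI) (auto simp: Cor_PA pw dest: Cor_supp)

lemma Cor_uminus [intro]: "x \<in> Cor Q i j \<Longrightarrow> - x \<in> Cor Q i j"
  by (rule CorI) (auto simp: Cor_PA pw dest: Cor_supp)

lemma Cor_diff [intro]: "x \<in> Cor Q i j \<Longrightarrow> y \<in> Cor Q i j \<Longrightarrow> x - y \<in> Cor Q i j"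
  using Cor_add[of x Q i j "- y"] Cor_uminus[of y Q i j] by simp

lemma Cor_sum [intro]: "(\<And>k. k \<in> I \<Longrightarrow> f k \<in> Cor Q i j) \<Longrightarrow> (\<Sum>k\<in>I. f k) \<in> Cor Q i j"
  by (induction I rule: infinite_finite_induct) auto

lemma Cor_mult [intro]:
  assumes Q: "finite (arrs Q)" and x: "x \<in> Cor Q i j" and y: "y \<in> Cor Q j k"
  shows "x \<star>\<^bsub>Q\<^esub> y \<in> Cor Q i k"
proof -
  have x': "x \<in> PQ Q" "re i 1 \<star>\<^bsub>Q\<^esub> x = x" and y': "y \<in> PQ Q" "y \<star>\<^bsub>Q\<^esub> re k 1 = y"
    using x y by (auto simp: Cor_iff[OF Q])
  have "re i 1 \<star>\<^bsub>Q\<^esub> (x \<star>\<^bsub>Q\<^esub> y) = x \<star>\<^bsub>Q\<^esub> y"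
    using mult_assoc[OF Q x'(1) y'(1), of "re i 1"] x' by simp
  moreover have "(x \<star>\<^bsub>Q\<^esub> y) \<star>\<^bsub>Q\<^esub> re k 1 = x \<star>\<^bsub>Q\<^esub> y"
    using mult_assoc[OF Q y'(1), of "re k 1" x] y' by simp
  ultimately show ?thesis
    using x' y' Q by (simp add: Cor_iff[OF Q] PA_mult)
qed

text \<open>A path of length 0 ends where it starts. Together with loop-freeness this keeps images
  of arrows free of constant terms.\<close>

lemma Cor_fil1:
  assumes "i \<noteq> j" "x \<in> Cor Q i j" shows "fil (Suc 0) x"
proof (rule filI)
  fix p :: "('v,'e) bpath" assume "plen p < Suc 0"
  then obtain v c where "p = (v,c,[])" by (cases p) auto
  then show "x p = 0" using Cor_supp[OF assms(2), of p] assms(1) by auto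
qed

lemma re_Cor [simp, intro]: "w \<in> Fi v \<Longrightarrow> re v w \<in> Cor Q v v"
  by (rule CorI) (auto simp: re_apply split: if_splits)

lemma ar_apply: "ar Q a (v,c,L) = (if v = tgt Q a \<and> map fst L = [a] then co v 1 c * co (src Q a) 1 (snd (hd L)) else 0)"
  by (simp add: ar_def)

lemma ar_Cor [simp, intro]: "a \<in> arrs Q \<Longrightarrow> ar Q a \<in> Cor Q (tgt Q a) (src Q a)"
proof (rule CorI)
  fix p assume "ar Q a p \<noteq> 0"
  moreover obtain v c L where "p = (v,c,L)" by (cases p)
  ultimately show "fst p = tgt Q a \<and> endv Q p = src Q a"
    by (cases L) (auto simp: ar_apply endv_def split: if_splits)
qed auto

lemma delta_apply: "delta p q = (if q = p then 1 else 0)"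
  by (simp add: delta_def)

lemma delta_PA [simp, intro]: "valid Q B p \<Longrightarrow> delta p \<in> PQ Q"
  by (auto simp: PA_def delta_apply)

lemma delta_Cor: "valid Q B p \<Longrightarrow> delta p \<in> Cor Q (fst p) (endv Q p)"
  by (rule CorI) (auto simp: delta_apply split: if_splits)

lemma fil_delta: "fil (plen p) (delta p)"
  by (rule filI) (auto simp: delta_apply)

lemma inR_zero: "inR 0"
  unfolding inR_def by (simp add: pw)

lemma inR_sum: "(\<And>i. i \<in> I \<Longrightarrow> inR (f i)) \<Longrightarrow> inR (\<Sum>i\<in>I. f i)"
  unfolding inR_def by (simp add: pw)

lemma re_total:
  assumes Q: "finite (arrs Q)" and x: "x \<in> PQ Q"
  shows "(\<Sum>v\<in>UNIV. re v 1) \<star>\<^bsub>Q\<^esub> x = x"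
proof
  fix p :: "('v,'e) bpath"
  obtain u c L where [simp]: "p = (u,c,L)" by (cases p)
  show "((\<Sum>v\<in>UNIV. re v 1) \<star>\<^bsub>Q\<^esub> x) p = x p"
    by (simp add: mult_sum_left pw re1_mult_apply[OF Q x])
qed

text \<open>A scalar of F acts as the element of \<open>R\<close> having that scalar at every
  vertex. Hence ring homomorphisms fixing \<open>R\<close> are F-linear although
  \<open>is_hom\<close> only demands additivity.\<close>

lemma sc_as_mult:
  assumes Q: "finite (arrs Q)" and x: "x \<in> PQ Q" and c: "c \<in> F"
  shows "sc c x = (\<Sum>v\<in>UNIV. re v c) \<star>\<^bsub>Q\<^esub> x"
proof -
  have "re v c = sc c (re v 1)" for v using re_sc[of 1 v c] c by simp
  then have "(\<Sum>v\<in>UNIV. re v c) = sc c (\<Sum>v\<in>UNIV. re v 1)" by (simp add: sc_sum)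
  then show ?thesis by (simp add: mult_sc_left re_total[OF Q x])
qed

definition is_hom :: "'v wquiver \<Rightarrow> 'v wquiver \<Rightarrow> (('v,'e) pelt \<Rightarrow> ('v,'e) pelt) \<Rightarrow> bool" where
  "is_hom Q Q' H \<longleftrightarrow> (\<forall>x\<in>PQ Q. H x \<in> PQ Q') \<and>
     (\<forall>x\<in>PQ Q. \<forall>y\<in>PQ Q. H (x + y) = H x + H y \<and> H (x \<star>\<^bsub>Q\<^esub> y) = H x \<star>\<^bsub>Q'\<^esub> H y) \<and>
     (\<forall>x\<in>PQ Q. inR x \<longrightarrow> H x = x)"

lemma hom_PA: "is_hom Q Q' H \<Longrightarrow> x \<in> PQ Q \<Longrightarrow> H x \<in> PQ Q'"
  unfolding is_hom_def by blast

lemma hom_add: "is_hom Q Q' H \<Longrightarrow> x \<in> PQ Q \<Longrightarrow> y \<in> PQ Q \<Longrightarrow> H (x + y) = H x + H y"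
  unfolding is_hom_def by blast

lemma hom_mult: "is_hom Q Q' H \<Longrightarrow> x \<in> PQ Q \<Longrightarrow> y \<in> PQ Q \<Longrightarrow> H (x \<star>\<^bsub>Q\<^esub> y) = H x \<star>\<^bsub>Q'\<^esub> H y"
  unfolding is_hom_def by blast

lemma hom_R: "is_hom Q Q' H \<Longrightarrow> x \<in> PQ Q \<Longrightarrow> inR x \<Longrightarrow> H x = x"
  unfolding is_hom_def by blast

lemma hom_re: "is_hom Q Q' H \<Longrightarrow> w \<in> Fi v \<Longrightarrow> H (re v w) = re v w"
  by (rule hom_R) auto

lemma hom_zero: "is_hom Q Q' H \<Longrightarrow> H 0 = 0"
  by (rule hom_R) (auto simp: inR_zero)

lemma hom_diff: 
  assumes H: "is_hom Q Q' H" and x: "x \<in> PQ Q" and y: "y \<in> PQ Q" 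
  shows "H (x - y) = H x - H y"
proof -
  have "H (x - y + y) = H (x - y) + H y" using x y by (intro hom_add[OF H]) auto
  then show ?thesis by (simp only: diff_add_cancel add_diff_cancel)
qed

lemma hom_sum:
  assumes H: "is_hom Q Q' H" and "\<And>i. i \<in> I \<Longrightarrow> f i \<in> PQ Q"
  shows "H (\<Sum>i\<in>I. f i) = (\<Sum>i\<in>I. H (f i))"
  using assms(2)
proof (induction I rule: infinite_finite_induct)
  case (insert i I)
  then have "H (f i + sum f I) = H (f i) + H (sum f I)"
    by (intro hom_add[OF H]) auto
  then show ?case using insert by (simp only: sum.insert insert_iff simp_thms)
qed (simp_all only: sum.infinite sum.empty simp_thms hom_zero[OF H])

lemma hom_sc:
  assumes H: "is_hom Q Q' H" and Q: "finite (arrs Q)" "finite (arrs Q')" and x: "x \<in> PQ Q" and c: "c \<in> F"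
  shows "H (sc c x) = sc c (H x)"
proof -
  have "(\<Sum>v\<in>UNIV. re v c) \<in> PQ Q" using c F_Fi by (intro PA_sum) auto
  moreover have "inR (\<Sum>v\<in>UNIV. re v c)" by (rule inR_sum) simp
  ultimately show ?thesis
    using sc_as_mult[OF Q(1) x c] sc_as_mult[OF Q(2) hom_PA[OF H x] c] hom_mult[OF H, of "\<Sum>v\<in>UNIV. re v c" x] x
      hom_R[OF H, of "\<Sum>v\<in>UNIV. re v c"] by simp
qed

lemma hom_Cor:
  assumes H: "is_hom Q Q' H" and Q: "finite (arrs Q)" "finite (arrs Q')" and x: "x \<in> Cor Q i j"
  shows "H x \<in> Cor Q' i j"
proof -
  have x': "x \<in> PQ Q" "re i 1 \<star>\<^bsub>Q\<^esub> x = x" "x \<star>\<^bsub>Q\<^esub> re j 1 = x" using x by (auto simp: Cor_iff[OF Q(1)])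
  have "re i 1 \<star>\<^bsub>Q'\<^esub> H x = H x"
    using hom_mult[OF H, of "re i 1" x] x' hom_re[OF H, of 1 i] by simp
  moreover have "H x \<star>\<^bsub>Q'\<^esub> re j 1 = H x"
    using hom_mult[OF H, of x "re j 1"] x' hom_re[OF H, of 1 j] by simp
  ultimately show ?thesis using hom_PA[OF H x'(1)] by (simp add: Cor_iff[OF Q(2)])
qed

lemma hom_ar_fil1:
  assumes H: "is_hom Q Q' H" and Q: "wq Q" "wq Q'" and a: "a \<in> arrs Q"
  shows "fil (Suc 0) (H (ar Q a))"
  using hom_Cor[OF H wq_finite[OF Q(1)] wq_finite[OF Q(2)] ar_Cor[OF a]] wq_loopfree[OF Q(1) a]
  by (rule Cor_fil1[rotated])

lemma hom_decomp:
  assumes H: "is_hom Q Q' H" and Q: "finite (arrs Q)" and x: "x \<in> PQ Q"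
  shows "H x = rp x + (\<Sum>a\<in>arrs Q. \<Sum>c\<in>B (tgt Q a). re (tgt Q a) c \<star>\<^bsub>Q'\<^esub> H (ar Q a) \<star>\<^bsub>Q'\<^esub> H (sh Q a c x))"
proof -
  let ?t = "\<lambda>a c. re (tgt Q a) c \<star>\<^bsub>Q\<^esub> ar Q a \<star>\<^bsub>Q\<^esub> sh Q a c x"
  have t: "?t a c \<in> PQ Q" if "a \<in> arrs Q" "c \<in> B (tgt Q a)" for a c
    using that Q x by auto
  have "H x = H (rp x + (\<Sum>a\<in>arrs Q. \<Sum>c\<in>B (tgt Q a). ?t a c))"
    using decomp[OF Q x] by simp
  also have "\<dots> = H (rp x) + H (\<Sum>a\<in>arrs Q. \<Sum>c\<in>B (tgt Q a). ?t a c)"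
    using x t by (intro hom_add[OF H] PA_sum rp_PA) auto
  also have "H (rp x) = rp x" using x by (intro hom_R[OF H]) auto
  also have "H (\<Sum>a\<in>arrs Q. \<Sum>c\<in>B (tgt Q a). ?t a c) = (\<Sum>a\<in>arrs Q. \<Sum>c\<in>B (tgt Q a). H (?t a c))"
    using t by (subst hom_sum[OF H]) (auto intro!: sum.cong hom_sum[OF H] PA_sum)
  also have "\<dots> = (\<Sum>a\<in>arrs Q. \<Sum>c\<in>B (tgt Q a). re (tgt Q a) c \<star>\<^bsub>Q'\<^esub> H (ar Q a) \<star>\<^bsub>Q'\<^esub> H (sh Q a c x))"
    using Q x by (intro sum.cong refl) (auto simp: hom_mult[OF H] hom_re[OF H])
  finally show ?thesis .
qed

lemma rp_fil: "fil (Suc 0) x \<Longrightarrow> rp x = 0"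
  by (rule ext) (auto simp: rp_def pw intro: filD)

text \<open>Automatic continuity: peel off first arrows with \<open>hom_decomp\<close>; the image of
  every peeled arrow has order at least 1 by \<open>hom_ar_fil1\<close>.\<close>

lemma hom_fil:
  assumes H: "is_hom Q Q' H" and Q: "wq Q" "wq Q'" and x: "x \<in> PQ Q" "fil n x"
  shows "fil n (H x)"
  using x
proof (induction n arbitrary: x)
  case (Suc n)
  have "rp x = 0" using Suc.prems fil_mono[of "Suc n" x "Suc 0"] by (intro rp_fil) auto
  moreover have "fil (Suc n) (re (tgt Q a) c \<star>\<^bsub>Q'\<^esub> H (ar Q a) \<star>\<^bsub>Q'\<^esub> H (sh Q a c x))" if "a \<in> arrs Q" for a c
    by (intro fil_mult_left fil_mult'[OF hom_ar_fil1[OF H Q that] Suc.IH]) (use Suc.prems in \<open>auto intro: fil_sh\<close>)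
  ultimately show ?case
    unfolding hom_decomp[OF H wq_finite[OF Q(1)] Suc.prems(1)] by (auto intro!: fil_add fil_sum)
qed auto

lemma hom_fil_diff:
  assumes H: "is_hom Q Q' H" and Q: "wq Q" "wq Q'" and x: "x \<in> PQ Q" "y \<in> PQ Q" "fil n (x - y)"
  shows "fil n (H x - H y)"
  using hom_fil[OF H Q _ x(3)] x hom_diff[OF H x(1,2)] by simp

text \<open>Two homomorphisms that agree on arrows have differences obeying the same recursion, so
  agreement up to order \<open>n\<close> improves to order \<open>n + 1\<close>.\<close>

lemma hom_ext:
  assumes H: "is_hom Q Q' H" and H': "is_hom Q Q' H'" and Q: "wq Q" "wq Q'"
    and eq: "\<And>a. a \<in> arrs Q \<Longrightarrow> H (ar Q a) = H' (ar Q a)" and x: "x \<in> PQ Q"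
  shows "H x = H' x"
proof (rule fil_all_eq)
  fix n show "fil n (H x - H' x)"
    using x
  proof (induction n arbitrary: x)
    case (Suc n)
    have "H x - H' x = (\<Sum>a\<in>arrs Q. \<Sum>c\<in>B (tgt Q a).
       re (tgt Q a) c \<star>\<^bsub>Q'\<^esub> H (ar Q a) \<star>\<^bsub>Q'\<^esub> (H (sh Q a c x) - H' (sh Q a c x)))"
      unfolding hom_decomp[OF H wq_finite[OF Q(1)] Suc.prems] hom_decomp[OF H' wq_finite[OF Q(1)] Suc.prems]
      by (simp only: add_diff_cancel_left sum_subtractf[symmetric]) 
         (intro sum.cong refl, simp only: mult_diff_right eq)
    moreover have "fil (Suc n) (re (tgt Q a) c \<star>\<^bsub>Q'\<^esub> H (ar Q a) \<star>\<^bsub>Q'\<^esub> (H (sh Q a c x) - H' (sh Q a c x)))"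
      if "a \<in> arrs Q" for a c
      by (intro fil_mult_left fil_mult'[OF hom_ar_fil1[OF H Q that] Suc.IH]) (use Suc.prems in auto)
    ultimately show ?case by (auto intro!: fil_sum)
  qed auto
qed

lemma hom_comp:
  assumes H: "is_hom Q Q' H" and H': "is_hom Q' Q'' H'" shows "is_hom Q Q'' (\<lambda>x. H' (H x))"
  unfolding is_hom_def
proof (intro conjI ballI impI)
  fix x assume x: "x \<in> PQ Q" "inR x"
  then show "H' (H x) = x" using hom_R[OF H x] hom_PA[OF H x(1)] hom_R[OF H'] by simp
qed (simp_all add: hom_PA[OF H] hom_PA[OF H'] hom_add[OF H] hom_add[OF H'] hom_mult[OF H] hom_mult[OF H'])

lemma hom_id: "is_hom Q Q (\<lambda>x. x)"
  by (simp add: is_hom_def)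

lemma hom_inv:
  assumes H: "is_hom Q Q' H" and Q: "finite (arrs Q)" and b: "bij_betw H (PQ Q) (PQ Q')"
  shows "is_hom Q' Q (the_inv_into (PQ Q) H)"
proof -
  let ?G = "the_inv_into (PQ Q) H"
  have inj: "inj_on H (PQ Q)" and im: "H ` PQ Q = PQ Q'" using b by (auto simp: bij_betw_def)
  have G: "?G y \<in> PQ Q" "H (?G y) = y" if "y \<in> PQ Q'" for y
    using that inj im by (auto intro: the_inv_into_into[OF inj] f_the_inv_into_f[OF inj])
  have GI: "?G y = x" if "x \<in> PQ Q" "H x = y" for x y
    using that the_inv_into_f_f[OF inj] by auto
  show ?thesis
    unfolding is_hom_def
  proof (intro conjI ballI impI)
    fix x y assume xy: "x \<in> PQ Q'" "y \<in> PQ Q'"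
    show "?G (x + y) = ?G x + ?G y"
      using G xy by (intro GI) (auto simp: hom_add[OF H])
    show "?G (x \<star>\<^bsub>Q'\<^esub> y) = ?G x \<star>\<^bsub>Q\<^esub> ?G y"
      using G xy Q by (intro GI) (auto simp: hom_mult[OF H])
  next
    fix x assume x: "x \<in> PQ Q'" "inR x"
    \<comment> \<open>\<open>R\<close> is common to all quivers on the same vertices: validity of a
      path of length 0 does not involve arrows.\<close>
    have "x \<in> PQ Q"
      unfolding PA_def
    proof (intro CollectI conjI allI impI)
      fix p show "x p \<in> F" using PA_F[OF x(1)] .
    next
      fix p assume p: "\<not> valid Q B p"
      show "x p = 0"
      proof (cases "plen p = 0")
        case True
        then obtain v c where "p = (v,c,[])" by (cases p) auto
        then show ?thesis using p PA_out[OF x(1), of p] by auto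
      qed (use x(2) in \<open>simp only: inR_def, blast\<close>)
    qed
    then show "?G x = x" using x hom_R[OF H] by (intro GI) auto
  qed (use G in auto)
qed

section \<open>Substitution: the homomorphism with prescribed values on arrows\<close>

primrec evn :: "'v wquiver \<Rightarrow> 'v wquiver \<Rightarrow> (nat \<Rightarrow> ('v,'e) pelt) \<Rightarrow> nat \<Rightarrow> ('v,'e) pelt \<Rightarrow> ('v,'e) pelt" where
  "evn Q Q' g 0 x = 0"
| "evn Q Q' g (Suc n) x = rp x + (\<Sum>a\<in>arrs Q. \<Sum>c\<in>B (tgt Q a). re (tgt Q a) c \<star>\<^bsub>Q'\<^esub> g a \<star>\<^bsub>Q'\<^esub> evn Q Q' g n (sh Q a c x))"

text \<open>\<open>evn\<close> with index \<open>n\<close> is correct in lengths below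
  \<open>n\<close>, since 0 is a correct answer below length 0 and each arrow gains one. So the
  coefficient at \<open>r\<close> is read off at index \<open>Suc (plen r)\<close>, from where it is
  stationary.\<close>

definition ev :: "'v wquiver \<Rightarrow> 'v wquiver \<Rightarrow> (nat \<Rightarrow> ('v,'e) pelt) \<Rightarrow> ('v,'e) pelt \<Rightarrow> ('v,'e) pelt" where
  "ev Q Q' g x = (\<lambda>r. evn Q Q' g (Suc (plen r)) x r)"

lemma rp_add: "rp (x + y) = rp x + rp y"
  by (auto simp: pw fun_eq_iff rp_def)

lemma rp_sc: "rp (sc c x) = sc c (rp x)"
  by (auto simp: pw fun_eq_iff rp_def)

lemma rp_PA': 
  assumes "x \<in> PQ Q" shows "rp x \<in> PQ Q'"
  unfolding PA_def
proof (intro CollectI conjI allI impI)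
  fix p show "rp x p \<in> F" using PA_F[OF assms] by (simp add: rp_def)
next
  fix p assume "\<not> valid Q' B p"
  then show "rp x p = 0" using PA_out[OF assms, of p] by (cases p) (auto simp: rp_def)
qed

lemma rp_mult:
  assumes Q: "finite (arrs Q)" "finite (arrs Q')" and x: "x \<in> PQ Q" "y \<in> PQ Q"
  shows "rp (x \<star>\<^bsub>Q\<^esub> y) = rp x \<star>\<^bsub>Q'\<^esub> rp y"
proof
  fix p :: "('v,'e) bpath"
  obtain v c L where [simp]: "p = (v,c,L)" by (cases p)
  show "rp (x \<star>\<^bsub>Q\<^esub> y) p = (rp x \<star>\<^bsub>Q'\<^esub> rp y) p"
  proof (cases L)
    case Nil
    then show ?thesis by (simp add: rp_def mult_Nil Q)
  next
    case (Cons ab L')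
    obtain a b where [simp]: "ab = (a,b)" by (cases ab)
    have "sh Q' a c (rp x) = 0" by (auto simp: pw fun_eq_iff sh_apply rp_def)
    then show ?thesis
      using mult_Cons[OF Q(2), of v c a b L' "rp x" "rp y"] mult_invalid[of Q' "(v,c,(a,b)#L')" "rp x" "rp y"]
      by (cases "valid Q' B p") (auto simp: Cons rp_def pw)
  qed
qed

text \<open>Puts a length-0 left factor into the structure-constant form in which it appears in
  \<open>sh_mult\<close>, so that the two can be matched in \<open>ev_mult\<close>.\<close>

lemma rp_mult_re:
  assumes Q: "finite (arrs Q)" and x: "x \<in> PQ Q" and c2: "c2 \<in> B v"
  shows "rp x \<star>\<^bsub>Q\<^esub> re v c2 = (\<Sum>c\<in>B v. sc (\<Sum>c1\<in>B v. x (v,c1,[]) * co v (c1 * c2) c) (re v c))"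
proof
  fix p :: "('v,'e) bpath"
  obtain u c' L where [simp]: "p = (u,c',L)" by (cases p)
  show "(rp x \<star>\<^bsub>Q\<^esub> re v c2) p = (\<Sum>c\<in>B v. sc (\<Sum>c1\<in>B v. x (v,c1,[]) * co v (c1 * c2) c) (re v c)) p"
  proof (cases "L = [] \<and> u = v \<and> c' \<in> B v")
    case True
    then have "(rp x \<star>\<^bsub>Q\<^esub> re v c2) p = (\<Sum>c1\<in>B v. \<Sum>c3\<in>B v. x (v,c1,[]) * co v c2 c3 * co v (c1 * c3) c')"
      by (simp add: mult_Nil[OF Q] rp_def re_apply)
    also have "\<dots> = (\<Sum>c1\<in>B v. x (v,c1,[]) * co v (c1 * c2) c')"
      by (intro sum.cong refl, subst co_expandr) (auto simp: c2 sum_distrib_left mult_ac)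
    also have "\<dots> = (\<Sum>c\<in>B v. (\<Sum>c1\<in>B v. x (v,c1,[]) * co v (c1 * c2) c) * co v c c')"
      by (rule sum_co_basis[symmetric]) (use True in simp)
    finally show ?thesis using True by (simp add: pw re_apply)
  next
    case False
    have "(rp x \<star>\<^bsub>Q\<^esub> re v c2) p = 0"
    proof (cases "valid Q B p")
      case True
      show ?thesis
      proof (cases L)
        case Nil
        have "(\<Sum>c1\<in>B u. \<Sum>c2a\<in>B u. rp x (u, c1, []) * re v c2 (u, c2a, []) * co u (c1 * c2a) c') = 0"
          using False True Nil by (cases "u = v") (auto simp: re_apply)
        then show ?thesis using True Nil by (simp add: mult_Nil[OF Q])
      next
        case (Cons ab L')
        obtain a b where [simp]: "ab = (a,b)" by (cases ab)
        have "sh Q a c' (rp x) = 0" by (auto simp: pw fun_eq_iff sh_apply rp_def)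
        then show ?thesis
          using mult_Cons[OF Q, of u c' a b L' "rp x" "re v c2"] True by (auto simp: Cons re_apply pw)
      qed
    qed (simp add: mult_invalid)
    then show ?thesis using False by (auto simp: pw re_apply co_out intro!: sum.neutral)
  qed
qed

context
  fixes Q Q' :: "'v wquiver" and g :: "nat \<Rightarrow> ('v,'e) pelt"
  assumes Q: "wq Q" and Q': "finite (arrs Q')" and g: "\<And>a. a \<in> arrs Q \<Longrightarrow> g a \<in> Cor Q' (tgt Q a) (src Q a)"
begin

lemma g_fil1: "a \<in> arrs Q \<Longrightarrow> fil (Suc 0) (g a)"
  using g wq_loopfree[OF Q] by (auto intro: Cor_fil1)

lemma g_PA: "a \<in> arrs Q \<Longrightarrow> g a \<in> PQ Q'"
  using g by (auto intro: Cor_PA)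

lemma evn_PA: "x \<in> PQ Q \<Longrightarrow> evn Q Q' g n x \<in> PQ Q'"
  by (induction n arbitrary: x) (auto intro!: PA_add PA_sum rp_PA' PA_mult Q' g_PA)

lemma evn_add: "evn Q Q' g n (x + y) = evn Q Q' g n x + evn Q Q' g n y"
proof (induction n arbitrary: x y)
  case (Suc n)
  show ?case
    by (simp only: evn.simps sh_add Suc mult_add_right rp_add sum.distrib ac_simps)
qed simp

lemma evn_sc: "evn Q Q' g n (sc c x) = sc c (evn Q Q' g n x)"
proof (induction n arbitrary: x)
  case (Suc n)
  show ?case
    by (simp only: evn.simps sh_sc Suc mult_sc_right rp_sc sc_add sc_sum)
qed simp

lemma evn_stable: "fil n (evn Q Q' g (n + k) x - evn Q Q' g n x)"
proof (induction n arbitrary: x)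
  case (Suc n)
  have "evn Q Q' g (Suc n + k) x - evn Q Q' g (Suc n) x = (\<Sum>a\<in>arrs Q. \<Sum>c\<in>B (tgt Q a).
      re (tgt Q a) c \<star>\<^bsub>Q'\<^esub> g a \<star>\<^bsub>Q'\<^esub> (evn Q Q' g (n + k) (sh Q a c x) - evn Q Q' g n (sh Q a c x)))"
    by (simp only: add_Suc evn.simps add_diff_cancel_left sum_subtractf mult_diff_right)
  moreover have "fil (Suc n) (re (tgt Q a) c \<star>\<^bsub>Q'\<^esub> g a \<star>\<^bsub>Q'\<^esub> (evn Q Q' g (n + k) (sh Q a c x) - evn Q Q' g n (sh Q a c x)))"
    if "a \<in> arrs Q" for a c
    by (intro fil_mult_left fil_mult'[OF g_fil1[OF that] Suc.IH]) auto
  ultimately show ?case by (auto intro!: fil_sum)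
qed auto

lemma ev_evn: "fil n (ev Q Q' g x - evn Q Q' g n x)"
proof (rule filI)
  fix p :: "('v,'e) bpath" assume "plen p < n"
  then obtain k where "n = Suc (plen p) + k" by (metis less_imp_Suc_add add_Suc)
  then show "(ev Q Q' g x - evn Q Q' g n x) p = 0"
    using filD[OF evn_stable[of "Suc (plen p)" k x], of p] by (simp only: ev_def minus_apply) simp
qed

lemma ev_PA: "x \<in> PQ Q \<Longrightarrow> ev Q Q' g x \<in> PQ Q'"
  unfolding PA_def[of Q'] using PA_F[OF evn_PA] PA_out[OF evn_PA] by (simp only: ev_def) blast

lemma ev_add: "ev Q Q' g (x + y) = ev Q Q' g x + ev Q Q' g y"
  by (rule ext) (simp only: ev_def evn_add plus_fun_apply)

lemma ev_sc: "ev Q Q' g (sc c x) = sc c (ev Q Q' g x)"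
  by (rule ext) (simp only: ev_def evn_sc sc_apply)

lemma ev_zero: "ev Q Q' g 0 = 0"
  using ev_sc[of 0 0] by simp

lemma ev_sum: "ev Q Q' g (\<Sum>i\<in>I. f i) = (\<Sum>i\<in>I. ev Q Q' g (f i))"
  by (induction I rule: infinite_finite_induct)
    (simp_all only: sum.infinite sum.empty sum.insert ev_zero ev_add simp_thms not_False_eq_True)

lemma ev_rec: "ev Q Q' g x = rp x + (\<Sum>a\<in>arrs Q. \<Sum>c\<in>B (tgt Q a). re (tgt Q a) c \<star>\<^bsub>Q'\<^esub> g a \<star>\<^bsub>Q'\<^esub> ev Q Q' g (sh Q a c x))"
    (is "_ = ?R")
proof (rule fil_all_eq)
  fix n
  have "fil n (ev Q Q' g x - evn Q Q' g (Suc n) x)"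
    using ev_evn[of "Suc n" x] by (rule fil_mono) simp
  moreover have "evn Q Q' g (Suc n) x - ?R = (\<Sum>a\<in>arrs Q. \<Sum>c\<in>B (tgt Q a).
      re (tgt Q a) c \<star>\<^bsub>Q'\<^esub> g a \<star>\<^bsub>Q'\<^esub> (evn Q Q' g n (sh Q a c x) - ev Q Q' g (sh Q a c x)))"
    by (simp only: evn.simps add_diff_cancel_left sum_subtractf mult_diff_right)
  moreover have "fil n (re (tgt Q a) c \<star>\<^bsub>Q'\<^esub> g a \<star>\<^bsub>Q'\<^esub> (evn Q Q' g n (sh Q a c x) - ev Q Q' g (sh Q a c x)))" for a c
    by (intro fil_mult_left fil_sym[OF ev_evn])
  ultimately have "fil n (evn Q Q' g (Suc n) x - ?R)" "fil n (ev Q Q' g x - evn Q Q' g (Suc n) x)"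
    by (auto intro!: fil_sum)
  then show "fil n (ev Q Q' g x - ?R)"
    using fil_trans by blast
qed

lemma ev_R: 
  assumes "inR x" shows "ev Q Q' g x = x"
proof -
  have "x p = 0" if "plen p \<noteq> 0" for p using assms that unfolding inR_def by blast
  then have "rp x = x" "\<And>a c. sh Q a c x = 0"
    by (auto simp: pw fun_eq_iff rp_def sh_def)
  then show ?thesis
    using ev_rec[of x] by (simp add: ev_zero)
qed

text \<open>Both sides are expanded along the first arrow: the left one by \<open>ev_rec\<close> and
  the Leibniz rule \<open>sh_mult\<close>, the right one by \<open>ev_rec\<close> for each
  factor.\<close>

lemma ev_mult:
  assumes x: "x \<in> PQ Q" and y: "y \<in> PQ Q"
  shows "ev Q Q' g (x \<star>\<^bsub>Q\<^esub> y) = ev Q Q' g x \<star>\<^bsub>Q'\<^esub> ev Q Q' g y"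
proof (rule fil_all_eq)
  note Qf = wq_finite[OF Q]
  let ?e = "ev Q Q' g"
  fix n show "fil n (?e (x \<star>\<^bsub>Q\<^esub> y) - ?e x \<star>\<^bsub>Q'\<^esub> ?e y)"
    using x
  proof (induction n arbitrary: x)
    case (Suc n)
    note x = Suc.prems
    let ?k = "\<lambda>a c2 c. \<Sum>c1\<in>B (tgt Q a). x (tgt Q a,c1,[]) * co (tgt Q a) (c1 * c2) c"
    have 1: "re (tgt Q a) c \<star>\<^bsub>Q'\<^esub> g a \<star>\<^bsub>Q'\<^esub> ?e (sh Q a c (x \<star>\<^bsub>Q\<^esub> y)) =
        (\<Sum>c2\<in>B (tgt Q a). sc (?k a c2 c) (re (tgt Q a) c \<star>\<^bsub>Q'\<^esub> g a \<star>\<^bsub>Q'\<^esub> ?e (sh Q a c2 y)))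
        + re (tgt Q a) c \<star>\<^bsub>Q'\<^esub> g a \<star>\<^bsub>Q'\<^esub> ?e (sh Q a c x \<star>\<^bsub>Q\<^esub> y)"
      if "a \<in> arrs Q" "c \<in> B (tgt Q a)" for a c
      unfolding sh_mult[OF Qf y that] ev_add ev_sum ev_sc mult_add_right mult_sum_right mult_sc_right ..
    have A: "?e (x \<star>\<^bsub>Q\<^esub> y) = rp (x \<star>\<^bsub>Q\<^esub> y) +
        ((\<Sum>a\<in>arrs Q. \<Sum>c\<in>B (tgt Q a). \<Sum>c2\<in>B (tgt Q a). sc (?k a c2 c) (re (tgt Q a) c \<star>\<^bsub>Q'\<^esub> g a \<star>\<^bsub>Q'\<^esub> ?e (sh Q a c2 y)))
        + (\<Sum>a\<in>arrs Q. \<Sum>c\<in>B (tgt Q a). re (tgt Q a) c \<star>\<^bsub>Q'\<^esub> g a \<star>\<^bsub>Q'\<^esub> ?e (sh Q a c x \<star>\<^bsub>Q\<^esub> y)))"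
      unfolding ev_rec[of "x \<star>\<^bsub>Q\<^esub> y"] sum.distrib[symmetric]
      by (intro arg_cong2[of _ _ _ _ "(+)"] refl sum.cong 1)
    have 2: "rp x \<star>\<^bsub>Q'\<^esub> (re (tgt Q a) c2 \<star>\<^bsub>Q'\<^esub> g a \<star>\<^bsub>Q'\<^esub> ?e (sh Q a c2 y)) =
       (\<Sum>c\<in>B (tgt Q a). sc (?k a c2 c) (re (tgt Q a) c \<star>\<^bsub>Q'\<^esub> g a \<star>\<^bsub>Q'\<^esub> ?e (sh Q a c2 y)))"
      if a: "a \<in> arrs Q" and c2: "c2 \<in> B (tgt Q a)" for a c2
    proof -
      have rr: "rp (rp x) = rp x" by (auto simp: rp_def)
      have m: "g a \<star>\<^bsub>Q'\<^esub> ?e (sh Q a c2 y) \<in> PQ Q'"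
        using g_PA[OF a] ev_PA y Q' by auto
      have "rp x \<star>\<^bsub>Q'\<^esub> (re (tgt Q a) c2 \<star>\<^bsub>Q'\<^esub> g a \<star>\<^bsub>Q'\<^esub> ?e (sh Q a c2 y))
        = (rp x \<star>\<^bsub>Q'\<^esub> re (tgt Q a) c2) \<star>\<^bsub>Q'\<^esub> (g a \<star>\<^bsub>Q'\<^esub> ?e (sh Q a c2 y))"
        using mult_assoc[OF Q' re_PA[OF B_Fi[OF c2]] m] by simp
      also have "rp x \<star>\<^bsub>Q'\<^esub> re (tgt Q a) c2 = (\<Sum>c\<in>B (tgt Q a). sc (?k a c2 c) (re (tgt Q a) c))"
        using rp_mult_re[OF Q' rp_PA'[OF x] c2] unfolding rr by (simp add: rp_def)
      finally show ?thesis
        by (simp only: mult_sum_left mult_sc_left)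
    qed
    have "rp x \<star>\<^bsub>Q'\<^esub> ?e y = rp x \<star>\<^bsub>Q'\<^esub> rp y +
       (\<Sum>a\<in>arrs Q. \<Sum>c2\<in>B (tgt Q a). rp x \<star>\<^bsub>Q'\<^esub> (re (tgt Q a) c2 \<star>\<^bsub>Q'\<^esub> g a \<star>\<^bsub>Q'\<^esub> ?e (sh Q a c2 y)))"
      by (subst ev_rec) (simp only: mult_add_right mult_sum_right)
    also have "\<dots> = rp (x \<star>\<^bsub>Q\<^esub> y) + (\<Sum>a\<in>arrs Q. \<Sum>c\<in>B (tgt Q a). \<Sum>c2\<in>B (tgt Q a). sc (?k a c2 c) (re (tgt Q a) c \<star>\<^bsub>Q'\<^esub> g a \<star>\<^bsub>Q'\<^esub> ?e (sh Q a c2 y)))"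
    proof -
      have "(\<Sum>c2\<in>B (tgt Q a). rp x \<star>\<^bsub>Q'\<^esub> (re (tgt Q a) c2 \<star>\<^bsub>Q'\<^esub> g a \<star>\<^bsub>Q'\<^esub> ?e (sh Q a c2 y))) =
        (\<Sum>c\<in>B (tgt Q a). \<Sum>c2\<in>B (tgt Q a). sc (?k a c2 c) (re (tgt Q a) c \<star>\<^bsub>Q'\<^esub> g a \<star>\<^bsub>Q'\<^esub> ?e (sh Q a c2 y)))"
        if "a \<in> arrs Q" for a
        using 2[OF that] by (subst sum.swap) (intro sum.cong refl)
      then show ?thesis
        unfolding rp_mult[OF Qf Q' x y] by (intro arg_cong2[of _ _ _ _ "(+)"] refl) (rule sum.cong[OF refl])
    qed
    finally have C: "rp x \<star>\<^bsub>Q'\<^esub> ?e y = \<dots>" .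
    have 3: "(re (tgt Q a) c \<star>\<^bsub>Q'\<^esub> g a \<star>\<^bsub>Q'\<^esub> ?e (sh Q a c x)) \<star>\<^bsub>Q'\<^esub> ?e y =
        re (tgt Q a) c \<star>\<^bsub>Q'\<^esub> g a \<star>\<^bsub>Q'\<^esub> (?e (sh Q a c x) \<star>\<^bsub>Q'\<^esub> ?e y)" if a: "a \<in> arrs Q" for a c
      using ev_PA[OF sh_PA[OF x]] ev_PA[OF y] g_PA[OF a] Q' by (simp add: mult_assoc PA_mult)
    have D: "?e x \<star>\<^bsub>Q'\<^esub> ?e y = rp x \<star>\<^bsub>Q'\<^esub> ?e y +
        (\<Sum>a\<in>arrs Q. \<Sum>c\<in>B (tgt Q a). re (tgt Q a) c \<star>\<^bsub>Q'\<^esub> g a \<star>\<^bsub>Q'\<^esub> (?e (sh Q a c x) \<star>\<^bsub>Q'\<^esub> ?e y))"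
      by (subst (1) ev_rec) (simp only: mult_add_left mult_sum_left 3 cong: sum.cong)
    \<comment> \<open>The terms whose first arrow comes from \<open>y\<close> cancel. What remains
      is the defect of multiplicativity for \<open>sh Q a c x\<close>, multiplied by a value
      \<open>g a\<close> of order at least 1.\<close>
    have "?e (x \<star>\<^bsub>Q\<^esub> y) - ?e x \<star>\<^bsub>Q'\<^esub> ?e y = (\<Sum>a\<in>arrs Q. \<Sum>c\<in>B (tgt Q a).
        re (tgt Q a) c \<star>\<^bsub>Q'\<^esub> g a \<star>\<^bsub>Q'\<^esub> (?e (sh Q a c x \<star>\<^bsub>Q\<^esub> y) - ?e (sh Q a c x) \<star>\<^bsub>Q'\<^esub> ?e y))"
      unfolding A D C by (simp only: mult_diff_right sum_subtractf add.assoc add_diff_cancel_left)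
    moreover have "fil (Suc n) (re (tgt Q a) c \<star>\<^bsub>Q'\<^esub> g a \<star>\<^bsub>Q'\<^esub> (?e (sh Q a c x \<star>\<^bsub>Q\<^esub> y) - ?e (sh Q a c x) \<star>\<^bsub>Q'\<^esub> ?e y))"
      if "a \<in> arrs Q" for a c
      by (intro fil_mult_left fil_mult'[OF g_fil1[OF that] Suc.IH]) (use x in auto)
    ultimately show ?case by (auto intro!: fil_sum)
  qed auto
qed

lemma ev_hom: "is_hom Q Q' (ev Q Q' g)"
  unfolding is_hom_def using ev_PA ev_add ev_mult ev_R by simp

lemma ev_ar:
  assumes a: "a \<in> arrs Q" shows "ev Q Q' g (ar Q a) = g a"
proof -
  have "sh Q a' c (ar Q a) = (if a' = a then sc (co (tgt Q a) 1 c) (re (src Q a) 1) else 0)" for a' c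
    by (auto simp: pw fun_eq_iff sh_apply ar_apply re_apply)
  then have e: "ev Q Q' g (sh Q a' c (ar Q a)) = (if a' = a then sc (co (tgt Q a) 1 c) (re (src Q a) 1) else 0)" for a' c
    using ev_R[of "re (src Q a) 1"] by (simp add: ev_sc ev_zero)
  have "rp (ar Q a) = 0" by (rule rp_fil) simp
  then have "ev Q Q' g (ar Q a) = (\<Sum>a'\<in>arrs Q. \<Sum>c\<in>B (tgt Q a'). re (tgt Q a') c \<star>\<^bsub>Q'\<^esub> g a' \<star>\<^bsub>Q'\<^esub>
      (if a' = a then sc (co (tgt Q a) 1 c) (re (src Q a) 1) else 0))"
    by (subst ev_rec) (simp only: e add_0)
  also have "\<dots> = (\<Sum>a'\<in>arrs Q. if a' = a then \<Sum>c\<in>B (tgt Q a). sc (co (tgt Q a) 1 c) (re (tgt Q a) c \<star>\<^bsub>Q'\<^esub> g a \<star>\<^bsub>Q'\<^esub> re (src Q a) 1) else 0)"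
  proof (intro sum.cong refl)
    fix a'
    show "(\<Sum>c\<in>B (tgt Q a'). re (tgt Q a') c \<star>\<^bsub>Q'\<^esub> g a' \<star>\<^bsub>Q'\<^esub>
        (if a' = a then sc (co (tgt Q a) 1 c) (re (src Q a) 1) else 0))
      = (if a' = a then \<Sum>c\<in>B (tgt Q a). sc (co (tgt Q a) 1 c) (re (tgt Q a) c \<star>\<^bsub>Q'\<^esub> g a \<star>\<^bsub>Q'\<^esub> re (src Q a) 1) else 0)"
      by (cases "a' = a") (simp_all add: mult_sc_right)
  qed
  also have "\<dots> = (\<Sum>c\<in>B (tgt Q a). sc (co (tgt Q a) 1 c) (re (tgt Q a) c \<star>\<^bsub>Q'\<^esub> g a \<star>\<^bsub>Q'\<^esub> re (src Q a) 1))"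
    using a wq_finite[OF Q] by simp
  also have "\<dots> = (\<Sum>c\<in>B (tgt Q a). sc (co (tgt Q a) 1 c) (re (tgt Q a) c)) \<star>\<^bsub>Q'\<^esub> g a \<star>\<^bsub>Q'\<^esub> re (src Q a) 1"
    by (simp only: mult_sum_left mult_sc_left)
  also have "(\<Sum>c\<in>B (tgt Q a). sc (co (tgt Q a) 1 c) (re (tgt Q a) c)) = re (tgt Q a) 1"
    by (subst re_sum[symmetric]) (auto simp: co_sum)
  finally show ?thesis
    using g[OF a] by (simp add: Cor_iff[OF Q'])
qed

end

end

section \<open>Automorphisms and cyclic equivalence\<close>

lemma diff_diff_swap: "(a - b) - (c - e) = (a - c) - (b - e)" for a :: "'a::ab_group_add"
  by (simp add: algebra_simps)

text \<open>Contraction principle for the filtration: iterates become stationary in every degree.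
  \<open>Inv\<close> is the domain on which the map contracts and has to be closed under limits; the
  index \<open>i\<close> allows a system of equations to be solved simultaneously.\<close>

lemma fixpoint_exists:
  fixes \<Psi> :: "('i \<Rightarrow> ('v,'e::field) pelt) \<Rightarrow> 'i \<Rightarrow> ('v,'e) pelt"
  assumes x0: "Inv x0" and step: "\<And>x. Inv x \<Longrightarrow> Inv (\<Psi> x)"
    and contr: "\<And>x y n i. Inv x \<Longrightarrow> Inv y \<Longrightarrow> (\<And>i. fil n (x i - y i)) \<Longrightarrow> fil (Suc n) (\<Psi> x i - \<Psi> y i)"
    and lim: "\<And>x. (\<And>n. \<exists>y. Inv y \<and> (\<forall>i. fil n (x i - y i))) \<Longrightarrow> Inv x"
  shows "\<exists>x. Inv x \<and> \<Psi> x = x"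
proof -
  define Xn where "Xn n = (\<Psi> ^^ n) x0" for n
  have Xs: "Xn (Suc n) = \<Psi> (Xn n)" for n by (simp add: Xn_def)
  have I: "Inv (Xn n)" for n
    by (induction n) (use x0 step in \<open>simp_all add: Xn_def\<close>)
  have st: "fil n (Xn (n + k) i - Xn n i)" for n k i
  proof (induction n arbitrary: i)
    case (Suc n)
    show ?case unfolding add_Suc Xs by (rule contr[OF I I Suc])
  qed simp
  \<comment> \<open>The iterates with index above \<open>plen r\<close> agree at
    \<open>r\<close>.\<close>
  define l where "l i r = Xn (Suc (plen r)) i r" for i r
  have l: "fil n (l i - Xn n i)" for n i
  proof (rule filI)
    fix p :: "('v,'e) bpath" assume "plen p < n"
    then obtain k where "n = Suc (plen p) + k" using less_imp_Suc_add[of "plen p" n] by auto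
    then show "(l i - Xn n i) p = 0"
      using filD[OF st[of "Suc (plen p)" k i], of p] by (simp add: l_def pw)
  qed
  have Il: "Inv l" by (rule lim) (use I l in blast)
  have "\<Psi> l i = l i" for i
  proof (rule fil_all_eq)
    fix n
    have "fil (Suc n) (\<Psi> l i - Xn (Suc n) i)" unfolding Xs by (rule contr[OF Il I l])
    moreover have "fil (Suc n) (Xn (Suc n) i - l i)" by (rule fil_sym[OF l])
    ultimately have "fil (Suc n) (\<Psi> l i - l i)" by (rule fil_trans)
    then show "fil n (\<Psi> l i - l i)" by (rule fil_mono) simp
  qed
  then show ?thesis using Il by (intro exI[of _ l]) auto
qed

context sp_data
begin

lemma PA_limit:
  assumes "\<And>n. \<exists>u\<in>PQ Q. fil n (x - u)" shows "x \<in> PQ Q"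
  unfolding PA_def
proof (intro CollectI conjI allI impI)
  fix p :: "('v,'e) bpath" obtain u where u: "u \<in> PQ Q" "fil (Suc (plen p)) (x - u)" using assms by blast
  then have e: "x p = u p" using filD[OF u(2), of p] by (simp add: pw)
  show "x p \<in> F" unfolding e by (rule PA_F[OF u(1)])
  show "\<not> valid Q B p \<Longrightarrow> x p = 0" unfolding e by (rule PA_out[OF u(1)])
qed

lemma Cor_limit:
  assumes "\<And>n. \<exists>u\<in>Cor Q i j. fil n (x - u)" shows "x \<in> Cor Q i j"
proof (rule CorI)
  show "x \<in> PQ Q" by (rule PA_limit) (use assms Cor_PA in blast)
  fix p :: "('v,'e) bpath" obtain u where u: "u \<in> Cor Q i j" "fil (Suc (plen p)) (x - u)" using assms by blast
  then have "x p = u p" using filD[OF u(2), of p] by (simp add: pw)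
  then show "x p \<noteq> 0 \<Longrightarrow> fst p = i \<and> endv Q p = j" using Cor_supp[OF u(1), of p] by simp
qed

text \<open>Agreement on arrows modulo length 2 means equality of the induced maps on the associated
  graded algebra. In the recursion either an arrow is replaced by a difference of order 2, or the
  difference sits in the shifted element.\<close>

lemma hom_cong2:
  assumes H: "is_hom Q Q' H" and H': "is_hom Q Q' H'" and Q: "wq Q" "wq Q'"
    and d: "\<And>a. a \<in> arrs Q \<Longrightarrow> fil 2 (H (ar Q a) - H' (ar Q a))" and x: "x \<in> PQ Q" "fil n x"
  shows "fil (Suc n) (H x - H' x)"
  using x
proof (induction n arbitrary: x)
  case (0 x)
  have "H x - H' x = (\<Sum>a\<in>arrs Q. \<Sum>c\<in>B (tgt Q a).
       re (tgt Q a) c \<star>\<^bsub>Q'\<^esub> H (ar Q a) \<star>\<^bsub>Q'\<^esub> H (sh Q a c x) - re (tgt Q a) c \<star>\<^bsub>Q'\<^esub> H' (ar Q a) \<star>\<^bsub>Q'\<^esub> H' (sh Q a c x))"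
    unfolding hom_decomp[OF H wq_finite[OF Q(1)] 0(1)] hom_decomp[OF H' wq_finite[OF Q(1)] 0(1)]
    by (simp only: add_diff_cancel_left sum_subtractf)
  moreover have "fil (Suc 0) (re (tgt Q a) c \<star>\<^bsub>Q'\<^esub> H (ar Q a) \<star>\<^bsub>Q'\<^esub> H (sh Q a c x) - re (tgt Q a) c \<star>\<^bsub>Q'\<^esub> H' (ar Q a) \<star>\<^bsub>Q'\<^esub> H' (sh Q a c x))"
    if "a \<in> arrs Q" for a c
    by (intro fil_diff fil_mult_left fil_mult_right hom_ar_fil1[OF H Q that] hom_ar_fil1[OF H' Q that])
  ultimately show ?case by (auto intro!: fil_sum)
next
  case (Suc n x)
  have e: "re (tgt Q a) c \<star>\<^bsub>Q'\<^esub> H (ar Q a) \<star>\<^bsub>Q'\<^esub> H (sh Q a c x) - re (tgt Q a) c \<star>\<^bsub>Q'\<^esub> H' (ar Q a) \<star>\<^bsub>Q'\<^esub> H' (sh Q a c x)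
     = re (tgt Q a) c \<star>\<^bsub>Q'\<^esub> (H (ar Q a) - H' (ar Q a)) \<star>\<^bsub>Q'\<^esub> H (sh Q a c x)
       + re (tgt Q a) c \<star>\<^bsub>Q'\<^esub> H' (ar Q a) \<star>\<^bsub>Q'\<^esub> (H (sh Q a c x) - H' (sh Q a c x))" for a c
    by (simp add: mult_diff_left mult_diff_right)
  have "H x - H' x = (\<Sum>a\<in>arrs Q. \<Sum>c\<in>B (tgt Q a).
       re (tgt Q a) c \<star>\<^bsub>Q'\<^esub> (H (ar Q a) - H' (ar Q a)) \<star>\<^bsub>Q'\<^esub> H (sh Q a c x)
       + re (tgt Q a) c \<star>\<^bsub>Q'\<^esub> H' (ar Q a) \<star>\<^bsub>Q'\<^esub> (H (sh Q a c x) - H' (sh Q a c x)))"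
    unfolding hom_decomp[OF H wq_finite[OF Q(1)] Suc.prems(1)] hom_decomp[OF H' wq_finite[OF Q(1)] Suc.prems(1)]
    by (simp only: add_diff_cancel_left sum_subtractf[symmetric] e)
  moreover have "fil (Suc (Suc n)) (re (tgt Q a) c \<star>\<^bsub>Q'\<^esub> (H (ar Q a) - H' (ar Q a)) \<star>\<^bsub>Q'\<^esub> H (sh Q a c x)
       + re (tgt Q a) c \<star>\<^bsub>Q'\<^esub> H' (ar Q a) \<star>\<^bsub>Q'\<^esub> (H (sh Q a c x) - H' (sh Q a c x)))" if a: "a \<in> arrs Q" for a c
  proof (rule fil_add)
    have s: "sh Q a c x \<in> PQ Q" "fil n (sh Q a c x)" using Suc.prems by (auto intro: fil_sh)
    show "fil (Suc (Suc n)) (re (tgt Q a) c \<star>\<^bsub>Q'\<^esub> (H (ar Q a) - H' (ar Q a)) \<star>\<^bsub>Q'\<^esub> H (sh Q a c x))"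
      by (intro fil_mult_left fil_mult'[OF d[OF a] hom_fil[OF H Q s]]) simp
    show "fil (Suc (Suc n)) (re (tgt Q a) c \<star>\<^bsub>Q'\<^esub> H' (ar Q a) \<star>\<^bsub>Q'\<^esub> (H (sh Q a c x) - H' (sh Q a c x)))"
      by (intro fil_mult_left fil_mult'[OF hom_ar_fil1[OF H' Q a] Suc.IH[OF s]]) simp
  qed
  ultimately show ?case by (auto intro!: fil_sum)
qed

text \<open>\<open>H\<close> minus the identity raises the order by \<open>hom_cong2\<close>. A
  kernel element therefore has arbitrarily high order, and a preimage of \<open>y\<close> is a fixed
  point of the contraction sending \<open>x\<close> to \<open>y - (H x - x)\<close>.\<close>

lemma unitri_bij:
  assumes H: "is_hom Q Q H" and Q: "wq Q"
    and d: "\<And>a. a \<in> arrs Q \<Longrightarrow> fil 2 (H (ar Q a) - ar Q a)"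
  shows "bij_betw H (PQ Q) (PQ Q)"
proof -
  have st: "fil (Suc n) (H x - x)" if "x \<in> PQ Q" "fil n x" for n x
    using hom_cong2[OF H hom_id Q Q d that] .
  have inj: "inj_on H (PQ Q)"
  proof (rule inj_onI)
    fix x y assume xy: "x \<in> PQ Q" "y \<in> PQ Q" "H x = H y"
    show "x = y"
    proof (rule fil_all_eq)
      fix n show "fil n (x - y)"
      proof (induction n)
        case (Suc n)
        have "fil (Suc n) (H (x - y) - (x - y))" using st[OF PA_diff[OF xy(1,2)] Suc] .
        moreover have "H (x - y) = 0" using hom_diff[OF H xy(1,2)] xy(3) by simp
        ultimately have "fil (Suc n) (- (x - y))" by simp
        from fil_uminus[OF this] show ?case by simp
      qed simp
    qed
  qed
  have "y \<in> H ` PQ Q" if y: "y \<in> PQ Q" for y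
  proof -
    let ?Inv = "\<lambda>x. \<forall>i::unit. x i \<in> PQ Q" and ?P = "\<lambda>x (i::unit). y - (H (x ()) - x ())"
    have "\<exists>x. ?Inv x \<and> ?P x = x"
    proof (rule fixpoint_exists)
      show "?Inv (\<lambda>_. 0)" by simp
      show "?Inv (?P x)" if "?Inv x" for x using that y hom_PA[OF H] by auto
      show "fil (Suc n) (?P x i - ?P x' i)" if "?Inv x" "?Inv x'" "\<And>i. fil n (x i - x' i)" for x x' n and i :: unit
      proof -
        have e: "?P x i - ?P x' i = - (H (x () - x' ()) - (x () - x' ()))"
          using hom_diff[OF H, of "x ()" "x' ()"] that by simp
        show ?thesis unfolding e using that by (intro fil_uminus st) auto
      qed
      show "?Inv x" if "\<And>n. \<exists>x'. ?Inv x' \<and> (\<forall>i. fil n (x i - x' i))" for x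
      proof
        fix i :: unit show "x i \<in> PQ Q"
          by (rule PA_limit) (use that in blast)
      qed
    qed
    then obtain x where x: "?Inv x" "?P x = x" by blast
    from fun_cong[OF x(2), of "()"] have "y = H (x ())" by (simp add: algebra_simps)
    then show ?thesis using x(1) by blast
  qed
  then show ?thesis
    using inj hom_PA[OF H] by (auto simp: bij_betw_def)
qed

text \<open>Inverse linear parts suffice: both composites are unitriangular, so \<open>G\<close> is
  injective because \<open>L\<close> after \<open>G\<close> is, and surjective because
  \<open>G\<close> after \<open>L\<close> is.\<close>

lemma hom_bij:
  assumes G: "is_hom Q Q' G" and L: "is_hom Q' Q L" and Q: "wq Q" "wq Q'"
    and GL: "\<And>a. a \<in> arrs Q' \<Longrightarrow> fil 2 (G (L (ar Q' a)) - ar Q' a)"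
    and LG: "\<And>a. a \<in> arrs Q \<Longrightarrow> fil 2 (L (G (ar Q a)) - ar Q a)"
  shows "bij_betw G (PQ Q) (PQ Q')"
proof -
  have 1: "bij_betw (\<lambda>x. G (L x)) (PQ Q') (PQ Q')"
    by (rule unitri_bij[OF hom_comp[OF L G] Q(2) GL])
  have 2: "bij_betw (\<lambda>x. L (G x)) (PQ Q) (PQ Q)"
    by (rule unitri_bij[OF hom_comp[OF G L] Q(1) LG])
  have "inj_on G (PQ Q)"
    using bij_betw_imp_inj_on[OF 2] unfolding inj_on_def by auto
  moreover have "y \<in> G ` PQ Q" if "y \<in> PQ Q'" for y
  proof -
    have "y \<in> (\<lambda>x. G (L x)) ` PQ Q'" using 1 that by (simp add: bij_betw_def)
    then show ?thesis using hom_PA[OF L] by blast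
  qed
  ultimately show ?thesis using hom_PA[OF G] by (auto simp: bij_betw_def)
qed

section \<open>The closed span of cyclic differences\<close>

definition CY :: "'v wquiver \<Rightarrow> ('v,'e) pelt set" where
  "CY Q = madic_closure (Fspan F (cycgens Q F Fi B))"

abbreviation Sp :: "'v wquiver \<Rightarrow> ('v,'e) pelt set" where
  "Sp Q \<equiv> Fspan F (cycgens Q F Fi B)"

lemma cyc_equiv_iff: "cyc_equiv Q F Fi B x y \<longleftrightarrow> x - y \<in> CY Q"
  by (simp add: cyc_equiv_def CY_def)

lemma Fspan_zero: "0 \<in> Fspan F G"
  unfolding Fspan_def by (rule CollectI, rule exI[of _ "[]"]) simp

lemma Fspan_add:
  assumes "x \<in> Fspan F G" "y \<in> Fspan F G" shows "x + y \<in> Fspan F G"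
proof -
  obtain l m where "x = sum_list (map (\<lambda>(c, x). (\<lambda>p. c * x p)) l)" "set l \<subseteq> F \<times> G"
      "y = sum_list (map (\<lambda>(c, x). (\<lambda>p. c * x p)) m)" "set m \<subseteq> F \<times> G"
    using assms unfolding Fspan_def by blast
  then show ?thesis
    unfolding Fspan_def by (intro CollectI exI[of _ "l @ m"]) simp
qed

lemma Fspan_sc:
  assumes "x \<in> Fspan F G" "k \<in> F" shows "sc k x \<in> Fspan F G"
proof -
  obtain l where l: "x = sum_list (map (\<lambda>(c, x). (\<lambda>p. c * x p)) l)" "set l \<subseteq> F \<times> G"
    using assms unfolding Fspan_def by blast
  have "sc k (sum_list (map (\<lambda>(c, x). (\<lambda>p. c * x p)) l)) = sum_list (map (\<lambda>(c, x). (\<lambda>p. c * x p)) (map (\<lambda>(c,x). (k * c, x)) l))"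
  proof (induction l)
    case (Cons cx l)
    obtain c x where [simp]: "cx = (c,x)" by (cases cx)
    have "sc k (\<lambda>p. c * x p) = (\<lambda>p. k * c * x p)" by (auto simp: sc_def)
    then show ?case using Cons by (simp add: sc_add)
  qed simp
  then show ?thesis
    unfolding Fspan_def l(1) using l(2) assms(2)
    by (intro CollectI exI[of _ "map (\<lambda>(c,x). (k * c, x)) l"]) auto
qed

lemma Fspan_gen:
  assumes "x \<in> G" shows "x \<in> Fspan F G"
  unfolding Fspan_def using assms by (intro CollectI exI[of _ "[(1,x)]"]) auto

lemma CY_iff: "x \<in> CY Q \<longleftrightarrow> (\<forall>n. \<exists>u\<in>Sp Q. fil n (x - u))"
  unfolding CY_def madic_closure_def fil_def by (simp add: pw)

lemma Sp_CY: "x \<in> Sp Q \<Longrightarrow> x \<in> CY Q"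
  unfolding CY_iff by (auto intro!: bexI[of _ x])

lemma CY_zero [simp, intro]: "0 \<in> CY Q"
  by (rule Sp_CY[OF Fspan_zero])

lemma CY_add [intro]:
  assumes "x \<in> CY Q" "y \<in> CY Q" shows "x + y \<in> CY Q"
  unfolding CY_iff
proof
  fix n
  obtain u v where uv: "u \<in> Sp Q" "fil n (x - u)" "v \<in> Sp Q" "fil n (y - v)"
    using assms unfolding CY_iff by blast
  have e: "x + y - (u + v) = (x - u) + (y - v)" by simp
  have "fil n (x + y - (u + v))" unfolding e using uv by (intro fil_add)
  with uv show "\<exists>u\<in>Sp Q. fil n (x + y - u)"
    by (intro bexI[of _ "u + v"]) (simp_all only: Fspan_add)
qed

lemma CY_sc [intro]:
  assumes "x \<in> CY Q" "k \<in> F" shows "sc k x \<in> CY Q"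
  unfolding CY_iff
proof
  fix n
  obtain u where "u \<in> Sp Q" "fil n (x - u)"
    using assms unfolding CY_iff by blast
  then show "\<exists>u\<in>Sp Q. fil n (sc k x - u)"
    using assms(2) by (intro bexI[of _ "sc k u"]) (simp_all add: fil_sc Fspan_sc flip: sc_diff)
qed

lemma CY_uminus [intro]: assumes "x \<in> CY Q" shows "- x \<in> CY Q"
proof -
  have "sc (- 1) x = - x" by (auto simp: fun_eq_iff pw)
  then show ?thesis using CY_sc[OF assms, of "- 1"] by simp
qed

lemma CY_diff [intro]: "x \<in> CY Q \<Longrightarrow> y \<in> CY Q \<Longrightarrow> x - y \<in> CY Q"
  using CY_add[of x Q "- y"] CY_uminus[of y Q] by simp

lemma CY_sum [intro]: "(\<And>i. i \<in> I \<Longrightarrow> f i \<in> CY Q) \<Longrightarrow> (\<Sum>i\<in>I. f i) \<in> CY Q"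
  by (induction I rule: infinite_finite_induct) auto

lemma CY_closed:
  assumes "\<And>n. \<exists>u\<in>CY Q. fil n (x - u)" shows "x \<in> CY Q"
  unfolding CY_iff
proof
  fix n
  obtain u where "u \<in> CY Q" and u: "fil n (x - u)" using assms by blast
  then obtain w where w: "w \<in> Sp Q" "fil n (u - w)" unfolding CY_iff by blast
  then show "\<exists>u\<in>Sp Q. fil n (x - u)" using fil_trans[OF u w(2)] by blast
qed

text \<open>The side conditions of \<open>cycgens\<close> in recursive form, suited to induction on
  the word.\<close>

fun okp :: "'v wquiver \<Rightarrow> 'v \<Rightarrow> 'e \<Rightarrow> (nat \<times> 'e) list \<Rightarrow> bool" where
  "okp Q v w [] = (w \<in> Fi v)"
| "okp Q v w ((a,w') # L) = (w \<in> Fi v \<and> a \<in> arrs Q \<and> tgt Q a = v \<and> okp Q (src Q a) w' L)"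

lemma okp_iff: "okp Q v w L \<longleftrightarrow> w \<in> Fi v \<and> achain Q v (map fst L) \<and>
    (\<forall>k<length L. snd (L ! k) \<in> Fi (src Q (fst (L ! k))))"
proof (induction L arbitrary: v w)
  case (Cons ab L)
  obtain a b where [simp]: "ab = (a,b)" by (cases ab)
  show ?case by (auto simp: Cons All_less_Suc2)
qed simp

lemma tensel_Nil: "w \<in> Fi v \<Longrightarrow> tensel Q F B v w [] = re v w"
  by (auto simp: tensel_def re_def fun_eq_iff co_out)

lemma tensel_Cons_apply:
  "tensel Q F B v w ((a,w') # L) (u,c,M) = (case M of [] \<Rightarrow> 0 | (a',b) # M' \<Rightarrow>
     if a' = a \<and> u = v \<and> c \<in> B v \<and> a \<in> arrs Q \<and> tgt Q a = v then co v w c * tensel Q F B (src Q a) w' L (src Q a,b,M') else 0)"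
  by (auto simp: tensel_def prod.lessThan_Suc_shift mult.assoc split: list.split simp del: prod.lessThan_Suc)

text \<open>The coefficientwise definition of \<open>tensel\<close> agrees with the product of its
  letters, which makes words accessible to algebraic identities and homomorphisms.\<close>

lemma tensel_Cons:
  assumes Q: "finite (arrs Q)" and "w \<in> Fi v" "a \<in> arrs Q" "tgt Q a = v" "tensel Q F B (src Q a) w' L \<in> PQ Q"
  shows "tensel Q F B v w ((a,w') # L) = re v w \<star>\<^bsub>Q\<^esub> ar Q a \<star>\<^bsub>Q\<^esub> tensel Q F B (src Q a) w' L"
proof
  fix p :: "('v,'e) bpath"
  obtain u c M where [simp]: "p = (u,c,M)" by (cases p)
  show "tensel Q F B v w ((a,w') # L) p = (re v w \<star>\<^bsub>Q\<^esub> ar Q a \<star>\<^bsub>Q\<^esub> tensel Q F B (src Q a) w' L) p"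
    using re_ar_mult_apply[OF Q assms(5,3), of w u c M] assms co_out[OF assms(2), of c]
    by (auto simp: tensel_Cons_apply split: list.split)
qed

lemma tensel_PA:
  assumes Q: "finite (arrs Q)" and "okp Q v w L" shows "tensel Q F B v w L \<in> PQ Q"
  using assms(2)
proof (induction L arbitrary: v w)
  case Nil
  then show ?case by (simp add: tensel_Nil)
next
  case (Cons ab L)
  obtain a b where [simp]: "ab = (a,b)" by (cases ab)
  show ?case using Cons Q by (auto simp: tensel_Cons)
qed

lemma tensel_Cons':
  assumes Q: "finite (arrs Q)" and "okp Q v w ((a,w') # L)"
  shows "tensel Q F B v w ((a,w') # L) = re v w \<star>\<^bsub>Q\<^esub> ar Q a \<star>\<^bsub>Q\<^esub> tensel Q F B (src Q a) w' L"
  using assms by (intro tensel_Cons tensel_PA) auto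

lemma tensel_Cor:
  assumes Q: "finite (arrs Q)" and "okp Q v w L" shows "tensel Q F B v w L \<in> Cor Q v (endv Q (v,w,L))"
  using assms(2)
proof (induction L arbitrary: v w)
  case Nil
  then show ?case by (simp add: tensel_Nil)
next
  case (Cons ab L)
  obtain a b where [simp]: "ab = (a,b)" by (cases ab)
  have "re v w \<star>\<^bsub>Q\<^esub> ar Q a \<star>\<^bsub>Q\<^esub> tensel Q F B (src Q a) b L \<in> Cor Q v (endv Q (src Q a,b,L))"
    using Cons.prems Cons.IH[of "src Q a" b] ar_Cor[of a Q] by (intro Cor_mult[OF Q] re_Cor) auto
  then show ?case using tensel_Cons'[OF Q, of v w a b L] Cons.prems by (simp add: endv_Cons)
qed

lemma delta_Nil: "c \<in> B v \<Longrightarrow> delta (v,c,[]) = re v c"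
  by (auto simp: fun_eq_iff delta_apply re_apply co_basis)

lemma delta_Cons:
  assumes Q: "finite (arrs Q)" and "valid Q B (v,c,(a,b)#L)"
  shows "delta (v,c,(a,b)#L) = re v c \<star>\<^bsub>Q\<^esub> ar Q a \<star>\<^bsub>Q\<^esub> delta (src Q a,b,L)"
proof
  fix p :: "('v,'e) bpath"
  obtain u e M where [simp]: "p = (u,e,M)" by (cases p)
  show "delta (v,c,(a,b)#L) p = (re v c \<star>\<^bsub>Q\<^esub> ar Q a \<star>\<^bsub>Q\<^esub> delta (src Q a,b,L)) p"
    using re_ar_mult_apply[OF Q, of "delta (src Q a,b,L)" a c u e M] assms
    by (auto simp: delta_apply co_basis split: list.split)
qed

lemma delta_tensel:
  assumes Q: "finite (arrs Q)" and "valid Q B (v,c,L)" 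
  shows "okp Q v c L \<and> tensel Q F B v c L = delta (v,c,L)"
  using assms(2)
proof (induction L arbitrary: v c)
  case (Cons ab L)
  obtain a b where ab: "ab = (a,b)" by (cases ab)
  have v: "valid Q B (v,c,(a,b)#L)" using Cons.prems by (simp add: ab)
  have IH: "okp Q (src Q a) b L" "tensel Q F B (src Q a) b L = delta (src Q a,b,L)"
    using Cons.IH[of "src Q a" b] v by auto
  have ok: "okp Q v c ((a,b)#L)" using v IH by auto
  show ?case unfolding ab using ok tensel_Cons'[OF Q ok] IH(2) delta_Cons[OF Q v] by simp
qed (auto simp: tensel_Nil delta_Nil)

lemma ar_re1 [simp]: "finite (arrs Q) \<Longrightarrow> a \<in> arrs Q \<Longrightarrow> ar Q a \<star>\<^bsub>Q\<^esub> re (src Q a) 1 = ar Q a"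
  using ar_Cor[of a Q] by (simp add: Cor_iff)

text \<open>This is the shape produced by \<open>rot1\<close>: the old leading coefficient
  \<open>w0\<close> is multiplied into the last coefficient, and the moved arrow is followed by 1
  because its own coefficient has become the leading one.\<close>

lemma tensel_snoc:
  assumes Q: "finite (arrs Q)" and "okp Q v w (R @ [(al,wl)])" and w0: "w0 \<in> Fi (src Q al)"
    and a1: "a1 \<in> arrs Q" "tgt Q a1 = src Q al"
  shows "okp Q v w (R @ [(al, wl * w0), (a1,1)]) \<and>
    tensel Q F B v w (R @ [(al, wl * w0), (a1,1)]) = tensel Q F B v w (R @ [(al,wl)]) \<star>\<^bsub>Q\<^esub> (re (src Q al) w0 \<star>\<^bsub>Q\<^esub> ar Q a1)"
  using assms(2)
proof (induction R arbitrary: v w)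
  case Nil
  let ?m = "re (src Q al) w0 \<star>\<^bsub>Q\<^esub> ar Q a1"
  have P: "re (src Q al) wl \<in> PQ Q" "re (src Q al) w0 \<in> PQ Q" "ar Q al \<in> PQ Q" "ar Q a1 \<in> PQ Q" "re v w \<in> PQ Q"
    using Nil w0 a1 by auto
  have ok: "okp Q v w [(al, wl * w0), (a1,1)]" "okp Q v w [(al,wl)]" "okp Q (src Q al) (wl * w0) [(a1,1)]"
    using Nil w0 a1 by auto
  have "tensel Q F B v w [(al, wl * w0), (a1,1)] = re v w \<star>\<^bsub>Q\<^esub> ar Q al \<star>\<^bsub>Q\<^esub> re (src Q al) (wl * w0) \<star>\<^bsub>Q\<^esub> ar Q a1"
    using tensel_Cons'[OF Q ok(1)] tensel_Cons'[OF Q ok(3)] a1 Q by (simp add: tensel_Nil)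
  also have "re (src Q al) (wl * w0) = re (src Q al) wl \<star>\<^bsub>Q\<^esub> re (src Q al) w0"
    using re_re[of wl "src Q al" w0 "src Q al" Q] Nil w0 Q by simp
  also have "re v w \<star>\<^bsub>Q\<^esub> ar Q al \<star>\<^bsub>Q\<^esub> (re (src Q al) wl \<star>\<^bsub>Q\<^esub> re (src Q al) w0) \<star>\<^bsub>Q\<^esub> ar Q a1
      = (re v w \<star>\<^bsub>Q\<^esub> ar Q al \<star>\<^bsub>Q\<^esub> re (src Q al) wl) \<star>\<^bsub>Q\<^esub> ?m"
    using P Q by (simp add: mult_assoc PA_mult)
  also have "re v w \<star>\<^bsub>Q\<^esub> ar Q al \<star>\<^bsub>Q\<^esub> re (src Q al) wl = tensel Q F B v w [(al,wl)]"
    using tensel_Cons'[OF Q ok(2)] Nil by (simp add: tensel_Nil)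
  finally show ?case using ok by simp
next
  case (Cons ab R)
  obtain a b where ab: "ab = (a,b)" by (cases ab)
  have ok: "okp Q v w ((a,b) # R @ [(al,wl)])" and ok': "okp Q (src Q a) b (R @ [(al,wl)])"
    using Cons.prems by (auto simp: ab)
  have IH: "okp Q (src Q a) b (R @ [(al, wl * w0), (a1,1)])"
    "tensel Q F B (src Q a) b (R @ [(al, wl * w0), (a1,1)]) = tensel Q F B (src Q a) b (R @ [(al,wl)]) \<star>\<^bsub>Q\<^esub> (re (src Q al) w0 \<star>\<^bsub>Q\<^esub> ar Q a1)"
    using Cons.IH[OF ok'] by auto
  have ok2: "okp Q v w ((a,b) # R @ [(al, wl * w0), (a1,1)])" using ok IH by simp
  have P: "re v w \<in> PQ Q" "ar Q a \<in> PQ Q" "tensel Q F B (src Q a) b (R @ [(al,wl)]) \<in> PQ Q" "re (src Q al) w0 \<star>\<^bsub>Q\<^esub> ar Q a1 \<in> PQ Q"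
    using ok tensel_PA[OF Q ok'] w0 a1 Q by auto
  show ?case
    using ok2 tensel_Cons'[OF Q ok2] tensel_Cons'[OF Q ok] IH P Q by (simp add: ab mult_assoc PA_mult)
qed

lemma cycgenI:
  assumes "L \<noteq> []" "src Q (fst (last L)) = v" "okp Q v w0 L"
  shows "tensel Q F B v w0 L - tensel Q F B (src Q (fst (hd L))) (fst (rot1 (w0, L))) (snd (rot1 (w0, L)))
    \<in> cycgens Q F Fi B"
  unfolding cycgens_def
  by (rule CollectI, rule exI[of _ v], rule exI[of _ w0], rule exI[of _ L]) (use assms okp_iff in blast)

text \<open>Rotating one letter is a commutator: with head \<open>w a\<close> and remaining word
  \<open>y\<close> the generator is (\<open>w a\<close>) \<open>y\<close> - \<open>y\<close>
  (\<open>w a\<close>). In this form homomorphisms can be applied to it.\<close>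

lemma cycgen_form:
  assumes Q: "wq Q" and "x \<in> cycgens Q F Fi B"
  obtains a w y where "a \<in> arrs Q" "w \<in> Fi (tgt Q a)" "y \<in> Cor Q (src Q a) (tgt Q a)"
    "x = (re (tgt Q a) w \<star>\<^bsub>Q\<^esub> ar Q a) \<star>\<^bsub>Q\<^esub> y - y \<star>\<^bsub>Q\<^esub> (re (tgt Q a) w \<star>\<^bsub>Q\<^esub> ar Q a)"
proof -
  note Qf = wq_finite[OF Q]
  from assms(2) obtain v w0 L where x: "x = tensel Q F B v w0 L -
        tensel Q F B (src Q (fst (hd L))) (fst (rot1 (w0, L))) (snd (rot1 (w0, L)))"
    and L: "L \<noteq> []" "src Q (fst (last L)) = v" and ok: "okp Q v w0 L"
    unfolding cycgens_def okp_iff by blast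
  obtain a w1 R where LR: "L = (a,w1) # R" using L by (cases L) auto
  have a: "a \<in> arrs Q" "tgt Q a = v" "w0 \<in> Fi v" and ok1: "okp Q (src Q a) w1 R" using ok by (auto simp: LR)
  \<comment> \<open>A cycle of length 1 would be a loop, so the second clause of \<open>rot1\<close>
    is always in its long case.\<close>
  have "R \<noteq> []" using L a wq_loopfree[OF Q, of a] by (auto simp: LR)
  then obtain R' al wl where R: "R = R' @ [(al,wl)]" by (cases R rule: rev_cases) auto
  have al: "src Q al = v" using L by (simp add: LR R)
  let ?y = "tensel Q F B (src Q a) w1 R"
  have y: "?y \<in> Cor Q (src Q a) (tgt Q a)"
    using tensel_Cor[OF Qf ok1] a al by (simp add: R endv_def)
  have yP: "?y \<in> PQ Q" using y by (rule Cor_PA)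
  have "tensel Q F B (src Q (fst (hd L))) (fst (rot1 (w0, L))) (snd (rot1 (w0, L))) = ?y \<star>\<^bsub>Q\<^esub> (re v w0 \<star>\<^bsub>Q\<^esub> ar Q a)"
    using tensel_snoc[OF Qf ok1[unfolded R], of w0 a] a al by (simp add: LR R)
  moreover have "tensel Q F B v w0 L = (re v w0 \<star>\<^bsub>Q\<^esub> ar Q a) \<star>\<^bsub>Q\<^esub> ?y"
    using tensel_Cons'[OF Qf ok[unfolded LR]] yP a Qf by (simp add: LR mult_assoc)
  ultimately show ?thesis using that[of a w0 ?y] a y x by simp
qed


lemma diff_add_diff: "(a - b) + (b - c) = a - c" for a :: "'a::ab_group_add"
  by simp

section \<open>Commutators of opposite corners are cyclically trivial\<close>

definition cmt :: "'v wquiver \<Rightarrow> ('v,'e) pelt \<Rightarrow> ('v,'e) pelt \<Rightarrow> ('v,'e) pelt" where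
  "cmt Q x y = x \<star>\<^bsub>Q\<^esub> y - y \<star>\<^bsub>Q\<^esub> x"

lemma cmt_sc: "cmt Q x (sc c y) = sc c (cmt Q x y)" "cmt Q (sc c x) y = sc c (cmt Q x y)"
  unfolding cmt_def mult_sc_left mult_sc_right sc_diff by (rule refl)+

lemma cmt_sum: "cmt Q x (\<Sum>i\<in>I. f i) = (\<Sum>i\<in>I. cmt Q x (f i))" "cmt Q (\<Sum>i\<in>I. f i) y = (\<Sum>i\<in>I. cmt Q (f i) y)"
  unfolding cmt_def mult_sum_left mult_sum_right sum_subtractf by (rule refl)+

lemma cmt_diff: "cmt Q x (y - z) = cmt Q x y - cmt Q x z" "cmt Q (y - z) x = cmt Q y x - cmt Q z x"
  unfolding cmt_def mult_diff_left mult_diff_right by (rule diff_diff_swap)+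

lemma cmt_fil: "fil n y \<Longrightarrow> fil n (cmt Q x y)" "fil n x \<Longrightarrow> fil n (cmt Q x y)"
  unfolding cmt_def by (intro fil_diff fil_mult_left fil_mult_right; assumption)+

definition Pl :: "'v wquiver \<Rightarrow> nat \<Rightarrow> ('v,'e) bpath set" where
  "Pl Q n = (\<Union>k<n. paths_len Q B k)"

lemma finite_Pl: "finite (arrs Q) \<Longrightarrow> finite (Pl Q n)"
  by (simp add: Pl_def finite_paths_len)

lemma Pl_iff: "p \<in> Pl Q n \<longleftrightarrow> valid Q B p \<and> plen p < n"
  unfolding Pl_def paths_len_def by blast

lemma approx:
  assumes Q: "finite (arrs Q)" and x: "x \<in> PQ Q"
  shows "fil n (x - (\<Sum>p\<in>Pl Q n. sc (x p) (delta p)))"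
proof (rule filI)
  fix q :: "('v,'e) bpath" assume q: "plen q < n"
  have "(\<Sum>p\<in>Pl Q n. sc (x p) (delta p)) q = (\<Sum>p\<in>Pl Q n. if p = q then x q else 0)"
    unfolding sum_fun_apply
  proof (rule sum.cong[OF refl])
    fix p show "sc (x p) (delta p) q = (if p = q then x q else 0)"
      by (cases "p = q") (simp_all add: sc_apply delta_apply)
  qed
  also have "\<dots> = (if q \<in> Pl Q n then x q else 0)"
    by (rule sum.delta[OF finite_Pl[OF Q]])
  also have "\<dots> = x q"
  proof (cases "valid Q B q")
    case True
    then have "q \<in> Pl Q n" using q by (simp only: Pl_iff simp_thms)
    then show ?thesis by (simp only: if_True)
  next
    case False
    then have "x q = 0" by (rule PA_out[OF x])
    then show ?thesis by (simp only: if_cancel)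
  qed
  finally show "(x - (\<Sum>p\<in>Pl Q n. sc (x p) (delta p))) q = 0" by (simp add: pw)
qed

text \<open>For \<open>y\<close> a basis path this is a generator of the span. General
  \<open>y\<close> follows since the commutator is F-linear and continuous in
  \<open>y\<close>.\<close>

lemma cmt_arrow:
  assumes Q: "wq Q" and a: "a \<in> arrs Q" and w: "w \<in> Fi (tgt Q a)" and y: "y \<in> Cor Q (src Q a) (tgt Q a)"
  shows "cmt Q (re (tgt Q a) w \<star>\<^bsub>Q\<^esub> ar Q a) y \<in> CY Q"
proof (rule CY_closed)
  note Qf = wq_finite[OF Q]
  let ?x = "re (tgt Q a) w \<star>\<^bsub>Q\<^esub> ar Q a"
  have d: "cmt Q ?x (delta q) \<in> CY Q" if q: "valid Q B q" "fst q = src Q a" "endv Q q = tgt Q a" for q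
  proof -
    obtain v b L where "q = (v,b,L)" by (cases q)
    then have qq: "q = (src Q a,b,L)" using q(2) by simp
    have Lne: "L \<noteq> []"
    proof
      assume "L = []"
      then have "endv Q q = src Q a" unfolding qq by simp
      then show False using q(3) wq_loopfree[OF Q a] by simp
    qed
    then obtain R' al wl where L: "L = R' @ [(al,wl)]" by (cases L rule: rev_cases) auto
    have ok1: "okp Q (src Q a) b L" and dt: "tensel Q F B (src Q a) b L = delta q"
      using delta_tensel[OF Qf q(1)[unfolded qq]] unfolding qq by blast+
    have al: "src Q al = tgt Q a" using q(3) unfolding qq L endv_def by simp
    have ok: "okp Q (tgt Q a) w ((a,b)#L)" using ok1 a w by simp
    have dP: "delta q \<in> PQ Q" using q by simp
    have 1: "tensel Q F B (tgt Q a) w ((a,b)#L) = ?x \<star>\<^bsub>Q\<^esub> delta q"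
      using tensel_Cons'[OF Qf ok] dt dP a Qf by (simp add: mult_assoc)
    have 2: "tensel Q F B (src Q a) (fst (rot1 (w, (a,b)#L))) (snd (rot1 (w, (a,b)#L))) = delta q \<star>\<^bsub>Q\<^esub> ?x"
    proof -
      have r: "rot1 (w, (a,b)#L) = (b, R' @ [(al, wl * w), (a,1)])" by (simp add: L)
      have "w \<in> Fi (src Q al)" unfolding al by (rule w)
      from conjunct2[OF tensel_snoc[OF Qf ok1[unfolded L] this a al[symmetric]]]
      show ?thesis unfolding r fst_conv snd_conv al dt[unfolded L] .
    qed
    have "tensel Q F B (tgt Q a) w ((a,b)#L) - tensel Q F B (src Q (fst (hd ((a,b)#L)))) (fst (rot1 (w, (a,b)#L))) (snd (rot1 (w, (a,b)#L)))
      \<in> cycgens Q F Fi B"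
      by (rule cycgenI[OF _ _ ok], simp, unfold L, simp add: al)
    then have "cmt Q ?x (delta q) \<in> cycgens Q F Fi B"
      unfolding list.sel fst_conv 1 2 cmt_def .
    then show ?thesis by (rule Sp_CY[OF Fspan_gen])
  qed
  fix n
  let ?y = "\<Sum>p\<in>Pl Q n. sc (y p) (delta p)"
  have "sc (y p) (cmt Q ?x (delta p)) \<in> CY Q" if "p \<in> Pl Q n" for p
  proof (cases "y p = 0")
    case False
    have "valid Q B p" using that by (simp only: Pl_iff)
    then show ?thesis
      using d[of p] Cor_supp[OF y False] PA_F[OF Cor_PA[OF y]] by (intro CY_sc) simp_all
  qed simp
  then have "cmt Q ?x ?y \<in> CY Q" unfolding cmt_sum cmt_sc by (rule CY_sum)
  moreover have "fil n (cmt Q ?x y - cmt Q ?x ?y)"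
    using cmt_fil(1)[OF approx[OF Qf Cor_PA[OF y]]] by (simp add: cmt_diff)
  ultimately show "\<exists>u\<in>CY Q. fil n (cmt Q ?x y - u)" by blast
qed

text \<open>The trace-like identity that shortens the first entry of a commutator at the cost of
  lengthening the second.\<close>

lemma cmt_mult:
  assumes Q: "finite (arrs Q)" and "x \<in> PQ Q" "x' \<in> PQ Q" "y \<in> PQ Q"
  shows "cmt Q (x \<star>\<^bsub>Q\<^esub> x') y = cmt Q x (x' \<star>\<^bsub>Q\<^esub> y) + cmt Q x' (y \<star>\<^bsub>Q\<^esub> x)"
  unfolding cmt_def mult_assoc[OF Q assms(3,4)] mult_assoc[OF Q assms(4,2)] mult_assoc[OF Q assms(2,3)]
  by (rule diff_add_diff[symmetric])

text \<open>A coefficient without an arrow is not the head of a generator. Writing \<open>y\<close>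
  as a sum of products \<open>u s\<close> with \<open>u\<close> of the form \<open>c a\<close>, the
  commutator of \<open>w\<close> with \<open>u s\<close> is that of \<open>w u\<close> with
  \<open>s\<close> minus that of \<open>u\<close> with \<open>s w\<close>, and both are covered by
  \<open>cmt_arrow\<close>.\<close>

lemma cmt_re:
  assumes Q: "wq Q" and w: "w \<in> Fi v" and y: "y \<in> Cor Q v v" "fil (Suc 0) y"
  shows "cmt Q (re v w) y \<in> CY Q"
proof -
  note Qf = wq_finite[OF Q]
  have "y = rp y + (\<Sum>a\<in>arrs Q. \<Sum>c\<in>B (tgt Q a). re (tgt Q a) c \<star>\<^bsub>Q\<^esub> ar Q a \<star>\<^bsub>Q\<^esub> sh Q a c y)"
    by (rule decomp[OF Qf Cor_PA[OF y(1)]])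
  then have "cmt Q (re v w) y = cmt Q (re v w) (\<Sum>a\<in>arrs Q. \<Sum>c\<in>B (tgt Q a). re (tgt Q a) c \<star>\<^bsub>Q\<^esub> ar Q a \<star>\<^bsub>Q\<^esub> sh Q a c y)"
    unfolding rp_fil[OF y(2)] by simp
  moreover have "cmt Q (re v w) (re (tgt Q a) c \<star>\<^bsub>Q\<^esub> ar Q a \<star>\<^bsub>Q\<^esub> sh Q a c y) \<in> CY Q"
    if a: "a \<in> arrs Q" and c: "c \<in> B (tgt Q a)" for a c
  proof (cases "tgt Q a = v")
    case False
    have "sh Q a c y = 0"
    proof
      fix p show "sh Q a c y p = 0 p"
        using False Cor_supp[OF y(1)] by (cases p) (force simp: sh_apply pw)
    qed
    then show ?thesis by (simp add: cmt_def)
  next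
    case True
    let ?u = "re v c \<star>\<^bsub>Q\<^esub> ar Q a" and ?s = "sh Q a c y"
    have s: "?s \<in> Cor Q (src Q a) v"
    proof (rule CorI)
      show "?s \<in> PQ Q" using Cor_PA[OF y(1)] by auto
      fix p assume p: "?s p \<noteq> 0"
      obtain u b L where "p = (u,b,L)" by (cases p)
      then show "fst p = src Q a \<and> endv Q p = v"
        using p Cor_supp[OF y(1), of "(tgt Q a,c,(a,b)#L)"] by (auto simp: sh_apply endv_Cons split: if_splits)
    qed
    have P: "?s \<in> PQ Q" "re v w \<in> PQ Q" "re v c \<in> PQ Q" "ar Q a \<in> PQ Q" "?u \<in> PQ Q"
      using Cor_PA[OF s] w c a True Qf by auto
    have "cmt Q (re v w) (?u \<star>\<^bsub>Q\<^esub> ?s) = cmt Q (re v w \<star>\<^bsub>Q\<^esub> ?u) ?s - cmt Q ?u (?s \<star>\<^bsub>Q\<^esub> re v w)"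
      using cmt_mult[OF Qf P(2,5,1)] unfolding cmt_def by (simp only: diff_diff_eq2 algebra_simps)
    moreover have "re v w \<star>\<^bsub>Q\<^esub> ?u = re v (w * c) \<star>\<^bsub>Q\<^esub> ar Q a"
      using P c True mult_assoc[OF Qf P(3,4), of "re v w"] re_re[of w v c v Q] w Qf by simp
    moreover have "cmt Q (re v (w * c) \<star>\<^bsub>Q\<^esub> ar Q a) ?s \<in> CY Q"
      using cmt_arrow[OF Q a, of "w * c" ?s] True w c s by simp
    moreover have "cmt Q ?u (?s \<star>\<^bsub>Q\<^esub> re v w) \<in> CY Q"
      using cmt_arrow[OF Q a, of c "?s \<star>\<^bsub>Q\<^esub> re v w"] True w c Cor_mult[OF Qf s re_Cor[OF w]] by simp
    ultimately show ?thesis using P Qf True by (simp add: mult_assoc CY_diff)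
  qed
  ultimately show ?thesis by (auto simp: cmt_sum)
qed

lemma cmt_delta:
  assumes Q: "wq Q" and "valid Q B (v,c,L)" "L \<noteq> []" "y \<in> Cor Q (endv Q (v,c,L)) v"
  shows "cmt Q (delta (v,c,L)) y \<in> CY Q"
  using assms(2-)
proof (induction L arbitrary: v c y)
  case (Cons ab L)
  note Qf = wq_finite[OF Q]
  obtain a b where ab: "ab = (a,b)" by (cases ab)
  have v: "valid Q B (v,c,(a,b)#L)" and a: "a \<in> arrs Q" "tgt Q a = v" "c \<in> B v" and v': "valid Q B (src Q a,b,L)"
    using Cons.prems by (auto simp: ab)
  have y: "y \<in> Cor Q (endv Q (src Q a,b,L)) v" using Cons.prems by (simp add: ab endv_Cons)
  let ?u = "re v c \<star>\<^bsub>Q\<^esub> ar Q a" and ?d = "delta (src Q a,b,L)"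
  have d: "?d \<in> Cor Q (src Q a) (endv Q (src Q a,b,L))" using delta_Cor[OF v'] by simp
  have u: "?u \<in> Cor Q v (src Q a)" using a by (intro Cor_mult[OF Qf] re_Cor) auto
  have P: "?u \<in> PQ Q" "?d \<in> PQ Q" "y \<in> PQ Q" "re v c \<in> PQ Q" "ar Q a \<in> PQ Q" using Cor_PA u d y a by auto
  have "delta (v,c,(a,b)#L) = ?u \<star>\<^bsub>Q\<^esub> ?d"
    using delta_Cons[OF Qf v] P Qf by (simp add: mult_assoc)
  then have e: "cmt Q (delta (v,c,(a,b)#L)) y = cmt Q ?u (?d \<star>\<^bsub>Q\<^esub> y) + cmt Q ?d (y \<star>\<^bsub>Q\<^esub> ?u)"
    using cmt_mult[OF Qf P(1-3)] by simp
  have 1: "cmt Q ?u (?d \<star>\<^bsub>Q\<^esub> y) \<in> CY Q"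
    using cmt_arrow[OF Q a(1), of c "?d \<star>\<^bsub>Q\<^esub> y"] a Cor_mult[OF Qf d y] by simp
  have yu: "y \<star>\<^bsub>Q\<^esub> ?u \<in> Cor Q (endv Q (src Q a,b,L)) (src Q a)" using Cor_mult[OF Qf y u] .
  have 2: "cmt Q ?d (y \<star>\<^bsub>Q\<^esub> ?u) \<in> CY Q"
  proof (cases "L = []")
    case True
    have "fil (Suc 0) (y \<star>\<^bsub>Q\<^esub> ?u)" by (intro fil_mult_left) simp
    then show ?thesis
      using cmt_re[OF Q, of b "src Q a" "y \<star>\<^bsub>Q\<^esub> ?u"] yu v' by (simp add: True delta_Nil)
  next
    case False
    then show ?thesis using Cons.IH[OF v' False yu] by simp
  qed
  show ?case using e 1 2 by (simp add: ab CY_add)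
qed simp

text \<open>Approximate \<open>x\<close> by combinations of basis paths of positive length; for
  these \<open>cmt_delta\<close> reduces letter by letter to \<open>cmt_arrow\<close> and
  \<open>cmt_re\<close>.\<close>

lemma cmt_CY:
  assumes Q: "wq Q" and x: "x \<in> Cor Q i j" "fil (Suc 0) x" and y: "y \<in> Cor Q j i"
  shows "cmt Q x y \<in> CY Q"
proof (rule CY_closed)
  note Qf = wq_finite[OF Q]
  fix n
  let ?x = "\<Sum>p\<in>Pl Q n. sc (x p) (delta p)"
  have "sc (x p) (cmt Q (delta p) y) \<in> CY Q" if "p \<in> Pl Q n" for p
  proof (cases "x p = 0")
    case False
    obtain v c L where p: "p = (v,c,L)" by (cases p)
    have "L \<noteq> []" using False filD[OF x(2), of p] by (auto simp: p)
    moreover have "valid Q B p" using that by (simp only: Pl_iff)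
    moreover have "fst p = i" "endv Q p = j" using Cor_supp[OF x(1) False] by auto
    ultimately show ?thesis
      using cmt_delta[OF Q, of v c L y] PA_F[OF Cor_PA[OF x(1)], of p] y
      by (intro CY_sc) (simp_all add: p)
  qed simp
  then have "cmt Q ?x y \<in> CY Q" unfolding cmt_sum cmt_sc by (rule CY_sum)
  moreover have "fil n (cmt Q x y - cmt Q ?x y)"
    using cmt_fil(2)[OF approx[OF Qf Cor_PA[OF x(1)]]] by (simp add: cmt_diff)
  ultimately show "\<exists>u\<in>CY Q. fil n (cmt Q x y - u)" by blast
qed

lemma FspanD:
  "x \<in> Fspan F G \<Longrightarrow> \<exists>l. x = sum_list (map (\<lambda>(c, x). (\<lambda>p. c * x p)) l) \<and> set l \<subseteq> F \<times> G"
  unfolding Fspan_def by simp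

lemma cycgen_hom:
  assumes H: "is_hom Q Q' H" and Q: "wq Q" "wq Q'" and x: "x \<in> cycgens Q F Fi B"
  shows "x \<in> PQ Q \<and> H x \<in> CY Q'"
proof -
  note Qf = wq_finite[OF Q(1)] wq_finite[OF Q(2)]
  obtain a w y where a: "a \<in> arrs Q" "w \<in> Fi (tgt Q a)" and y: "y \<in> Cor Q (src Q a) (tgt Q a)"
    and xx: "x = (re (tgt Q a) w \<star>\<^bsub>Q\<^esub> ar Q a) \<star>\<^bsub>Q\<^esub> y - y \<star>\<^bsub>Q\<^esub> (re (tgt Q a) w \<star>\<^bsub>Q\<^esub> ar Q a)"
    using cycgen_form[OF Q(1) x] .
  let ?u = "re (tgt Q a) w \<star>\<^bsub>Q\<^esub> ar Q a"
  have u: "?u \<in> Cor Q (tgt Q a) (src Q a)" using a Qf by auto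
  have P: "?u \<in> PQ Q" "y \<in> PQ Q" using u y Cor_PA by auto
  have fu: "fil (Suc 0) ?u" by (rule fil_mult_left[OF fil_ar])
  have "H x = cmt Q' (H ?u) (H y)"
    using P Qf by (simp add: xx hom_diff[OF H] hom_mult[OF H] cmt_def del: PA_mult) (simp add: hom_diff[OF H] hom_mult[OF H] PA_mult)
  moreover have "cmt Q' (H ?u) (H y) \<in> CY Q'"
    using hom_Cor[OF H Qf u] hom_Cor[OF H Qf y] hom_fil[OF H Q P(1) fu]
    by (intro cmt_CY[OF Q(2)])
  ultimately show ?thesis using P Qf by (simp add: xx PA_mult)
qed

text \<open>Cyclic equivalence survives homomorphisms: a generator is a commutator of opposite
  corners, hence so is its image, and \<open>cmt_CY\<close> applies. Linearity and continuity carry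
  this to the closed span.\<close>

lemma CY_hom:
  assumes H: "is_hom Q Q' H" and Q: "wq Q" "wq Q'" and x: "x \<in> CY Q"
  shows "x \<in> PQ Q \<and> H x \<in> CY Q'"
proof -
  note Qf = wq_finite[OF Q(1)] wq_finite[OF Q(2)]
  have sp: "u \<in> PQ Q \<and> H u \<in> CY Q'" if u: "u \<in> Sp Q" for u
  proof -
    obtain l where l: "u = sum_list (map (\<lambda>(c, x). (\<lambda>p. c * x p)) l)" "set l \<subseteq> F \<times> cycgens Q F Fi B"
      using FspanD[OF u] by (elim exE conjE)
    show ?thesis unfolding l(1) using l(2)
    proof (induction l)
      case Nil
      show ?case by (simp add: hom_zero[OF H])
    next
      case (Cons cx l)
      obtain c x where cx: "cx = (c,x)" by (cases cx)
      let ?s = "sum_list (map (\<lambda>(c, x). (\<lambda>p. c * x p)) l)"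
      have s: "?s \<in> PQ Q" "H ?s \<in> CY Q'" and c: "c \<in> F" and x: "x \<in> PQ Q" "H x \<in> CY Q'"
        using Cons cycgen_hom[OF H Q, of x] by (auto simp: cx)
      have e: "sum_list (map (\<lambda>(c, x). (\<lambda>p. c * x p)) (cx # l)) = sc c x + ?s"
        by (simp add: cx sc_def)
      have "H (sc c x + ?s) = sc c (H x) + H ?s"
        using hom_add[OF H PA_sc[OF x(1) c] s(1)] hom_sc[OF H Qf x(1) c] by simp
      then show ?case unfolding e using s x c by (auto intro: CY_add CY_sc)
    qed
  qed
  have xP: "x \<in> PQ Q" by (rule PA_limit) (use x sp in \<open>unfold CY_iff, blast\<close>)
  have "H x \<in> CY Q'"
  proof (rule CY_closed)
    fix n
    obtain u where u: "u \<in> Sp Q" "fil n (x - u)" using x unfolding CY_iff by blast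
    then have "fil n (H x - H u)" using sp[OF u(1)] by (intro hom_fil_diff[OF H Q xP]) auto
    then show "\<exists>u\<in>CY Q'. fil n (H x - u)" using sp[OF u(1)] by blast
  qed
  then show ?thesis using xP by blast
qed

end

section \<open>Right-equivalences and subquivers\<close>

text \<open>Since elements are coefficient functions, the algebra of \<open>Q1\<close> is literally
  a subset of that of \<open>Q\<close>, and the inclusion homomorphism is the identity map.\<close>

definition sub :: "'v wquiver \<Rightarrow> 'v wquiver \<Rightarrow> bool" where
  "sub Q1 Q \<longleftrightarrow> arrs Q1 \<subseteq> arrs Q \<and> (\<forall>a\<in>arrs Q1. src Q1 a = src Q a \<and> tgt Q1 a = tgt Q a)"

lemma sub_arrs: "sub Q1 Q \<Longrightarrow> a \<in> arrs Q1 \<Longrightarrow> a \<in> arrs Q"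
  by (auto simp: sub_def)

lemma sub_src: "sub Q1 Q \<Longrightarrow> a \<in> arrs Q1 \<Longrightarrow> src Q1 a = src Q a"
  by (auto simp: sub_def)

lemma sub_tgt: "sub Q1 Q \<Longrightarrow> a \<in> arrs Q1 \<Longrightarrow> tgt Q1 a = tgt Q a"
  by (auto simp: sub_def)

lemma sub_wq: "sub Q1 Q \<Longrightarrow> wq Q \<Longrightarrow> wq Q1"
  unfolding sub_def wq_def using finite_subset[of "arrs Q1" "arrs Q"] by auto

lemma sub_dsum1: "sub Q1 (dsumQ Q1 Q2)"
  by (auto simp: sub_def dsumQ_def)

lemma sub_dsum2: "arrs Q1 \<inter> arrs Q2 = {} \<Longrightarrow> sub Q2 (dsumQ Q1 Q2)"
  by (auto simp: sub_def dsumQ_def)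

lemma wq_dsum: "wq Q1 \<Longrightarrow> wq Q2 \<Longrightarrow> wq (dsumQ Q1 Q2)"
  by (auto simp: wq_def dsumQ_def)

context sp_data
begin

lemma right_equiv_iff: "right_equiv F Fi B Q S Q' S' \<longleftrightarrow>
   (\<exists>H. is_hom Q Q' H \<and> bij_betw H (PQ Q) (PQ Q') \<and> H S - S' \<in> CY Q')"
  unfolding right_equiv_def is_hom_def cyc_equiv_iff using bij_betwE by blast

lemma right_equiv_sym:
  assumes Q: "wq Q" "wq Q'" and S: "S \<in> PQ Q" "S' \<in> PQ Q'" and r: "right_equiv F Fi B Q S Q' S'"
  shows "right_equiv F Fi B Q' S' Q S"
proof -
  obtain H where H: "is_hom Q Q' H" and b: "bij_betw H (PQ Q) (PQ Q')" and c: "H S - S' \<in> CY Q'"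
    using r unfolding right_equiv_iff by blast
  let ?G = "the_inv_into (PQ Q) H"
  have G: "is_hom Q' Q ?G" by (rule hom_inv[OF H wq_finite[OF Q(1)] b])
  have "?G (H S - S') \<in> CY Q" using CY_hom[OF G Q(2,1) c] by blast
  moreover have "?G (H S) = S" using b S by (auto simp: bij_betw_def the_inv_into_f_f)
  ultimately have "S - ?G S' \<in> CY Q" using hom_diff[OF G hom_PA[OF H S(1)] S(2)] by simp
  then have "?G S' - S \<in> CY Q" using CY_uminus[of "S - ?G S'"] by simp
  then show ?thesis
    unfolding right_equiv_iff using G bij_betw_the_inv_into[OF b] by blast
qed

lemma right_equiv_trans:
  assumes Q: "wq Q" "wq Q'" "wq Q''" and S: "S \<in> PQ Q" "S' \<in> PQ Q'"
    and r: "right_equiv F Fi B Q S Q' S'" "right_equiv F Fi B Q' S' Q'' S''"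
  shows "right_equiv F Fi B Q S Q'' S''"
proof -
  obtain H where H: "is_hom Q Q' H" and b: "bij_betw H (PQ Q) (PQ Q')" and c: "H S - S' \<in> CY Q'"
    using r unfolding right_equiv_iff by blast
  obtain G where G: "is_hom Q' Q'' G" and b': "bij_betw G (PQ Q') (PQ Q'')" and c': "G S' - S'' \<in> CY Q''"
    using r unfolding right_equiv_iff by blast
  have "G (H S - S') \<in> CY Q''" using CY_hom[OF G Q(2,3) c] by blast
  then have "G (H S) - G S' \<in> CY Q''" using hom_diff[OF G hom_PA[OF H S(1)] S(2)] by simp
  from CY_add[OF this c'] have "G (H S) - S'' \<in> CY Q''" by simp
  then show ?thesis
    unfolding right_equiv_iff using hom_comp[OF H G] bij_betw_trans[OF b b'] by (auto simp: comp_def)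
qed

lemma valid_sub: "sub Q1 Q \<Longrightarrow> valid Q1 B (v,c,L) \<Longrightarrow> valid Q B (v,c,L)"
proof (induction L arbitrary: v c)
  case (Cons ab L)
  obtain a b where [simp]: "ab = (a,b)" by (cases ab)
  show ?case using Cons.prems Cons.IH[of "src Q a" b] sub_src[OF Cons.prems(1), of a] sub_tgt[OF Cons.prems(1), of a]
    sub_arrs[OF Cons.prems(1), of a] by auto
qed simp

lemma PA_sub: 
  assumes s: "sub Q1 Q" and x: "x \<in> PQ Q1" shows "x \<in> PQ Q"
  unfolding PA_def
proof (intro CollectI conjI allI impI)
  fix p show "x p \<in> F" using PA_F[OF x] .
next
  fix p assume "\<not> valid Q B p"
  then have "\<not> valid Q1 B p" using valid_sub[OF s] by (cases p) blast
  then show "x p = 0" using PA_out[OF x] by blast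
qed

lemma sh_sub:
  assumes s: "sub Q1 Q" and a: "a \<in> arrs Q1" shows "sh Q1 a c x = sh Q a c x"
  unfolding sh_def sub_src[OF s a] sub_tgt[OF s a] ..

lemma mult_sub:
  assumes s: "sub Q1 Q" and Q: "finite (arrs Q)" and x: "x \<in> PQ Q1" and y: "y \<in> PQ Q1"
  shows "x \<star>\<^bsub>Q1\<^esub> y = x \<star>\<^bsub>Q\<^esub> y"
proof -
  have Q1: "finite (arrs Q1)" using s Q by (auto simp: sub_def intro: finite_subset)
  have "(x \<star>\<^bsub>Q1\<^esub> y) (v,c,L) = (x \<star>\<^bsub>Q\<^esub> y) (v,c,L)" if "valid Q B (v,c,L)" "x \<in> PQ Q1" for v c L x
    using that
  proof (induction L arbitrary: v c x)
    case Nil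
    then show ?case by (simp add: mult_Nil Q Q1)
  next
    case (Cons ab L)
    obtain a b where ab: "ab = (a,b)" by (cases ab)
    have v: "valid Q B (v,c,(a,b)#L)" using Cons.prems by (simp add: ab)
    then have r: "valid Q B (src Q a,b,L)" and cB: "c \<in> B v" and av: "tgt Q a = v" by auto
    show ?case
    proof (cases "a \<in> arrs Q1")
      case True
      note e = sub_src[OF s True] sub_tgt[OF s True] sh_sub[OF s True]
      have IH: "(sh Q a c x \<star>\<^bsub>Q1\<^esub> y) (src Q a,b,L) = (sh Q a c x \<star>\<^bsub>Q\<^esub> y) (src Q a,b,L)"
        using Cons.IH[OF r sh_PA[OF Cons.prems(2), of a c]] unfolding e .
      show ?thesis
      proof (cases "valid Q1 B (v,c,(a,b)#L)")
        case v1: True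
        show ?thesis unfolding ab mult_Cons[OF Q1 v1] mult_Cons[OF Q v] e IH ..
      next
        case False
        then have n: "\<not> valid Q1 B (src Q a,b,L)" using True cB av e by auto
        have "y (v,c2,(a,b)#L) = 0" for c2
          by (rule PA_out[OF y]) (use n e True in auto)
        moreover have "(sh Q a c x \<star>\<^bsub>Q\<^esub> y) (src Q a,b,L) = 0"
          unfolding IH[symmetric] by (rule mult_invalid[OF n])
        ultimately show ?thesis unfolding ab mult_Cons[OF Q v] mult_invalid[OF False] by simp
      qed
    next
      case False
      have "y (v,c2,(a,b)#L) = 0" for c2
        by (rule PA_out[OF y]) (use False in auto)
      moreover have "sh Q a c x = 0"
      proof
        fix p :: "('v,'e) bpath" obtain u b' M where p: "p = (u,b',M)" by (cases p)
        have "x (tgt Q a,c,(a,b')#M) = 0" by (rule PA_out[OF Cons.prems(2)]) (use False in auto)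
        then show "sh Q a c x p = 0 p" by (simp add: p sh_apply pw)
      qed
      ultimately show ?thesis
        unfolding ab mult_Cons[OF Q v] using mult_invalid[of Q1 "(v,c,(a,b)#L)" x y] False by (simp add: pw)
    qed
  qed
  then have "(x \<star>\<^bsub>Q1\<^esub> y) p = (x \<star>\<^bsub>Q\<^esub> y) p" for p
  proof (cases "valid Q B p")
    case False
    then have "\<not> valid Q1 B p" using valid_sub[OF s] by (cases p) blast
    then show ?thesis using False by (simp add: mult_invalid)
  qed (use x \<open>\<And>x v c L. valid Q B (v, c, L) \<Longrightarrow> x \<in> PQ Q1 \<Longrightarrow> (x \<star>\<^bsub>Q1\<^esub> y) (v, c, L) = (x \<star>\<^bsub>Q\<^esub> y) (v, c, L)\<close> in \<open>cases p, simp\<close>)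
  then show ?thesis by (rule ext)
qed

lemma incl_hom:
  assumes s: "sub Q1 Q" and Q: "finite (arrs Q)" shows "is_hom Q1 Q (\<lambda>x. x)"
  unfolding is_hom_def
  using PA_sub[OF s] mult_sub[OF s Q] by (intro conjI ballI impI refl)

lemma hom_restrict:
  assumes "is_hom Q Q' H" "sub Q1 Q" "finite (arrs Q)" shows "is_hom Q1 Q' H"
  using hom_comp[OF incl_hom[OF assms(2,3)] assms(1)] .

lemma ar_sub: 
  assumes s: "sub Q1 Q" and a: "a \<in> arrs Q1" shows "ar Q1 a = ar Q a"
  unfolding ar_def sub_src[OF s a] sub_tgt[OF s a] ..

text \<open>The retraction of the inclusion (\<open>proj_id\<close>). Being a homomorphism, it also
  brings cyclic equivalences down to the subquiver.\<close>

definition proj :: "'v wquiver \<Rightarrow> 'v wquiver \<Rightarrow> ('v,'e) pelt \<Rightarrow> ('v,'e) pelt" where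
  "proj Q Q1 = ev Q Q1 (\<lambda>a. if a \<in> arrs Q1 then ar Q1 a else 0)"

context
  fixes Q Q1 :: "'v wquiver" assumes s: "sub Q1 Q" and Q: "wq Q"
begin

lemma proj_g: "a \<in> arrs Q \<Longrightarrow> (if a \<in> arrs Q1 then ar Q1 a else 0) \<in> Cor Q1 (tgt Q a) (src Q a)"
  using ar_Cor[of a Q1] sub_src[OF s, of a] sub_tgt[OF s, of a] by simp

lemma sub_finite: "finite (arrs Q1)"
  using sub_wq[OF s Q] by (rule wq_finite)

lemma proj_hom: "is_hom Q Q1 (proj Q Q1)"
  unfolding proj_def by (rule ev_hom[OF Q sub_finite proj_g])

lemma proj_ar: "a \<in> arrs Q \<Longrightarrow> proj Q Q1 (ar Q a) = (if a \<in> arrs Q1 then ar Q1 a else 0)"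
  unfolding proj_def by (rule ev_ar[OF Q sub_finite proj_g])

lemma proj_id: "x \<in> PQ Q1 \<Longrightarrow> proj Q Q1 x = x"
proof (rule hom_ext[OF hom_restrict[OF proj_hom s wq_finite[OF Q]] hom_id sub_wq[OF s Q] sub_wq[OF s Q]])
  fix a assume "a \<in> arrs Q1"
  then show "proj Q Q1 (ar Q1 a) = ar Q1 a"
    using proj_ar[of a] sub_arrs[OF s, of a] ar_sub[OF s, of a] by simp
qed

lemma CY_sub: "x \<in> CY Q1 \<Longrightarrow> x \<in> CY Q"
  using CY_hom[OF incl_hom[OF s wq_finite[OF Q]] sub_wq[OF s Q] Q] by blast

lemma CY_proj: "x \<in> CY Q \<Longrightarrow> proj Q Q1 x \<in> CY Q1"
  using CY_hom[OF proj_hom Q sub_wq[OF s Q]] by blast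

end

text \<open>All arrows are set to 0. As a homomorphism, \<open>rp\<close> can be compared by
  \<open>hom_ext\<close> and \<open>hom_cong2\<close> with maps that kill every arrow, exactly or
  modulo length 2.\<close>

lemma hom_rp:
  assumes Q: "wq Q" and Q': "finite (arrs Q')" shows "is_hom Q Q' rp"
proof -
  have "is_hom Q Q' (ev Q Q' (\<lambda>_. 0))" by (rule ev_hom[OF Q Q']) simp
  moreover have "ev Q Q' (\<lambda>_. 0) = rp"
    by (rule ext, subst ev_rec[OF Q Q']) simp_all
  ultimately show ?thesis by simp
qed

end

section \<open>Composita of the vertex fields\<close>

text \<open>The ambient field as a ring record, to which the HOL-Algebra theory of dimension over
  subfields applies.\<close>

definition uring :: "'e::field ring" where
  "uring = \<lparr>carrier = UNIV, mult = (*), one = 1, ring.zero = 0, add = (+)\<rparr>"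

lemma uring_simps [simp]:
  "carrier uring = UNIV" "x \<otimes>\<^bsub>uring\<^esub> y = x * y" "\<one>\<^bsub>uring\<^esub> = 1" "\<zero>\<^bsub>uring\<^esub> = 0" "x \<oplus>\<^bsub>uring\<^esub> y = x + y"
  by (simp_all add: uring_def)

lemma uring_field: "Ring.field (uring :: 'e::field ring)"
proof (rule cring.cring_fieldI2)
  show "cring (uring :: 'e ring)"
  proof (rule cringI)
    show "abelian_group (uring :: 'e ring)"
    proof (rule abelian_groupI)
      fix x :: 'e show "\<exists>y\<in>carrier uring. y \<oplus>\<^bsub>uring\<^esub> x = \<zero>\<^bsub>uring\<^esub>"
        by (rule bexI[of _ "- x"]) simp_all
    qed (simp_all add: algebra_simps)
    show "comm_monoid (uring :: 'e ring)"
      by (rule comm_monoidI) (simp_all add: algebra_simps)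
  qed (simp_all add: algebra_simps)
  show "\<zero>\<^bsub>uring\<^esub> \<noteq> \<one>\<^bsub>(uring :: 'e ring)\<^esub>" by simp
  fix a :: 'e assume "a \<noteq> \<zero>\<^bsub>uring\<^esub>"
  then show "\<exists>b\<in>carrier uring. a \<otimes>\<^bsub>uring\<^esub> b = \<one>\<^bsub>uring\<^esub>"
    by (intro bexI[of _ "inverse a"]) simp_all
qed

interpretation uring: ring "uring :: 'e::field ring"
  by (rule cring.axioms(1)[OF domain.axioms(1)[OF field.axioms(1)[OF uring_field]]])

lemma uring_uminus: "\<ominus>\<^bsub>uring\<^esub> x = - (x::'e::field)"
  by (rule uring.minus_equality) simp_all

lemma uring_subfield:
  assumes "is_subfield (K :: 'e::field set)" shows "subfield K uring"
proof (rule field.subfieldI'[OF uring_field])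
  show "subring K uring"
    by (rule uring.subringI) (use assms in \<open>simp_all add: is_subfield_def uring_uminus\<close>)
  fix k assume k: "k \<in> K - {\<zero>\<^bsub>uring\<^esub>}"
  then have "inv\<^bsub>uring\<^esub> k = inverse k"
    by (intro uring.inv_char) auto
  then show "inv\<^bsub>uring\<^esub> k \<in> K"
    using assms k by (simp add: is_subfield_def)
qed

lemma combine_sum:
  assumes "distinct Us" shows "uring.combine (map f Us) Us = (\<Sum>u\<in>set Us. f u * u)"
  using assms by (induction Us) auto

lemma Span_sum:
  assumes K: "is_subfield K" and d: "distinct Us"
  shows "uring.Span K Us = {\<Sum>u\<in>set Us. f u * u | f. \<forall>u. f u \<in> K}"
proof -
  have eq: "uring.Span K Us = {uring.combine Ks Us | Ks. length Ks = length Us \<and> set Ks \<subseteq> K}"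
    by (rule uring.Span_eq_combine_set_length_version[OF uring_subfield[OF K]]) simp
  have "\<exists>f. (\<forall>u. f u \<in> K) \<and> Ks = map f Us" if "length Ks = length Us" "set Ks \<subseteq> K" for Ks
  proof -
    define f where "f u = (case map_of (zip Us Ks) u of None \<Rightarrow> 0 | Some k \<Rightarrow> k)" for u
    have "f u \<in> K" for u
      using that(2) K by (auto simp: f_def is_subfield_def split: option.split dest!: map_of_SomeD set_zip_rightD)
    moreover have "Ks = map f Us"
    proof (rule nth_equalityI)
      show "length Ks = length (map f Us)" using that by simp
      fix i assume "i < length Ks"
      then show "Ks ! i = map f Us ! i"
        using that d by (simp add: f_def map_of_zip_nth)
    qed
    ultimately show ?thesis by blast
  qed
  then have ex: "\<And>Ks. length Ks = length Us \<Longrightarrow> set Ks \<subseteq> K \<Longrightarrow> \<exists>f. (\<forall>u. f u \<in> K) \<and> Ks = map f Us" .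
  show ?thesis
    unfolding eq
  proof (intro equalityI subsetI)
    fix x assume "x \<in> {uring.combine Ks Us | Ks. length Ks = length Us \<and> set Ks \<subseteq> K}"
    then obtain Ks where x: "x = uring.combine Ks Us" and Ks: "length Ks = length Us" "set Ks \<subseteq> K" by (elim CollectE exE conjE)
    obtain f where f: "\<forall>u. f u \<in> K" "Ks = map f Us" using ex[OF Ks] by (elim exE conjE)
    show "x \<in> {\<Sum>u\<in>set Us. f u * u | f. \<forall>u. f u \<in> K}"
      unfolding x f(2) combine_sum[OF d] using f(1) by (intro CollectI exI[of _ f] conjI refl)
  next
    fix x assume "x \<in> {\<Sum>u\<in>set Us. f u * u | f. \<forall>u. f u \<in> K}"
    then obtain f where x: "x = (\<Sum>u\<in>set Us. f u * u)" and f: "\<forall>u. f u \<in> K" by (elim CollectE exE conjE)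
    show "x \<in> {uring.combine Ks Us | Ks. length Ks = length Us \<and> set Ks \<subseteq> K}"
      unfolding x combine_sum[OF d, symmetric] using f by (intro CollectI exI[of _ "map f Us"] conjI refl) auto
  qed
qed

lemma dimension_Span_le:
  assumes K: "is_subfield K"
  shows "\<exists>m\<le>length Us. uring.dimension m K (uring.Span K Us)"
proof (induction Us)
  case Nil
  then show ?case using uring.zero_dim[of K] by auto
next
  case (Cons u Us)
  then obtain m where m: "m \<le> length Us" "uring.dimension m K (uring.Span K Us)" by blast
  show ?case
  proof (cases "u \<in> uring.Span K Us")
    case True
    have "uring.Span K (u # Us) = uring.Span K Us"
    proof
      show "uring.Span K (u # Us) \<subseteq> uring.Span K Us"
        using True uring.Span_base_incl[OF uring_subfield[OF K], of Us]
        by (intro uring.mono_Span_subset[OF uring_subfield[OF K]]) auto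
      show "uring.Span K Us \<subseteq> uring.Span K (u # Us)"
        by (intro uring.mono_Span[OF uring_subfield[OF K]]) auto
    qed
    then show ?thesis using m by (intro exI[of _ m]) simp
  next
    case False
    have "uring.dimension (Suc m) K (uring.line_extension K u (uring.Span K Us))"
      by (rule uring.Suc_dim) (use False m in auto)
    then show ?thesis using m by (intro exI[of _ "Suc m"]) simp
  qed
qed

text \<open>If some member lay in the span of its successors, the list would span a space of
  dimension smaller than its length.\<close>

lemma independent_of_dimension:
  assumes K: "is_subfield K" and "uring.dimension (length Us) K (uring.Span K Us)"
  shows "uring.independent K Us"
  using assms(2)
proof (induction Us)
  case Nil
  then show ?case by simp
next
  case (Cons u Us)
  obtain m where m: "m \<le> length Us" "uring.dimension m K (uring.Span K Us)"
    using dimension_Span_le[OF K] by blast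
  have "u \<notin> uring.Span K Us"
  proof
    assume u: "u \<in> uring.Span K Us"
    have "uring.Span K (u # Us) = uring.Span K Us"
    proof
      show "uring.Span K (u # Us) \<subseteq> uring.Span K Us"
        using u uring.Span_base_incl[OF uring_subfield[OF K], of Us]
        by (intro uring.mono_Span_subset[OF uring_subfield[OF K]]) auto
      show "uring.Span K Us \<subseteq> uring.Span K (u # Us)"
        by (intro uring.mono_Span[OF uring_subfield[OF K]]) auto
    qed
    then have "uring.dimension (length (u # Us)) K (uring.Span K Us)" using Cons.prems by simp
    then have "length (u # Us) = m" using uring.dimension_is_inj[OF uring_subfield[OF K] _ m(2)] by blast
    then show False using m(1) by simp
  qed
  moreover have "uring.dimension (Suc m) K (uring.Span K (u # Us))"
    using uring.Suc_dim[of u "uring.Span K Us" m K] \<open>u \<notin> uring.Span K Us\<close> m by simp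
  then have "Suc m = length (u # Us)"
    using uring.dimension_is_inj[OF uring_subfield[OF K] _ Cons.prems] by blast
  then have "uring.independent K Us" using m Cons.IH by simp
  ultimately show ?case using uring.li_Cons[of u K Us] by simp
qed

lemma independent_sum:
  assumes K: "is_subfield K" and "uring.independent K Us" and f: "\<And>u. f u \<in> K"
    and s: "(\<Sum>u\<in>set Us. f u * u) = 0" and u: "u \<in> set Us"
  shows "f u = 0"
proof -
  have d: "distinct Us" by (rule uring.independent_distinct[OF uring_subfield[OF K] assms(2)])
  have "uring.combine (map f Us) Us = \<zero>\<^bsub>uring\<^esub>" using combine_sum[OF d] s by simp
  then have "set (take (length Us) (map f Us)) \<subseteq> {\<zero>\<^bsub>uring\<^esub>}"
    using uring.independent_imp_trivial_combine[OF uring_subfield[OF K] assms(2), of "map f Us"] f by auto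
  then show ?thesis using u by auto
qed

lemma sum_independent:
  assumes K: "is_subfield K" and d: "distinct Us"
    and *: "\<And>f. (\<And>u. f u \<in> K) \<Longrightarrow> (\<Sum>u\<in>set Us. f u * u) = 0 \<Longrightarrow> \<forall>u\<in>set Us. f u = 0"
  shows "uring.independent K Us"
  using d *
proof (induction Us)
  case Nil
  then show ?case by simp
next
  case (Cons u Us)
  have "\<forall>v\<in>set Us. f v = 0" if f: "\<And>u. f u \<in> K" and s: "(\<Sum>u\<in>set Us. f u * u) = 0" for f
  proof -
    let ?g = "f(u := 0)"
    have "(\<Sum>v\<in>set Us. ?g v * v) = (\<Sum>v\<in>set Us. f v * v)"
      using Cons.prems(1) by (intro sum.cong) auto
    then have "(\<Sum>v\<in>set (u # Us). ?g v * v) = 0" using Cons.prems(1) s by simp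
    then have "\<forall>v\<in>set (u # Us). ?g v = 0"
      using f K by (intro Cons.prems(2)) (auto simp: is_subfield_def)
    then show ?thesis using Cons.prems(1) by (auto split: if_splits)
  qed
  then have 1: "uring.independent K Us" using Cons.IH Cons.prems(1) by simp
  have "u \<notin> uring.Span K Us"
  proof
    assume "u \<in> uring.Span K Us"
    then obtain f where f: "\<And>v. f v \<in> K" "u = (\<Sum>v\<in>set Us. f v * v)"
      using Span_sum[OF K] Cons.prems(1) by auto
    let ?g = "f(u := - 1)"
    have "(\<Sum>v\<in>set Us. ?g v * v) = u"
    proof -
      have "(\<Sum>v\<in>set Us. ?g v * v) = (\<Sum>v\<in>set Us. f v * v)"
        using Cons.prems(1) by (intro sum.cong refl) auto
      then show ?thesis using f(2) by simp
    qed
    then have "(\<Sum>v\<in>set (u # Us). ?g v * v) = 0" using Cons.prems(1) by simp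
    moreover have "?g v \<in> K" for v using f K by (auto simp: is_subfield_def)
    ultimately have "?g u = 0" using Cons.prems(2)[of ?g] by auto
    then show False by simp
  qed
  then show ?case using 1 uring.li_Cons[of u K Us] by simp
qed

lemma ex1_eq_aux: "\<exists>!x. P x \<Longrightarrow> P a \<Longrightarrow> P b \<Longrightarrow> a = b"
  by blast

lemma is_basis_independent:
  assumes F: "is_subfield F" and b: "is_basis F K (set Us)" and d: "distinct Us" 
  shows "uring.independent F Us \<and> uring.Span F Us \<supseteq> K"
proof
  have b': "\<forall>x\<in>K. \<exists>!l. (\<forall>c. l c \<in> F) \<and> (\<forall>c. c \<notin> set Us \<longrightarrow> l c = 0) \<and> x = (\<Sum>c\<in>set Us. l c * c)" "set Us \<subseteq> K"
    using b unfolding is_basis_def by simp_all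
  show "K \<subseteq> uring.Span F Us"
  proof
    fix x assume "x \<in> K"
    from ex1_implies_ex[OF bspec[OF b'(1) this]]
    obtain l where l: "(\<forall>c. l c \<in> F) \<and> (\<forall>c. c \<notin> set Us \<longrightarrow> l c = 0) \<and> x = (\<Sum>c\<in>set Us. l c * c)" ..
    then show "x \<in> uring.Span F Us"
      unfolding Span_sum[OF F d] by (intro CollectI exI[of _ l]) simp
  qed
  show "uring.independent F Us"
  proof (rule sum_independent[OF F d])
    fix f assume f: "\<And>u. f u \<in> F" "(\<Sum>u\<in>set Us. f u * u) = 0"
    show "\<forall>u\<in>set Us. f u = 0"
    proof
      fix u assume u: "u \<in> set Us"
      then have uK: "u \<in> K" using b'(2) by blast
      \<comment> \<open>Two expansions of the basis element \<open>u\<close>: the trivial one, and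
        the same with the relation \<open>f\<close> added. Uniqueness of coordinates forces
        \<open>f u\<close> to vanish.\<close>
      define l1 where "l1 = (\<lambda>c. if c = u then 1 else 0 :: 'a)"
      define l2 where "l2 = (\<lambda>c. if c \<in> set Us then l1 c + f c else 0)"
      have s1: "u = (\<Sum>c\<in>set Us. l1 c * c)"
        using u by (simp add: l1_def if_distrib[of "\<lambda>x. x * _"] cong: if_cong)
      have "(\<Sum>c\<in>set Us. l2 c * c) = (\<Sum>c\<in>set Us. l1 c * c + f c * c)"
        by (intro sum.cong) (auto simp: l2_def algebra_simps)
      then have s2: "u = (\<Sum>c\<in>set Us. l2 c * c)" using s1 f(2) by (simp add: sum.distrib)
      have 1: "(\<forall>c. l1 c \<in> F) \<and> (\<forall>c. c \<notin> set Us \<longrightarrow> l1 c = 0) \<and> u = (\<Sum>c\<in>set Us. l1 c * c)"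
        using F u s1 unfolding l1_def is_subfield_def by (intro conjI allI impI) auto
      have 2: "(\<forall>c. l2 c \<in> F) \<and> (\<forall>c. c \<notin> set Us \<longrightarrow> l2 c = 0) \<and> u = (\<Sum>c\<in>set Us. l2 c * c)"
      proof (intro conjI allI impI)
        fix c show "l2 c \<in> F" using F f(1)[of c] unfolding l2_def l1_def is_subfield_def by simp
        show "c \<notin> set Us \<Longrightarrow> l2 c = 0" by (simp add: l2_def)
      qed (rule s2)
      have "l1 = l2" using bspec[OF b'(1) uK] 1 2
        by (rule ex1_eq_aux[where P = "\<lambda>l. (\<forall>c. l c \<in> F) \<and> (\<forall>c. c \<notin> set Us \<longrightarrow> l c = 0) \<and> u = (\<Sum>c\<in>set Us. l c * c)"])
      then have "l1 u = l2 u" by simp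
      then show "f u = 0" using u by (simp add: l2_def)
    qed
  qed
qed

context sp_data
begin

section \<open>Linear disjointness of two vertex fields\<close>

lemma basis_list:
  assumes b: "is_basis F (Fi v) (set Us)" and d: "distinct Us"
  shows "uring.dimension (length Us) F (Fi v)"
proof -
  have i: "uring.independent F Us" and sp: "Fi v \<subseteq> uring.Span F Us"
    using is_basis_independent[OF is_subfield_F b d] by auto
  have "set Us \<subseteq> Fi v" using b unfolding is_basis_def by simp
  then have "uring.Span F Us \<subseteq> Fi v"
    unfolding Span_sum[OF is_subfield_F d] using F_Fi by (auto intro!: Fi_sum Fi_closed(5))
  then have "uring.Span F Us = Fi v" using sp by simp
  then show ?thesis using uring.dimension_independent[OF i] by simp
qed

lemma dimension_Fi: "uring.dimension (d v) F (Fi v)"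
proof -
  have "ext_deg F (Fi v) (d v)" using sp_setup by (simp add: sp_setup_def)
  then obtain Bs where b: "is_basis F (Fi v) Bs" and c: "card Bs = d v" unfolding ext_deg_def by blast
  have "finite Bs" using b unfolding is_basis_def by simp
  then obtain Us where Us: "set Us = Bs" "distinct Us" using finite_distinct_list by blast
  then have "length Us = d v" using c distinct_card by fastforce
  then show ?thesis using basis_list[of v Us] b Us by simp
qed

lemma card_B: "card (B v) = d v"
proof -
  obtain Us where Us: "set Us = B v" "distinct Us" using finite_distinct_list[OF finite_B[of v]] by blast
  have "uring.dimension (length Us) F (Fi v)" using basis_list[of v Us] basis[of v] Us by simp
  then have "length Us = d v"
    using uring.dimension_is_inj[OF uring_subfield[OF is_subfield_F] _ dimension_Fi] by blast
  then show ?thesis using Us distinct_card by fastforce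
qed

text \<open>The compositum F_i F_j, given as the F_i-span of a basis of F_j so that its dimension
  over F_i is at most \<open>d j\<close> by construction. It is symmetric in \<open>i\<close> and
  \<open>j\<close> by \<open>KK_sym\<close>.\<close>

definition KK :: "'v \<Rightarrow> 'v \<Rightarrow> 'e set" where
  "KK i j = {\<Sum>c\<in>B j. f c * c | f. \<forall>c. f c \<in> Fi i}"

lemma KKI: "(\<And>c. f c \<in> Fi i) \<Longrightarrow> (\<Sum>c\<in>B j. f c * c) \<in> KK i j"
  unfolding KK_def by blast

lemma KK_double:
  assumes "\<And>c c'. l c c' \<in> F" shows "(\<Sum>c\<in>B i. \<Sum>c'\<in>B j. l c c' * (c * c')) \<in> KK i j"
proof -
  have "(\<Sum>c\<in>B i. \<Sum>c'\<in>B j. l c c' * (c * c')) = (\<Sum>c'\<in>B j. (\<Sum>c\<in>B i. l c c' * c) * c')"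
    by (subst sum.swap) (simp add: sum_distrib_right mult.assoc)
  also have "\<dots> \<in> KK i j"
    by (rule KKI) (use assms F_Fi in \<open>auto intro!: Fi_sum Fi_closed(5)\<close>)
  finally show ?thesis .
qed

lemma KK_doubleE:
  assumes "x \<in> KK i j"
  obtains l where "\<And>c c'. l c c' \<in> F" "x = (\<Sum>c\<in>B i. \<Sum>c'\<in>B j. l c c' * (c * c'))"
proof -
  obtain f where f: "\<And>c. f c \<in> Fi i" "x = (\<Sum>c'\<in>B j. f c' * c')" using assms unfolding KK_def by blast
  have "x = (\<Sum>c'\<in>B j. (\<Sum>c\<in>B i. co i (f c') c * c) * c')" using f by (simp add: co_sum)
  also have "\<dots> = (\<Sum>c\<in>B i. \<Sum>c'\<in>B j. co i (f c') c * (c * c'))"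
    by (subst sum.swap) (simp add: sum_distrib_right mult.assoc)
  finally show ?thesis using that[of "\<lambda>c c'. co i (f c') c"] f by auto
qed

lemma KK_sym_sub: "KK i j \<subseteq> KK j i"
proof
  fix x assume "x \<in> KK i j"
  then obtain l where l: "\<And>c c'. l c c' \<in> F" "x = (\<Sum>c\<in>B i. \<Sum>c'\<in>B j. l c c' * (c * c'))" by (rule KK_doubleE) blast
  have "x = (\<Sum>c\<in>B j. \<Sum>c'\<in>B i. l c' c * (c * c'))"
    unfolding l(2) by (subst sum.swap) (simp add: mult.commute)
  then show "x \<in> KK j i" using KK_double[where l = "\<lambda>c c'. l c' c" and i = j and j = i] l(1) by simp
qed

lemma KK_sym: "KK i j = KK j i"
  using KK_sym_sub by blast

lemma one_KK: "1 \<in> KK i j"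
proof -
  have "(\<Sum>c\<in>B j. co j 1 c * c) \<in> KK i j" by (rule KKI) (auto intro: F_Fi)
  then show ?thesis by (simp add: co_sum)
qed

lemma KK_mult_Fi: "w \<in> Fi i \<Longrightarrow> x \<in> KK i j \<Longrightarrow> w * x \<in> KK i j"
proof -
  assume w: "w \<in> Fi i" and "x \<in> KK i j"
  then obtain f where f: "\<And>c. f c \<in> Fi i" "x = (\<Sum>c'\<in>B j. f c' * c')" unfolding KK_def by blast
  have "w * x = (\<Sum>c'\<in>B j. (w * f c') * c')" unfolding f(2) by (simp add: sum_distrib_left mult.assoc)
  also have "\<dots> \<in> KK i j" by (rule KKI) (use w f in auto)
  finally show ?thesis .
qed

lemma KK_mult_Fj: "w \<in> Fi j \<Longrightarrow> x \<in> KK i j \<Longrightarrow> w * x \<in> KK i j"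
  using KK_mult_Fi[of w j x i] by (simp add: KK_sym)

lemma KK_add: 
  assumes "x \<in> KK i j" "y \<in> KK i j" shows "x + y \<in> KK i j"
proof -
  obtain f where f: "\<And>c. f c \<in> Fi i" "x = (\<Sum>c'\<in>B j. f c' * c')" using assms unfolding KK_def by blast
  obtain g where g: "\<And>c. g c \<in> Fi i" "y = (\<Sum>c'\<in>B j. g c' * c')" using assms unfolding KK_def by blast
  have "x + y = (\<Sum>c'\<in>B j. (f c' + g c') * c')" unfolding f(2) g(2) by (simp add: sum.distrib distrib_right)
  also have "\<dots> \<in> KK i j" by (rule KKI) (use f g in auto)
  finally show ?thesis .
qed

lemma KK_zero: "0 \<in> KK i j"
  using KK_mult_Fi[of 0 i 1 j] one_KK by simp

lemma KK_sum: "(\<And>k. k \<in> I \<Longrightarrow> f k \<in> KK i j) \<Longrightarrow> (\<Sum>k\<in>I. f k) \<in> KK i j"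
  by (induction I rule: infinite_finite_induct) (auto intro: KK_add KK_zero)

lemma KK_mult: 
  assumes "x \<in> KK i j" "y \<in> KK i j" shows "x * y \<in> KK i j"
proof -
  obtain f where f: "\<And>c. f c \<in> Fi i" "x = (\<Sum>c'\<in>B j. f c' * c')" using assms unfolding KK_def by blast
  have "x * y = (\<Sum>c'\<in>B j. f c' * (c' * y))" unfolding f(2) by (simp add: sum_distrib_right mult.assoc)
  also have "\<dots> \<in> KK i j" by (intro KK_sum KK_mult_Fi KK_mult_Fj) (use f assms in auto)
  finally show ?thesis .
qed

lemma KK_Span:
  assumes "set Us = B j" "distinct Us" shows "uring.Span (Fi i) Us = KK i j"
  unfolding KK_def Span_sum[OF is_subfield_Fi assms(2)] assms(1) ..

lemma KK_dim:
  assumes Us: "set Us = B j" "distinct Us"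
  obtains m where "m \<le> d j" "uring.dimension m (Fi i) (KK i j)" "uring.dimension (d i * m) F (KK i j)"
proof -
  have l: "length Us = d j" using Us card_B[of j] distinct_card by fastforce
  obtain m where m: "m \<le> length Us" "uring.dimension m (Fi i) (uring.Span (Fi i) Us)"
    using dimension_Span_le[OF is_subfield_Fi] by blast
  have "uring.dimension (d i * m) F (KK i j)"
    using uring.telescopic_base[OF uring_subfield[OF is_subfield_F] uring_subfield[OF is_subfield_Fi] dimension_Fi]
      m(2) KK_Span[OF Us] by simp
  then show ?thesis using that[of m] m l KK_Span[OF Us] by simp
qed

text \<open>Let \<open>m\<close> be the dimension of the compositum over F_i. Its dimension over F
  is \<open>d i * m\<close>, and by symmetry also a multiple of \<open>d j\<close>. Coprimality
  gives that \<open>d j\<close> divides \<open>m\<close>; since \<open>m\<close> is nonzero and at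
  most \<open>d j\<close>, they are equal, and a spanning list of that length is
  independent.\<close>

lemma KK_independent:
  assumes ij: "i \<noteq> j" and Us: "set Us = B j" "distinct Us"
  shows "uring.independent (Fi i) Us \<and> uring.dimension (d j) (Fi i) (KK i j)"
proof -
  obtain Vs where Vs: "set Vs = B i" "distinct Vs" using finite_distinct_list[OF finite_B[of i]] by blast
  obtain m where m: "m \<le> d j" "uring.dimension m (Fi i) (KK i j)" "uring.dimension (d i * m) F (KK i j)"
    using KK_dim[OF Us] .
  obtain n where n: "uring.dimension (d j * n) F (KK j i)"
    using KK_dim[OF Vs] by blast
  have "d i * m = d j * n"
    using uring.dimension_is_inj[OF uring_subfield[OF is_subfield_F] m(3)] n KK_sym[of i j] by simp
  then have "d j dvd d i * m" by simp
  moreover have "coprime (d j) (d i)" using sp_setup ij by (simp add: sp_setup_def)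
  ultimately have dv: "d j dvd m" by (simp add: coprime_dvd_mult_right_iff)
  have "m \<noteq> 0"
  proof
    assume "m = 0"
    then have "KK i j = {0}" using uring.dimension_zero[OF uring_subfield[OF is_subfield_Fi]] m(2) by fastforce
    then show False using one_KK[of i j] by simp
  qed
  then have mj: "m = d j" using dv m(1) dvd_imp_le by fastforce
  have "length Us = d j" using Us card_B[of j] distinct_card by fastforce
  then show ?thesis
    using independent_of_dimension[OF is_subfield_Fi, of Us i] m(2) mj KK_Span[OF Us] by simp
qed

lemma KK_indep:
  assumes ij: "i \<noteq> j" and f: "\<And>c. f c \<in> Fi i" "(\<Sum>c\<in>B j. f c * c) = 0" and c: "c \<in> B j"
  shows "f c = 0"
proof -
  obtain Us where Us: "set Us = B j" "distinct Us" using finite_distinct_list[OF finite_B[of j]] by blast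
  show ?thesis
    using independent_sum[OF is_subfield_Fi conjunct1[OF KK_independent[OF ij Us]] f(1)] f(2) c Us by simp
qed

text \<open>Injectivity of the multiplication map from F_i (x) F_j to E, in coordinates.\<close>

lemma KK_indep2:
  assumes ij: "i \<noteq> j" and l: "\<And>c c'. l c c' \<in> F" "(\<Sum>c\<in>B i. \<Sum>c'\<in>B j. l c c' * (c * c')) = 0"
    and c: "c \<in> B i" "c' \<in> B j"
  shows "l c c' = 0"
proof -
  have "(\<Sum>c'\<in>B j. (\<Sum>c\<in>B i. l c c' * c) * c') = 0"
    using l(2) by (subst (asm) sum.swap) (simp add: sum_distrib_right mult.assoc)
  then have 0: "(\<Sum>c\<in>B i. l c c' * c) = 0"
    by (rule KK_indep[OF ij, rotated]) (use l F_Fi c in \<open>auto intro!: Fi_sum Fi_closed(5)\<close>)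
  have "co i (\<Sum>e\<in>B i. l e c' * e) c = (\<Sum>e\<in>B i. l e c' * co i e c)"
    by (rule co_lin) (use l in auto)
  also have "\<dots> = l c c'" using sum_co_basis[OF c(1)] .
  finally show ?thesis unfolding 0 by simp
qed

text \<open>Multiplying a basis of the compositum over F_i by \<open>m\<close> gives an independent
  list of the full length \<open>d j\<close>. It spans, and the expansion of 1 in it exhibits the
  inverse.\<close>

lemma KK_inverse:
  assumes ij: "i \<noteq> j" and m: "m \<in> KK i j" "m \<noteq> 0" shows "inverse m \<in> KK i j"
proof -
  obtain Us where Us: "set Us = B j" "distinct Us" using finite_distinct_list[OF finite_B[of j]] by blast
  have len: "length Us = d j" using Us card_B[of j] distinct_card by fastforce
  let ?Vs = "map (\<lambda>u. m * u) Us"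
  have inj: "inj_on (\<lambda>u. m * u) (set Us)" using m(2) by (auto simp: inj_on_def)
  have dV: "distinct ?Vs" using Us inj by (simp add: distinct_map)
  have s: "(\<Sum>v\<in>set ?Vs. f v * v) = m * (\<Sum>c\<in>B j. f (m * c) * c)" for f
    using inj Us(1) by (simp add: sum.reindex sum_distrib_left mult_ac)
  have iV: "uring.independent (Fi i) ?Vs"
  proof (rule sum_independent[OF is_subfield_Fi dV])
    fix f assume f: "\<And>u. f u \<in> Fi i" "(\<Sum>v\<in>set ?Vs. f v * v) = 0"
    then have "(\<Sum>c\<in>B j. f (m * c) * c) = 0" using s m(2) by simp
    then have "f (m * c) = 0" if "c \<in> B j" for c
      using KK_indep[OF ij, of "\<lambda>c. f (m * c)"] f(1) that by blast
    then show "\<forall>u\<in>set ?Vs. f u = 0" using Us by auto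
  qed
  have "set ?Vs \<subseteq> KK i j"
  proof
    fix v assume "v \<in> set ?Vs"
    then obtain u where u: "u \<in> B j" "v = m * u" using Us by auto
    then show "v \<in> KK i j" using KK_mult_Fj[of u j m i] m by (simp add: mult.commute)
  qed
  then have "uring.Span (Fi i) ?Vs = KK i j"
    using uring.independent_length_eq_dimension[OF uring_subfield[OF is_subfield_Fi] conjunct2[OF KK_independent[OF ij Us]] iV] len
    by simp
  then have "1 \<in> uring.Span (Fi i) ?Vs" using one_KK by simp
  then obtain f where f: "\<forall>u. f u \<in> Fi i" "1 = (\<Sum>v\<in>set ?Vs. f v * v)"
    unfolding Span_sum[OF is_subfield_Fi dV] by blast
  then have "inverse m = (\<Sum>c\<in>B j. f (m * c) * c)"
    using m(2) s by (simp add: field_simps)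
  then show ?thesis using KKI[of "\<lambda>c. f (m * c)" i j] f(1) by simp
qed


section \<open>Linear and quadratic parts\<close>

text \<open>The coefficient of $a$ in $x$, an element of $F_i \otimes F_j$, read in the compositum $F_i F_j$; no information is lost because $i \neq j$.\<close>

definition h1 :: "'v wquiver \<Rightarrow> ('v,'e) pelt \<Rightarrow> nat \<Rightarrow> 'e" where
  "h1 Q x a = (\<Sum>c\<in>B (tgt Q a). \<Sum>c'\<in>B (src Q a). x (tgt Q a,c,[(a,c')]) * (c * c'))"

text \<open>For a 2-cycle the outer coefficients \<open>c0\<close> and \<open>c2\<close> lie in the
  same vertex field, and rotating the cycle multiplies them together. Their product with
  \<open>c1\<close> is thus insensitive to where the coefficients are placed.\<close>

definition hh :: "'v wquiver \<Rightarrow> ('v,'e) pelt \<Rightarrow> nat \<Rightarrow> nat \<Rightarrow> 'e" where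
  "hh Q U a b = (\<Sum>c0\<in>B (tgt Q a). \<Sum>c1\<in>B (src Q a). \<Sum>c2\<in>B (src Q b).
     U (tgt Q a,c0,[(a,c1),(b,c2)]) * (c0 * c1 * c2))"

text \<open>Symmetric in $a$ and $b$, hence invariant under cyclic equivalence.\<close>

definition hat :: "'v wquiver \<Rightarrow> ('v,'e) pelt \<Rightarrow> nat \<Rightarrow> nat \<Rightarrow> 'e" where
  "hat Q U a b = hh Q U a b + hh Q U b a"

lemma h1_add: "h1 Q (x + y) a = h1 Q x a + h1 Q y a"
  by (simp add: h1_def pw distrib_right sum.distrib)

lemma h1_sc: "h1 Q (sc k x) a = k * h1 Q x a"
  by (simp add: h1_def pw sum_distrib_left mult.assoc)

lemma h1_diff: "h1 Q (x - y) a = h1 Q x a - h1 Q y a"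
  by (simp add: h1_def pw left_diff_distrib sum_subtractf)

lemma h1_zero: "h1 Q 0 a = 0"
  by (simp add: h1_def pw)

lemma h1_sum: "h1 Q (\<Sum>i\<in>I. f i) a = (\<Sum>i\<in>I. h1 Q (f i) a)"
  by (induction I rule: infinite_finite_induct)
    (simp_all only: sum.infinite sum.empty sum.insert h1_zero h1_add simp_thms not_False_eq_True)

lemma hh_add: "hh Q (x + y) a b = hh Q x a b + hh Q y a b"
  by (simp add: hh_def pw distrib_right sum.distrib)

lemma hh_sc: "hh Q (sc k x) a b = k * hh Q x a b"
  by (simp add: hh_def pw sum_distrib_left mult.assoc)

lemma hh_diff: "hh Q (x - y) a b = hh Q x a b - hh Q y a b"
  by (simp add: hh_def pw left_diff_distrib sum_subtractf)

lemma hh_zero: "hh Q 0 a b = 0"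
  by (simp add: hh_def pw)

lemma hh_sum: "hh Q (\<Sum>i\<in>I. f i) a b = (\<Sum>i\<in>I. hh Q (f i) a b)"
  by (induction I rule: infinite_finite_induct)
    (simp_all only: sum.infinite sum.empty sum.insert hh_zero hh_add simp_thms not_False_eq_True)

lemma h1_fil: "fil 2 x \<Longrightarrow> h1 Q x a = 0"
  by (simp add: h1_def filD)

lemma hh_fil: "fil 3 x \<Longrightarrow> hh Q x a b = 0"
  by (simp add: hh_def filD)

lemma h1_cong: "fil 2 (x - y) \<Longrightarrow> h1 Q x a = h1 Q y a"
  using h1_fil[of "x - y" Q a] by (simp add: h1_diff)

lemma h1_re_left:
  assumes Q: "finite (arrs Q)" and x: "x \<in> PQ Q" and w: "w \<in> Fi v"
  shows "h1 Q (re v w \<star>\<^bsub>Q\<^esub> x) a = (if v = tgt Q a then w * h1 Q x a else 0)"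
proof (cases "v = tgt Q a")
  case True
  have "h1 Q (re v w \<star>\<^bsub>Q\<^esub> x) a = (\<Sum>c\<in>B v. \<Sum>c'\<in>B (src Q a). \<Sum>c2\<in>B v. co v (w * c2) c * x (v,c2,[(a,c')]) * (c * c'))"
    using True w by (simp add: h1_def re_mult_apply[OF Q x] sum_distrib_right)
  also have "\<dots> = (\<Sum>c'\<in>B (src Q a). \<Sum>c\<in>B v. \<Sum>c2\<in>B v. co v (w * c2) c * x (v,c2,[(a,c')]) * (c * c'))"
    by (rule sum.swap)
  also have "\<dots> = (\<Sum>c'\<in>B (src Q a). \<Sum>c2\<in>B v. \<Sum>c\<in>B v. co v (w * c2) c * x (v,c2,[(a,c')]) * (c * c'))"
    by (intro sum.cong refl sum.swap)
  also have "\<dots> = (\<Sum>c'\<in>B (src Q a). \<Sum>c2\<in>B v. x (v,c2,[(a,c')]) * c' * (\<Sum>c\<in>B v. co v (w * c2) c * c))"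
    by (intro sum.cong refl) (simp add: sum_distrib_left mult_ac)
  also have "\<dots> = (\<Sum>c'\<in>B (src Q a). \<Sum>c2\<in>B v. x (v,c2,[(a,c')]) * c' * (w * c2))"
    by (intro sum.cong refl) (simp add: co_sum w)
  also have "\<dots> = (\<Sum>c2\<in>B v. \<Sum>c'\<in>B (src Q a). x (v,c2,[(a,c')]) * c' * (w * c2))"
    by (rule sum.swap)
  finally show ?thesis using True by (simp add: h1_def sum_distrib_left mult_ac)
next
  case False
  then show ?thesis by (auto simp: h1_def re_mult_apply[OF Q x w])
qed

lemma h1_re_right:
  assumes Q: "finite (arrs Q)" and x: "x \<in> PQ Q" and w: "w \<in> Fi v" and a: "a \<in> arrs Q"
  shows "h1 Q (x \<star>\<^bsub>Q\<^esub> re v w) a = (if v = src Q a then w * h1 Q x a else 0)"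
proof -
  have e: "(x \<star>\<^bsub>Q\<^esub> re v w) (tgt Q a,c,[(a,c')]) = (if v = src Q a then \<Sum>e1\<in>B v. x (tgt Q a,c,[(a,e1)]) * co v (e1 * w) c' else 0)"
    if c: "c \<in> B (tgt Q a)" "c' \<in> B (src Q a)" for c c'
  proof -
    have v: "valid Q B (tgt Q a,c,[(a,c')])" using a c by simp
    have "(x \<star>\<^bsub>Q\<^esub> re v w) (tgt Q a,c,[(a,c')]) = (sh Q a c x \<star>\<^bsub>Q\<^esub> re v w) (src Q a,c',[])"
      unfolding mult_Cons[OF Q v] by (simp add: re_apply)
    also have "\<dots> = (\<Sum>e1\<in>B (src Q a). \<Sum>e2\<in>B (src Q a). x (tgt Q a,c,[(a,e1)]) * re v w (src Q a,e2,[]) * co (src Q a) (e1 * e2) c')"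
      using c by (simp add: mult_Nil[OF Q] sh_apply)
    also have "\<dots> = (if v = src Q a then \<Sum>e1\<in>B v. x (tgt Q a,c,[(a,e1)]) * co v (e1 * w) c' else 0)"
    proof (cases "v = src Q a")
      case True
      have "(\<Sum>e2\<in>B v. x (tgt Q a,c,[(a,e1)]) * re v w (v,e2,[]) * co v (e1 * e2) c') = x (tgt Q a,c,[(a,e1)]) * co v (e1 * w) c'"
        if "e1 \<in> B v" for e1
        using co_expandr[of e1 v w c'] that w by (simp add: re_apply sum_distrib_left mult.assoc)
      then show ?thesis using True by auto
    qed (simp add: re_apply)
    finally show ?thesis .
  qed
  show ?thesis
  proof (cases "v = src Q a")
    case True
    have "h1 Q (x \<star>\<^bsub>Q\<^esub> re v w) a = (\<Sum>c\<in>B (tgt Q a). \<Sum>c'\<in>B v. \<Sum>e1\<in>B v. x (tgt Q a,c,[(a,e1)]) * co v (e1 * w) c' * (c * c'))"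
      unfolding h1_def using e True by (simp add: sum_distrib_right)
    also have "\<dots> = (\<Sum>c\<in>B (tgt Q a). \<Sum>e1\<in>B v. \<Sum>c'\<in>B v. x (tgt Q a,c,[(a,e1)]) * co v (e1 * w) c' * (c * c'))"
      by (intro sum.cong refl sum.swap)
    also have "\<dots> = (\<Sum>c\<in>B (tgt Q a). \<Sum>e1\<in>B v. x (tgt Q a,c,[(a,e1)]) * c * (\<Sum>c'\<in>B v. co v (e1 * w) c' * c'))"
      by (intro sum.cong refl) (simp add: sum_distrib_left mult_ac)
    also have "\<dots> = (\<Sum>c\<in>B (tgt Q a). \<Sum>e1\<in>B v. x (tgt Q a,c,[(a,e1)]) * c * (e1 * w))"
      by (intro sum.cong refl) (simp add: co_sum w)
    finally show ?thesis using True by (simp add: h1_def sum_distrib_left mult_ac)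
  next
    case False
    then show ?thesis unfolding h1_def using e by simp
  qed
qed

text \<open>The coefficients meeting at the middle vertex are multiplied in its field and
  re-expanded by the product; evaluating in E undoes the expansion through \<open>co_sum\<close>,
  and the remaining sum factors.\<close>

lemma hh_mult:
  assumes Q: "finite (arrs Q)" and x: "fil (Suc 0) x" and y: "fil (Suc 0) y" and a: "a \<in> arrs Q" and b: "b \<in> arrs Q"
  shows "hh Q (x \<star>\<^bsub>Q\<^esub> y) a b = (if tgt Q b = src Q a then h1 Q x a * h1 Q y b else 0)"
proof (cases "tgt Q b = src Q a")
  case True
  let ?s = "src Q a"
  have e: "(x \<star>\<^bsub>Q\<^esub> y) (tgt Q a,c0,[(a,c1),(b,c2)]) = (\<Sum>e1\<in>B ?s. \<Sum>e2\<in>B ?s. x (tgt Q a,c0,[(a,e1)]) * y (?s,e2,[(b,c2)]) * co ?s (e1 * e2) c1)"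
    if c: "c0 \<in> B (tgt Q a)" "c1 \<in> B ?s" "c2 \<in> B (src Q b)" for c0 c1 c2
  proof -
    have v: "valid Q B (tgt Q a,c0,[(a,c1),(b,c2)])" and v': "valid Q B (src Q a,c1,[(b,c2)])" using a b c True by simp_all
    have x0: "x (u,c,[]) = 0" and y0: "y (u,c,[]) = 0" for u c using filD[OF x] filD[OF y] by simp_all
    have "(x \<star>\<^bsub>Q\<^esub> y) (tgt Q a,c0,[(a,c1),(b,c2)]) = (sh Q a c0 x \<star>\<^bsub>Q\<^esub> y) (?s,c1,[(b,c2)])"
      unfolding mult_Cons[OF Q v] by (simp add: x0)
    also have "\<dots> = (\<Sum>e1\<in>B ?s. \<Sum>e2\<in>B ?s. x (tgt Q a,c0,[(a,e1)]) * y (?s,e2,[(b,c2)]) * co ?s (e1 * e2) c1)"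
      unfolding mult_Cons[OF Q v'] by (simp add: mult_Nil[OF Q] y0 sh_apply)
    finally show ?thesis .
  qed
  have "hh Q (x \<star>\<^bsub>Q\<^esub> y) a b = (\<Sum>c0\<in>B (tgt Q a). \<Sum>c1\<in>B ?s. \<Sum>c2\<in>B (src Q b). \<Sum>e1\<in>B ?s. \<Sum>e2\<in>B ?s.
      x (tgt Q a,c0,[(a,e1)]) * y (?s,e2,[(b,c2)]) * co ?s (e1 * e2) c1 * (c0 * c1 * c2))"
    unfolding hh_def by (intro sum.cong refl) (simp add: e sum_distrib_right)
  also have "\<dots> = (\<Sum>c0\<in>B (tgt Q a). \<Sum>c2\<in>B (src Q b). \<Sum>c1\<in>B ?s. \<Sum>e1\<in>B ?s. \<Sum>e2\<in>B ?s.
      x (tgt Q a,c0,[(a,e1)]) * y (?s,e2,[(b,c2)]) * co ?s (e1 * e2) c1 * (c0 * c1 * c2))"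
    by (intro sum.cong refl sum.swap)
  also have "\<dots> = (\<Sum>c0\<in>B (tgt Q a). \<Sum>c2\<in>B (src Q b). \<Sum>e1\<in>B ?s. \<Sum>c1\<in>B ?s. \<Sum>e2\<in>B ?s.
      x (tgt Q a,c0,[(a,e1)]) * y (?s,e2,[(b,c2)]) * co ?s (e1 * e2) c1 * (c0 * c1 * c2))"
    by (intro sum.cong refl sum.swap)
  also have "\<dots> = (\<Sum>c0\<in>B (tgt Q a). \<Sum>c2\<in>B (src Q b). \<Sum>e1\<in>B ?s. \<Sum>e2\<in>B ?s. \<Sum>c1\<in>B ?s.
      x (tgt Q a,c0,[(a,e1)]) * y (?s,e2,[(b,c2)]) * co ?s (e1 * e2) c1 * (c0 * c1 * c2))"
    by (intro sum.cong refl sum.swap)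
  also have "\<dots> = (\<Sum>c0\<in>B (tgt Q a). \<Sum>c2\<in>B (src Q b). \<Sum>e1\<in>B ?s. \<Sum>e2\<in>B ?s.
      x (tgt Q a,c0,[(a,e1)]) * y (?s,e2,[(b,c2)]) * c0 * c2 * (\<Sum>c1\<in>B ?s. co ?s (e1 * e2) c1 * c1))"
    by (intro sum.cong refl) (simp add: sum_distrib_left mult_ac)
  also have "\<dots> = (\<Sum>c0\<in>B (tgt Q a). \<Sum>c2\<in>B (src Q b). \<Sum>e1\<in>B ?s. \<Sum>e2\<in>B ?s.
      (x (tgt Q a,c0,[(a,e1)]) * (c0 * e1)) * (y (?s,e2,[(b,c2)]) * (e2 * c2)))"
    by (intro sum.cong refl, subst co_sum) (auto simp: mult_ac)
  also have "\<dots> = (\<Sum>c0\<in>B (tgt Q a). \<Sum>e1\<in>B ?s. \<Sum>c2\<in>B (src Q b). \<Sum>e2\<in>B ?s.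
      (x (tgt Q a,c0,[(a,e1)]) * (c0 * e1)) * (y (?s,e2,[(b,c2)]) * (e2 * c2)))"
    by (intro sum.cong refl sum.swap)
  also have "\<dots> = h1 Q x a * (\<Sum>c2\<in>B (src Q b). \<Sum>e2\<in>B ?s. y (?s,e2,[(b,c2)]) * (e2 * c2))"
    by (simp only: h1_def sum_distrib_right) (simp only: sum_distrib_left)
  also have "(\<Sum>c2\<in>B (src Q b). \<Sum>e2\<in>B ?s. y (?s,e2,[(b,c2)]) * (e2 * c2)) = h1 Q y b"
    unfolding h1_def True by (rule sum.swap)
  finally show ?thesis using True by simp
next
  case False
  have "(x \<star>\<^bsub>Q\<^esub> y) (tgt Q a,c0,[(a,c1),(b,c2)]) = 0" for c0 c1 c2
    by (rule mult_invalid) (use False in simp)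
  then show ?thesis using False by (simp add: hh_def)
qed

lemma h1_Cor:
  assumes x: "x \<in> Cor Q i j" and n: "h1 Q x a \<noteq> 0" shows "tgt Q a = i \<and> src Q a = j"
proof (rule ccontr)
  assume c: "\<not> ?thesis"
  have "x (tgt Q a,c,[(a,c')]) = 0" for c c'
    using Cor_supp[OF x, of "(tgt Q a,c,[(a,c')])"] c by (auto simp: endv_def)
  then show False using n by (simp add: h1_def)
qed

lemma h1_ar:
  assumes a: "a \<in> arrs Q" "b \<in> arrs Q" shows "h1 Q (ar Q a) b = (if b = a then 1 else 0)"
proof (cases "b = a")
  case True
  have "h1 Q (ar Q a) a = (\<Sum>c\<in>B (tgt Q a). \<Sum>c'\<in>B (src Q a). (co (tgt Q a) 1 c * c) * (co (src Q a) 1 c' * c'))"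
    by (simp add: h1_def ar_apply mult_ac)
  also have "\<dots> = (\<Sum>c\<in>B (tgt Q a). co (tgt Q a) 1 c * c) * (\<Sum>c'\<in>B (src Q a). co (src Q a) 1 c' * c')"
    by (simp add: sum_product)
  finally show ?thesis using True by (simp add: co_sum)
qed (auto simp: h1_def ar_apply)

lemma h1_inj:
  assumes Q: "wq Q" and x: "x \<in> PQ Q" and a: "a \<in> arrs Q" and 0: "h1 Q x a = 0"
  shows "x (v,c,[(a,c')]) = 0"
proof (cases "valid Q B (v,c,[(a,c')])")
  case True
  have "x (tgt Q a,c,[(a,c')]) = 0"
    by (rule KK_indep2[where l = "\<lambda>c c'. x (tgt Q a,c,[(a,c')])", OF wq_loopfree[OF Q a]])
      (use True 0 PA_F[OF x] in \<open>auto simp: h1_def\<close>)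
  then show ?thesis using True by simp
qed (rule PA_out[OF x])

lemma fil2I:
  assumes Q: "wq Q" and x: "x \<in> PQ Q" "fil (Suc 0) x" and 0: "\<And>a. a \<in> arrs Q \<Longrightarrow> h1 Q x a = 0"
  shows "fil 2 x"
proof (rule filI)
  fix p :: "('v,'e) bpath" assume p: "plen p < 2"
  obtain v c L where pp: "p = (v,c,L)" by (cases p)
  show "x p = 0"
  proof (cases L)
    case Nil
    then show ?thesis using filD[OF x(2), of p] by (simp add: pp)
  next
    case (Cons ab L')
    obtain a b where ab: "ab = (a,b)" by (cases ab)
    have L': "L' = []" using p by (simp add: pp Cons)
    show ?thesis
    proof (cases "a \<in> arrs Q")
      case True
      show ?thesis unfolding pp Cons ab L' by (rule h1_inj[OF Q x(1) True 0[OF True]])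
    next
      case False
      show ?thesis unfolding pp Cons ab by (rule PA_out[OF x(1)]) (use False in simp)
    qed
  qed
qed

lemma rp_expand:
  assumes y: "y \<in> PQ Q" 
  shows "rp y = (\<Sum>v\<in>UNIV. \<Sum>c\<in>B v. sc (y (v,c,[])) (re v c))"
proof
  fix p :: "('v,'e) bpath"
  obtain u b L where p: "p = (u,b,L)" by (cases p)
  have "(\<Sum>c\<in>B v. y (v,c,[]) * re v c p) = (if v = u then if L = [] then y (u,b,[]) else 0 else 0)" for v
  proof (cases "v = u \<and> L = []")
    case True
    show ?thesis
    proof (cases "b \<in> B u")
      case bB: True
      then show ?thesis using True sum_co_basis[OF bB, of "\<lambda>c. y (u,c,[])"] by (simp add: p re_apply)
    next
      case False
      have "y (u,b,[]) = 0" by (rule PA_out[OF y]) (use False in simp)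
      then show ?thesis using True False by (simp add: p re_apply co_out)
    qed
  qed (auto simp: p re_apply)
  then show "rp y p = (\<Sum>v\<in>UNIV. \<Sum>c\<in>B v. sc (y (v,c,[])) (re v c)) p"
    by (simp add: pw rp_def p)
qed

lemma h1_rp_right:
  assumes Q: "finite (arrs Q)" and x: "x \<in> PQ Q" and y: "y \<in> PQ Q'" and a: "a \<in> arrs Q"
  shows "h1 Q (x \<star>\<^bsub>Q\<^esub> rp y) a = (\<Sum>c\<in>B (src Q a). y (src Q a,c,[]) * c) * h1 Q x a"
proof -
  have "h1 Q (x \<star>\<^bsub>Q\<^esub> rp y) a = (\<Sum>v\<in>UNIV. \<Sum>c\<in>B v. y (v,c,[]) * h1 Q (x \<star>\<^bsub>Q\<^esub> re v c) a)"
    unfolding rp_expand[OF y] mult_sum_right mult_sc_right h1_sum h1_sc ..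
  also have "\<dots> = (\<Sum>v\<in>UNIV. if v = src Q a then (\<Sum>c\<in>B (src Q a). y (src Q a,c,[]) * c) * h1 Q x a else 0)"
    by (intro sum.cong refl) (simp add: h1_re_right[OF Q x _ a] sum_distrib_right mult.assoc)
  finally show ?thesis by simp
qed

lemma h1_rp_left:
  assumes Q: "finite (arrs Q)" and x: "x \<in> PQ Q" and y: "y \<in> PQ Q'"
  shows "h1 Q (rp y \<star>\<^bsub>Q\<^esub> x) a = (\<Sum>c\<in>B (tgt Q a). y (tgt Q a,c,[]) * c) * h1 Q x a"
proof -
  have "h1 Q (rp y \<star>\<^bsub>Q\<^esub> x) a = (\<Sum>v\<in>UNIV. \<Sum>c\<in>B v. y (v,c,[]) * h1 Q (re v c \<star>\<^bsub>Q\<^esub> x) a)"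
    unfolding rp_expand[OF y] mult_sum_left mult_sc_left h1_sum h1_sc ..
  also have "\<dots> = (\<Sum>v\<in>UNIV. if v = tgt Q a then (\<Sum>c\<in>B (tgt Q a). y (tgt Q a,c,[]) * c) * h1 Q x a else 0)"
    by (intro sum.cong refl) (simp add: h1_re_left[OF Q x] sum_distrib_right mult.assoc)
  finally show ?thesis by simp
qed

text \<open>Linear parts compose like matrices over E. Left and right coefficients of an arrow may
  be pulled out of \<open>h1\<close> as ordinary factors because E is commutative and the image of
  an arrow keeps its end vertices.\<close>

lemma h1_hom:
  assumes H: "is_hom Q Q' H" and Q: "wq Q" "wq Q'" and x: "x \<in> PQ Q" "fil (Suc 0) x" and a': "a' \<in> arrs Q'"
  shows "h1 Q' (H x) a' = (\<Sum>a\<in>arrs Q. h1 Q x a * h1 Q' (H (ar Q a)) a')"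
proof -
  note Qf = wq_finite[OF Q(1)] wq_finite[OF Q(2)]
  have t: "h1 Q' (re (tgt Q a) c \<star>\<^bsub>Q'\<^esub> H (ar Q a) \<star>\<^bsub>Q'\<^esub> H (sh Q a c x)) a' =
     (\<Sum>c'\<in>B (src Q a). x (tgt Q a,c,[(a,c')]) * (c * c')) * h1 Q' (H (ar Q a)) a'"
    if a: "a \<in> arrs Q" and c: "c \<in> B (tgt Q a)" for a c
  proof -
    let ?g = "H (ar Q a)" and ?s = "sh Q a c x"
    have g: "?g \<in> Cor Q' (tgt Q a) (src Q a)" by (rule hom_Cor[OF H Qf ar_Cor[OF a]])
    have gP: "?g \<in> PQ Q'" using g by (rule Cor_PA)
    have g1: "fil (Suc 0) ?g" by (rule hom_ar_fil1[OF H Q a])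
    have s: "?s \<in> PQ Q" using x by auto
    have sH: "H ?s \<in> PQ Q'" by (rule hom_PA[OF H s])
    have r: "rp ?s \<in> PQ Q" "rp ?s \<in> PQ Q'" using s rp_PA' by auto
    have "fil (Suc 0) (?s - rp ?s)"
      by (rule filI) (simp add: rp_def pw)
    then have "fil (Suc 0) (H ?s - rp ?s)"
      using hom_fil_diff[OF H Q s r(1)] hom_R[OF H r(1)] by simp
    then have "fil 2 (?g \<star>\<^bsub>Q'\<^esub> (H ?s - rp ?s))" by (rule fil_mult'[OF g1]) simp
    then have "fil 2 (re (tgt Q a) c \<star>\<^bsub>Q'\<^esub> ?g \<star>\<^bsub>Q'\<^esub> H ?s - re (tgt Q a) c \<star>\<^bsub>Q'\<^esub> ?g \<star>\<^bsub>Q'\<^esub> rp ?s)"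
      by (simp only: mult_diff_right[symmetric] fil_mult_left)
    then have "h1 Q' (re (tgt Q a) c \<star>\<^bsub>Q'\<^esub> ?g \<star>\<^bsub>Q'\<^esub> H ?s) a' = h1 Q' (re (tgt Q a) c \<star>\<^bsub>Q'\<^esub> ?g \<star>\<^bsub>Q'\<^esub> rp ?s) a'"
      by (rule h1_cong)
    also have "\<dots> = (if tgt Q a = tgt Q' a' then c * ((\<Sum>e\<in>B (src Q' a'). ?s (src Q' a',e,[]) * e) * h1 Q' ?g a') else 0)"
      using h1_re_left[OF Qf(2) PA_mult[OF Qf(2) gP r(2)] B_Fi[OF c], of a'] h1_rp_right[OF Qf(2) gP s a'] by simp
    also have "\<dots> = (\<Sum>c'\<in>B (src Q a). x (tgt Q a,c,[(a,c')]) * (c * c')) * h1 Q' ?g a'"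
    proof (cases "h1 Q' ?g a' = 0")
      case False
      then have "tgt Q' a' = tgt Q a" "src Q' a' = src Q a" using h1_Cor[OF g] by auto
      then show ?thesis by (simp add: sh_apply sum_distrib_left sum_distrib_right mult_ac)
    qed simp
    finally show ?thesis .
  qed
  have "h1 Q' (H x) a' = (\<Sum>a\<in>arrs Q. \<Sum>c\<in>B (tgt Q a). h1 Q' (re (tgt Q a) c \<star>\<^bsub>Q'\<^esub> H (ar Q a) \<star>\<^bsub>Q'\<^esub> H (sh Q a c x)) a')"
    unfolding hom_decomp[OF H Qf(1) x(1)] rp_fil[OF x(2)] by (simp add: h1_sum)
  also have "\<dots> = (\<Sum>a\<in>arrs Q. h1 Q x a * h1 Q' (H (ar Q a)) a')"
    using t by (simp add: h1_def[of Q x] sum_distrib_right)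
  finally show ?thesis .
qed

lemma hh_sh:
  assumes U: "U \<in> PQ Q" and a: "a \<in> arrs Q" and b: "b \<in> arrs Q"
  shows "hh Q U a b = (\<Sum>c\<in>B (tgt Q a). c * h1 Q (sh Q a c U) b)"
proof (cases "tgt Q b = src Q a")
  case True
  then show ?thesis
    by (simp add: hh_def h1_def sh_apply sum_distrib_left mult_ac)
next
  case False
  have "U (tgt Q a,c0,[(a,c1),(b,c2)]) = 0" for c0 c1 c2
    by (rule PA_out[OF U]) (use False in simp)
  then show ?thesis using False by (simp add: hh_def h1_def sh_apply)
qed

lemma hh_hom:
  assumes H: "is_hom Q Q' H" and Q: "wq Q" "wq Q'" and U: "U \<in> PQ Q" "fil 2 U"
    and a': "a' \<in> arrs Q'" and b': "b' \<in> arrs Q'" and op: "tgt Q' b' = src Q' a'"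
  shows "hh Q' (H U) a' b' = (\<Sum>a\<in>arrs Q. \<Sum>b\<in>arrs Q. hh Q U a b * h1 Q' (H (ar Q a)) a' * h1 Q' (H (ar Q b)) b')"
proof -
  note Qf = wq_finite[OF Q(1)] wq_finite[OF Q(2)]
  have t: "hh Q' (re (tgt Q a) c \<star>\<^bsub>Q'\<^esub> H (ar Q a) \<star>\<^bsub>Q'\<^esub> H (sh Q a c U)) a' b' =
     c * h1 Q' (H (ar Q a)) a' * (\<Sum>b\<in>arrs Q. h1 Q (sh Q a c U) b * h1 Q' (H (ar Q b)) b')"
    if a: "a \<in> arrs Q" and c: "c \<in> B (tgt Q a)" for a c
  proof -
    let ?g = "H (ar Q a)" and ?s = "sh Q a c U"
    have g: "?g \<in> Cor Q' (tgt Q a) (src Q a)" by (rule hom_Cor[OF H Qf ar_Cor[OF a]])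
    have gP: "?g \<in> PQ Q'" using g by (rule Cor_PA)
    have g1: "fil (Suc 0) ?g" by (rule hom_ar_fil1[OF H Q a])
    have s: "?s \<in> PQ Q" using U by auto
    have s1: "fil (Suc 0) ?s" using U(2) by (intro fil_sh) (simp add: numeral_2_eq_2)
    have sH: "H ?s \<in> PQ Q'" "fil (Suc 0) (H ?s)" using hom_PA[OF H s] hom_fil[OF H Q s s1] by auto
    have "re (tgt Q a) c \<star>\<^bsub>Q'\<^esub> ?g \<star>\<^bsub>Q'\<^esub> H ?s = (re (tgt Q a) c \<star>\<^bsub>Q'\<^esub> ?g) \<star>\<^bsub>Q'\<^esub> H ?s"
      by (rule mult_assoc[OF Qf(2) gP sH(1), symmetric])
    then have "hh Q' (re (tgt Q a) c \<star>\<^bsub>Q'\<^esub> ?g \<star>\<^bsub>Q'\<^esub> H ?s) a' b' = h1 Q' (re (tgt Q a) c \<star>\<^bsub>Q'\<^esub> ?g) a' * h1 Q' (H ?s) b'"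
      by (simp only: hh_mult[OF Qf(2) fil_mult_left[OF g1] sH(2) a' b'] op if_True simp_thms)
    also have "h1 Q' (re (tgt Q a) c \<star>\<^bsub>Q'\<^esub> ?g) a' = c * h1 Q' ?g a'"
      using h1_re_left[OF Qf(2) gP B_Fi[OF c], of a'] h1_Cor[OF g, of a'] by auto
    finally show ?thesis using h1_hom[OF H Q s s1 b'] by simp
  qed
  have "fil (Suc 0) U" using U(2) by (rule fil_mono) simp
  then have "hh Q' (H U) a' b' = (\<Sum>a\<in>arrs Q. \<Sum>c\<in>B (tgt Q a). hh Q' (re (tgt Q a) c \<star>\<^bsub>Q'\<^esub> H (ar Q a) \<star>\<^bsub>Q'\<^esub> H (sh Q a c U)) a' b')"
    unfolding hom_decomp[OF H Qf(1) U(1)] by (simp add: hh_sum rp_fil)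
  also have "\<dots> = (\<Sum>a\<in>arrs Q. \<Sum>c\<in>B (tgt Q a). \<Sum>b\<in>arrs Q. c * h1 Q (sh Q a c U) b * h1 Q' (H (ar Q a)) a' * h1 Q' (H (ar Q b)) b')"
    using t by (simp add: sum_distrib_left mult_ac)
  also have "\<dots> = (\<Sum>a\<in>arrs Q. \<Sum>b\<in>arrs Q. \<Sum>c\<in>B (tgt Q a). c * h1 Q (sh Q a c U) b * h1 Q' (H (ar Q a)) a' * h1 Q' (H (ar Q b)) b')"
    by (intro sum.cong refl sum.swap)
  also have "\<dots> = (\<Sum>a\<in>arrs Q. \<Sum>b\<in>arrs Q. hh Q U a b * h1 Q' (H (ar Q a)) a' * h1 Q' (H (ar Q b)) b')"
    by (intro sum.cong refl) (simp add: hh_sh[OF U(1)] sum_distrib_right)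
  finally show ?thesis .
qed

text \<open>The quadratic form changes by congruence with the matrix of the linear part of
  \<open>H\<close>.\<close>

lemma hat_hom:
  assumes H: "is_hom Q Q' H" and Q: "wq Q" "wq Q'" and U: "U \<in> PQ Q" "fil 2 U"
    and a': "a' \<in> arrs Q'" and b': "b' \<in> arrs Q'" and op: "tgt Q' b' = src Q' a'" "tgt Q' a' = src Q' b'"
  shows "hat Q' (H U) a' b' = (\<Sum>a\<in>arrs Q. \<Sum>b\<in>arrs Q. hat Q U a b * h1 Q' (H (ar Q a)) a' * h1 Q' (H (ar Q b)) b')"
proof -
  have "hh Q' (H U) b' a' = (\<Sum>b\<in>arrs Q. \<Sum>a\<in>arrs Q. hh Q U b a * h1 Q' (H (ar Q b)) b' * h1 Q' (H (ar Q a)) a')"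
    by (rule hh_hom[OF H Q U b' a' op(2)])
  also have "\<dots> = (\<Sum>a\<in>arrs Q. \<Sum>b\<in>arrs Q. hh Q U b a * h1 Q' (H (ar Q a)) a' * h1 Q' (H (ar Q b)) b')"
    by (subst sum.swap) (simp add: mult_ac)
  finally show ?thesis
    unfolding hat_def hh_hom[OF H Q U a' b' op(1)] by (simp add: distrib_right sum.distrib)
qed

text \<open>A generator is a commutator of two elements without constant term. By
  \<open>hh_mult\<close> its entry at (\<open>a\<close>,\<open>b\<close>) is the negative of its
  entry at (\<open>b\<close>,\<open>a\<close>), so the symmetrised value is 0. Agreement up to
  length 2 suffices for the passage to the closure.\<close>

lemma hat_CY:
  assumes Q: "wq Q" and U: "U \<in> CY Q" and a: "a \<in> arrs Q" and b: "b \<in> arrs Q"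
    and op: "tgt Q b = src Q a" "tgt Q a = src Q b"
  shows "hat Q U a b = 0"
proof -
  note Qf = wq_finite[OF Q]
  have g: "hat Q x a b = 0" if x: "x \<in> cycgens Q F Fi B" for x
  proof -
    obtain e w y where e: "e \<in> arrs Q" "w \<in> Fi (tgt Q e)" and y: "y \<in> Cor Q (src Q e) (tgt Q e)"
      and xx: "x = (re (tgt Q e) w \<star>\<^bsub>Q\<^esub> ar Q e) \<star>\<^bsub>Q\<^esub> y - y \<star>\<^bsub>Q\<^esub> (re (tgt Q e) w \<star>\<^bsub>Q\<^esub> ar Q e)"
      using cycgen_form[OF Q x] .
    have f: "fil (Suc 0) (re (tgt Q e) w \<star>\<^bsub>Q\<^esub> ar Q e)" by (rule fil_mult_left[OF fil_ar])
    have fy: "fil (Suc 0) y" using y wq_loopfree[OF Q e(1)] by (intro Cor_fil1) auto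
    show ?thesis
      unfolding xx hat_def hh_diff hh_mult[OF Qf f fy a b] hh_mult[OF Qf fy f a b] hh_mult[OF Qf f fy b a] hh_mult[OF Qf fy f b a]
      using op by simp
  qed
  have sp: "hat Q u a b = 0" if u: "u \<in> Sp Q" for u
  proof -
    obtain l where l: "u = sum_list (map (\<lambda>(c, x). (\<lambda>p. c * x p)) l)" "set l \<subseteq> F \<times> cycgens Q F Fi B"
      using FspanD[OF u] by (elim exE conjE)
    show ?thesis unfolding l(1) using l(2)
    proof (induction l)
      case Nil
      show ?case by (simp add: hat_def hh_zero)
    next
      case (Cons cx l)
      obtain c x where cx: "cx = (c,x)" by (cases cx)
      let ?s = "sum_list (map (\<lambda>(c, x). (\<lambda>p. c * x p)) l)"
      have e: "sum_list (map (\<lambda>(c, x). (\<lambda>p. c * x p)) (cx # l)) = sc c x + ?s"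
        by (simp add: cx sc_def)
      have "hat Q (sc c x + ?s) a b = c * hat Q x a b + hat Q ?s a b"
        by (simp add: hat_def hh_add hh_sc algebra_simps)
      then show ?case unfolding e using Cons g[of x] by (simp add: cx)
    qed
  qed
  obtain u where u: "u \<in> Sp Q" "fil 3 (U - u)" using U unfolding CY_iff by blast
  have "hat Q (U - u) a b = 0" by (simp add: hat_def hh_fil[OF u(2)])
  moreover have "hat Q U a b = hat Q (U - u) a b + hat Q u a b" by (simp add: hat_def hh_diff)
  ultimately show ?thesis using sp[OF u(1)] by simp
qed


section \<open>Quadratic parts and cyclic derivatives of potentials\<close>

lemma potential_PA: "is_potential Q F B S \<Longrightarrow> S \<in> PQ Q"
  unfolding is_potential_def by simp

lemma potential_cyclic: "is_potential Q F B S \<Longrightarrow> S p \<noteq> 0 \<Longrightarrow> valid Q B p \<and> plen p \<noteq> 0 \<and> endv Q p = fst p"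
  unfolding is_potential_def is_cyclic_def by blast

text \<open>A cycle of length 1 would be a loop.\<close>

lemma potential_fil2:
  assumes Q: "wq Q" and S: "is_potential Q F B S" shows "fil 2 S"
proof (rule filI, rule ccontr)
  fix p assume p: "plen p < 2" "S p \<noteq> 0"
  obtain v c L where pp: "p = (v,c,L)" by (cases p)
  have c: "valid Q B p" "plen p \<noteq> 0" "endv Q p = fst p" using potential_cyclic[OF S p(2)] by auto
  then obtain a b where "L = [(a,b)]" using p(1) by (cases L) (auto simp: pp)
  then have "a \<in> arrs Q" "tgt Q a = src Q a" using c by (auto simp: pp endv_def)
  then show False using wq_loopfree[OF Q] by blast
qed

lemma hh_potential:
  assumes S: "is_potential Q1 F B S" and s: "sub Q1 Q" and n: "hh Q S a b \<noteq> 0"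
  shows "a \<in> arrs Q1 \<and> b \<in> arrs Q1 \<and> tgt Q b = src Q a \<and> tgt Q a = src Q b"
proof -
  have "\<exists>c0 c1 c2. S (tgt Q a,c0,[(a,c1),(b,c2)]) \<noteq> 0"
  proof (rule ccontr)
    assume "\<not> ?thesis"
    then show False using n by (simp add: hh_def)
  qed
  then obtain c0 c1 c2 where "S (tgt Q a,c0,[(a,c1),(b,c2)]) \<noteq> 0" by (elim exE)
  from potential_cyclic[OF S this] have "a \<in> arrs Q1" "b \<in> arrs Q1" "tgt Q1 b = src Q1 a" "src Q1 b = tgt Q a"
    by (auto simp: endv_def)
  then show ?thesis using sub_src[OF s] sub_tgt[OF s] by auto
qed

lemma hat_potential:
  assumes S: "is_potential Q1 F B S" and s: "sub Q1 Q" and n: "hat Q S a b \<noteq> 0"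
  shows "a \<in> arrs Q1 \<and> b \<in> arrs Q1 \<and> tgt Q b = src Q a \<and> tgt Q a = src Q b"
proof -
  have "hh Q S a b \<noteq> 0 \<or> hh Q S b a \<noteq> 0" using n by (auto simp: hat_def)
  then show ?thesis
  proof
    assume "hh Q S a b \<noteq> 0" then show ?thesis by (rule hh_potential[OF S s])
  next
    assume "hh Q S b a \<noteq> 0" from hh_potential[OF S s this] show ?thesis by simp
  qed
qed

lemma sub_refl [simp]: "sub Q Q"
  by (simp add: sub_def)

lemma hat_sub:
  assumes s: "sub Q1 Q" and a: "a \<in> arrs Q1" "b \<in> arrs Q1" shows "hat Q1 S a b = hat Q S a b"
  unfolding hat_def hh_def sub_src[OF s a(1)] sub_src[OF s a(2)] sub_tgt[OF s a(1)] sub_tgt[OF s a(2)] ..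

lemma h1_tensel:
  assumes Q: "finite (arrs Q)" and ok: "okp Q v w [(b,w')]" and a: "a \<in> arrs Q"
  shows "h1 Q (tensel Q F B v w [(b,w')]) a = (if a = b then w * w' else 0)"
proof -
  have b: "b \<in> arrs Q" "tgt Q b = v" "w \<in> Fi v" "w' \<in> Fi (src Q b)" using ok by auto
  have m: "ar Q b \<star>\<^bsub>Q\<^esub> re (src Q b) w' \<in> PQ Q" using b Q by auto
  show ?thesis
    unfolding tensel_Cons'[OF Q ok] tensel_Nil[OF b(4)] h1_re_left[OF Q m b(3)] h1_re_right[OF Q ar_PA[OF b(1)] b(4) a] h1_ar[OF b(1) a]
    using b by auto
qed

lemma hh_delta:
  assumes Q: "finite (arrs Q)" and v: "valid Q B (v,c0,[(a1,c1),(a2,c2)])" and a: "a \<in> arrs Q" "b \<in> arrs Q"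
  shows "hh Q (delta (v,c0,[(a1,c1),(a2,c2)])) a b = (if a = a1 \<and> b = a2 then c0 * c1 * c2 else 0)"
proof -
  have w: "a1 \<in> arrs Q" "a2 \<in> arrs Q" "tgt Q a1 = v" "tgt Q a2 = src Q a1" "c0 \<in> Fi v" "c1 \<in> Fi (src Q a1)" "c2 \<in> Fi (src Q a2)"
    and v': "valid Q B (src Q a1,c1,[(a2,c2)])" using v by auto
  let ?d = "delta (src Q a1,c1,[(a2,c2)]) :: ('v,'e) pelt" and ?x = "re v c0 \<star>\<^bsub>Q\<^esub> ar Q a1"
  have d: "?d \<in> PQ Q" using v' by (rule delta_PA)
  have f: "fil (Suc 0) ?x" "fil (Suc 0) ?d" using fil_mult_left[OF fil_ar] fil_delta[of "(src Q a1,c1,[(a2,c2)])"] by auto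
  have "delta (v,c0,[(a1,c1),(a2,c2)]) = ?x \<star>\<^bsub>Q\<^esub> ?d"
    using delta_Cons[OF Q v] mult_assoc[OF Q ar_PA[OF w(1)] d, of "re v c0"] by simp
  moreover have "h1 Q ?x a = (if a = a1 then c0 else 0)"
    using h1_re_left[OF Q ar_PA[OF w(1)] w(5), of a] h1_ar[OF w(1) a(1)] w by auto
  moreover have "h1 Q ?d b = (if b = a2 then c1 * c2 else 0)"
  proof -
    have "okp Q (src Q a1) c1 [(a2,c2)]" "tensel Q F B (src Q a1) c1 [(a2,c2)] = ?d" using delta_tensel[OF Q v'] by blast+
    then show ?thesis using h1_tensel[OF Q _ a(2), of "src Q a1" c1 a2 c2] by simp
  qed
  moreover have "hh Q (?x \<star>\<^bsub>Q\<^esub> ?d) a b = (if tgt Q b = src Q a then h1 Q ?x a * h1 Q ?d b else 0)"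
    by (rule hh_mult[OF Q f a])
  ultimately show ?thesis
    using w(4) by (simp only: mult_zero_left mult_zero_right if_cancel) (auto simp: mult.assoc)
qed

lemma deg2_expand:
  assumes Q: "finite (arrs Q)" and S: "S \<in> PQ Q" and d: "\<forall>p. plen p \<noteq> 2 \<longrightarrow> S p = 0"
  shows "S = (\<Sum>p\<in>paths_len Q B 2. sc (S p) (delta p))"
proof
  fix q :: "('v,'e) bpath"
  have "(\<Sum>p\<in>paths_len Q B 2. sc (S p) (delta p)) q = (\<Sum>p\<in>paths_len Q B 2. if p = q then S q else 0)"
    unfolding sum_fun_apply
  proof (rule sum.cong[OF refl])
    fix p show "sc (S p) (delta p) q = (if p = q then S q else 0)"
      by (cases "p = q") (simp_all add: sc_apply delta_apply)
  qed
  also have "\<dots> = (if q \<in> paths_len Q B 2 then S q else 0)"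
    by (rule sum.delta[OF finite_paths_len[OF Q]])
  also have "\<dots> = S q"
  proof (cases "q \<in> paths_len Q B 2")
    case False
    then have "\<not> valid Q B q \<or> plen q \<noteq> 2" unfolding paths_len_def by blast
    then have "S q = 0" using spec[OF d, of q] PA_out[OF S, of q] by blast
    then show ?thesis by simp
  qed simp
  finally show "S q = (\<Sum>p\<in>paths_len Q B 2. sc (S p) (delta p)) q" by simp
qed

lemma path2_cases:
  assumes p: "valid Q B p" "plen p = 2"
  obtains v c0 a1 c1 a2 c2 where "p = (v,c0,[(a1,c1),(a2,c2)])" "a1 \<in> arrs Q" "a2 \<in> arrs Q" "tgt Q a1 = v" "tgt Q a2 = src Q a1"
    "c0 \<in> B v" "c1 \<in> B (src Q a1)" "c2 \<in> B (src Q a2)"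
proof -
  obtain v c0 L where pp: "p = (v,c0,L)" by (cases p)
  then obtain x y where "L = [x,y]" using p(2) by (auto simp: length_Suc_conv numeral_2_eq_2)
  moreover obtain a1 c1 where "x = (a1,c1)" by (cases x)
  moreover obtain a2 c2 where "y = (a2,c2)" by (cases y)
  ultimately have "p = (v,c0,[(a1,c1),(a2,c2)])" using pp by simp
  then show ?thesis using that p(1) by auto
qed

lemma cder_path2:
  "cder_path Q F B a (v,c0,[(a1,c1),(a2,c2)]) =
     (if a1 = a then tensel Q F B (src Q a) c1 [(a2,c2 * c0)] else 0) + (if a2 = a then tensel Q F B (src Q a) (c2 * c0) [(a1,c1)] else 0)"
proof -
  have s: "{1..length [(a1,c1),(a2,c2)]} = {Suc 0, Suc (Suc 0)}" by auto
  show ?thesis unfolding cder_path_def prod.case s by (simp add: add.commute)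
qed

lemma tensel_length:
  assumes "length M \<noteq> length L" shows "tensel Q F B v w L (u,c,M) = 0"
proof -
  have "map fst M \<noteq> map fst L" using assms map_eq_imp_length_eq[of fst M fst L] by blast
  then show ?thesis by (simp add: tensel_def)
qed

lemma cder_deg2:
  assumes Q: "wq Q" and S: "is_potential Q F B S" and d: "\<forall>p. plen p \<noteq> 2 \<longrightarrow> S p = 0"
  shows "cder Q F B a S = (\<Sum>p\<in>paths_len Q B 2. sc (S p) (cder_path Q F B a p))"
proof
  fix r :: "('v,'e) bpath"
  show "cder Q F B a S r = (\<Sum>p\<in>paths_len Q B 2. sc (S p) (cder_path Q F B a p)) r"
  proof (cases "plen r = 1")
    case True
    then have "plen r + 1 = 2" by simp
    then show ?thesis unfolding cder_def by (simp only: pw)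
  next
    case False
    have z1: "S p * cder_path Q F B a p r = 0" if "p \<in> paths_len Q B 2" for p
    proof -
      have p: "valid Q B p" "plen p = 2" using that unfolding paths_len_def by blast+
      obtain v c0 a1 c1 a2 c2 where pp: "p = (v,c0,[(a1,c1),(a2,c2)])" and "a1 \<in> arrs Q" "a2 \<in> arrs Q" "tgt Q a1 = v" "tgt Q a2 = src Q a1"
        "c0 \<in> B v" "c1 \<in> B (src Q a1)" "c2 \<in> B (src Q a2)" by (rule path2_cases[OF p])
      obtain u e M where r: "r = (u,e,M)" by (cases r)
      then have M: "length M \<noteq> length [(a,c)]" for a :: nat and c :: 'e using False by simp
      show ?thesis unfolding pp cder_path2 r plus_fun_apply
        using tensel_length[OF M] by (simp add: zero_fun_apply)
    qed
    have z2: "S p * cder_path Q F B a p r = 0" if "p \<in> paths_len Q B (plen r + 1)" for p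
    proof -
      have "plen p \<noteq> 2" using that False unfolding paths_len_def by auto
      then show ?thesis using spec[OF d, of p] by simp
    qed
    have "(\<Sum>p\<in>paths_len Q B 2. S p * cder_path Q F B a p r) = 0" by (rule sum.neutral, rule ballI, rule z1)
    moreover have "(\<Sum>p\<in>paths_len Q B (plen r + 1). S p * cder_path Q F B a p r) = 0" by (rule sum.neutral, rule ballI, rule z2)
    ultimately show ?thesis unfolding cder_def sum_fun_apply sc_apply by (simp only:)
  qed
qed

lemma cder_term:
  assumes Q: "wq Q" and S: "is_potential Q F B S" and p: "p \<in> paths_len Q B 2" and n: "S p \<noteq> 0"
  shows "cder_path Q F B a p \<in> PQ Q \<and> (a \<in> arrs Q \<longrightarrow> b \<in> arrs Q \<longrightarrow> h1 Q (cder_path Q F B a p) b = hat Q (delta p) a b)"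
proof -
  note Qf = wq_finite[OF Q]
  have pv: "valid Q B p" "plen p = 2" using p unfolding paths_len_def by blast+
  obtain v c0 a1 c1 a2 c2 where pp: "p = (v,c0,[(a1,c1),(a2,c2)])" and w: "a1 \<in> arrs Q" "a2 \<in> arrs Q" "tgt Q a1 = v" "tgt Q a2 = src Q a1"
    "c0 \<in> B v" "c1 \<in> B (src Q a1)" "c2 \<in> B (src Q a2)" by (rule path2_cases[OF pv])
  have cl: "src Q a2 = v" using potential_cyclic[OF S n] by (simp add: pp endv_def)
  have c02: "c2 * c0 \<in> Fi (src Q a2)" using w cl by auto
  have ok1: "okp Q (src Q a1) c1 [(a2,c2 * c0)]" and ok2: "okp Q (src Q a2) (c2 * c0) [(a1,c1)]"
    using w cl c02 by auto
  have P: "cder_path Q F B a p \<in> PQ Q"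
    unfolding pp cder_path2
  proof (rule PA_add)
    show "(if a1 = a then tensel Q F B (src Q a) c1 [(a2,c2 * c0)] else 0) \<in> PQ Q"
      using tensel_PA[OF Qf ok1] by (cases "a1 = a") simp_all
    show "(if a2 = a then tensel Q F B (src Q a) (c2 * c0) [(a1,c1)] else 0) \<in> PQ Q"
      using tensel_PA[OF Qf ok2] by (cases "a2 = a") simp_all
  qed
  moreover have "h1 Q (cder_path Q F B a p) b = hat Q (delta p) a b" if a: "a \<in> arrs Q" and b: "b \<in> arrs Q"
  proof -
    have e: "hat Q (delta p) a b = (if a = a1 \<and> b = a2 then c0 * c1 * c2 else 0) + (if b = a1 \<and> a = a2 then c0 * c1 * c2 else 0)"
      unfolding hat_def pp
      by (rule arg_cong2[of _ _ _ _ "(+)", OF hh_delta[OF Qf pv(1)[unfolded pp] a b] hh_delta[OF Qf pv(1)[unfolded pp] b a]])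
    have A1: "h1 Q (if a1 = a then tensel Q F B (src Q a) c1 [(a2,c2 * c0)] else 0) b = (if a = a1 \<and> b = a2 then c0 * c1 * c2 else 0)"
    proof (cases "a1 = a")
      case True
      show ?thesis using h1_tensel[OF Qf ok1 b] unfolding True by (simp add: mult_ac)
    qed (simp add: h1_zero)
    have A2: "h1 Q (if a2 = a then tensel Q F B (src Q a) (c2 * c0) [(a1,c1)] else 0) b = (if b = a1 \<and> a = a2 then c0 * c1 * c2 else 0)"
    proof (cases "a2 = a")
      case True
      show ?thesis using h1_tensel[OF Qf ok2 b] unfolding True by (simp add: mult_ac)
    qed (simp add: h1_zero)
    show ?thesis
      unfolding e unfolding pp cder_path2 h1_add A1 A2 ..
  qed
  ultimately show ?thesis by (intro conjI impI)
qed

lemma cder_PA: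
  assumes Q: "wq Q" and S: "is_potential Q F B S" and d: "\<forall>p. plen p \<noteq> 2 \<longrightarrow> S p = 0"
  shows "cder Q F B a S \<in> PQ Q"
  unfolding cder_deg2[OF assms]
proof (rule PA_sum)
  fix p assume p: "p \<in> paths_len Q B 2"
  show "sc (S p) (cder_path Q F B a p) \<in> PQ Q"
    using cder_term[OF Q S p] PA_F[OF potential_PA[OF S], of p] by (cases "S p = 0") auto
qed

text \<open>The cyclic derivatives of a degree-2 potential are the rows of its symmetrised matrix:
  the two positions at which \<open>a\<close> can stand in a 2-cycle produce the two summands of
  \<open>hat\<close>.\<close>

lemma h1_cder:
  assumes Q: "wq Q" and S: "is_potential Q F B S" and d: "\<forall>p. plen p \<noteq> 2 \<longrightarrow> S p = 0"
    and a: "a \<in> arrs Q" and b: "b \<in> arrs Q"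
  shows "h1 Q (cder Q F B a S) b = hat Q S a b"
proof -
  have "h1 Q (cder Q F B a S) b = (\<Sum>p\<in>paths_len Q B 2. S p * h1 Q (cder_path Q F B a p) b)"
    unfolding cder_deg2[OF Q S d] h1_sum h1_sc ..
  also have "\<dots> = (\<Sum>p\<in>paths_len Q B 2. S p * hat Q (delta p) a b)"
  proof (rule sum.cong[OF refl])
    fix p assume p: "p \<in> paths_len Q B 2"
    show "S p * h1 Q (cder_path Q F B a p) b = S p * hat Q (delta p) a b"
    proof (cases "S p = 0")
      case False
      have "h1 Q (cder_path Q F B a p) b = hat Q (delta p) a b"
        using mp[OF mp[OF conjunct2[OF cder_term[OF Q S p False]] a] b] .
      then show ?thesis by (simp only:)
    qed simp
  qed
  also have "\<dots> = hat Q (\<Sum>p\<in>paths_len Q B 2. sc (S p) (delta p)) a b"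
    unfolding hat_def hh_sum hh_sc distrib_left sum.distrib ..
  also have "(\<Sum>p\<in>paths_len Q B 2. sc (S p) (delta p)) = S"
    by (rule deg2_expand[OF wq_finite[OF Q] potential_PA[OF S] d, symmetric])
  finally show ?thesis .
qed

lemma inR_rp_eq: "inR r \<Longrightarrow> rp r = r"
proof
  fix p assume "inR r"
  then have "plen p \<noteq> 0 \<longrightarrow> r p = 0" unfolding inR_def by blast
  then show "rp r p = r p" by (simp add: rp_def)
qed

lemma bimod_genD:
  "x \<in> bimod_gen Q F B M \<Longrightarrow> \<exists>l. x = sum_list (map (\<lambda>(r, x, r'). (r \<star>\<^bsub>Q\<^esub> x) \<star>\<^bsub>Q\<^esub> r') l) \<and>
     set l \<subseteq> {r\<in>PQ Q. inR r} \<times> M \<times> {r\<in>PQ Q. inR r}"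
  unfolding bimod_gen_def by simp

text \<open>Triviality, read in the composita: the rows of the symmetrised quadratic form span every unit vector.\<close>

lemma trivial_rows:
  assumes Q: "wq Q" and S: "is_potential Q F B S" and t: "is_trivial Q F B S" and y: "y \<in> arrs Q"
  shows "\<exists>k. \<forall>b\<in>arrs Q. (if b = y then 1 else 0) = (\<Sum>a\<in>arrs Q. k a * hat Q S a b)"
proof -
  note Qf = wq_finite[OF Q]
  have d: "\<forall>p. plen p \<noteq> 2 \<longrightarrow> S p = 0" and
    bg: "bimod_gen Q F B {cder Q F B a S | a. a \<in> arrs Q} = {x\<in>PA Q F B. \<forall>p. plen p \<noteq> 1 \<longrightarrow> x p = 0}"
    using t unfolding is_trivial_def by simp_all
  have "ar Q y \<in> {x\<in>PA Q F B. \<forall>p. plen p \<noteq> 1 \<longrightarrow> x p = 0}"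
  proof (intro CollectI conjI allI impI)
    fix p :: "('v,'e) bpath" assume "plen p \<noteq> 1"
    then show "ar Q y p = 0" by (cases p) (auto simp: ar_apply)
  qed (use y in auto)
  then have yb: "ar Q y \<in> bimod_gen Q F B {cder Q F B a S | a. a \<in> arrs Q}" unfolding bg .
  obtain l where l: "ar Q y = sum_list (map (\<lambda>(r, x, r'). (r \<star>\<^bsub>Q\<^esub> x) \<star>\<^bsub>Q\<^esub> r') l)"
     "set l \<subseteq> {r\<in>PA Q F B. inR r} \<times> {cder Q F B a S | a. a \<in> arrs Q} \<times> {r\<in>PA Q F B. inR r}"
    using bimod_genD[OF yb] by (elim exE conjE)
  have "\<exists>k. \<forall>b\<in>arrs Q. h1 Q (sum_list (map (\<lambda>(r, x, r'). (r \<star>\<^bsub>Q\<^esub> x) \<star>\<^bsub>Q\<^esub> r') l)) b = (\<Sum>a\<in>arrs Q. k a * hat Q S a b)"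
    using l(2)
  proof (induction l)
    case Nil
    show ?case by (rule exI[of _ "\<lambda>_. 0"]) (simp add: h1_zero)
  next
    case (Cons z l)
    have "set l \<subseteq> {r\<in>PA Q F B. inR r} \<times> {cder Q F B a S | a. a \<in> arrs Q} \<times> {r\<in>PA Q F B. inR r}"
      using Cons.prems unfolding list.set insert_subset by (rule conjunct2)
    from Cons.IH[OF this]
    obtain k where k: "\<forall>b\<in>arrs Q. h1 Q (sum_list (map (\<lambda>(r, x, r'). (r \<star>\<^bsub>Q\<^esub> x) \<star>\<^bsub>Q\<^esub> r') l)) b = (\<Sum>a\<in>arrs Q. k a * hat Q S a b)"
      by (elim exE)
    obtain r x r' where z: "z = (r,x,r')" by (cases z)
    have rr: "r \<in> PQ Q" "inR r" "r' \<in> PQ Q" "inR r'" and "x \<in> {cder Q F B a S | a. a \<in> arrs Q}"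
      using Cons.prems unfolding z list.set insert_subset mem_Times_iff fst_conv snd_conv by simp_all
    then obtain a where a: "a \<in> arrs Q" "x = cder Q F B a S" by (elim CollectE exE conjE)
    have xP: "x \<in> PQ Q" unfolding a(2) by (rule cder_PA[OF Q S d])
    \<comment> \<open>The component at \<open>v\<close> of an element of \<open>R\<close>, evaluated
      as a field element.\<close>
    let ?\<rho> = "\<lambda>r v. \<Sum>c\<in>B v. r (v,c,[]) * c"
    have h: "h1 Q ((r \<star>\<^bsub>Q\<^esub> x) \<star>\<^bsub>Q\<^esub> r') b = ?\<rho> r (src Q a) * ?\<rho> r' (tgt Q a) * hat Q S a b" if b: "b \<in> arrs Q" for b
    proof -
      have e: "rp r = r" "rp r' = r'" using rr(2,4) by (simp_all only: inR_rp_eq)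
      have "h1 Q ((r \<star>\<^bsub>Q\<^esub> x) \<star>\<^bsub>Q\<^esub> r') b = ?\<rho> r' (src Q b) * h1 Q (r \<star>\<^bsub>Q\<^esub> x) b"
        using h1_rp_right[OF Qf PA_mult[OF Qf rr(1) xP] rr(3) b] unfolding e .
      also have "h1 Q (r \<star>\<^bsub>Q\<^esub> x) b = ?\<rho> r (tgt Q b) * h1 Q x b"
        using h1_rp_left[OF Qf xP rr(1), of b] unfolding e .
      also have "h1 Q x b = hat Q S a b" unfolding a(2) by (rule h1_cder[OF Q S d a(1) b])
      finally have f: "h1 Q ((r \<star>\<^bsub>Q\<^esub> x) \<star>\<^bsub>Q\<^esub> r') b = ?\<rho> r' (src Q b) * (?\<rho> r (tgt Q b) * hat Q S a b)" .
      \<comment> \<open>A nonzero entry forces \<open>b\<close> to be opposite to \<open>a\<close>,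
        so the two factors can be expressed through the end vertices of \<open>a\<close> and the
        multiplier no longer depends on \<open>b\<close>.\<close>
      show ?thesis
      proof (cases "hat Q S a b = 0")
        case False
        then have "tgt Q b = src Q a" "src Q b = tgt Q a" using hat_potential[OF S sub_refl, of a b] by simp_all
        then show ?thesis unfolding f by (simp only: mult_ac)
      qed (simp add: f)
    qed
    let ?k = "\<lambda>e. k e + (if e = a then ?\<rho> r (src Q a) * ?\<rho> r' (tgt Q a) else 0)"
    have "h1 Q (sum_list (map (\<lambda>(r, x, r'). (r \<star>\<^bsub>Q\<^esub> x) \<star>\<^bsub>Q\<^esub> r') (z # l))) b = (\<Sum>e\<in>arrs Q. ?k e * hat Q S e b)" if b: "b \<in> arrs Q" for b
    proof -
      have "(\<Sum>e\<in>arrs Q. ?k e * hat Q S e b) = (\<Sum>e\<in>arrs Q. k e * hat Q S e b)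
         + (\<Sum>e\<in>arrs Q. if e = a then ?\<rho> r (src Q a) * ?\<rho> r' (tgt Q a) * hat Q S a b else 0)"
        unfolding sum.distrib[symmetric]
      proof (rule sum.cong[OF refl])
        fix e show "?k e * hat Q S e b = k e * hat Q S e b + (if e = a then ?\<rho> r (src Q a) * ?\<rho> r' (tgt Q a) * hat Q S a b else 0)"
          by (cases "e = a") (simp_all only: distrib_right if_True if_False add_0_right simp_thms)
      qed
      also have "(\<Sum>e\<in>arrs Q. if e = a then ?\<rho> r (src Q a) * ?\<rho> r' (tgt Q a) * hat Q S a b else 0) = h1 Q ((r \<star>\<^bsub>Q\<^esub> x) \<star>\<^bsub>Q\<^esub> r') b"
        unfolding h[OF b] by (rule trans[OF sum.delta[OF Qf]]) (simp only: a(1) if_True)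
      finally show ?thesis using bspec[OF k b] unfolding z list.map prod.case sum_list.Cons h1_add by (simp only: add.commute)
    qed
    then show ?case by (intro exI[of _ ?k] ballI)
  qed
  then have "\<exists>k. \<forall>b\<in>arrs Q. h1 Q (ar Q y) b = (\<Sum>a\<in>arrs Q. k a * hat Q S a b)" unfolding l(1)[symmetric] .
  then obtain k where k: "\<forall>b\<in>arrs Q. h1 Q (ar Q y) b = (\<Sum>a\<in>arrs Q. k a * hat Q S a b)" by (elim exE)
  show ?thesis
  proof (intro exI[of _ k] ballI)
    fix b assume b: "b \<in> arrs Q"
    show "(if b = y then 1 else 0) = (\<Sum>a\<in>arrs Q. k a * hat Q S a b)"
      using bspec[OF k b] unfolding h1_ar[OF y b] .
  qed
qed


section \<open>Uniqueness\<close>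

definition homg :: "nat \<Rightarrow> ('v,'e) pelt \<Rightarrow> bool" where
  "homg n x \<longleftrightarrow> (\<forall>p. plen p \<noteq> n \<longrightarrow> x p = 0)"

definition part :: "nat \<Rightarrow> ('v,'e) pelt \<Rightarrow> ('v,'e) pelt" where
  "part n x = (\<lambda>p. if plen p = n then x p else 0)"

lemma homgD: "homg n x \<Longrightarrow> plen p \<noteq> n \<Longrightarrow> x p = 0"
  unfolding homg_def by blast

lemma homgI: "(\<And>p. plen p \<noteq> n \<Longrightarrow> x p = 0) \<Longrightarrow> homg n x"
  unfolding homg_def by blast

lemma homg_part: "homg n (part n x)"
  by (rule homgI) (simp add: part_def)

lemma part_homg: "homg n x \<Longrightarrow> part n x = x"
  by (rule ext) (simp add: part_def homgD)

lemma part_diff: "part n (x - y) = part n x - part n y"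
  by (rule ext) (simp add: part_def pw)

lemma part_add: "part n (x + y) = part n x + part n y"
  by (rule ext) (simp add: part_def pw)

lemma part_sc: "part n (sc c x) = sc c (part n x)"
  by (rule ext) (simp add: part_def pw)

lemma part_fil: "fil (Suc n) x \<Longrightarrow> part n x = 0"
  by (rule ext) (simp add: part_def pw filD)

lemma fil_part: "fil n x \<Longrightarrow> fil (Suc n) (x - part n x)"
proof (rule filI)
  fix p :: "('v,'e) bpath" assume x: "fil n x" and "plen p < Suc n"
  then have "plen p < n \<or> plen p = n" by linarith
  then show "(x - part n x) p = 0" using filD[OF x, of p] by (auto simp: part_def pw)
qed

lemma homg_fil: "homg n x \<Longrightarrow> fil n x"
  by (rule filI) (simp add: homgD)

lemma homg_fil_zero: "homg n x \<Longrightarrow> fil (Suc n) x \<Longrightarrow> x = 0"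
  using part_homg[of n x] part_fil[of n x] by simp

lemma homg_diff: "homg n x \<Longrightarrow> homg n y \<Longrightarrow> homg n (x - y)"
  by (rule homgI) (simp add: homgD pw)

lemma homg_sum: "(\<And>i. i \<in> I \<Longrightarrow> homg n (f i)) \<Longrightarrow> homg n (\<Sum>i\<in>I. f i)"
  by (rule homgI, unfold sum_fun_apply, rule sum.neutral, rule ballI, rule homgD)

lemma homg_re: "homg 0 (re v w)"
  by (rule homgI) (auto simp: re_def split: prod.split)

lemma homg_ar: "homg (Suc 0) (ar Q a)"
proof (rule homgI)
  fix p :: "('v,'e) bpath" assume p: "plen p \<noteq> Suc 0"
  obtain v c L where "p = (v,c,L)" by (cases p)
  then show "ar Q a p = 0" using p by (auto simp: ar_apply)
qed

lemma homg_mult: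
  assumes x: "homg m x" and y: "homg n y" shows "homg (m + n) (x \<star>\<^bsub>Q\<^esub> y)"
proof (rule homgI)
  fix r :: "('v,'e) bpath" assume r: "plen r \<noteq> m + n"
  have "x p * y q = 0" if "k \<le> plen r" "p \<in> paths_len Q B k" "q \<in> paths_len Q B (plen r - k)" for k p q
  proof (cases "k = m")
    case True
    then have "plen q \<noteq> n" using r that by (auto simp: paths_len_def)
    then have "y q = 0" by (rule homgD[OF y])
    then show ?thesis by simp
  next
    case False
    then have "plen p \<noteq> m" using that by (auto simp: paths_len_def)
    then have "x p = 0" by (rule homgD[OF x])
    then show ?thesis by simp
  qed
  then show "(x \<star>\<^bsub>Q\<^esub> y) r = 0"
    by (auto simp: pmult_def intro!: sum.neutral)
qed

lemma part_PA: "x \<in> PQ Q \<Longrightarrow> part n x \<in> PQ Q"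
  unfolding PA_def part_def by simp

lemma part_Cor: "x \<in> Cor Q i j \<Longrightarrow> part n x \<in> Cor Q i j"
  by (rule CorI[OF part_PA[OF Cor_PA]], assumption) (auto simp: part_def dest: Cor_supp split: if_splits)

lemma homg_sh: "homg (Suc n) x \<Longrightarrow> homg n (sh Q a c x)"
proof (rule homgI)
  fix p :: "('v,'e) bpath" assume x: "homg (Suc n) x" and p: "plen p \<noteq> n"
  obtain u b L where pp: "p = (u,b,L)" by (cases p)
  have "x (tgt Q a,c,(a,b)#L) = 0" by (rule homgD[OF x]) (use p pp in simp)
  then show "sh Q a c x p = 0" by (simp add: pp sh_apply)
qed

lemma hom_homg:
  assumes H: "is_hom Q Q' H" and Q: "finite (arrs Q)" and g: "\<And>a. a \<in> arrs Q \<Longrightarrow> homg (Suc 0) (H (ar Q a))"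
    and x: "x \<in> PQ Q" "homg n x"
  shows "homg n (H x)"
  using x
proof (induction n arbitrary: x)
  case 0
  have "inR x" unfolding inR_def using homgD[OF 0(2)] by blast
  then show ?case using hom_R[OF H 0(1)] 0(2) by simp
next
  case (Suc n)
  have "rp x = 0" using homg_fil[OF Suc.prems(2)] fil_mono[of "Suc n" x "Suc 0"] by (intro rp_fil) simp
  moreover have "homg (Suc n) (re (tgt Q a) c \<star>\<^bsub>Q'\<^esub> H (ar Q a) \<star>\<^bsub>Q'\<^esub> H (sh Q a c x))" if a: "a \<in> arrs Q" for a c
    using homg_mult[OF homg_re homg_mult[OF g[OF a] Suc.IH[OF sh_PA[OF Suc.prems(1)] homg_sh[OF Suc.prems(2)]]]] by simp
  ultimately show ?case
    unfolding hom_decomp[OF H Q Suc.prems(1)] by (simp add: homg_sum)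
qed

lemma rot1_length: "length (snd (rot1 z)) = length (snd z)"
  by (cases z rule: rot1.cases) auto

lemma cycgen_part:
  assumes "x \<in> cycgens Q F Fi B" shows "part n x = x \<or> part n x = 0"
proof -
  from assms obtain v w0 L where x: "x = tensel Q F B v w0 L -
        tensel Q F B (src Q (fst (hd L))) (fst (rot1 (w0, L))) (snd (rot1 (w0, L)))"
    unfolding cycgens_def by blast
  have z: "x (u,c,M) = 0" if "length M \<noteq> length L" for u c M
    unfolding x minus_apply using that rot1_length[of "(w0,L)"] by (simp add: tensel_length)
  show ?thesis
  proof (cases "n = length L")
    case True
    have "homg n x"
    proof (rule homgI)
      fix p :: "('v,'e) bpath" assume "plen p \<noteq> n"
      then show "x p = 0" using z True by (cases p) simp
    qed
    then show ?thesis using part_homg by blast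
  next
    case False
    have "part n x = 0"
    proof
      fix p :: "('v,'e) bpath" show "part n x p = 0 p" using z False by (cases p) (simp add: part_def pw)
    qed
    then show ?thesis ..
  qed
qed

text \<open>Rotation preserves length, so each generator is homogeneous and the closed span is
  graded.\<close>

lemma CY_part:
  assumes x: "x \<in> CY Q" shows "part n x \<in> CY Q"
proof (rule CY_closed)
  have sp: "part n u \<in> CY Q" if u: "u \<in> Sp Q" for u
  proof -
    obtain l where l: "u = sum_list (map (\<lambda>(c, x). (\<lambda>p. c * x p)) l)" "set l \<subseteq> F \<times> cycgens Q F Fi B"
      using FspanD[OF u] by (elim exE conjE)
    show ?thesis unfolding l(1) using l(2)
    proof (induction l)
      case Nil
      have "part n 0 = 0" by (rule ext) (simp add: part_def pw)
      then show ?case by simp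
    next
      case (Cons cx l)
      obtain c x where cx: "cx = (c,x)" by (cases cx)
      let ?s = "sum_list (map (\<lambda>(c, x). (\<lambda>p. c * x p)) l)"
      have e: "sum_list (map (\<lambda>(c, x). (\<lambda>p. c * x p)) (cx # l)) = sc c x + ?s"
        by (simp add: cx sc_def)
      have c: "c \<in> F" and xg: "x \<in> cycgens Q F Fi B" and s: "part n ?s \<in> CY Q"
        using Cons by (auto simp: cx)
      have "part n x \<in> CY Q" using cycgen_part[OF xg, of n] Sp_CY[OF Fspan_gen[OF xg]] by auto
      then show ?case unfolding e part_add part_sc using c s by (intro CY_add CY_sc)
    qed
  qed
  fix m
  obtain u where u: "u \<in> Sp Q" "fil m (x - u)" using x unfolding CY_iff by blast
  have "fil m (part n x - part n u)"
    unfolding part_diff[symmetric] by (rule filI) (simp add: part_def filD[OF u(2)])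
  then show "\<exists>u\<in>CY Q. fil m (part n x - u)" using sp[OF u(1)] by blast
qed

section \<open>Linear parts and projections to subquivers\<close>

lemma h1_sub: "sub Q1 Q \<Longrightarrow> a \<in> arrs Q1 \<Longrightarrow> h1 Q1 x a = h1 Q x a"
  using sub_src[of Q1 Q a] sub_tgt[of Q1 Q a] by (simp add: h1_def)

lemma h1_sub_out: "x \<in> PQ Q1 \<Longrightarrow> a \<notin> arrs Q1 \<Longrightarrow> h1 Q x a = 0"
  using PA_out[of x Q1 "(tgt Q a,_,[(a,_)])"] by (simp add: h1_def)

lemma h1_proj:
  assumes s: "sub Q1 Q" and Q: "wq Q" and x: "x \<in> PQ Q" "fil (Suc 0) x" and a: "a \<in> arrs Q1"
  shows "h1 Q (proj Q Q1 x) a = h1 Q x a"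
proof -
  have "h1 Q (proj Q Q1 x) a = (\<Sum>b\<in>arrs Q. h1 Q x b * h1 Q1 (proj Q Q1 (ar Q b)) a)"
    using h1_hom[OF proj_hom[OF s Q] Q sub_wq[OF s Q] x a] h1_sub[OF s a] by simp
  also have "\<dots> = (\<Sum>b\<in>arrs Q. if b = a then h1 Q x a else 0)"
  proof (rule sum.cong[OF refl])
    fix b assume b: "b \<in> arrs Q"
    show "h1 Q x b * h1 Q1 (proj Q Q1 (ar Q b)) a = (if b = a then h1 Q x a else 0)"
      unfolding proj_ar[OF s Q b] using h1_ar[of b Q1 a] a by (cases "b \<in> arrs Q1") (auto simp: h1_zero)
  qed
  finally show ?thesis using sub_arrs[OF s a] wq_finite[OF Q] by simp
qed

lemma sub_part:
  assumes s: "sub Q1 Q" and Q: "wq Q" and x: "x \<in> PQ Q" "fil (Suc 0) x"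
    and 0: "\<And>a. a \<in> arrs Q \<Longrightarrow> a \<notin> arrs Q1 \<Longrightarrow> h1 Q x a = 0"
  shows "fil 2 (x - proj Q Q1 x)"
proof (rule fil2I[OF Q])
  have p: "proj Q Q1 x \<in> PQ Q1" by (rule hom_PA[OF proj_hom[OF s Q] x(1)])
  show "x - proj Q Q1 x \<in> PQ Q" using x(1) PA_sub[OF s p] by (rule PA_diff)
  show "fil (Suc 0) (x - proj Q Q1 x)"
    using x(2) hom_fil[OF proj_hom[OF s Q] Q sub_wq[OF s Q] x] by (rule fil_diff)
  fix a assume a: "a \<in> arrs Q"
  show "h1 Q (x - proj Q Q1 x) a = 0"
  proof (cases "a \<in> arrs Q1")
    case True
    then show ?thesis unfolding h1_diff h1_proj[OF s Q x True] by simp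
  next
    case False
    then show ?thesis unfolding h1_diff using 0[OF a False] h1_sub_out[OF p False] by simp
  qed
qed

lemma split_part:
  assumes s: "sub Q1 Q" "sub Q2 Q" and Q: "wq Q" and A: "arrs Q = arrs Q1 \<union> arrs Q2" "arrs Q1 \<inter> arrs Q2 = {}"
    and x: "x \<in> PQ Q" "fil (Suc 0) x"
  shows "fil 2 (x - proj Q Q2 x - proj Q Q1 x)"
proof (rule fil2I[OF Q])
  have p: "proj Q Q1 x \<in> PQ Q1" "proj Q Q2 x \<in> PQ Q2" using hom_PA[OF proj_hom[OF s(1) Q] x(1)] hom_PA[OF proj_hom[OF s(2) Q] x(1)] .
  show "x - proj Q Q2 x - proj Q Q1 x \<in> PQ Q" using x(1) PA_sub[OF s(1) p(1)] PA_sub[OF s(2) p(2)] by (intro PA_diff)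
  show "fil (Suc 0) (x - proj Q Q2 x - proj Q Q1 x)"
    using x(2) hom_fil[OF proj_hom[OF s(1) Q] Q sub_wq[OF s(1) Q] x] hom_fil[OF proj_hom[OF s(2) Q] Q sub_wq[OF s(2) Q] x]
    by (intro fil_diff)
  fix a assume a: "a \<in> arrs Q"
  show "h1 Q (x - proj Q Q2 x - proj Q Q1 x) a = 0"
  proof (cases "a \<in> arrs Q1")
    case True
    then have "a \<notin> arrs Q2" using A by blast
    then show ?thesis unfolding h1_diff h1_proj[OF s(1) Q x True] using h1_sub_out[OF p(2)] by simp
  next
    case False
    then have t: "a \<in> arrs Q2" using A a by blast
    show ?thesis unfolding h1_diff h1_proj[OF s(2) Q x t] using h1_sub_out[OF p(1) False] by simp
  qed
qed

section \<open>Behaviour of trivial arrows under a right-equivalence\<close>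

lemma hat_diff: "hat Q (x - y) a b = hat Q x a b - hat Q y a b"
  by (simp add: hat_def hh_diff)

text \<open>Write L for the matrix of the linear part of \<open>H\<close>, and M, M' for those of
  \<open>St\<close>, \<open>St'\<close>. Comparing degree 2 gives M' = L^T M L. Triviality of
  \<open>St'\<close> writes the unit row at \<open>y\<close> as k M'. Multiplying by the inverse of
  L, which is the linear part of \<open>G\<close>, row \<open>y\<close> of \<open>G\<close> equals k
  L^T M, and column \<open>a\<close> of M is zero because \<open>a\<close> does not occur in
  \<open>St\<close>.\<close>

lemma lin_triv:
  assumes Q: "wq Q" "wq Q'" and s: "sub Qt Q" "sub Qt' Q'"
    and S: "is_potential Qt F B St" "is_potential Qt' F B St'" and t: "is_trivial Qt' F B St'"
    and H: "is_hom Q Q' H" and G: "is_hom Q' Q G" and GH: "\<And>x. x \<in> PQ Q \<Longrightarrow> G (H x) = x"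
    and D: "H (St + Sr) - (St' + Sr') \<in> CY Q'" and r: "Sr \<in> PQ Q" "fil 3 Sr" "fil 3 Sr'"
    and y: "y \<in> arrs Qt'" and a: "a \<in> arrs Q" "a \<notin> arrs Qt"
  shows "h1 Q (G (ar Q' y)) a = 0"
proof -
  note Qf = wq_finite[OF Q(1)] wq_finite[OF Q(2)]
  let ?\<Lambda> = "\<lambda>e b'. h1 Q' (H (ar Q e)) b'"
  have wt': "wq Qt'" by (rule sub_wq[OF s(2) Q(2)])
  have StP: "St \<in> PQ Q" by (rule PA_sub[OF s(1) potential_PA[OF S(1)]])
  have St2: "fil 2 St" by (rule potential_fil2[OF sub_wq[OF s(1) Q(1)] S(1)])
  \<comment> \<open>The congruence is wanted at all positions, to allow a plain matrix computation.
    Where the arrows are not opposite, both sides vanish for reasons of source and target.\<close>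
  have G': "hat Q' St' a' b' = (\<Sum>c\<in>arrs Q. \<Sum>e\<in>arrs Q. hat Q St c e * ?\<Lambda> c a' * ?\<Lambda> e b')"
    if a': "a' \<in> arrs Q'" and b': "b' \<in> arrs Q'" for a' b'
  proof (cases "tgt Q' b' = src Q' a' \<and> tgt Q' a' = src Q' b'")
    case True
    then have op: "tgt Q' b' = src Q' a'" "tgt Q' a' = src Q' b'" by auto
    have "H (St + Sr) = H St + H Sr" by (rule hom_add[OF H StP r(1)])
    moreover have "fil 3 (H Sr)" by (rule hom_fil[OF H Q r(1,2)])
    ultimately have "hat Q' (H (St + Sr)) a' b' = hat Q' (H St) a' b'"
      by (simp add: hat_def hh_add hh_fil)
    moreover have "hat Q' (St' + Sr') a' b' = hat Q' St' a' b'"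
      using r(3) by (simp add: hat_def hh_add hh_fil)
    moreover have "hat Q' (H (St + Sr)) a' b' - hat Q' (St' + Sr') a' b' = 0"
      using hat_CY[OF Q(2) D a' b' op] by (simp add: hat_diff)
    ultimately show ?thesis using hat_hom[OF H Q StP St2 a' b' op] by simp
  next
    case False
    then have "hat Q' St' a' b' = 0" using hat_potential[OF S(2) s(2), of a' b'] by blast
    moreover have "hat Q St c e * ?\<Lambda> c a' * ?\<Lambda> e b' = 0" if c: "c \<in> arrs Q" and e: "e \<in> arrs Q" for c e
    proof (rule ccontr)
      assume "\<not> ?thesis"
      then have n: "hat Q St c e \<noteq> 0" "?\<Lambda> c a' \<noteq> 0" "?\<Lambda> e b' \<noteq> 0" by auto
      have "tgt Q' a' = tgt Q c" "src Q' a' = src Q c" using h1_Cor[OF hom_Cor[OF H Qf ar_Cor[OF c]] n(2)] by auto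
      moreover have "tgt Q' b' = tgt Q e" "src Q' b' = src Q e" using h1_Cor[OF hom_Cor[OF H Qf ar_Cor[OF e]] n(3)] by auto
      moreover have "tgt Q e = src Q c" "tgt Q c = src Q e" using hat_potential[OF S(1) s(1) n(1)] by auto
      ultimately show False using False by simp
    qed
    then have "(\<Sum>c\<in>arrs Q. \<Sum>e\<in>arrs Q. hat Q St c e * ?\<Lambda> c a' * ?\<Lambda> e b') = 0"
      by (intro sum.neutral ballI)
    ultimately show ?thesis by simp
  qed
  obtain k where k: "\<forall>b\<in>arrs Qt'. (if b = y then 1 else 0) = (\<Sum>a\<in>arrs Qt'. k a * hat Qt' St' a b)"
    using trivial_rows[OF wt' S(2) t y] by (elim exE)
  have k': "(if b' = y then 1 else 0) = (\<Sum>a'\<in>arrs Qt'. k a' * hat Q' St' a' b')" if b': "b' \<in> arrs Q'" for b'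
  proof (cases "b' \<in> arrs Qt'")
    case True
    have "(\<Sum>a'\<in>arrs Qt'. k a' * hat Qt' St' a' b') = (\<Sum>a'\<in>arrs Qt'. k a' * hat Q' St' a' b')"
      by (rule sum.cong[OF refl]) (simp only: hat_sub[OF s(2) _ True])
    then show ?thesis using bspec[OF k True] by simp
  next
    case False
    then have "hat Q' St' a' b' = 0" for a' using hat_potential[OF S(2) s(2), of a' b'] by blast
    then show ?thesis using False y by auto
  qed
  have yQ: "y \<in> arrs Q'" using sub_arrs[OF s(2) y] .
  have LM: "(\<Sum>b'\<in>arrs Q'. ?\<Lambda> e b' * h1 Q (G (ar Q' b')) a) = (if a = e then 1 else 0)" if e: "e \<in> arrs Q" for e
    using h1_hom[OF G Q(2,1) hom_PA[OF H ar_PA[OF e]] hom_ar_fil1[OF H Q e] a(1)] GH[OF ar_PA[OF e]] h1_ar[OF e a(1)] by simp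
  have "h1 Q (G (ar Q' y)) a = (\<Sum>b'\<in>arrs Q'. (if b' = y then 1 else 0) * h1 Q (G (ar Q' b')) a)"
    using yQ Qf(2) by (simp add: if_distrib[of "\<lambda>x. x * _"] cong: if_cong)
  also have "\<dots> = (\<Sum>b'\<in>arrs Q'. \<Sum>a'\<in>arrs Qt'. \<Sum>c\<in>arrs Q. \<Sum>e\<in>arrs Q. k a' * hat Q St c e * ?\<Lambda> c a' * (?\<Lambda> e b' * h1 Q (G (ar Q' b')) a))"
  proof (rule sum.cong[OF refl])
    fix b' assume b': "b' \<in> arrs Q'"
    show "(if b' = y then 1 else 0) * h1 Q (G (ar Q' b')) a
      = (\<Sum>a'\<in>arrs Qt'. \<Sum>c\<in>arrs Q. \<Sum>e\<in>arrs Q. k a' * hat Q St c e * ?\<Lambda> c a' * (?\<Lambda> e b' * h1 Q (G (ar Q' b')) a))"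
      unfolding k'[OF b'] sum_distrib_right
      by (rule sum.cong[OF refl]) (simp add: G'[OF sub_arrs[OF s(2)] b'] sum_distrib_left sum_distrib_right mult_ac)
  qed
  also have "\<dots> = (\<Sum>a'\<in>arrs Qt'. \<Sum>b'\<in>arrs Q'. \<Sum>c\<in>arrs Q. \<Sum>e\<in>arrs Q. k a' * hat Q St c e * ?\<Lambda> c a' * (?\<Lambda> e b' * h1 Q (G (ar Q' b')) a))"
    by (rule sum.swap)
  also have "\<dots> = (\<Sum>a'\<in>arrs Qt'. \<Sum>c\<in>arrs Q. \<Sum>b'\<in>arrs Q'. \<Sum>e\<in>arrs Q. k a' * hat Q St c e * ?\<Lambda> c a' * (?\<Lambda> e b' * h1 Q (G (ar Q' b')) a))"
    by (intro sum.cong refl sum.swap)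
  also have "\<dots> = (\<Sum>a'\<in>arrs Qt'. \<Sum>c\<in>arrs Q. \<Sum>e\<in>arrs Q. \<Sum>b'\<in>arrs Q'. k a' * hat Q St c e * ?\<Lambda> c a' * (?\<Lambda> e b' * h1 Q (G (ar Q' b')) a))"
    by (intro sum.cong refl sum.swap)
  also have "\<dots> = (\<Sum>a'\<in>arrs Qt'. \<Sum>c\<in>arrs Q. \<Sum>e\<in>arrs Q. 0)"
  proof (intro sum.cong refl)
    fix a' c e assume e: "e \<in> arrs Q"
    have h0: "hat Q St c a = 0" using hat_potential[OF S(1) s(1), of c a] a(2) by blast
    show "(\<Sum>b'\<in>arrs Q'. k a' * hat Q St c e * ?\<Lambda> c a' * (?\<Lambda> e b' * h1 Q (G (ar Q' b')) a)) = 0"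
      unfolding sum_distrib_left[symmetric] LM[OF e] using h0 by auto
  qed
  finally show ?thesis by simp
qed


text \<open>The common data of the two comparisons: inverse homomorphisms whose linear parts are
  block triangular with respect to trivial and reduced arrows, in both directions. The symmetry
  yields every statement about \<open>H\<close> for \<open>G\<close> as well, through
  \<open>blk_swap\<close>.\<close>

definition blk where
  "blk Q Qt Qr Q' Qt' Qr' H G \<longleftrightarrow> wq Q \<and> wq Q' \<and> sub Qt Q \<and> sub Qr Q \<and> sub Qt' Q' \<and> sub Qr' Q' \<and>
     arrs Q = arrs Qt \<union> arrs Qr \<and> arrs Qt \<inter> arrs Qr = {} \<and> arrs Q' = arrs Qt' \<union> arrs Qr' \<and> arrs Qt' \<inter> arrs Qr' = {} \<and>
     is_hom Q Q' H \<and> is_hom Q' Q G \<and> (\<forall>x\<in>PQ Q. G (H x) = x) \<and> (\<forall>x\<in>PQ Q'. H (G x) = x) \<and>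
     (\<forall>y\<in>arrs Qt'. fil 2 (G (ar Q' y) - proj Q Qt (G (ar Q' y)))) \<and>
     (\<forall>y\<in>arrs Qt. fil 2 (H (ar Q y) - proj Q' Qt' (H (ar Q y))))"

lemma blk_swap: "blk Q Qt Qr Q' Qt' Qr' H G \<Longrightarrow> blk Q' Qt' Qr' Q Qt Qr G H"
  unfolding blk_def by blast

lemma proj_rp:
  assumes s: "sub Q1 Q" "sub Q2 Q" and Q: "wq Q" and d: "arrs Q1 \<inter> arrs Q2 = {}" and x: "x \<in> PQ Q1"
  shows "proj Q Q2 x = rp x"
proof (rule hom_ext[OF hom_restrict[OF proj_hom[OF s(2) Q] s(1) wq_finite[OF Q]] hom_rp sub_wq[OF s(1) Q] sub_wq[OF s(2) Q] _ x])
  show "wq Q1" by (rule sub_wq[OF s(1) Q])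
  show "finite (arrs Q2)" by (rule wq_finite[OF sub_wq[OF s(2) Q]])
  fix a assume a: "a \<in> arrs Q1"
  then have "a \<notin> arrs Q2" using d by blast
  then show "proj Q Q2 (ar Q1 a) = rp (ar Q1 a)"
    using proj_ar[OF s(2) Q sub_arrs[OF s(1) a]] by (simp add: ar_sub[OF s(1) a] rp_fil)
qed

context
  fixes Q Qt Qr Q' Qt' Qr' :: "'v wquiver" and H G
  assumes b: "blk Q Qt Qr Q' Qt' Qr' H G"
begin

lemma bQ: "wq Q" "wq Q'" and bs: "sub Qt Q" "sub Qr Q" "sub Qt' Q'" "sub Qr' Q'"
  and bA: "arrs Q = arrs Qt \<union> arrs Qr" "arrs Qt \<inter> arrs Qr = {}" "arrs Q' = arrs Qt' \<union> arrs Qr'" "arrs Qt' \<inter> arrs Qr' = {}"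
  and bH: "is_hom Q Q' H" and bG: "is_hom Q' Q G"
  and GH: "x \<in> PQ Q \<Longrightarrow> G (H x) = x" and HG: "y \<in> PQ Q' \<Longrightarrow> H (G y) = y"
  and L1: "a' \<in> arrs Qt' \<Longrightarrow> fil 2 (G (ar Q' a') - proj Q Qt (G (ar Q' a')))"
  and L2: "a \<in> arrs Qt \<Longrightarrow> fil 2 (H (ar Q a) - proj Q' Qt' (H (ar Q a)))"
  using b unfolding blk_def by simp_all

lemma bw: "wq Qt" "wq Qr" "wq Qt'" "wq Qr'"
  using sub_wq bs bQ by blast+

text \<open>Replacing \<open>G y\<close> by its trivial component costs only terms of length 2, so
  \<open>H\<close> undoes \<open>G\<close> on the trivial block already.\<close>

lemma block_t:
  assumes y: "y \<in> arrs Qt'"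
  shows "fil 2 (proj Q' Qt' (H (proj Q Qt (G (ar Q' y)))) - ar Qt' y)"
proof -
  have yQ: "y \<in> arrs Q'" by (rule sub_arrs[OF bs(3) y])
  let ?v = "G (ar Q' y)" let ?w = "proj Q Qt ?v"
  have v: "?v \<in> PQ Q" by (rule hom_PA[OF bG ar_PA[OF yQ]])
  have w: "?w \<in> PQ Q" by (rule PA_sub[OF bs(1) hom_PA[OF proj_hom[OF bs(1) bQ(1)] v]])
  have "fil 2 (H ?v - H ?w)" by (rule hom_fil_diff[OF bH bQ v w L1[OF y]])
  then have "fil 2 (ar Q' y - H ?w)" using HG[OF ar_PA[OF yQ]] by simp
  from hom_fil_diff[OF proj_hom[OF bs(3) bQ(2)] bQ(2) bw(3) ar_PA[OF yQ] hom_PA[OF bH w] this]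
  have "fil 2 (ar Qt' y - proj Q' Qt' (H ?w))" using proj_ar[OF bs(3) bQ(2) yQ] y by simp
  then show ?thesis by (rule fil_sym)
qed

lemma block_kill:
  assumes w: "w \<in> PQ Qt" "fil (Suc 0) w" shows "fil 2 (proj Q' Qr' (H w))"
proof -
  let ?K = "\<lambda>x. proj Q' Qr' (H x)"
  have K: "is_hom Qt Qr' ?K"
    by (rule hom_comp[OF hom_restrict[OF bH bs(1) wq_finite[OF bQ(1)]] proj_hom[OF bs(4) bQ(2)]])
  have "fil 2 (?K (ar Qt a) - rp (ar Qt a))" if a: "a \<in> arrs Qt" for a
  proof -
    have aQ: "a \<in> arrs Q" by (rule sub_arrs[OF bs(1) a])
    let ?h = "H (ar Q a)"
    have h: "?h \<in> PQ Q'" "fil (Suc 0) ?h" using hom_PA[OF bH ar_PA[OF aQ]] hom_ar_fil1[OF bH bQ aQ] .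
    have p: "proj Q' Qt' ?h \<in> PQ Qt'" "fil (Suc 0) (proj Q' Qt' ?h)"
      using hom_PA[OF proj_hom[OF bs(3) bQ(2)] h(1)] hom_fil[OF proj_hom[OF bs(3) bQ(2)] bQ(2) bw(3) h] .
    have "proj Q' Qr' (proj Q' Qt' ?h) = 0"
      using proj_rp[OF bs(3,4) bQ(2) bA(4) p(1)] rp_fil[OF p(2)] by simp
    then have "fil 2 (proj Q' Qr' ?h)"
      using hom_fil_diff[OF proj_hom[OF bs(4) bQ(2)] bQ(2) bw(4) h(1) PA_sub[OF bs(3) p(1)] L2[OF a]] by simp
    then show ?thesis using ar_sub[OF bs(1) a] by (simp add: rp_fil)
  qed
  then have "fil (Suc (Suc 0)) (?K w - rp w)"
    by (rule hom_cong2[OF K hom_rp[OF bw(1) wq_finite[OF bw(4)]] bw(1,4) _ w])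
  then show ?thesis using rp_fil[OF w(2)] by (simp add: numeral_2_eq_2)
qed

text \<open>Here \<open>G y\<close> may have a trivial component of order 1. But \<open>H\<close>
  sends it to trivial arrows modulo length 2, and these are removed by the projection
  (\<open>block_kill\<close>).\<close>

lemma block_r:
  assumes y: "y \<in> arrs Qr'"
  shows "fil 2 (proj Q' Qr' (H (proj Q Qr (G (ar Q' y)))) - ar Qr' y)"
proof -
  have yQ: "y \<in> arrs Q'" by (rule sub_arrs[OF bs(4) y])
  let ?v = "G (ar Q' y)" let ?r = "proj Q Qr ?v" and ?t = "proj Q Qt ?v"
  have v: "?v \<in> PQ Q" "fil (Suc 0) ?v" using hom_PA[OF bG ar_PA[OF yQ]] hom_ar_fil1[OF bG bQ(2,1) yQ] .
  have r: "?r \<in> PQ Q" by (rule PA_sub[OF bs(2) hom_PA[OF proj_hom[OF bs(2) bQ(1)] v(1)]])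
  have t: "?t \<in> PQ Qt" "fil (Suc 0) ?t"
    using hom_PA[OF proj_hom[OF bs(1) bQ(1)] v(1)] hom_fil[OF proj_hom[OF bs(1) bQ(1)] bQ(1) bw(1) v] .
  have tQ: "?t \<in> PQ Q" by (rule PA_sub[OF bs(1) t(1)])
  let ?P = "\<lambda>x. proj Q' Qr' (H x)"
  have P: "is_hom Q Qr' ?P" by (rule hom_comp[OF bH proj_hom[OF bs(4) bQ(2)]])
  have "fil 2 (?v - ?r - ?t)" by (rule split_part[OF bs(1,2) bQ(1) bA(1,2) v])
  from hom_fil_diff[OF P bQ(1) bw(4) PA_diff[OF v(1) r] tQ this] 
  have "fil 2 (?P (?v - ?r))" using fil_add[OF _ block_kill[OF t]] by fastforce
  then have "fil 2 (?P ?v - ?P ?r)" using hom_diff[OF P v(1) r] by simp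
  then have "fil 2 (ar Qr' y - ?P ?r)"
    using HG[OF ar_PA[OF yQ]] proj_ar[OF bs(4) bQ(2) yQ] y by simp
  then show ?thesis by (rule fil_sym)
qed

end

text \<open>The projected map may send \<open>St\<close> to a potential with terms of higher degree.
  Its linearisation is a graded isomorphism sending \<open>St\<close> exactly to the degree-2 part.
  There the reduced potentials are invisible since they start in degree 3, and
  \<open>CY_part\<close> extracts that degree from the given equivalence.\<close>

lemma triv_block:
  assumes b: "blk Q Qt Qr Q' Qt' Qr' H G"
    and S: "is_potential Qt F B St" "homg 2 St" "St' \<in> PQ Qt'" "homg 2 St'"
    and D: "H (St + Sr) - (St' + Sr') \<in> CY Q'" and r: "Sr \<in> PQ Q" "fil 3 Sr" "Sr' \<in> PQ Q'" "fil 3 Sr'"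
  shows "right_equiv F Fi B Qt St Qt' St'"
proof -
  note bQ = bQ[OF b] and bs = bs[OF b] and bA = bA[OF b] and bH = bH[OF b] and bG = bG[OF b] and bw = bw[OF b]
  note p' = proj_hom[OF bs(3) bQ(2)] and p = proj_hom[OF bs(1) bQ(1)]
  let ?HT = "\<lambda>x. proj Q' Qt' (H x)" and ?GT = "\<lambda>x. proj Q Qt (G x)"
  have HTQ: "is_hom Q Qt' ?HT" by (rule hom_comp[OF bH p'])
  have HT: "is_hom Qt Qt' ?HT" by (rule hom_restrict[OF HTQ bs(1) wq_finite[OF bQ(1)]])
  have GT: "is_hom Qt' Qt ?GT" by (rule hom_restrict[OF hom_comp[OF bG p] bs(3) wq_finite[OF bQ(2)]])
  \<comment> \<open>Cutting off everything beyond length 1 makes the resulting \<open>?E\<close>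
    homogeneous.\<close>
  define g where "g a = part (Suc 0) (?HT (ar Qt a))" for a
  have g: "g a \<in> Cor Qt' (tgt Qt a) (src Qt a)" if "a \<in> arrs Qt" for a
    unfolding g_def by (rule part_Cor[OF hom_Cor[OF HT wq_finite[OF bw(1)] wq_finite[OF bw(3)] ar_Cor[OF that]]])
  let ?E = "ev Qt Qt' g"
  have E: "is_hom Qt Qt' ?E" by (rule ev_hom[OF bw(1) wq_finite[OF bw(3)] g])
  have Ea: "?E (ar Qt a) = g a" if "a \<in> arrs Qt" for a by (rule ev_ar[OF bw(1) wq_finite[OF bw(3)] g that])
  have d: "fil 2 (?HT (ar Qt a) - ?E (ar Qt a))" if a: "a \<in> arrs Qt" for a
    unfolding Ea[OF a] g_def using fil_part[OF hom_ar_fil1[OF HT bw(1,3) a]] by (simp add: numeral_2_eq_2)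
  have cong: "fil (Suc n) (?HT x - ?E x)" if "x \<in> PQ Qt" "fil n x" for x n
    by (rule hom_cong2[OF HT E bw(1,3) d that])
  have bt: "fil 2 (?HT (?GT (ar Qt' a)) - ar Qt' a)" if a: "a \<in> arrs Qt'" for a
    using block_t[OF b a] ar_sub[OF bs(3) a] by simp
  have bt': "fil 2 (?GT (?HT (ar Qt a)) - ar Qt a)" if a: "a \<in> arrs Qt" for a
    using block_t[OF blk_swap[OF b] a] ar_sub[OF bs(1) a] by simp
  have "bij_betw ?E (PQ Qt) (PQ Qt')"
  proof (rule hom_bij[OF E GT bw(1,3)])
    fix a assume a: "a \<in> arrs Qt'"
    have u: "?GT (ar Qt' a) \<in> PQ Qt" "fil (Suc 0) (?GT (ar Qt' a))"
      using hom_PA[OF GT ar_PA[OF a]] hom_ar_fil1[OF GT bw(3,1) a] .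
    have "fil 2 (?E (?GT (ar Qt' a)) - ?HT (?GT (ar Qt' a)))"
      using fil_sym[OF cong[OF u]] by (simp add: numeral_2_eq_2)
    then show "fil 2 (?E (?GT (ar Qt' a)) - ar Qt' a)" using bt[OF a] by (rule fil_trans)
  next
    fix a assume a: "a \<in> arrs Qt"
    have u: "?HT (ar Qt a) \<in> PQ Qt'" "?E (ar Qt a) \<in> PQ Qt'" using hom_PA[OF HT ar_PA[OF a]] hom_PA[OF E ar_PA[OF a]] .
    have "fil 2 (?GT (?E (ar Qt a)) - ?GT (?HT (ar Qt a)))"
      by (rule hom_fil_diff[OF GT bw(3,1) u(2,1) fil_sym[OF d[OF a]]])
    then show "fil 2 (?GT (?E (ar Qt a)) - ar Qt a)" using bt'[OF a] by (rule fil_trans)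
  qed
  moreover have "?E St - St' \<in> CY Qt'"
  proof -
    have StP: "St \<in> PQ Qt" "St \<in> PQ Q" using potential_PA[OF S(1)] PA_sub[OF bs(1)] by auto
    have St'Q: "St' \<in> PQ Q'" by (rule PA_sub[OF bs(3) S(3)])
    have "proj Q' Qt' (H (St + Sr) - (St' + Sr')) \<in> CY Qt'" by (rule CY_proj[OF bs(3) bQ(2) D])
    moreover have "proj Q' Qt' (H (St + Sr) - (St' + Sr')) = (?HT St + ?HT Sr) - (St' + proj Q' Qt' Sr')"
      using hom_diff[OF p' hom_PA[OF bH PA_add[OF StP(2) r(1)]] PA_add[OF St'Q r(3)]] hom_add[OF HTQ StP(2) r(1)]
        hom_add[OF p' St'Q r(3)] proj_id[OF bs(3) bQ(2) S(3)] by simp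
    ultimately have "part 2 ((?HT St + ?HT Sr) - (St' + proj Q' Qt' Sr')) \<in> CY Qt'" using CY_part by fastforce
    moreover have "fil 3 (?HT Sr)" "fil 3 (proj Q' Qt' Sr')"
      using hom_fil[OF HTQ bQ(1) bw(3) r(1,2)] hom_fil[OF p' bQ(2) bw(3) r(3,4)] .
    then have "part 2 (?HT Sr) = 0" "part 2 (proj Q' Qt' Sr') = 0" using part_fil[of 2] by (simp_all add: numeral_3_eq_3 numeral_2_eq_2)
    ultimately have 1: "part 2 (?HT St) - St' \<in> CY Qt'" by (simp add: part_diff part_add part_homg[OF S(4)])
    have "homg (Suc 0) (?E (ar Qt a))" if "a \<in> arrs Qt" for a unfolding Ea[OF that] g_def by (rule homg_part)
    then have "homg 2 (?E St)" by (rule hom_homg[OF E wq_finite[OF bw(1)] _ StP(1) S(2)])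
    moreover have "part 2 (?HT St - ?E St) = 0" using cong[OF StP(1) homg_fil[OF S(2)]] by (rule part_fil)
    ultimately have "part 2 (?HT St) = ?E St" by (simp add: part_diff part_homg)
    then show ?thesis using 1 by simp
  qed
  ultimately show ?thesis unfolding right_equiv_iff using E by blast
qed

text \<open>Every term of a degree-2 potential contains both arrows of an opposite pair, and one of
  them is sent to 0.\<close>

lemma kill_potential:
  assumes K: "is_hom Q1 Q2 K" and Q: "wq Q1" "wq Q2" and S: "is_potential Q1 F B S" "homg 2 S"
    and k: "\<And>a b. a \<in> arrs Q1 \<Longrightarrow> b \<in> arrs Q1 \<Longrightarrow> tgt Q1 b = src Q1 a \<Longrightarrow> src Q1 b = tgt Q1 a \<Longrightarrow> K (ar Q1 a) = 0 \<or> K (ar Q1 b) = 0"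
  shows "K S = 0"
proof -
  note Qf = wq_finite[OF Q(1)] wq_finite[OF Q(2)]
  have SP: "S \<in> PQ Q1" by (rule potential_PA[OF S(1)])
  have t: "sc (S p) (delta p) \<in> PQ Q1 \<and> K (sc (S p) (delta p)) = 0" if p: "p \<in> paths_len Q1 B 2" for p
  proof (cases "S p = 0")
    case False
    have pv: "valid Q1 B p" "plen p = 2" using p unfolding paths_len_def by blast+
    obtain v c0 a1 c1 a2 c2 where pp: "p = (v,c0,[(a1,c1),(a2,c2)])" and w: "a1 \<in> arrs Q1" "a2 \<in> arrs Q1" "tgt Q1 a1 = v" "tgt Q1 a2 = src Q1 a1"
      "c0 \<in> B v" "c1 \<in> B (src Q1 a1)" "c2 \<in> B (src Q1 a2)" by (rule path2_cases[OF pv])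
    have "src Q1 a2 = tgt Q1 a1" using potential_cyclic[OF S(1) False] w by (simp add: pp endv_def)
    then have kk: "K (ar Q1 a1) = 0 \<or> K (ar Q1 a2) = 0" using k[OF w(1,2,4)] by simp
    have v1: "valid Q1 B (v,c0,[(a1,c1),(a2,c2)])" "valid Q1 B (src Q1 a1,c1,[(a2,c2)])" "valid Q1 B (src Q1 a2,c2,[])"
      using w by auto
    have P: "re v c0 \<in> PQ Q1" "re (src Q1 a1) c1 \<in> PQ Q1" "ar Q1 a1 \<in> PQ Q1" "ar Q1 a2 \<in> PQ Q1"
      "delta (src Q1 a1,c1,[(a2,c2)]) \<in> PQ Q1" "delta (src Q1 a2,c2,[]) \<in> PQ Q1"
      using w v1 delta_PA by auto
    note m = hom_mult[OF K] 
    have "K (delta (v,c0,[(a1,c1),(a2,c2)])) = K (re v c0) \<star>\<^bsub>Q2\<^esub> K (ar Q1 a1) \<star>\<^bsub>Q2\<^esub> K (delta (src Q1 a1,c1,[(a2,c2)]))"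
      unfolding delta_Cons[OF Qf(1) v1(1)] m[OF P(1) PA_mult[OF Qf(1) P(3,5)]] m[OF P(3,5)] ..
    moreover have "K (delta (src Q1 a1,c1,[(a2,c2)])) = K (re (src Q1 a1) c1) \<star>\<^bsub>Q2\<^esub> K (ar Q1 a2) \<star>\<^bsub>Q2\<^esub> K (delta (src Q1 a2,c2,[]))"
      unfolding delta_Cons[OF Qf(1) v1(2)] m[OF P(2) PA_mult[OF Qf(1) P(4,6)]] m[OF P(4,6)] ..
    ultimately have "K (delta p) = 0" using kk by (auto simp: pp)
    then show ?thesis using hom_sc[OF K Qf delta_PA[OF pv(1)] PA_F[OF SP, of p]] delta_PA[OF pv(1)] PA_F[OF SP, of p] by auto
  qed (simp add: hom_zero[OF K])
  have "K S = K (\<Sum>p\<in>paths_len Q1 B 2. sc (S p) (delta p))"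
    using deg2_expand[OF Qf(1) SP] S(2) unfolding homg_def by metis
  also have "\<dots> = (\<Sum>p\<in>paths_len Q1 B 2. K (sc (S p) (delta p)))" by (rule hom_sum[OF K]) (use t in blast)
  also have "\<dots> = 0" using t by (intro sum.neutral ballI) blast
  finally show ?thesis .
qed


text \<open>On each side one arrow of every opposite pair of trivial arrows (selected by an ordering of the vertices) is killed: this makes both trivial potentials vanish without having to follow how the trivial and the reduced part interact in higher degree.\<close>

lemma red_block:
  assumes b: "blk Q Qt Qr Q' Qt' Qr' H G"
    and S: "is_potential Qt F B St" "homg 2 St" "is_potential Qt' F B St'" "homg 2 St'"
    and r: "Sr \<in> PQ Qr" "Sr' \<in> PQ Qr'"
    and D: "H (St + Sr) - (St' + Sr') \<in> CY Q'"
  shows "right_equiv F Fi B Qr Sr Qr' Sr'"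
proof -
  note bQ = bQ[OF b] and bs = bs[OF b] and bA = bA[OF b] and bH = bH[OF b] and bG = bG[OF b] and bw = bw[OF b]
  note Qf = wq_finite[OF bQ(1)] wq_finite[OF bQ(2)]
  note pt' = proj_hom[OF bs(3) bQ(2)] and pt = proj_hom[OF bs(1) bQ(1)]
    and pr' = proj_hom[OF bs(4) bQ(2)] and pr = proj_hom[OF bs(2) bQ(1)]
  obtain f :: "'v \<Rightarrow> nat" where f: "inj f"
    using finite_imp_inj_to_nat_seg[OF finite_UNIV[where 'a = 'v]] by blast
  \<comment> \<open>Of two opposite arrows exactly one satisfies \<open>ng\<close>. On the source
    side the trivial arrows with \<open>ng\<close> are to be killed, on the target side those
    without it.\<close>
  define ng where "ng R a \<longleftrightarrow> f (src R a) < f (tgt R a)" for R :: "'v wquiver" and a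
  have ng2: "ng R a \<or> ng R c" if "wq R" "a \<in> arrs R" "tgt R c = src R a" "src R c = tgt R a" for R a c
  proof -
    have "f (tgt R a) \<noteq> f (src R a)" using wq_loopfree[OF that(1,2)] f by (auto dest: injD)
    then show ?thesis using that(3,4) by (auto simp: ng_def)
  qed
  \<comment> \<open>The linear part of the trivial component of \<open>G a'\<close>. For a trivial
    arrow \<open>a'\<close> it agrees with \<open>G a'\<close> modulo length 2, and being
    homogeneous it lets a linear identity later hold exactly.\<close>
  define lz where "lz a' = part (Suc 0) (proj Q Qt (G (ar Q' a')))" for a'
  have lz: "lz a' \<in> Cor Q (tgt Q' a') (src Q' a')" and lzG: "fil 2 (G (ar Q' a') - lz a')" if a': "a' \<in> arrs Qt'" for a'
  proof -
    have aQ: "a' \<in> arrs Q'" by (rule sub_arrs[OF bs(3) a'])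
    have g: "G (ar Q' a') \<in> Cor Q (tgt Q' a') (src Q' a')" by (rule hom_Cor[OF bG Qf(2,1) ar_Cor[OF aQ]])
    have g1: "fil (Suc 0) (G (ar Q' a'))" by (rule hom_ar_fil1[OF bG bQ(2,1) aQ])
    have p: "proj Q Qt (G (ar Q' a')) \<in> Cor Qt (tgt Q' a') (src Q' a')"
      by (rule hom_Cor[OF pt Qf(1) wq_finite[OF bw(1)] g])
    have p1: "fil (Suc 0) (proj Q Qt (G (ar Q' a')))" by (rule hom_fil[OF pt bQ(1) bw(1) Cor_PA[OF g] g1])
    show "lz a' \<in> Cor Q (tgt Q' a') (src Q' a')"
      unfolding lz_def by (rule part_Cor[OF hom_Cor[OF incl_hom[OF bs(1) Qf(1)] wq_finite[OF bw(1)] Qf(1) p]])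
    have "fil 2 (proj Q Qt (G (ar Q' a')) - lz a')"
      unfolding lz_def using fil_part[OF p1] by (simp add: numeral_2_eq_2)
    with L1[OF b a'] show "fil 2 (G (ar Q' a') - lz a')" by (rule fil_trans)
  qed
  \<comment> \<open>A change of arrows on the target side that replaces \<open>a'\<close> by
    \<open>H (lz a')\<close>, which differs from it only from length 2 on. Undoing this change turns
    these images of source elements into plain arrows, ready to be killed.\<close>
  define gX where "gX a' = (if a' \<in> arrs Qt' \<and> ng Q' a' then H (lz a') else ar Q' a')" for a'
  have gX: "gX a' \<in> Cor Q' (tgt Q' a') (src Q' a')" if "a' \<in> arrs Q'" for a'
    using hom_Cor[OF bH Qf lz] ar_Cor[OF that] by (simp add: gX_def)
  let ?X = "ev Q' Q' gX"
  have X: "is_hom Q' Q' ?X" by (rule ev_hom[OF bQ(2) Qf(2) gX])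
  have Xa: "?X (ar Q' a') = gX a'" if "a' \<in> arrs Q'" for a' by (rule ev_ar[OF bQ(2) Qf(2) gX that])
  have X2: "fil 2 (?X (ar Q' a') - ar Q' a')" if a': "a' \<in> arrs Q'" for a'
  proof (cases "a' \<in> arrs Qt' \<and> ng Q' a'")
    case True
    have "fil 2 (H (lz a') - H (G (ar Q' a')))"
      by (rule hom_fil_diff[OF bH bQ Cor_PA[OF lz] hom_PA[OF bG ar_PA[OF a']] fil_sym[OF lzG]]) (use True in auto)
    then show ?thesis using True HG[OF b ar_PA[OF a']] by (simp add: Xa[OF a'] gX_def)
  next
    case False
    then have "gX a' = ar Q' a'" unfolding gX_def by (rule if_not_P)
    then show ?thesis by (simp add: Xa[OF a'])
  qed
  have Xb: "bij_betw ?X (PQ Q') (PQ Q')" by (rule unitri_bij[OF X bQ(2) X2])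
  let ?I = "the_inv_into (PQ Q') ?X"
  have I: "is_hom Q' Q' ?I" by (rule hom_inv[OF X Qf(2) Xb])
  have IX: "?I (?X x) = x" if "x \<in> PQ Q'" for x
    using Xb that by (simp add: bij_betw_def the_inv_into_f_f)
  have XI: "?X (?I x) = x" if "x \<in> PQ Q'" for x
    using Xb that by (simp add: bij_betw_def f_the_inv_into_f)
  \<comment> \<open>It kills \<open>H (lz a')\<close> for trivial \<open>a'\<close> with
    \<open>ng\<close>, and the trivial arrows without \<open>ng\<close> themselves; the reduced
    arrows are fixed. Modulo length 2 it is the plain projection.\<close>
  let ?T = "\<lambda>x. proj Q' Qr' (?I x)"
  have T: "is_hom Q' Qr' ?T" by (rule hom_comp[OF I pr'])
  have Ta: "?T (ar Q' a') = proj Q' Qr' (ar Q' a')" if a': "a' \<in> arrs Q'" and n: "\<not> (a' \<in> arrs Qt' \<and> ng Q' a')" for a'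
  proof -
    have "?X (ar Q' a') = ar Q' a'" unfolding Xa[OF a'] gX_def by (rule if_not_P[OF n])
    then have "?I (ar Q' a') = ar Q' a'" using IX[OF ar_PA[OF a']] by simp
    then show ?thesis by simp
  qed
  have T2: "fil 2 (?T (ar Q' a') - proj Q' Qr' (ar Q' a'))" if a': "a' \<in> arrs Q'" for a'
  proof -
    have y: "?I (ar Q' a') \<in> PQ Q'" "fil (Suc 0) (?I (ar Q' a'))"
      using hom_PA[OF I ar_PA[OF a']] hom_ar_fil1[OF I bQ(2,2) a'] .
    have "fil (Suc (Suc 0)) (?X (?I (ar Q' a')) - ?I (ar Q' a'))"
      by (rule hom_cong2[OF X hom_id bQ(2,2) X2 y])
    then have "fil 2 (?I (ar Q' a') - ar Q' a')"
      unfolding XI[OF ar_PA[OF a']] using fil_sym by (simp add: numeral_2_eq_2)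
    then show ?thesis by (rule hom_fil_diff[OF pr' bQ(2) bw(4) y(1) ar_PA[OF a']])
  qed
  have Tc: "fil 2 (?T u - proj Q' Qr' u)" if "u \<in> PQ Q'" "fil (Suc 0) u" for u
    using hom_cong2[OF T pr' bQ(2) bw(4) T2 that] by (simp add: numeral_2_eq_2)
  have Ez: "is_hom Qt' Q (ev Qt' Q lz)" and Ea: "ev Qt' Q lz (ar Qt' a') = lz a'" if "a' \<in> arrs Qt'" for a'
  proof -
    have g: "lz a \<in> Cor Q (tgt Qt' a) (src Qt' a)" if a: "a \<in> arrs Qt'" for a
      using lz[OF a] sub_src[OF bs(3) a] sub_tgt[OF bs(3) a] by simp
    show "is_hom Qt' Q (ev Qt' Q lz)" by (rule ev_hom[OF bw(3) Qf(1) g])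
    show "ev Qt' Q lz (ar Qt' a') = lz a'" by (rule ev_ar[OF bw(3) Qf(1) g that])
  qed
  \<comment> \<open>For parallel arrows \<open>ng\<close> takes the same value, so the linear part
    \<open>lam\<close> of \<open>H z\<close> involves only target arrows with \<open>ng\<close>.
    Substituting \<open>lz\<close> for these arrows recovers \<open>z\<close>; hence
    \<open>H z\<close> is built from elements \<open>H (lz a')\<close> that \<open>?T\<close>
    kills.\<close>
  have Tz: "?T (H (ar Q z)) = 0" if z: "z \<in> arrs Qt" and nz: "ng Q z" for z
  proof -
    have zQ: "z \<in> arrs Q" by (rule sub_arrs[OF bs(1) z])
    define lam where "lam = part (Suc 0) (proj Q' Qt' (H (ar Q z)))"
    have h: "H (ar Q z) \<in> Cor Q' (tgt Q z) (src Q z)" by (rule hom_Cor[OF bH Qf ar_Cor[OF zQ]])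
    have p: "proj Q' Qt' (H (ar Q z)) \<in> Cor Qt' (tgt Q z) (src Q z)" by (rule hom_Cor[OF pt' Qf(2) wq_finite[OF bw(3)] h])
    have p1: "fil (Suc 0) (proj Q' Qt' (H (ar Q z)))"
      by (rule hom_fil[OF pt' bQ(2) bw(3) Cor_PA[OF h] hom_ar_fil1[OF bH bQ zQ]])
    have l: "lam \<in> Cor Qt' (tgt Q z) (src Q z)" unfolding lam_def by (rule part_Cor[OF p])
    have lP: "lam \<in> PQ Qt'" "lam \<in> PQ Q'" using Cor_PA[OF l] PA_sub[OF bs(3)] by auto
    have lh: "homg (Suc 0) lam" unfolding lam_def by (rule homg_part)
    have l1: "fil (Suc 0) lam" by (rule homg_fil[OF lh])
    have "fil 2 (proj Q' Qt' (H (ar Q z)) - lam)"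
      unfolding lam_def using fil_part[OF p1] by (simp add: numeral_2_eq_2)
    with L2[OF b z] have l2: "fil 2 (H (ar Q z) - lam)" by (rule fil_trans)
    show ?thesis
    \<comment> \<open>The facts \<open>Ez\<close> and \<open>Ea\<close> are stated relative to an
      arrow of \<open>Qt'\<close>. If there is none, \<open>H z\<close> has order 2, hence so has
      \<open>z\<close>, which must be 0.\<close>
    proof (cases "arrs Qt' = {}")
      case True
      have "proj Q' Qt' (H (ar Q z)) = 0"
      proof
        fix q :: "('v,'e) bpath"
        obtain v c L where q: "q = (v,c,L)" by (cases q)
        show "proj Q' Qt' (H (ar Q z)) q = 0 q"
        proof (cases L)
          case Nil
          then show ?thesis using filD[OF p1, of q] by (simp add: q pw)
        next
          case (Cons ab L')
          then show ?thesis using PA_out[OF Cor_PA[OF p], of q] True by (cases ab) (simp add: q pw)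
        qed
      qed
      then have "fil 2 (H (ar Q z))" using L2[OF b z] by simp
      then have "fil 2 (G (H (ar Q z)))" by (rule hom_fil[OF bG bQ(2,1) Cor_PA[OF h]])
      then have "fil 2 (ar Q z)" using GH[OF b ar_PA[OF zQ]] by simp
      then have "ar Q z = 0" using homg_fil_zero[OF homg_ar] by (simp only: numeral_2_eq_2)
      then show ?thesis using hom_zero[OF hom_comp[OF bH T]] by simp
    next
      case False
      then obtain e where e: "e \<in> arrs Qt'" by blast
      note E = Ez[OF e]
      let ?E = "ev Qt' Q lz"
      have GR: "is_hom Qt' Q G" by (rule hom_restrict[OF bG bs(3) Qf(2)])
      have "fil 2 (?E (ar Qt' a) - G (ar Qt' a))" if a: "a \<in> arrs Qt'" for a
        unfolding Ea[OF a] unfolding ar_sub[OF bs(3) a] by (rule fil_sym[OF lzG[OF a]])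
      from hom_cong2[OF E GR bw(3) bQ(1) this lP(1) l1]
      have "fil 2 (?E lam - G lam)" by (simp add: numeral_2_eq_2)
      moreover have "fil 2 (G lam - G (H (ar Q z)))"
        by (rule hom_fil_diff[OF bG bQ(2,1) lP(2) Cor_PA[OF h] fil_sym[OF l2]])
      ultimately have e2: "fil 2 (?E lam - ar Q z)"
        unfolding GH[OF b ar_PA[OF zQ]] by (rule fil_trans)
      have "homg (Suc 0) (?E (ar Qt' a))" if "a \<in> arrs Qt'" for a
        unfolding Ea[OF that] lz_def by (rule homg_part)
      then have "homg (Suc 0) (?E lam)" by (rule hom_homg[OF E wq_finite[OF bw(3)] _ lP(1) lh])
      then have "homg (Suc 0) (?E lam - ar Q z)" by (rule homg_diff[OF _ homg_ar])
      \<comment> \<open>Both sides are homogeneous of degree 1, so agreement modulo length 2 is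
        equality.\<close>
      from homg_fil_zero[OF this e2[unfolded numeral_2_eq_2]]
      have Elam: "?E lam = ar Q z" by (simp only: right_minus_eq)
      let ?K = "\<lambda>x. ?T (H (?E x))"
      have K: "is_hom Qt' Qr' ?K" by (rule hom_comp[OF E hom_comp[OF bH T]])
      have k0: "?K (ar Qt' a) = 0" if a: "a \<in> arrs Qt'" and na: "ng Q' a" for a
      proof -
        have aQ: "a \<in> arrs Q'" by (rule sub_arrs[OF bs(3) a])
        have "H (lz a) = ?X (ar Q' a)" unfolding Xa[OF aQ] gX_def using a na by simp
        then have "?K (ar Qt' a) = proj Q' Qr' (ar Q' a)" unfolding Ea[OF a] using IX[OF ar_PA[OF aQ]] by simp
        moreover have "a \<notin> arrs Qr'" using a bA(4) by blast
        ultimately show ?thesis using proj_ar[OF bs(4) bQ(2) aQ] by simp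
      qed
      have t0: "re (tgt Qt' a) c \<star>\<^bsub>Qr'\<^esub> ?K (ar Qt' a) \<star>\<^bsub>Qr'\<^esub> ?K (sh Qt' a c lam) = 0" if a: "a \<in> arrs Qt'" for a c
      proof (cases "ng Q' a")
        case True
        then show ?thesis using k0[OF a] by simp
      next
        case False
        have "sh Qt' a c lam = 0"
        proof
          fix q :: "('v,'e) bpath"
          obtain u e L where q: "q = (u,e,L)" by (cases q)
          have "lam (tgt Qt' a,c,(a,e)#L) = 0"
          proof (rule ccontr)
            assume n: "lam (tgt Qt' a,c,(a,e)#L) \<noteq> 0"
            then have "L = []" using homgD[OF lh, of "(tgt Qt' a,c,(a,e)#L)"] by auto
            then have "tgt Qt' a = tgt Q z" "src Qt' a = src Q z" using Cor_supp[OF l n] by (auto simp: endv_def)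
            then have "ng Q' a" using nz sub_src[OF bs(3) a] sub_tgt[OF bs(3) a] by (simp add: ng_def)
            then show False using False by simp
          qed
          then show "sh Qt' a c lam q = 0 q" by (simp add: q sh_apply pw)
        qed
        then show ?thesis using hom_zero[OF K] by simp
      qed
      have "?K lam = rp lam + (\<Sum>a\<in>arrs Qt'. \<Sum>c\<in>B (tgt Qt' a). re (tgt Qt' a) c \<star>\<^bsub>Qr'\<^esub> ?K (ar Qt' a) \<star>\<^bsub>Qr'\<^esub> ?K (sh Qt' a c lam))"
        by (rule hom_decomp[OF K wq_finite[OF bw(3)] lP(1)])
      also have "(\<Sum>a\<in>arrs Qt'. \<Sum>c\<in>B (tgt Qt' a). re (tgt Qt' a) c \<star>\<^bsub>Qr'\<^esub> ?K (ar Qt' a) \<star>\<^bsub>Qr'\<^esub> ?K (sh Qt' a c lam)) = 0"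
        by (intro sum.neutral ballI t0)
      finally show ?thesis using rp_fil[OF l1] Elam by simp
    qed
  qed
  let ?O = "\<lambda>x. ?T (H x)" and ?L = "\<lambda>x. proj Q Qr (G x)"
  have OQ: "is_hom Q Qr' ?O" by (rule hom_comp[OF bH T])
  have Oh: "is_hom Qr Qr' ?O" by (rule hom_restrict[OF OQ bs(2) Qf(1)])
  have Lh: "is_hom Qr' Qr ?L" by (rule hom_restrict[OF hom_comp[OF bG pr] bs(4) Qf(2)])
  have "bij_betw ?O (PQ Qr) (PQ Qr')"
  proof (rule hom_bij[OF Oh Lh bw(2,4)])
    fix a assume a: "a \<in> arrs Qr'"
    have l: "?L (ar Qr' a) \<in> PQ Q" "fil (Suc 0) (?L (ar Qr' a))"
      using PA_sub[OF bs(2) hom_PA[OF Lh ar_PA[OF a]]] hom_ar_fil1[OF Lh bw(4,2) a] .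
    have "fil 2 (?O (?L (ar Qr' a)) - proj Q' Qr' (H (?L (ar Qr' a))))"
      by (rule Tc[OF hom_PA[OF bH l(1)] hom_fil[OF bH bQ l]])
    moreover have "fil 2 (proj Q' Qr' (H (?L (ar Qr' a))) - ar Qr' a)"
      using block_r[OF b a] ar_sub[OF bs(4) a] by simp
    ultimately show "fil 2 (?O (?L (ar Qr' a)) - ar Qr' a)" by (rule fil_trans)
  next
    fix a assume a: "a \<in> arrs Qr"
    have aQ: "a \<in> arrs Q" by (rule sub_arrs[OF bs(2) a])
    let ?u = "H (ar Qr a)"
    have u: "?u \<in> PQ Q'" "fil (Suc 0) ?u"
      using hom_PA[OF bH ar_PA[OF aQ]] hom_ar_fil1[OF bH bQ aQ] ar_sub[OF bs(2) a] by simp_all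
    have "fil 2 (?L (?O (ar Qr a)) - ?L (proj Q' Qr' ?u))"
      by (rule hom_fil_diff[OF Lh bw(4,2) hom_PA[OF T u(1)] hom_PA[OF pr' u(1)] Tc[OF u]])
    moreover have "fil 2 (?L (proj Q' Qr' ?u) - ar Qr a)"
      using block_r[OF blk_swap[OF b] a] ar_sub[OF bs(2) a] by simp
    ultimately show "fil 2 (?L (?O (ar Qr a)) - ar Qr a)" by (rule fil_trans)
  qed
  moreover have "?O Sr - Sr' \<in> CY Qr'"
  proof -
    have P: "St \<in> PQ Q" "Sr \<in> PQ Q" "St' \<in> PQ Q'" "Sr' \<in> PQ Q'"
      using PA_sub[OF bs(1) potential_PA[OF S(1)]] PA_sub[OF bs(2) r(1)] PA_sub[OF bs(3) potential_PA[OF S(3)]] PA_sub[OF bs(4) r(2)] .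
    have "?T (H (St + Sr) - (St' + Sr')) \<in> CY Qr'" using CY_hom[OF T bQ(2) bw(4) D] by (rule conjunct2)
    moreover have "?T (H (St + Sr) - (St' + Sr')) = (?O St + ?O Sr) - (?T St' + ?T Sr')"
      unfolding hom_diff[OF T hom_PA[OF bH PA_add[OF P(1,2)]] PA_add[OF P(3,4)]] hom_add[OF OQ P(1,2)] hom_add[OF T P(3,4)] ..
    moreover have "?O St = 0"
    proof (rule kill_potential[OF hom_restrict[OF OQ bs(1) Qf(1)] bw(1,4) S(1,2)])
      fix a c assume a: "a \<in> arrs Qt" "c \<in> arrs Qt" "tgt Qt c = src Qt a" "src Qt c = tgt Qt a"
      then have "ng Q a \<or> ng Q c"
        using ng2[OF bw(1) a(1,3,4)] sub_src[OF bs(1)] sub_tgt[OF bs(1)] by (simp add: ng_def)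
      then show "?O (ar Qt a) = 0 \<or> ?O (ar Qt c) = 0"
        using Tz[OF a(1)] Tz[OF a(2)] ar_sub[OF bs(1) a(1)] ar_sub[OF bs(1) a(2)] by auto
    qed
    moreover have "?T St' = 0"
    proof (rule kill_potential[OF hom_restrict[OF T bs(3) Qf(2)] bw(3,4) S(3,4)])
      have tp: "?T (ar Qt' a) = 0" if a: "a \<in> arrs Qt'" and n: "\<not> ng Q' a" for a
      proof -
        have aQ: "a \<in> arrs Q'" by (rule sub_arrs[OF bs(3) a])
        have "a \<notin> arrs Qr'" using a bA(4) by blast
        then have "proj Q' Qr' (ar Q' a) = 0" using proj_ar[OF bs(4) bQ(2) aQ] by simp
        then show ?thesis using Ta[OF aQ] n ar_sub[OF bs(3) a] by simp
      qed
      fix a c assume a: "a \<in> arrs Qt'" "c \<in> arrs Qt'" "tgt Qt' c = src Qt' a" "src Qt' c = tgt Qt' a"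
      have "\<not> ng Q' a \<or> \<not> ng Q' c"
        using a sub_src[OF bs(3)] sub_tgt[OF bs(3)] by (auto simp: ng_def)
      then show "?T (ar Qt' a) = 0 \<or> ?T (ar Qt' c) = 0" using tp[OF a(1)] tp[OF a(2)] by blast
    qed
    moreover have "?T Sr' = Sr'"
    proof (rule hom_ext[OF hom_restrict[OF T bs(4) Qf(2)] hom_id bw(4,4) _ r(2)])
      fix a assume a: "a \<in> arrs Qr'"
      have aQ: "a \<in> arrs Q'" by (rule sub_arrs[OF bs(4) a])
      have "a \<notin> arrs Qt'" using a bA(4) by blast
      then show "?T (ar Qr' a) = ar Qr' a"
        using Ta[OF aQ] proj_ar[OF bs(4) bQ(2) aQ] a ar_sub[OF bs(4) a] by simp
    qed
    ultimately show ?thesis by simp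
  qed
  ultimately show ?thesis unfolding right_equiv_iff using Oh by blast
qed

section \<open>Assembling uniqueness\<close>

lemma SP_potential: "is_SP Q F Fi B S \<Longrightarrow> wq Q \<and> is_potential Q F B S"
  unfolding is_SP_def by blast

lemma reduced_fil3:
  assumes Q: "wq Q" and S: "is_potential Q F B S" and r: "is_reduced S" shows "fil 3 S"
proof (rule filI)
  fix p :: "('v,'e) bpath" assume "plen p < 3"
  then have "plen p < 2 \<or> plen p = 2" by linarith
  then show "S p = 0"
    using filD[OF potential_fil2[OF Q S], of p] r unfolding is_reduced_def by blast
qed

lemma uniqueness:
  assumes d: "arrs Qt \<inter> arrs Qr = {}" "arrs Qt' \<inter> arrs Qr' = {}"
    and t: "is_SP Qt F Fi B St" "is_trivial Qt F B St" "is_SP Qt' F Fi B St'" "is_trivial Qt' F B St'"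
    and r: "is_SP Qr F Fi B Sr" "is_reduced Sr" "is_SP Qr' F Fi B Sr'" "is_reduced Sr'"
    and e: "right_equiv F Fi B (dsumQ Qt Qr) (St + Sr) (dsumQ Qt' Qr') (St' + Sr')"
  shows "right_equiv F Fi B Qt St Qt' St' \<and> right_equiv F Fi B Qr Sr Qr' Sr'"
proof -
  let ?Q = "dsumQ Qt Qr" and ?Q' = "dsumQ Qt' Qr'"
  note w = conjunct1[OF SP_potential[OF t(1)]] conjunct1[OF SP_potential[OF t(3)]] conjunct1[OF SP_potential[OF r(1)]] conjunct1[OF SP_potential[OF r(3)]]
  note S = conjunct2[OF SP_potential[OF t(1)]] conjunct2[OF SP_potential[OF t(3)]] conjunct2[OF SP_potential[OF r(1)]] conjunct2[OF SP_potential[OF r(3)]]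
  have wQ: "wq ?Q" "wq ?Q'" using wq_dsum w by auto
  note Qf = wq_finite[OF wQ(1)] wq_finite[OF wQ(2)]
  have s: "sub Qt ?Q" "sub Qr ?Q" "sub Qt' ?Q'" "sub Qr' ?Q'"
    using sub_dsum1 sub_dsum2 d by auto
  have h: "homg 2 St" "homg 2 St'" using t unfolding is_trivial_def homg_def by blast+
  have f3: "fil 3 Sr" "fil 3 Sr'" using reduced_fil3[OF w(3) S(3) r(2)] reduced_fil3[OF w(4) S(4) r(4)] .
  have P: "St \<in> PQ ?Q" "Sr \<in> PQ ?Q" "St' \<in> PQ ?Q'" "Sr' \<in> PQ ?Q'"
    using PA_sub[OF s(1) potential_PA[OF S(1)]] PA_sub[OF s(2) potential_PA[OF S(3)]]
      PA_sub[OF s(3) potential_PA[OF S(2)]] PA_sub[OF s(4) potential_PA[OF S(4)]] .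
  obtain H where H: "is_hom ?Q ?Q' H" and bij: "bij_betw H (PQ ?Q) (PQ ?Q')" and D: "H (St + Sr) - (St' + Sr') \<in> CY ?Q'"
    using e unfolding right_equiv_iff by blast
  let ?G = "the_inv_into (PQ ?Q) H"
  have G: "is_hom ?Q' ?Q ?G" by (rule hom_inv[OF H Qf(1) bij])
  have GH: "?G (H x) = x" if "x \<in> PQ ?Q" for x using bij that by (simp add: bij_betw_def the_inv_into_f_f)
  have HG: "H (?G x) = x" if "x \<in> PQ ?Q'" for x using bij that by (simp add: bij_betw_def f_the_inv_into_f)
  have D': "?G (St' + Sr') - (St + Sr) \<in> CY ?Q"
  proof -
    have "?G (H (St + Sr) - (St' + Sr')) \<in> CY ?Q" using CY_hom[OF G wQ(2,1) D] by (rule conjunct2)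
    then have "(St + Sr) - ?G (St' + Sr') \<in> CY ?Q"
      unfolding hom_diff[OF G hom_PA[OF H PA_add[OF P(1,2)]] PA_add[OF P(3,4)]] GH[OF PA_add[OF P(1,2)]] .
    from CY_uminus[OF this] show ?thesis by simp
  qed
  have L1: "fil 2 (?G (ar ?Q' y) - proj ?Q Qt (?G (ar ?Q' y)))" if y: "y \<in> arrs Qt'" for y
  proof (rule sub_part[OF s(1) wQ(1)])
    have yQ: "y \<in> arrs ?Q'" by (rule sub_arrs[OF s(3) y])
    show "?G (ar ?Q' y) \<in> PQ ?Q" "fil (Suc 0) (?G (ar ?Q' y))" using hom_PA[OF G ar_PA[OF yQ]] hom_ar_fil1[OF G wQ(2,1) yQ] .
    fix a assume a: "a \<in> arrs ?Q" "a \<notin> arrs Qt"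
    show "h1 ?Q (?G (ar ?Q' y)) a = 0"
      by (rule lin_triv[OF wQ s(1,3) S(1,2) t(4) H G GH D P(2) f3 y a])
  qed
  have L2: "fil 2 (H (ar ?Q y) - proj ?Q' Qt' (H (ar ?Q y)))" if y: "y \<in> arrs Qt" for y
  proof (rule sub_part[OF s(3) wQ(2)])
    have yQ: "y \<in> arrs ?Q" by (rule sub_arrs[OF s(1) y])
    show "H (ar ?Q y) \<in> PQ ?Q'" "fil (Suc 0) (H (ar ?Q y))" using hom_PA[OF H ar_PA[OF yQ]] hom_ar_fil1[OF H wQ yQ] .
    fix a assume a: "a \<in> arrs ?Q'" "a \<notin> arrs Qt'"
    show "h1 ?Q' (H (ar ?Q y)) a = 0"
      by (rule lin_triv[OF wQ(2,1) s(3,1) S(2,1) t(2) G H HG D' P(4) f3(2,1) y a])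
  qed
  have b: "blk ?Q Qt Qr ?Q' Qt' Qr' H ?G"
    unfolding blk_def using wQ s d H G GH HG L1 L2 by (simp add: dsumQ_def)
  show ?thesis
    using triv_block[OF b S(1) h(1) potential_PA[OF S(2)] h(2) D P(2) f3(1) P(4) f3(2)]
      red_block[OF b S(1) h(1) S(2) h(2) potential_PA[OF S(3)] potential_PA[OF S(4)] D] by blast
qed


section \<open>Rotation and normal forms of potentials\<close>

lemma homg1_eqI:
  assumes Q: "wq Q" and x: "x \<in> PQ Q" "homg (Suc 0) x" and y: "y \<in> PQ Q" "homg (Suc 0) y"
    and e: "\<And>a. a \<in> arrs Q \<Longrightarrow> h1 Q x a = h1 Q y a"
  shows "x = y"
proof -
  have h: "homg (Suc 0) (x - y)" by (rule homg_diff[OF x(2) y(2)])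
  have "fil 2 (x - y)"
    by (rule fil2I[OF Q PA_diff[OF x(1) y(1)] homg_fil[OF h]]) (simp only: h1_diff e right_minus_eq)
  from homg_fil_zero[OF h this[unfolded numeral_2_eq_2]] show ?thesis by (simp only: right_minus_eq)
qed

lemma homg_delta: "homg (plen p) (delta p)"
  by (rule homgI) (auto simp: delta_apply)

lemma homg_0 [simp]: "homg n 0"
  by (rule homgI) (simp add: pw)

lemma delta_append:
  assumes Q: "finite (arrs Q)" and "valid Q B (v,c,L1 @ (a,c') # L2)"
  shows "valid Q B (v,c,L1) \<and> endv Q (v,c,L1) = tgt Q a \<and> a \<in> arrs Q \<and> valid Q B (src Q a,c',L2)
    \<and> endv Q (v,c,L1 @ (a,c') # L2) = endv Q (src Q a,c',L2)
    \<and> delta (v,c,L1 @ (a,c') # L2) = delta (v,c,L1) \<star>\<^bsub>Q\<^esub> ar Q a \<star>\<^bsub>Q\<^esub> delta (src Q a,c',L2)"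
  using assms(2)
proof (induction L1 arbitrary: v c)
  case Nil
  then show ?case using delta_Cons[OF Q, of v c a c' L2] by (simp add: endv_Cons delta_Nil)
next
  case (Cons x L1)
  obtain a1 c1 where x: "x = (a1,c1)" by (cases x)
  have v: "valid Q B (v,c,(a1,c1) # L1 @ (a,c') # L2)" using Cons.prems x by simp
  then have "valid Q B (src Q a1,c1,L1 @ (a,c') # L2)" and a1: "a1 \<in> arrs Q" and c: "c \<in> B v" and t: "tgt Q a1 = v" by auto
  note IH = Cons.IH[OF this(1)]
  then have v1: "valid Q B (v,c,(a1,c1) # L1)" using a1 c t by simp
  let ?D = "delta (src Q a1,c1,L1)" and ?E = "ar Q a \<star>\<^bsub>Q\<^esub> delta (src Q a,c',L2)"
  have D: "?D \<in> PQ Q" "?E \<in> PQ Q" "ar Q a1 \<star>\<^bsub>Q\<^esub> ?D \<in> PQ Q" using IH Q a1 by auto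
  have "delta (v,c,(a1,c1) # L1 @ (a,c') # L2) = re v c \<star>\<^bsub>Q\<^esub> ar Q a1 \<star>\<^bsub>Q\<^esub> ?D \<star>\<^bsub>Q\<^esub> ?E"
    using delta_Cons[OF Q v] IH by simp
  also have "\<dots> = (re v c \<star>\<^bsub>Q\<^esub> ar Q a1 \<star>\<^bsub>Q\<^esub> ?D) \<star>\<^bsub>Q\<^esub> ?E"
    using mult_assoc[OF Q D(1,2), of "ar Q a1"] mult_assoc[OF Q D(3,2), of "re v c"] by simp
  also have "re v c \<star>\<^bsub>Q\<^esub> ar Q a1 \<star>\<^bsub>Q\<^esub> ?D = delta (v,c,(a1,c1) # L1)" using delta_Cons[OF Q v1] by simp
  finally show ?case using IH v1 x by (simp add: endv_Cons)
qed

text \<open>The value is an algebra element instead of a path: rotation multiplies the last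
  coefficient by the old leading one, and a product of two basis elements is in general a
  combination of basis elements.\<close>

definition rotp :: "'v wquiver \<Rightarrow> nat set \<Rightarrow> nat \<Rightarrow> ('v,'e) bpath \<Rightarrow> ('v,'e) pelt" where
  "rotp Q N a = (\<lambda>(v,c,L). if valid Q B (v,c,L) \<and> endv Q (v,c,L) = v then
     (case dropWhile (\<lambda>x. fst x \<notin> N) L of [] \<Rightarrow> 0
      | x # L2 \<Rightarrow> if fst x = a then delta (src Q a,snd x,L2) \<star>\<^bsub>Q\<^esub> delta (v,c,takeWhile (\<lambda>x. fst x \<notin> N) L) else 0) else 0)"

definition fr :: "nat set \<Rightarrow> ('v,'e) pelt \<Rightarrow> ('v,'e) pelt" where
  "fr N U = (\<lambda>p. if \<forall>x\<in>set (snd (snd p)). fst x \<notin> N then U p else 0)"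

text \<open>On a cyclic path, rotate the first letter in $N$ to the front and delete it if it is $a$.\<close>

definition Rt :: "'v wquiver \<Rightarrow> nat set \<Rightarrow> nat \<Rightarrow> ('v,'e) pelt \<Rightarrow> ('v,'e) pelt" where
  "Rt Q N a U = (\<lambda>r. \<Sum>p\<in>paths_len Q B (Suc (plen r)). U p * rotp Q N a p r)"

lemma rotp_first:
  assumes "valid Q B (v,c,L1 @ (a,c') # L2)" "endv Q (v,c,L1 @ (a,c') # L2) = v" "\<forall>x\<in>set L1. fst x \<notin> N" "a \<in> N"
  shows "rotp Q N a' (v,c,L1 @ (a,c') # L2) = (if a' = a then delta (src Q a,c',L2) \<star>\<^bsub>Q\<^esub> delta (v,c,L1) else 0)"
proof -
  have "dropWhile (\<lambda>x. fst x \<notin> N) (L1 @ (a,c') # L2) = (a,c') # L2"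
    "takeWhile (\<lambda>x. fst x \<notin> N) (L1 @ (a,c') # L2) = L1"
    using assms(3,4) by (auto simp: dropWhile_append2 takeWhile_append2)
  then show ?thesis using assms(1,2) by (simp add: rotp_def)
qed

lemma rotp_free:
  assumes "\<forall>x\<in>set L. fst x \<notin> N" shows "rotp Q N a (v,c,L) = 0"
proof -
  have "dropWhile (\<lambda>x. fst x \<notin> N) L = []" using assms by simp
  then show ?thesis unfolding rotp_def prod.case by (simp only: list.case if_cancel)
qed

lemma split_first:
  assumes "\<not> (\<forall>x\<in>set L. fst x \<notin> N)"
  obtains L1 a c' L2 where "L = L1 @ (a,c') # L2" "a \<in> N" "\<forall>x\<in>set L1. fst x \<notin> N"
proof -
  have "\<exists>x\<in>set L. fst x \<in> N" using assms by blast
  from split_list_first_prop[OF this] obtain ys x zs where "L = ys @ x # zs" "fst x \<in> N" "\<forall>y\<in>set ys. fst y \<notin> N"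
    by blast
  then show thesis using that by (cases x) simp
qed

lemma rotp_props:
  assumes Q: "finite (arrs Q)"
  shows "rotp Q N a p \<in> Cor Q (src Q a) (tgt Q a) \<and> (rotp Q N a p r \<noteq> 0 \<longrightarrow> plen p = Suc (plen r))"
proof -
  obtain v c L where p: "p = (v,c,L)" by (cases p)
  show ?thesis
  proof (cases "valid Q B p \<and> endv Q p = v \<and> \<not> (\<forall>x\<in>set L. fst x \<notin> N)")
    case False
    have "rotp Q N a p = 0"
    proof (cases "\<forall>x\<in>set L. fst x \<notin> N")
      case True
      then show ?thesis unfolding p by (rule rotp_free)
    next
      case nf: False
      then have "\<not> (valid Q B (v,c,L) \<and> endv Q (v,c,L) = v)" using False unfolding p by blast
      then show ?thesis unfolding p rotp_def prod.case by (rule if_not_P)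
    qed
    then show ?thesis by (simp add: pw)
  next
    case True
    then obtain L1 a' c' L2 where L: "L = L1 @ (a',c') # L2" "a' \<in> N" "\<forall>x\<in>set L1. fst x \<notin> N"
      using split_first by blast
    have v: "valid Q B (v,c,L1 @ (a',c') # L2)" "endv Q (v,c,L1 @ (a',c') # L2) = v" using True p L by auto
    note e = rotp_first[OF v L(3,2), of a]
    show ?thesis
    proof (cases "a = a'")
      case False
      then show ?thesis using e by (simp add: p L pw)
    next
      case True
      note d = delta_append[OF Q v(1)]
      have D1: "delta (v,c,L1) \<in> Cor Q v (tgt Q a')" using delta_Cor[of Q "(v,c,L1)"] d by simp
      have D2: "delta (src Q a',c',L2) \<in> Cor Q (src Q a') v" using delta_Cor[of Q "(src Q a',c',L2)"] d v(2) by simp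
      have hg: "homg (length L2 + length L1) (delta (src Q a',c',L2) \<star>\<^bsub>Q\<^esub> delta (v,c,L1))"
        using homg_mult[OF homg_delta[of "(src Q a',c',L2)"] homg_delta[of "(v,c,L1)"]] by simp
      have "plen p = Suc (plen r)" if "(delta (src Q a',c',L2) \<star>\<^bsub>Q\<^esub> delta (v,c,L1)) r \<noteq> 0"
      proof (rule ccontr)
        assume "plen p \<noteq> Suc (plen r)"
        then have "plen r \<noteq> length L2 + length L1" by (simp add: p L)
        from homgD[OF hg this] that show False by contradiction
      qed
      then show ?thesis using e Cor_mult[OF Q D2 D1] True by (simp add: p L)
    qed
  qed
qed

text \<open>Cut the path before its first letter \<open>a\<close> in \<open>N\<close>. The original
  is \<open>D1\<close> times \<open>a D2\<close>, the rotated word is \<open>a D2\<close> times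
  \<open>D1\<close>, and the difference is a commutator of opposite corners.\<close>

lemma delta_rot:
  assumes Q: "wq Q" and p: "valid Q B p" "endv Q p = fst p" and N: "N \<subseteq> arrs Q"
  shows "delta p - (fr N (delta p) + (\<Sum>a\<in>N. ar Q a \<star>\<^bsub>Q\<^esub> rotp Q N a p)) \<in> CY Q"
proof -
  obtain v c L where pe: "p = (v,c,L)" by (cases p)
  note Qf = wq_finite[OF Q]
  have Nf: "finite N" using N Qf by (rule finite_subset)
  show ?thesis
  proof (cases "\<forall>x\<in>set L. fst x \<notin> N")
    case True
    have "fr N (delta p) = delta p" using True by (auto simp: fr_def pe delta_apply)
    moreover have "(\<Sum>a\<in>N. ar Q a \<star>\<^bsub>Q\<^esub> rotp Q N a p) = 0"
      unfolding pe rotp_free[OF True] by (simp only: mult_zero_right sum.neutral_const)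
    ultimately show ?thesis by simp
  next
    case False
    then obtain L1 a c' L2 where L: "L = L1 @ (a,c') # L2" "a \<in> N" "\<forall>x\<in>set L1. fst x \<notin> N"
      using split_first by blast
    have v: "valid Q B (v,c,L1 @ (a,c') # L2)" "endv Q (v,c,L1 @ (a,c') # L2) = v" using p pe L by auto
    note d = delta_append[OF Qf v(1)]
    let ?D1 = "delta (v,c,L1)" and ?D2 = "delta (src Q a,c',L2)"
    have D1: "?D1 \<in> Cor Q v (tgt Q a)" using delta_Cor[of Q "(v,c,L1)"] d by simp
    have D2: "?D2 \<in> Cor Q (src Q a) v" using delta_Cor[of Q "(src Q a,c',L2)"] d v(2) by simp
    have aA: "a \<in> arrs Q" using d by simp
    have f0: "fr N (delta p) = 0" using False by (intro ext) (auto simp: fr_def pe delta_apply pw)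
    have "(\<Sum>a'\<in>N. ar Q a' \<star>\<^bsub>Q\<^esub> rotp Q N a' p) = (\<Sum>a'\<in>N. if a' = a then ar Q a \<star>\<^bsub>Q\<^esub> ?D2 \<star>\<^bsub>Q\<^esub> ?D1 else 0)"
      unfolding pe L(1) rotp_first[OF v L(3,2)] by (rule sum.cong) (simp_all only: if_True if_False mult_zero_right refl split: if_split, blast)
    also have "\<dots> = ar Q a \<star>\<^bsub>Q\<^esub> ?D2 \<star>\<^bsub>Q\<^esub> ?D1" using Nf L(2) by (simp only: sum.delta if_True)
    also have "\<dots> = (ar Q a \<star>\<^bsub>Q\<^esub> ?D2) \<star>\<^bsub>Q\<^esub> ?D1" by (rule mult_assoc[OF Qf Cor_PA[OF D2] Cor_PA[OF D1], symmetric])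
    finally have s: "(\<Sum>a'\<in>N. ar Q a' \<star>\<^bsub>Q\<^esub> rotp Q N a' p) = (ar Q a \<star>\<^bsub>Q\<^esub> ?D2) \<star>\<^bsub>Q\<^esub> ?D1" .
    have x: "ar Q a \<star>\<^bsub>Q\<^esub> ?D2 \<in> Cor Q (tgt Q a) v" by (rule Cor_mult[OF Qf ar_Cor[OF aA] D2])
    have dp: "delta p = ?D1 \<star>\<^bsub>Q\<^esub> ar Q a \<star>\<^bsub>Q\<^esub> ?D2" using d by (simp add: pe L)
    have "- cmt Q (ar Q a \<star>\<^bsub>Q\<^esub> ?D2) ?D1 \<in> CY Q"
      by (rule CY_uminus[OF cmt_CY[OF Q x fil_mult_right[OF fil_ar] D1]])
    moreover have "delta p - (fr N (delta p) + (\<Sum>a'\<in>N. ar Q a' \<star>\<^bsub>Q\<^esub> rotp Q N a' p)) = - cmt Q (ar Q a \<star>\<^bsub>Q\<^esub> ?D2) ?D1"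
      unfolding f0 s unfolding dp cmt_def by (simp only: add_0 minus_diff_eq)
    ultimately show ?thesis by simp
  qed
qed

lemma Rt_approx:
  assumes Q: "finite (arrs Q)"
  shows "fil n (Rt Q N a U - (\<Sum>p\<in>Pl Q (Suc n). sc (U p) (rotp Q N a p)))"
proof (rule filI)
  fix r :: "('v,'e) bpath" assume r: "plen r < n"
  have "(\<Sum>p\<in>Pl Q (Suc n). U p * rotp Q N a p r) = (\<Sum>p\<in>paths_len Q B (Suc (plen r)). U p * rotp Q N a p r)"
  proof (rule sum.mono_neutral_right[OF finite_Pl[OF Q]])
    show "paths_len Q B (Suc (plen r)) \<subseteq> Pl Q (Suc n)" using r by (auto simp: Pl_iff paths_len_def)
    show "\<forall>p\<in>Pl Q (Suc n) - paths_len Q B (Suc (plen r)). U p * rotp Q N a p r = 0"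
    proof
      fix p assume p: "p \<in> Pl Q (Suc n) - paths_len Q B (Suc (plen r))"
      then have "plen p \<noteq> Suc (plen r)" by (simp add: Pl_iff paths_len_def)
      then show "U p * rotp Q N a p r = 0" using rotp_props[OF Q, of N a p r] by auto
    qed
  qed
  then show "(Rt Q N a U - (\<Sum>p\<in>Pl Q (Suc n). sc (U p) (rotp Q N a p))) r = 0" by (simp add: pw Rt_def)
qed

lemma Rt_Cor:
  assumes Q: "finite (arrs Q)" and U: "U \<in> PQ Q" shows "Rt Q N a U \<in> Cor Q (src Q a) (tgt Q a)"
proof (rule Cor_limit)
  fix n
  have "(\<Sum>p\<in>Pl Q (Suc n). sc (U p) (rotp Q N a p)) \<in> Cor Q (src Q a) (tgt Q a)"
    by (intro Cor_sum Cor_sc PA_F[OF U] conjunct1[OF rotp_props[OF Q]])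
  then show "\<exists>u\<in>Cor Q (src Q a) (tgt Q a). fil n (Rt Q N a U - u)" using Rt_approx[OF Q] by blast
qed

lemma Rt_diff: "Rt Q N a (U - V) = Rt Q N a U - Rt Q N a V"
  by (rule ext) (simp add: Rt_def pw left_diff_distrib sum_subtractf)

lemma Rt_fil:
  assumes "fil (Suc n) U" shows "fil n (Rt Q N a U)"
proof (rule filI)
  fix r :: "('v,'e) bpath" assume "plen r < n"
  then have "U p = 0" if "p \<in> paths_len Q B (Suc (plen r))" for p
    using filD[OF assms, of p] that by (simp add: paths_len_def)
  then show "Rt Q N a U r = 0" unfolding Rt_def by (simp add: sum.neutral)
qed

lemma Rt_homg:
  assumes "homg (Suc n) U" shows "homg n (Rt Q N a U)"
proof (rule homgI)
  fix r :: "('v,'e) bpath" assume "plen r \<noteq> n"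
  then have "U p = 0" if "p \<in> paths_len Q B (Suc (plen r))" for p
    using homgD[OF assms, of p] that by (simp add: paths_len_def)
  then show "Rt Q N a U r = 0" unfolding Rt_def by (simp add: sum.neutral)
qed

text \<open>\<open>delta_rot\<close> summed over all terms, with the infinite sum controlled by
  \<open>Rt_approx\<close>. It expresses a cyclic element through data that is linear in
  \<open>U\<close> and lowers the length by exactly one, which is what the fixed-point equation in
  \<open>higher_order\<close> exploits.\<close>

lemma Rt_CY:
  assumes Q: "wq Q" and U: "U \<in> PQ Q" and cyc: "\<And>p. U p \<noteq> 0 \<Longrightarrow> endv Q p = fst p" and N: "N \<subseteq> arrs Q"
  shows "U - (fr N U + (\<Sum>a\<in>N. ar Q a \<star>\<^bsub>Q\<^esub> Rt Q N a U)) \<in> CY Q"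
proof (rule CY_closed)
  fix n
  note Qf = wq_finite[OF Q]
  let ?P = "Pl Q (Suc n)"
  let ?u = "\<Sum>p\<in>?P. sc (U p) (delta p - (fr N (delta p) + (\<Sum>a\<in>N. ar Q a \<star>\<^bsub>Q\<^esub> rotp Q N a p)))"
  let ?A = "\<Sum>p\<in>?P. sc (U p) (delta p)" and ?C = "\<lambda>a. \<Sum>p\<in>?P. sc (U p) (rotp Q N a p)"
  have A: "fil n (U - ?A)" by (rule fil_mono[OF approx[OF Qf U]]) simp
  have "?u \<in> CY Q"
  proof (rule CY_sum)
    fix p assume p: "p \<in> ?P"
    show "sc (U p) (delta p - (fr N (delta p) + (\<Sum>a\<in>N. ar Q a \<star>\<^bsub>Q\<^esub> rotp Q N a p))) \<in> CY Q"
    proof (cases "U p = 0")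
      case False
      have "valid Q B p" using p by (simp add: Pl_iff)
      from CY_sc[OF delta_rot[OF Q this cyc[OF False] N] PA_F[OF U]] show ?thesis .
    qed simp
  qed
  moreover have "?u = ?A - (fr N ?A + (\<Sum>a\<in>N. ar Q a \<star>\<^bsub>Q\<^esub> ?C a))"
  proof -
    have 1: "(\<Sum>p\<in>?P. sc (U p) (fr N (delta p))) = fr N ?A"
    proof
      fix q :: "('v,'e) bpath"
      show "(\<Sum>p\<in>?P. sc (U p) (fr N (delta p))) q = fr N ?A q"
      proof (cases "\<forall>x\<in>set (snd (snd q)). fst x \<notin> N")
        case True
        show ?thesis unfolding fr_def pw if_P[OF True] ..
      next
        case False
        show ?thesis unfolding fr_def pw if_not_P[OF False] by simp
      qed
    qed
    have "(\<Sum>p\<in>?P. sc (U p) (\<Sum>a\<in>N. ar Q a \<star>\<^bsub>Q\<^esub> rotp Q N a p)) = (\<Sum>a\<in>N. \<Sum>p\<in>?P. sc (U p) (ar Q a \<star>\<^bsub>Q\<^esub> rotp Q N a p))"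
      unfolding sc_sum by (rule sum.swap)
    also have "\<dots> = (\<Sum>a\<in>N. ar Q a \<star>\<^bsub>Q\<^esub> ?C a)" by (simp only: mult_sum_right mult_sc_right)
    finally show ?thesis by (simp only: sc_diff sc_add sum_subtractf sum.distrib 1)
  qed
  moreover have "fil n (fr N U - fr N ?A)"
  proof (rule filI)
    fix p :: "('v,'e) bpath" assume "plen p < n"
    then have "U p - ?A p = 0" using filD[OF A] unfolding minus_apply by blast
    then show "(fr N U - fr N ?A) p = 0" by (simp add: fr_def pw)
  qed
  moreover have "fil n (\<Sum>a\<in>N. ar Q a \<star>\<^bsub>Q\<^esub> (Rt Q N a U - ?C a))"
    by (intro fil_sum fil_mult_left Rt_approx[OF Qf])
  moreover have "U - (fr N U + (\<Sum>a\<in>N. ar Q a \<star>\<^bsub>Q\<^esub> Rt Q N a U)) - (?A - (fr N ?A + (\<Sum>a\<in>N. ar Q a \<star>\<^bsub>Q\<^esub> ?C a)))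
    = (U - ?A) - (fr N U - fr N ?A) - (\<Sum>a\<in>N. ar Q a \<star>\<^bsub>Q\<^esub> (Rt Q N a U - ?C a))"
    unfolding mult_diff_right sum_subtractf by (simp only: algebra_simps)
  ultimately have "fil n (U - (fr N U + (\<Sum>a\<in>N. ar Q a \<star>\<^bsub>Q\<^esub> Rt Q N a U)) - ?u)" "?u \<in> CY Q"
    using fil_diff[OF fil_diff[OF A]] by (simp_all only:)
  then show "\<exists>u\<in>CY Q. fil n (U - (fr N U + (\<Sum>a\<in>N. ar Q a \<star>\<^bsub>Q\<^esub> Rt Q N a U)) - u)" by (rule rev_bexI[rotated])
qed

section \<open>Collecting cyclically equivalent terms\<close>

lemma potential_iff:
  "is_potential Q F B S \<longleftrightarrow> S \<in> PQ Q \<and> fil (Suc 0) S \<and> (\<forall>p. S p \<noteq> 0 \<longrightarrow> endv Q p = fst p)"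
proof
  assume S: "is_potential Q F B S"
  have "fil (Suc 0) S"
  proof (rule filI, rule ccontr)
    fix p :: "('v,'e) bpath" assume "plen p < Suc 0" "S p \<noteq> 0"
    then show False using potential_cyclic[OF S, of p] by simp
  qed
  then show "S \<in> PQ Q \<and> fil (Suc 0) S \<and> (\<forall>p. S p \<noteq> 0 \<longrightarrow> endv Q p = fst p)"
    using potential_PA[OF S] potential_cyclic[OF S] by blast
next
  assume S: "S \<in> PQ Q \<and> fil (Suc 0) S \<and> (\<forall>p. S p \<noteq> 0 \<longrightarrow> endv Q p = fst p)"
  have "is_cyclic Q B p" if p: "S p \<noteq> 0" for p
    unfolding is_cyclic_def
  proof (intro conjI)
    show "valid Q B p" using PA_out p S by blast
    show "endv Q p = fst p" using p S by blast
    show "plen p \<noteq> 0" using filD[of "Suc 0" S p] p S by auto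
  qed
  then show "is_potential Q F B S" using S unfolding is_potential_def by blast
qed

text \<open>\<open>rl\<close> is proportionality of paths modulo cyclic equivalence. Each class is
  collected on one representative, and paths that are cyclically trivial are dropped. The control on
  lengths in the conclusion keeps homogeneous potentials homogeneous and reduced ones
  reduced.\<close>

lemma SP_normal_form:
  assumes Q: "wq Q" and S: "is_potential Q F B S"
  obtains S' where "is_SP Q F Fi B S'" "S - S' \<in> CY Q" "\<And>r. S' r \<noteq> 0 \<Longrightarrow> \<exists>p. plen p = plen r \<and> S p \<noteq> 0"
proof -
  note Qf = wq_finite[OF Q]
  define rl where "rl p q \<longleftrightarrow> (\<exists>c\<in>F. c \<noteq> 0 \<and> delta p - sc c (delta q) \<in> CY Q)" for p q :: "('v,'e) bpath"
  have rl_refl: "rl p p" for p unfolding rl_def by (rule bexI[of _ 1]) simp_all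
  have rl_sym: "rl q p" if pq: "rl p q" for p q
  proof -
    obtain c where c: "c \<in> F" "c \<noteq> 0" "delta p - sc c (delta q) \<in> CY Q" using pq unfolding rl_def by blast
    have "sc (- inverse c) (delta p - sc c (delta q)) \<in> CY Q" by (rule CY_sc[OF c(3)]) (use c(1) in simp)
    moreover have "sc (- inverse c) (delta p - sc c (delta q)) = delta q - sc (inverse c) (delta p)"
      unfolding sc_diff sc_sc using c(2) by (intro ext) (simp add: pw)
    ultimately show ?thesis unfolding rl_def using c by (intro bexI[of _ "inverse c"]) auto
  qed
  have rl_trans: "rl p r" if pq: "rl p q" and qr: "rl q r" for p q r
  proof -
    obtain c where c: "c \<in> F" "c \<noteq> 0" "delta p - sc c (delta q) \<in> CY Q" using pq unfolding rl_def by blast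
    obtain e where e: "e \<in> F" "e \<noteq> 0" "delta q - sc e (delta r) \<in> CY Q" using qr unfolding rl_def by blast
    have "delta p - sc c (delta q) + sc c (delta q - sc e (delta r)) \<in> CY Q" by (intro CY_add CY_sc c e)
    then have "delta p - sc (c * e) (delta r) \<in> CY Q" by (simp only: sc_diff sc_sc diff_add_diff)
    then show ?thesis unfolding rl_def using c e by (intro bexI[of _ "c * e"]) auto
  qed
  \<comment> \<open>Since \<open>CY Q\<close> is graded, a path that is not cyclically trivial is
    equivalent only to paths of its own length. Therefore each coefficient of \<open>S'\<close>
    below is a finite sum.\<close>
  have len: "plen q = plen p" if pq: "rl p q" and np: "delta p \<notin> CY Q" for p q
  proof (rule ccontr)
    assume n: "plen q \<noteq> plen p"
    obtain c where c: "delta p - sc c (delta q) \<in> CY Q" using pq unfolding rl_def by blast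
    have "part (plen p) (delta q) = 0" using n by (intro ext) (auto simp: part_def delta_apply pw)
    then have "part (plen p) (delta p - sc c (delta q)) = delta p"
      unfolding part_diff part_sc part_homg[OF homg_delta] by simp
    then show False using CY_part[OF c, of "plen p"] np by simp
  qed
  \<comment> \<open>Equivalent paths satisfy the same defining predicate, so the choice depends only
    on the class (\<open>rep_eq\<close>).\<close>
  define rep where "rep p = (SOME q. is_cyclic Q B q \<and> rl p q)" for p
  have rep: "is_cyclic Q B (rep p) \<and> rl p (rep p)" if "is_cyclic Q B p" for p
    unfolding rep_def by (rule someI[of _ p]) (use that rl_refl in blast)
  have rep_eq: "rep p = rep q" if pq: "rl p q" for p q
  proof -
    have "rl p x = rl q x" for x using rl_trans[OF rl_sym[OF pq], of x] rl_trans[OF pq, of x] by blast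
    then show ?thesis unfolding rep_def by (simp only:)
  qed
  define k where "k p = (SOME c. c \<in> F \<and> delta p - sc c (delta (rep p)) \<in> CY Q)" for p
  have k: "k p \<in> F \<and> delta p - sc (k p) (delta (rep p)) \<in> CY Q" if "is_cyclic Q B p" for p
    unfolding k_def by (rule someI_ex) (use rep[OF that] in \<open>unfold rl_def, blast\<close>)
  define ok where "ok p \<longleftrightarrow> is_cyclic Q B p \<and> delta p \<notin> CY Q" for p
  define S' where "S' r = (\<Sum>p\<in>paths_len Q B (plen r). if ok p \<and> rep p = r then S p * k p else 0)" for r
  have S'E: "\<exists>p. plen p = plen r \<and> S p \<noteq> 0 \<and> ok p \<and> rep p = r" if nz: "S' r \<noteq> 0" for r
  proof -
    obtain p where p: "p \<in> paths_len Q B (plen r)" "(if ok p \<and> rep p = r then S p * k p else 0) \<noteq> 0"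
      using nz unfolding S'_def by (rule sum.not_neutral_contains_not_neutral)
    have "ok p \<and> rep p = r" using p(2) by (rule contrapos_np) (rule if_not_P)
    moreover from this have "S p \<noteq> 0" using p(2) by auto
    moreover have "plen p = plen r" using p(1) by (simp add: paths_len_def)
    ultimately show ?thesis by blast
  qed
  have S'cyc: "is_cyclic Q B r" if "S' r \<noteq> 0" for r
    using S'E[OF that] rep unfolding ok_def by blast
  have SP: "is_SP Q F Fi B S'"
    unfolding is_SP_def
  proof (intro conjI allI impI Q)
    show "is_potential Q F B S'"
      unfolding is_potential_def PA_def
    proof (intro conjI CollectI allI impI)
      show "S' r \<in> F" for r
        unfolding S'_def using k PA_F[OF potential_PA[OF S]] by (intro F_sum) (simp add: ok_def)
      show "S' r = 0" if "\<not> valid Q B r" for r using S'cyc[of r] that unfolding is_cyclic_def by blast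
      show "is_cyclic Q B r" if "S' r \<noteq> 0" for r using S'cyc[OF that] .
    qed
    fix p q assume p: "S' p \<noteq> 0" and q: "S' q \<noteq> 0" and n: "p \<noteq> q"
    show "\<not> (\<exists>c\<in>F. c \<noteq> 0 \<and> cyc_equiv Q F Fi B (delta p) (\<lambda>r. c * delta q r))"
    proof
      assume "\<exists>c\<in>F. c \<noteq> 0 \<and> cyc_equiv Q F Fi B (delta p) (\<lambda>r. c * delta q r)"
      then have pq: "rl p q" unfolding rl_def cyc_equiv_iff sc_def .
      obtain p1 where p1: "ok p1" "rep p1 = p" using S'E[OF p] by blast
      obtain q1 where q1: "ok q1" "rep q1 = q" using S'E[OF q] by blast
      have pp: "rl p1 p" and qq: "rl q1 q" using rep[of p1] rep[of q1] p1 q1 unfolding ok_def by blast+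
      have "rl p1 q1" by (rule rl_trans[OF rl_trans[OF pp pq] rl_sym[OF qq]])
      from rep_eq[OF this] show False using p1 q1 n by simp
    qed
  qed
  have "S - S' \<in> CY Q"
  proof (rule CY_closed)
    fix n
    define t where "t p = (if ok p then sc (k p) (delta (rep p)) else 0)" for p
    let ?u = "\<Sum>p\<in>Pl Q n. sc (S p) (delta p - t p)"
    have "?u \<in> CY Q"
    proof (rule CY_sum)
      fix p
      show "sc (S p) (delta p - t p) \<in> CY Q"
      proof (cases "S p = 0")
        case False
        then have c: "is_cyclic Q B p" using S unfolding is_potential_def by blast
        have "delta p - t p \<in> CY Q"
        proof (cases "ok p")
          case True
          then show ?thesis using k[OF c] unfolding t_def by simp
        next
          case False
          then show ?thesis using c unfolding t_def ok_def by simp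
        qed
        from CY_sc[OF this PA_F[OF potential_PA[OF S]]] show ?thesis .
      qed simp
    qed
    moreover have "fil n (S - S' - ?u)"
    proof (rule filI)
      fix r :: "('v,'e) bpath" assume r: "plen r < n"
      have 1: "S r = (\<Sum>p\<in>Pl Q n. S p * delta p r)"
        using filD[OF approx[OF Qf potential_PA[OF S]] r] by (simp add: pw)
      have "(\<Sum>p\<in>Pl Q n. S p * t p r) = (\<Sum>p\<in>paths_len Q B (plen r). S p * t p r)"
      proof (rule sum.mono_neutral_right[OF finite_Pl[OF Qf]])
        show "paths_len Q B (plen r) \<subseteq> Pl Q n" using r by (auto simp: Pl_iff paths_len_def)
        show "\<forall>p\<in>Pl Q n - paths_len Q B (plen r). S p * t p r = 0"
        proof
          fix p assume p: "p \<in> Pl Q n - paths_len Q B (plen r)"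
          then have l: "plen p \<noteq> plen r" by (simp add: Pl_iff paths_len_def)
          show "S p * t p r = 0"
          proof (cases "ok p")
            case o: True
            then have "rl p (rep p)" "delta p \<notin> CY Q" using rep[of p] unfolding ok_def by blast+
            then have "plen (rep p) = plen p" by (rule len)
            then have "r \<noteq> rep p" using l by auto
            then show ?thesis using o by (simp add: t_def pw delta_apply)
          qed (simp add: t_def pw)
        qed
      qed
      also have "\<dots> = S' r" unfolding S'_def by (rule sum.cong) (auto simp: t_def pw delta_apply)
      finally have 2: "S' r = (\<Sum>p\<in>Pl Q n. S p * t p r)" ..
      show "(S - S' - ?u) r = 0"
        unfolding pw right_diff_distrib sum_subtractf 1[symmetric] 2[symmetric] by simp
    qed
    ultimately show "\<exists>u\<in>CY Q. fil n (S - S' - u)" by blast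
  qed
  moreover have "\<exists>p. plen p = plen r \<and> S p \<noteq> 0" if "S' r \<noteq> 0" for r using S'E[OF that] by blast
  ultimately show thesis by (rule that[OF SP])
qed


section \<open>Quadratic normal form\<close>

lemma homg_sc: "homg n x \<Longrightarrow> homg n (sc k x)"
  unfolding homg_def pw by simp

lemma homg_add: "homg n x \<Longrightarrow> homg n y \<Longrightarrow> homg n (x + y)"
  unfolding homg_def pw by simp

lemma KK_uminus: "x \<in> KK i j \<Longrightarrow> - x \<in> KK i j"
  using KK_mult_Fi[of "- 1" i x j] by simp

text \<open>Surjectivity complementing the injectivity of \<open>h1\<close>: an element of the
  compositum is an F-combination of products \<open>c c'\<close>, and each of these is realised by
  \<open>c a c'\<close>.\<close>

lemma ael_ex:
  assumes Q: "wq Q" and a: "a \<in> arrs Q" and m: "m \<in> KK (tgt Q a) (src Q a)"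
  shows "\<exists>x. x \<in> Cor Q (tgt Q a) (src Q a) \<and> homg (Suc 0) x \<and> (\<forall>b\<in>arrs Q. h1 Q x b = (if b = a then m else 0))"
proof -
  note Qf = wq_finite[OF Q]
  let ?i = "tgt Q a" and ?j = "src Q a"
  obtain l where l: "\<And>c c'. l c c' \<in> F" and me: "m = (\<Sum>c\<in>B ?i. \<Sum>c'\<in>B ?j. l c c' * (c * c'))"
    using KK_doubleE[OF m] by metis
  let ?t = "\<lambda>c c'. re ?i c \<star>\<^bsub>Q\<^esub> ar Q a \<star>\<^bsub>Q\<^esub> re ?j c'"
  let ?x = "\<Sum>c\<in>B ?i. \<Sum>c'\<in>B ?j. sc (l c c') (?t c c')"
  have "?x \<in> Cor Q ?i ?j"
    by (intro Cor_sum Cor_sc l Cor_mult[OF Qf re_Cor] Cor_mult[OF Qf ar_Cor[OF a] re_Cor] B_Fi)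
  moreover have "homg (Suc 0) (?t c c')" for c c'
    using homg_mult[OF homg_re homg_mult[OF homg_ar homg_re]] by (simp only: add_0 add_0_right)
  then have "homg (Suc 0) ?x" by (intro homg_sum homg_sc)
  moreover have "h1 Q ?x b = (if b = a then m else 0)" if b: "b \<in> arrs Q" for b
  proof -
    have "h1 Q (?t c c') b = (if b = a then c * c' else 0)" if c: "c \<in> B ?i" "c' \<in> B ?j" for c c'
      unfolding h1_re_left[OF Qf PA_mult[OF Qf ar_PA[OF a] re_PA[OF B_Fi[OF c(2)]]] B_Fi[OF c(1)]]
        h1_re_right[OF Qf ar_PA[OF a] B_Fi[OF c(2)] b] h1_ar[OF a b] by simp
    then have "h1 Q ?x b = (\<Sum>c\<in>B ?i. \<Sum>c'\<in>B ?j. l c c' * (if b = a then c * c' else 0))"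
      unfolding h1_sum h1_sc by (intro sum.cong refl) simp
    then show ?thesis unfolding me by simp
  qed
  ultimately show ?thesis by blast
qed

lemma h1_surj:
  assumes Q: "wq Q" and f: "\<And>a. a \<in> arrs Q \<Longrightarrow> f a \<in> KK (tgt Q a) (src Q a)"
    and s: "\<And>a. a \<in> arrs Q \<Longrightarrow> f a \<noteq> 0 \<Longrightarrow> tgt Q a = i \<and> src Q a = j"
  shows "\<exists>x. x \<in> Cor Q i j \<and> homg (Suc 0) x \<and> (\<forall>b\<in>arrs Q. h1 Q x b = f b)"
proof -
  have "\<forall>a\<in>arrs Q. \<exists>x. x \<in> Cor Q (tgt Q a) (src Q a) \<and> homg (Suc 0) x \<and> (\<forall>b\<in>arrs Q. h1 Q x b = (if b = a then f a else 0))"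
    using ael_ex[OF Q _ f] by blast
  from bchoice[OF this] obtain g where
    g: "\<forall>a\<in>arrs Q. g a \<in> Cor Q (tgt Q a) (src Q a) \<and> homg (Suc 0) (g a) \<and> (\<forall>b\<in>arrs Q. h1 Q (g a) b = (if b = a then f a else 0))"
    by blast
  let ?A = "{a \<in> arrs Q. tgt Q a = i \<and> src Q a = j}"
  have A: "finite ?A" using wq_finite[OF Q] by simp
  have "sum g ?A \<in> Cor Q i j" by (rule Cor_sum) (use g in auto)
  moreover have "homg (Suc 0) (sum g ?A)" by (rule homg_sum) (use g in auto)
  moreover have "h1 Q (sum g ?A) b = f b" if b: "b \<in> arrs Q" for b
  proof -
    have "h1 Q (sum g ?A) b = (\<Sum>a\<in>?A. if b = a then f a else 0)"
      unfolding h1_sum by (rule sum.cong) (use g b in auto)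
    also have "\<dots> = (if b \<in> ?A then f b else 0)" by (rule sum.delta'[OF A])
    also have "\<dots> = f b" using s[OF b] b by auto
    finally show ?thesis .
  qed
  ultimately show ?thesis by blast
qed

lemma hat_KK:
  assumes U: "is_potential Q F B U" and a: "a \<in> arrs Q" and b: "b \<in> arrs Q"
  shows "hat Q U a b \<in> KK (tgt Q a) (src Q a)"
proof -
  have *: "hh Q U x y \<in> KK (tgt Q x) (src Q x)" for x y
  proof (cases "hh Q U x y = 0")
    case False
    have o: "src Q y = tgt Q x" using hh_potential[OF U sub_refl False] by simp
    show ?thesis unfolding hh_def o
    proof (intro KK_sum)
      fix c0 c1 c2 assume c: "c0 \<in> B (tgt Q x)" "c1 \<in> B (src Q x)" "c2 \<in> B (tgt Q x)"
      let ?u = "U (tgt Q x, c0, [(x, c1), (y, c2)])"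
      have "?u * c0 * c2 \<in> Fi (tgt Q x)" using PA_F[OF potential_PA[OF U]] F_Fi c by simp
      from KK_mult_Fi[OF this KK_mult_Fj[OF B_Fi[OF c(2)] one_KK]]
      have "?u * c0 * c2 * (c1 * 1) \<in> KK (tgt Q x) (src Q x)" .
      then show "?u * (c0 * c1 * c2) \<in> KK (tgt Q x) (src Q x)" by (simp add: mult_ac)
    qed
  qed (simp add: KK_zero)
  show ?thesis
  proof (cases "hat Q U a b = 0")
    case False
    have "tgt Q b = src Q a \<and> tgt Q a = src Q b" using hat_potential[OF U sub_refl False] by blast
    then have "hh Q U b a \<in> KK (tgt Q a) (src Q a)" using *[of b a] KK_sym by simp
    then show ?thesis unfolding hat_def by (rule KK_add[OF *])
  qed (simp add: KK_zero)
qed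

lemma hat_commute: "hat Q U a b = hat Q U b a"
  unfolding hat_def by (rule add.commute)

text \<open>Rotate every 2-cycle so that the arrow going up in a fixed ordering of the vertices
  stands first. After this only one of the two summands of \<open>hat\<close> can be nonzero, so
  vanishing of the sum forces each of them to vanish, in any characteristic.\<close>

lemma hat_inj:
  assumes Q: "wq Q" and U: "is_potential Q F B U" "homg 2 U"
    and 0: "\<And>a b. a \<in> arrs Q \<Longrightarrow> b \<in> arrs Q \<Longrightarrow> hat Q U a b = 0"
  shows "U \<in> CY Q"
proof -
  note Qf = wq_finite[OF Q] and UP = potential_PA[OF U(1)]
  obtain f :: "'v \<Rightarrow> nat" where f: "inj f"
    using finite_imp_inj_to_nat_seg[OF finite_UNIV[where 'a = 'v]] by blast
  let ?N = "{a \<in> arrs Q. f (src Q a) < f (tgt Q a)}"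
  have N: "?N \<subseteq> arrs Q" "finite ?N" using Qf by auto
  let ?w = "\<lambda>a. Rt Q ?N a U"
  let ?V = "\<Sum>a\<in>?N. ar Q a \<star>\<^bsub>Q\<^esub> ?w a"
  have wC: "?w a \<in> Cor Q (src Q a) (tgt Q a)" for a by (rule Rt_Cor[OF Qf UP])
  have wh: "homg (Suc 0) (?w a)" for a by (rule Rt_homg) (use U(2) in \<open>simp only: numeral_2_eq_2\<close>)
  have fr0: "fr ?N U = 0"
  proof
    fix p :: "('v,'e) bpath"
    have "\<exists>x\<in>set (snd (snd p)). fst x \<in> ?N" if p: "U p \<noteq> 0"
    proof -
      have c: "valid Q B p" "endv Q p = fst p" using potential_cyclic[OF U(1) p] by auto
      have "plen p = 2" using homgD[OF U(2)] p by blast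
      from path2_cases[OF c(1) this] obtain v c0 a1 c1 a2 c2 where e: "p = (v,c0,[(a1,c1),(a2,c2)])" "a1 \<in> arrs Q" "a2 \<in> arrs Q"
        "tgt Q a1 = v" "tgt Q a2 = src Q a1" by metis
      have "src Q a2 = v" using c(2) e(1) by (simp add: endv_def)
      moreover have "f (tgt Q a1) \<noteq> f (src Q a1)" using wq_loopfree[OF Q e(2)] f by (auto dest: injD)
      ultimately show ?thesis using e by auto
    qed
    then show "fr ?N U p = 0 p" unfolding fr_def pw by auto
  qed
  have D: "U - ?V \<in> CY Q"
    using Rt_CY[OF Q UP _ N(1)] potential_cyclic[OF U(1)] unfolding fr0 by simp
  have w0: "?w a = 0" if a: "a \<in> ?N" for a
  proof (rule homg1_eqI[OF Q Cor_PA[OF wC] wh PA_zero homg_0])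
    fix b assume b: "b \<in> arrs Q"
    have aQ: "a \<in> arrs Q" using a by simp
    show "h1 Q (?w a) b = h1 Q 0 b"
    proof (rule ccontr)
      assume "h1 Q (?w a) b \<noteq> h1 Q 0 b"
      then have n: "h1 Q (?w a) b \<noteq> 0" by (simp add: h1_zero)
      have o: "tgt Q b = src Q a" "src Q b = tgt Q a" using h1_Cor[OF wC n] by auto
      have bN: "b \<notin> ?N" using a o by simp
      have hV: "hh Q ?V x y = (\<Sum>e\<in>?N. if tgt Q y = src Q x then h1 Q (ar Q e) x * h1 Q (?w e) y else 0)"
        if "x \<in> arrs Q" "y \<in> arrs Q" for x y
        unfolding hh_sum by (intro sum.cong refl hh_mult[OF Qf fil_ar homg_fil[OF wh] that])
      have "hh Q ?V a b = (\<Sum>e\<in>?N. if a = e then h1 Q (?w e) b else 0)"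
        unfolding hV[OF aQ b] using o by (intro sum.cong refl) (simp add: h1_ar[OF _ aQ])
      also have "\<dots> = h1 Q (?w a) b" unfolding sum.delta'[OF N(2)] using a by (rule if_P)
      finally have 1: "hh Q ?V a b = h1 Q (?w a) b" .
      have 2: "hh Q ?V b a = 0" unfolding hV[OF b aQ]
        by (intro sum.neutral ballI) (use bN in \<open>auto simp: h1_ar[OF _ b]\<close>)
      have "hat Q (U - ?V) a b = 0" by (rule hat_CY[OF Q D aQ b o(1)]) (simp add: o)
      then have "hat Q ?V a b = 0" unfolding hat_diff 0[OF aQ b] by simp
      then show False using n unfolding hat_def 1 2 by simp
    qed
  qed
  have "?V = 0" by (rule sum.neutral) (use w0 in simp)
  then show ?thesis using D by simp
qed

section \<open>Linear changes of arrows and the pivot step\<close>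

lemma cyc_split:
  assumes Q: "finite (arrs Q)" and S: "S \<in> PQ Q" "\<And>p. S p \<noteq> 0 \<Longrightarrow> endv Q p = fst p"
  shows "S = (\<Sum>v\<in>UNIV. re v 1 \<star>\<^bsub>Q\<^esub> S)" "re v 1 \<star>\<^bsub>Q\<^esub> S \<in> Cor Q v v"
proof -
  show "S = (\<Sum>v\<in>UNIV. re v 1 \<star>\<^bsub>Q\<^esub> S)" using re_total[OF Q S(1)] unfolding mult_sum_left by simp
  have e: "(re v 1 \<star>\<^bsub>Q\<^esub> S) p = (if fst p = v then S p else 0)" for p
    using re1_mult_apply[OF Q S(1), of v] by (cases p) simp
  show "re v 1 \<star>\<^bsub>Q\<^esub> S \<in> Cor Q v v"
    by (rule CorI[OF PA_mult[OF Q re_PA[OF Fi_closed(2)] S(1)]]) (use S(2) in \<open>auto simp: e split: if_splits\<close>)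
qed

text \<open>Elements supported on closed paths are sums of diagonal corners, and homomorphisms
  preserve corners and the order.\<close>

lemma hom_potential:
  assumes H: "is_hom Q Q' H" and Q: "wq Q" "wq Q'" and S: "is_potential Q F B S"
  shows "is_potential Q' F B (H S)"
proof -
  note Qf = wq_finite[OF Q(1)] wq_finite[OF Q(2)]
  have P: "S \<in> PQ Q" "fil (Suc 0) S" and c: "\<And>p. S p \<noteq> 0 \<Longrightarrow> endv Q p = fst p"
    using S unfolding potential_iff by auto
  note s = cyc_split[OF Qf(1) P(1) c]
  have "H S = H (\<Sum>v\<in>UNIV. re v 1 \<star>\<^bsub>Q\<^esub> S)" using s(1) by (rule arg_cong)
  also have "\<dots> = (\<Sum>v\<in>UNIV. H (re v 1 \<star>\<^bsub>Q\<^esub> S))" by (rule hom_sum[OF H Cor_PA[OF s(2)]])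
  finally have HS: "H S p = (\<Sum>v\<in>UNIV. H (re v 1 \<star>\<^bsub>Q\<^esub> S) p)" for p by (simp only: sum_fun_apply)
  have "endv Q' p = fst p" if n: "H S p \<noteq> 0" for p
  proof -
    obtain v where "H (re v 1 \<star>\<^bsub>Q\<^esub> S) p \<noteq> 0" using n unfolding HS by (rule sum.not_neutral_contains_not_neutral)
    then show ?thesis using Cor_supp[OF hom_Cor[OF H Qf s(2)]] by metis
  qed
  then show ?thesis unfolding potential_iff using hom_PA[OF H P(1)] hom_fil[OF H Q P] by blast
qed

text \<open>Substitutions whose linear parts have mutually inverse matrices over E;
  \<open>hom_bij\<close> needs nothing beyond the linear parts.\<close>

lemma lin_bij:
  assumes Q: "wq Q" and g: "\<And>e. e \<in> arrs Q \<Longrightarrow> g e \<in> Cor Q (tgt Q e) (src Q e)"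
    and l: "\<And>e. e \<in> arrs Q \<Longrightarrow> l e \<in> Cor Q (tgt Q e) (src Q e)"
    and gl: "\<And>e x. e \<in> arrs Q \<Longrightarrow> x \<in> arrs Q \<Longrightarrow> (\<Sum>c\<in>arrs Q. h1 Q (g e) c * h1 Q (l c) x) = (if x = e then 1 else 0)"
    and lg: "\<And>e x. e \<in> arrs Q \<Longrightarrow> x \<in> arrs Q \<Longrightarrow> (\<Sum>c\<in>arrs Q. h1 Q (l e) c * h1 Q (g c) x) = (if x = e then 1 else 0)"
  shows "bij_betw (ev Q Q g) (PQ Q) (PQ Q)"
proof -
  note Qf = wq_finite[OF Q]
  have *: "fil 2 (ev Q Q m (ev Q Q k (ar Q e)) - ar Q e)"
    if m: "\<And>e. e \<in> arrs Q \<Longrightarrow> m e \<in> Cor Q (tgt Q e) (src Q e)" and k: "\<And>e. e \<in> arrs Q \<Longrightarrow> k e \<in> Cor Q (tgt Q e) (src Q e)"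
    and s: "\<And>x. x \<in> arrs Q \<Longrightarrow> (\<Sum>c\<in>arrs Q. h1 Q (k e) c * h1 Q (m c) x) = (if x = e then 1 else 0)"
    and e: "e \<in> arrs Q" for m k :: "nat \<Rightarrow> ('v,'e) pelt" and e
  proof -
    have M: "is_hom Q Q (ev Q Q m)" by (rule ev_hom[OF Q Qf m])
    have mk: "ev Q Q m (ar Q c) = m c" if "c \<in> arrs Q" for c by (rule ev_ar[OF Q Qf m that])
    have ke: "ev Q Q k (ar Q e) = k e" by (rule ev_ar[OF Q Qf k e])
    have k1: "fil (Suc 0) (k e)" by (rule Cor_fil1[OF wq_loopfree[OF Q e] k[OF e]])
    show ?thesis unfolding ke
    proof (rule fil2I[OF Q])
      show "ev Q Q m (k e) - ar Q e \<in> PQ Q" by (rule PA_diff[OF hom_PA[OF M Cor_PA[OF k[OF e]]] ar_PA[OF e]])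
      show "fil (Suc 0) (ev Q Q m (k e) - ar Q e)" by (rule fil_diff[OF hom_fil[OF M Q Q Cor_PA[OF k[OF e]] k1] fil_ar])
      fix x assume x: "x \<in> arrs Q"
      have "h1 Q (ev Q Q m (k e)) x = (\<Sum>c\<in>arrs Q. h1 Q (k e) c * h1 Q (m c) x)"
        unfolding h1_hom[OF M Q Q Cor_PA[OF k[OF e]] k1 x] by (rule sum.cong) (simp_all add: mk)
      then show "h1 Q (ev Q Q m (k e) - ar Q e) x = 0"
        unfolding h1_diff h1_ar[OF e x] s[OF x] by simp
    qed
  qed
  show ?thesis
    by (rule hom_bij[OF ev_hom[OF Q Qf g] ev_hom[OF Q Qf l] Q Q *[OF g l lg] *[OF l g gl]])
qed

lemma sum_rows:
  fixes Fc :: "'i \<Rightarrow> 'b::field"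
  assumes A: "finite A" "a \<in> A" "b \<in> A" "x \<in> A" "a \<noteq> b"
  shows "(\<Sum>c\<in>A. Fc c * (if c = a then la else if c = b then lb else if x = c then 1 else 0))
    = Fc a * la + Fc b * lb + (if x = a \<or> x = b then 0 else Fc x)"
proof -
  have "(\<Sum>c\<in>A. Fc c * (if c = a then la else if c = b then lb else if x = c then 1 else 0))
    = (\<Sum>c\<in>A. (if c = a then Fc a * la else 0) + (if c = b then Fc b * lb else 0) + (if c = x then (if x = a \<or> x = b then 0 else Fc x) else 0))"
    using A(5) by (intro sum.cong) auto
  also have "\<dots> = Fc a * la + Fc b * lb + (if x = a \<or> x = b then 0 else Fc x)"
    unfolding sum.distrib sum.delta[OF A(1)] using A by simp
  finally show ?thesis .
qed

text \<open>A partial matching of \<open>K\<close>: the pairs are \<open>y\<close> and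
  \<open>z y\<close> for \<open>y\<close> in \<open>Y\<close>, each arrow lies in at most one pair,
  and the two arrows of a pair are opposite.\<close>

definition prs :: "'v wquiver \<Rightarrow> nat set \<Rightarrow> nat set \<Rightarrow> (nat \<Rightarrow> nat) \<Rightarrow> bool" where
  "prs Q K Y z \<longleftrightarrow> Y \<subseteq> K \<inter> arrs Q \<and> z ` Y \<subseteq> K \<inter> arrs Q \<and> inj_on z Y \<and> Y \<inter> z ` Y = {} \<and>
     (\<forall>y\<in>Y. tgt Q (z y) = src Q y \<and> src Q (z y) = tgt Q y)"

definition qf :: "'v wquiver \<Rightarrow> nat set \<Rightarrow> (nat \<Rightarrow> nat) \<Rightarrow> ('v,'e) pelt" where
  "qf Q Y z = (\<Sum>y\<in>Y. ar Q y \<star>\<^bsub>Q\<^esub> ar Q (z y))"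

lemma cyc2_potential:
  assumes Q: "wq Q" and a: "a \<in> arrs Q" "b \<in> arrs Q" "tgt Q b = src Q a" "src Q b = tgt Q a"
  shows "is_potential Q F B (ar Q a \<star>\<^bsub>Q\<^esub> ar Q b) \<and> homg 2 (ar Q a \<star>\<^bsub>Q\<^esub> ar Q b)"
proof -
  note Qf = wq_finite[OF Q]
  have h: "homg 2 (ar Q a \<star>\<^bsub>Q\<^esub> ar Q b)"
    using homg_mult[OF homg_ar homg_ar] by (simp add: numeral_2_eq_2)
  have c: "ar Q a \<star>\<^bsub>Q\<^esub> ar Q b \<in> Cor Q (tgt Q a) (tgt Q a)"
    using Cor_mult[OF Qf ar_Cor[OF a(1)]] ar_Cor[OF a(2)] a(3,4) by simp
  show ?thesis unfolding potential_iff
    using Cor_PA[OF c] fil_mono[OF homg_fil[OF h], of "Suc 0"] Cor_supp[OF c] h by simp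
qed

lemma potential_add:
  assumes "is_potential Q F B S" "is_potential Q F B T" shows "is_potential Q F B (S + T)"
proof -
  have "endv Q p = fst p" if "(S + T) p \<noteq> 0" for p
  proof -
    have "S p \<noteq> 0 \<or> T p \<noteq> 0" using that by (auto simp: plus_fun_apply)
    then show ?thesis using assms unfolding potential_iff by blast
  qed
  then show ?thesis using assms PA_add fil_add unfolding potential_iff by blast
qed

lemma potential_diff:
  assumes "is_potential Q F B S" "is_potential Q F B T" shows "is_potential Q F B (S - T)"
proof -
  have "endv Q p = fst p" if "(S - T) p \<noteq> 0" for p
  proof -
    have "S p \<noteq> 0 \<or> T p \<noteq> 0" using that by (auto simp: minus_apply)
    then show ?thesis using assms unfolding potential_iff by blast
  qed
  then show ?thesis using assms PA_diff fil_diff unfolding potential_iff by blast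
qed

text \<open>Symmetric elimination with the off-diagonal pivot \<open>m\<close> at
  (\<open>a\<close>,\<open>b\<close>). The diagonal entries vanish since an arrow is never opposite
  to itself. The pair is split off with coefficient 1, and a Schur complement supported away from
  \<open>a\<close> and \<open>b\<close> remains.\<close>

lemma pivot:
  assumes Q: "wq Q" and U: "is_potential Q F B U" "homg 2 U"
    and K: "\<And>a b. hat Q U a b \<noteq> 0 \<Longrightarrow> a \<in> K \<and> b \<in> K"
    and n: "hat Q U a b \<noteq> 0"
  shows "\<exists>H. is_hom Q Q H \<and> bij_betw H (PQ Q) (PQ Q) \<and> (\<forall>r\<in>arrs Q - {a,b}. H (ar Q r) = ar Q r) \<and>
    is_potential Q F B (H U - ar Q a \<star>\<^bsub>Q\<^esub> ar Q b) \<and> homg 2 (H U - ar Q a \<star>\<^bsub>Q\<^esub> ar Q b) \<and>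
    (\<forall>x y. hat Q (H U - ar Q a \<star>\<^bsub>Q\<^esub> ar Q b) x y \<noteq> 0 \<longrightarrow> x \<in> K - {a,b} \<and> y \<in> K - {a,b})"
proof -
  note Qf = wq_finite[OF Q] and UP = potential_PA[OF U(1)]
  let ?M = "hat Q U"
  note hp = hat_potential[OF U(1) sub_refl]
  have a: "a \<in> arrs Q" and b: "b \<in> arrs Q" and o: "tgt Q b = src Q a" "src Q b = tgt Q a" using hp[OF n] by auto
  have ab: "a \<noteq> b" using o(1) wq_loopfree[OF Q a] by auto
  have d0: "?M x x = 0" for x
  proof (rule ccontr)
    assume "?M x x \<noteq> 0"
    from hp[OF this] wq_loopfree[OF Q] show False by metis
  qed
  define m where "m = ?M a b"
  have m0: "m \<noteq> 0" using n m_def by simp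
  have mK: "m \<in> KK (tgt Q a) (src Q a)" unfolding m_def by (rule hat_KK[OF U(1) a b])
  have miK: "inverse m \<in> KK (tgt Q a) (src Q a)" by (rule KK_inverse[OF wq_loopfree[OF Q a] mK m0])
  \<comment> \<open>The substitution \<open>a\<close> to \<open>a\<close> - sum of (M(c,b)/m) c over
    the other \<open>c\<close>, and \<open>b\<close> to \<open>b\<close>/m - sum of (M(a,c)/m) c,
    where M is the matrix of \<open>U\<close>. Besides clearing the cross terms it scales the pivot
    to 1.\<close>
  define fa where "fa c = (if c = a then 1 else - (?M c b * inverse m))" for c
  define fb where "fb c = (if c = b then inverse m else - (?M a c * inverse m))" for c
  \<comment> \<open>The inverse substitution: \<open>ka\<close> re-adds what \<open>fa\<close>
    subtracts, and \<open>kb\<close> multiplies by \<open>m\<close> again.\<close>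
  define ka where "ka c = ?M c b * inverse m" for c
  define kb where "kb c = ?M a c" for c
  have pa: "tgt Q c = tgt Q a \<and> src Q c = src Q a" if "?M c b \<noteq> 0" for c using hp[OF that] o by simp
  have pb: "tgt Q c = tgt Q b \<and> src Q c = src Q b" if "?M a c \<noteq> 0" for c using hp[OF that] o by simp
  have MKa: "?M c b \<in> KK (tgt Q a) (src Q a)" if c: "c \<in> arrs Q" for c
  proof (cases "?M c b = 0")
    case False
    then show ?thesis using hat_KK[OF U(1) c b] pa[OF False] by simp
  qed (simp add: KK_zero)
  have MKb: "?M a c \<in> KK (tgt Q a) (src Q a)" if c: "c \<in> arrs Q" for c by (rule hat_KK[OF U(1) a c])
  have sK: "KK (tgt Q b) (src Q b) = KK (tgt Q a) (src Q a)" unfolding o by (rule KK_sym)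
  have ex: "\<exists>x. x \<in> Cor Q (tgt Q e) (src Q e) \<and> homg (Suc 0) x \<and> (\<forall>c\<in>arrs Q. h1 Q x c = f c)"
    if s: "\<And>c. c \<in> arrs Q \<Longrightarrow> f c \<noteq> 0 \<Longrightarrow> tgt Q c = tgt Q e \<and> src Q c = src Q e"
      and f: "\<And>c. c \<in> arrs Q \<Longrightarrow> f c \<in> KK (tgt Q e) (src Q e)" for e f
  proof (rule h1_surj[OF Q _ s])
    fix c assume c: "c \<in> arrs Q"
    show "f c \<in> KK (tgt Q c) (src Q c)"
    proof (cases "f c = 0")
      case False
      then show ?thesis using f[OF c] s[OF c] by simp
    qed (simp add: KK_zero)
  qed
  have "\<exists>x. x \<in> Cor Q (tgt Q a) (src Q a) \<and> homg (Suc 0) x \<and> (\<forall>c\<in>arrs Q. h1 Q x c = fa c)"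
  proof (rule ex)
    fix c assume c: "c \<in> arrs Q"
    show "fa c \<noteq> 0 \<Longrightarrow> tgt Q c = tgt Q a \<and> src Q c = src Q a" unfolding fa_def using pa[of c] by (auto split: if_splits)
    show "fa c \<in> KK (tgt Q a) (src Q a)" unfolding fa_def using one_KK KK_uminus[OF KK_mult[OF MKa[OF c] miK]] by simp
  qed
  then obtain ga where ga: "ga \<in> Cor Q (tgt Q a) (src Q a)" "homg (Suc 0) ga" "\<And>c. c \<in> arrs Q \<Longrightarrow> h1 Q ga c = fa c" by blast
  have "\<exists>x. x \<in> Cor Q (tgt Q a) (src Q a) \<and> homg (Suc 0) x \<and> (\<forall>c\<in>arrs Q. h1 Q x c = ka c)"
  proof (rule ex)
    fix c assume c: "c \<in> arrs Q"
    show "ka c \<noteq> 0 \<Longrightarrow> tgt Q c = tgt Q a \<and> src Q c = src Q a" unfolding ka_def using pa[of c] by auto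
    show "ka c \<in> KK (tgt Q a) (src Q a)" unfolding ka_def by (rule KK_mult[OF MKa[OF c] miK])
  qed
  then obtain la where la: "la \<in> Cor Q (tgt Q a) (src Q a)" "\<And>c. c \<in> arrs Q \<Longrightarrow> h1 Q la c = ka c" by blast
  have "\<exists>x. x \<in> Cor Q (tgt Q b) (src Q b) \<and> homg (Suc 0) x \<and> (\<forall>c\<in>arrs Q. h1 Q x c = fb c)"
  proof (rule ex)
    fix c assume c: "c \<in> arrs Q"
    show "fb c \<noteq> 0 \<Longrightarrow> tgt Q c = tgt Q b \<and> src Q c = src Q b" unfolding fb_def using pb[of c] by (auto split: if_splits)
    show "fb c \<in> KK (tgt Q b) (src Q b)" unfolding fb_def sK using miK KK_uminus[OF KK_mult[OF MKb[OF c] miK]] by simp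
  qed
  then obtain gb where gb: "gb \<in> Cor Q (tgt Q b) (src Q b)" "homg (Suc 0) gb" "\<And>c. c \<in> arrs Q \<Longrightarrow> h1 Q gb c = fb c" by blast
  have "\<exists>x. x \<in> Cor Q (tgt Q b) (src Q b) \<and> homg (Suc 0) x \<and> (\<forall>c\<in>arrs Q. h1 Q x c = kb c)"
  proof (rule ex)
    fix c assume c: "c \<in> arrs Q"
    show "kb c \<noteq> 0 \<Longrightarrow> tgt Q c = tgt Q b \<and> src Q c = src Q b" unfolding kb_def using pb[of c] by auto
    show "kb c \<in> KK (tgt Q b) (src Q b)" unfolding kb_def sK by (rule MKb[OF c])
  qed
  then obtain lb where lb: "lb \<in> Cor Q (tgt Q b) (src Q b)" "\<And>c. c \<in> arrs Q \<Longrightarrow> h1 Q lb c = kb c" by blast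
  define g where "g e = (if e = a then ga else if e = b then gb else ar Q e)" for e
  define l where "l e = (if e = a then la else if e = b then lb else ar Q e)" for e
  have gC: "g e \<in> Cor Q (tgt Q e) (src Q e)" and lC: "l e \<in> Cor Q (tgt Q e) (src Q e)" if "e \<in> arrs Q" for e
    unfolding g_def l_def using ga(1) gb(1) la(1) lb(1) that by auto
  have hg: "h1 Q (g e) x = (if e = a then fa x else if e = b then fb x else if x = e then 1 else 0)" if "e \<in> arrs Q" "x \<in> arrs Q" for e x
    unfolding g_def using ga(3) gb(3) h1_ar that by simp
  have hl: "h1 Q (l e) x = (if e = a then ka x else if e = b then kb x else if x = e then 1 else 0)" if "e \<in> arrs Q" "x \<in> arrs Q" for e x
    unfolding l_def using la(2) lb(2) h1_ar that by simp
  have v: "fa a = 1" "fa b = 0" "fb a = 0" "fb b = inverse m" "ka a = 1" "ka b = 0" "kb a = 0" "kb b = m"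
    unfolding fa_def fb_def ka_def kb_def using ab d0 m0 m_def by auto
  have gl: "(\<Sum>c\<in>arrs Q. h1 Q (g e) c * h1 Q (l c) x) = (if x = e then 1 else 0)" if e: "e \<in> arrs Q" and x: "x \<in> arrs Q" for e x
  proof -
    have "(\<Sum>c\<in>arrs Q. h1 Q (g e) c * h1 Q (l c) x)
      = (\<Sum>c\<in>arrs Q. h1 Q (g e) c * (if c = a then ka x else if c = b then kb x else if x = c then 1 else 0))"
      by (rule sum.cong) (simp_all add: hl x)
    then show ?thesis unfolding sum_rows[OF Qf a b x ab] hg[OF e a] hg[OF e b] hg[OF e x]
      using ab m0 v by (auto simp: fa_def fb_def ka_def kb_def)
  qed
  have lg: "(\<Sum>c\<in>arrs Q. h1 Q (l e) c * h1 Q (g c) x) = (if x = e then 1 else 0)" if e: "e \<in> arrs Q" and x: "x \<in> arrs Q" for e x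
  proof -
    have "(\<Sum>c\<in>arrs Q. h1 Q (l e) c * h1 Q (g c) x)
      = (\<Sum>c\<in>arrs Q. h1 Q (l e) c * (if c = a then fa x else if c = b then fb x else if x = c then 1 else 0))"
      by (rule sum.cong) (simp_all add: hg x)
    then show ?thesis unfolding sum_rows[OF Qf a b x ab] hl[OF e a] hl[OF e b] hl[OF e x]
      using ab m0 v by (auto simp: fa_def fb_def ka_def kb_def)
  qed
  let ?H = "ev Q Q g"
  have H: "is_hom Q Q ?H" by (rule ev_hom[OF Q Qf gC])
  have Hg: "?H (ar Q e) = g e" if "e \<in> arrs Q" for e by (rule ev_ar[OF Q Qf gC that])
  have bij: "bij_betw ?H (PQ Q) (PQ Q)" by (rule lin_bij[OF Q gC lC gl lg])
  have "homg (Suc 0) (?H (ar Q e))" if e: "e \<in> arrs Q" for e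
    unfolding Hg[OF e] g_def using ga(2) gb(2) homg_ar by simp
  from hom_homg[OF H Qf this UP U(2)] have h2: "homg 2 (?H U)" .
  note c2 = cyc2_potential[OF Q a b o]
  let ?W = "?H U - ar Q a \<star>\<^bsub>Q\<^esub> ar Q b"
  have W: "is_potential Q F B ?W" "homg 2 ?W"
    using potential_diff[OF hom_potential[OF H Q Q U(1)] conjunct1[OF c2]] homg_diff[OF h2 conjunct2[OF c2]] .
  have "x \<in> K - {a,b} \<and> y \<in> K - {a,b}" if nW: "hat Q ?W x y \<noteq> 0" for x y
  proof -
    have x: "x \<in> arrs Q" and y: "y \<in> arrs Q" and xy: "tgt Q y = src Q x" "tgt Q x = src Q y"
      using hat_potential[OF W(1) sub_refl nW] by auto
    let ?T = "\<lambda>e. ?M e a * fa y + ?M e b * fb y + (if y = a \<or> y = b then 0 else ?M e y)"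
    have "hat Q (?H U) x y = (\<Sum>e\<in>arrs Q. \<Sum>f\<in>arrs Q. ?M e f * h1 Q (?H (ar Q e)) x * h1 Q (?H (ar Q f)) y)"
      by (rule hat_hom[OF H Q Q UP potential_fil2[OF Q U(1)] x y xy])
    also have "\<dots> = (\<Sum>e\<in>arrs Q. ?T e * (if e = a then fa x else if e = b then fb x else if x = e then 1 else 0))"
    proof (rule sum.cong[OF refl])
      fix e assume e: "e \<in> arrs Q"
      have "(\<Sum>f\<in>arrs Q. ?M e f * h1 Q (?H (ar Q e)) x * h1 Q (?H (ar Q f)) y)
        = (\<Sum>f\<in>arrs Q. ?M e f * (if f = a then fa y else if f = b then fb y else if y = f then 1 else 0)) * h1 Q (g e) x"
        unfolding sum_distrib_right by (intro sum.cong refl) (simp add: Hg e hg y mult_ac)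
      then show "(\<Sum>f\<in>arrs Q. ?M e f * h1 Q (?H (ar Q e)) x * h1 Q (?H (ar Q f)) y)
        = ?T e * (if e = a then fa x else if e = b then fb x else if x = e then 1 else 0)"
        unfolding sum_rows[OF Qf a b y ab] hg[OF e x] .
    qed
    also have "\<dots> = ?T a * fa x + ?T b * fb x + (if x = a \<or> x = b then 0 else ?T x)"
      by (rule sum_rows[OF Qf a b x ab])
    finally have HU: "hat Q (?H U) x y = ?T a * fa x + ?T b * fb x + (if x = a \<or> x = b then 0 else ?T x)" .
    \<comment> \<open>Substituting on the column side already turns row \<open>a\<close> into the
      unit row at \<open>b\<close> and row \<open>b\<close> into \<open>m\<close> times the unit row
      at \<open>a\<close>.\<close>
    have Ta: "?T a = (if y = b then 1 else 0)"
      unfolding d0 m_def[symmetric] using ab m0 v by (auto simp: fb_def)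
    have Tb: "?T b = (if y = a then m else 0)"
      unfolding d0 hat_commute[of Q U b] m_def[symmetric] using ab m0 v by (auto simp: fa_def)
    have hc: "hat Q (ar Q a \<star>\<^bsub>Q\<^esub> ar Q b) x y = (if x = a \<and> y = b \<or> x = b \<and> y = a then 1 else 0)"
      unfolding hat_def hh_mult[OF Qf fil_ar fil_ar x y] hh_mult[OF Qf fil_ar fil_ar y x] h1_ar[OF a x] h1_ar[OF a y] h1_ar[OF b x] h1_ar[OF b y]
      using xy ab by auto
    have nn: "?T a * fa x + ?T b * fb x + (if x = a \<or> x = b then 0 else ?T x) - (if x = a \<and> y = b \<or> x = b \<and> y = a then 1 else 0) \<noteq> 0"
      using nW unfolding hat_diff HU hc .
    have y': "y \<noteq> a \<and> y \<noteq> b"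
    proof (rule ccontr)
      assume "\<not> (y \<noteq> a \<and> y \<noteq> b)"
      then consider "y = a" | "y = b" by blast
      then show False
      proof cases
        case 1
        show False using nn unfolding Ta Tb unfolding 1 using ab m0 v by (auto simp: fb_def hat_commute[of Q U x a] split: if_splits)
      next
        case 2
        show False using nn unfolding Ta Tb unfolding 2 using ab m0 v by (auto simp: fa_def split: if_splits)
      qed
    qed
    have x': "x \<noteq> a \<and> x \<noteq> b" using nn y' unfolding Ta Tb by (auto split: if_splits)
    \<comment> \<open>The Schur complement entry. Each of its summands involves only entries of the
      old matrix, so \<open>x\<close> and \<open>y\<close> remain in \<open>K\<close>.\<close>
    have "?M x a * fa y + ?M x b * fb y + ?M x y \<noteq> 0" using nn x' y' unfolding Ta Tb by simp
    then have "?M x a * fa y \<noteq> 0 \<or> ?M x b * fb y \<noteq> 0 \<or> ?M x y \<noteq> 0" by auto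
    then have "(?M x a \<noteq> 0 \<and> ?M y b \<noteq> 0) \<or> (?M x b \<noteq> 0 \<and> ?M a y \<noteq> 0) \<or> ?M x y \<noteq> 0"
      using y' unfolding fa_def fb_def by auto
    then have "x \<in> K \<and> y \<in> K" using K by blast
    then show ?thesis using x' y' by blast
  qed
  moreover have "\<forall>r\<in>arrs Q - {a,b}. ?H (ar Q r) = ar Q r" using Hg g_def by simp
  ultimately show ?thesis using H bij W by blast
qed

text \<open>Induction on the set \<open>K\<close> supporting the matrix. That arrows outside
  \<open>K\<close> are fixed is part of the claim because the isomorphism for
  \<open>K - {a,b}\<close> must leave the product already split off untouched.\<close>

lemma quad_normal:
  assumes Q: "wq Q" and K: "finite K"
  shows "\<forall>U. is_potential Q F B U \<and> homg 2 U \<and> (\<forall>a b. hat Q U a b \<noteq> 0 \<longrightarrow> a \<in> K \<and> b \<in> K) \<longrightarrow>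
    (\<exists>H Y z. is_hom Q Q H \<and> bij_betw H (PQ Q) (PQ Q) \<and> (\<forall>r\<in>arrs Q - K. H (ar Q r) = ar Q r) \<and>
       prs Q K Y z \<and> H U - qf Q Y z \<in> CY Q)"
  using K
proof (induction K rule: finite_psubset_induct)
  case (psubset K)
  show ?case
  proof (intro allI impI, elim conjE)
    fix U assume U: "is_potential Q F B U" "homg 2 U" and s: "\<forall>a b. hat Q U a b \<noteq> 0 \<longrightarrow> a \<in> K \<and> b \<in> K"
    show "\<exists>H Y z. is_hom Q Q H \<and> bij_betw H (PQ Q) (PQ Q) \<and> (\<forall>r\<in>arrs Q - K. H (ar Q r) = ar Q r) \<and>
       prs Q K Y z \<and> H U - qf Q Y z \<in> CY Q"
    proof (cases "\<forall>a b. hat Q U a b = 0")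
      case True
      have "U \<in> CY Q" by (rule hat_inj[OF Q U]) (use True in blast)
      then have "U - qf Q {} id \<in> CY Q" by (simp add: qf_def)
      moreover have "prs Q K {} id" by (simp add: prs_def)
      ultimately show ?thesis using hom_id bij_betw_id[unfolded id_def] by blast
    next
      case False
      then obtain a b where n: "hat Q U a b \<noteq> 0" by blast
      have abK: "a \<in> K" "b \<in> K" using s n by auto
      have ab: "a \<in> arrs Q" "b \<in> arrs Q" "tgt Q b = src Q a" "src Q b = tgt Q a"
        using hat_potential[OF U(1) sub_refl n] by auto
      have nab: "a \<noteq> b" using ab wq_loopfree[OF Q ab(1)] by auto
      let ?c = "ar Q a \<star>\<^bsub>Q\<^esub> ar Q b"
      obtain H where H: "is_hom Q Q H" "bij_betw H (PQ Q) (PQ Q)" and Hr: "\<forall>r\<in>arrs Q - {a,b}. H (ar Q r) = ar Q r"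
        and W: "is_potential Q F B (H U - ?c)" "homg 2 (H U - ?c)"
          "\<forall>x y. hat Q (H U - ?c) x y \<noteq> 0 \<longrightarrow> x \<in> K - {a,b} \<and> y \<in> K - {a,b}"
        using pivot[OF Q U s[rule_format] n] by blast
      have "K - {a,b} \<subset> K" using abK by blast
      from psubset.IH[OF this] W obtain H' Y z where H': "is_hom Q Q H'" "bij_betw H' (PQ Q) (PQ Q)"
        and Hr': "\<forall>r\<in>arrs Q - (K - {a,b}). H' (ar Q r) = ar Q r" and p: "prs Q (K - {a,b}) Y z"
        and D: "H' (H U - ?c) - qf Q Y z \<in> CY Q" by blast
      have aY: "a \<notin> Y" "b \<notin> Y" "a \<notin> z ` Y" "b \<notin> z ` Y" and Yf: "finite Y"
        using p finite_subset[of Y "arrs Q"] wq_finite[OF Q] unfolding prs_def by auto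
      have zY: "(z(a := b)) ` Y = z ` Y" using aY by (intro image_cong) auto
      have P: "prs Q K (insert a Y) (z(a := b))"
        unfolding prs_def image_insert zY
        using p abK ab aY nab unfolding prs_def by (auto simp: inj_on_def)
      have q: "qf Q (insert a Y) (z(a := b)) = ?c + qf Q Y z"
      proof -
        have "(\<Sum>y\<in>Y. ar Q y \<star>\<^bsub>Q\<^esub> ar Q ((z(a := b)) y)) = (\<Sum>y\<in>Y. ar Q y \<star>\<^bsub>Q\<^esub> ar Q (z y))"
          using aY by (intro sum.cong refl) auto
        then show ?thesis unfolding qf_def sum.insert[OF Yf aY(1)] by simp
      qed
      have UP: "U \<in> PQ Q" by (rule potential_PA[OF U(1)])
      have cP: "?c \<in> PQ Q" using ab wq_finite[OF Q] by simp
      have "H' ?c = ?c" using hom_mult[OF H'(1)] Hr' ab by simp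
      then have "H' (H U) - qf Q (insert a Y) (z(a := b)) = H' (H U - ?c) - qf Q Y z"
        unfolding q hom_diff[OF H'(1) hom_PA[OF H(1) UP] cP] by (simp only: diff_diff_eq)
      then have "H' (H U) - qf Q (insert a Y) (z(a := b)) \<in> CY Q" using D by simp
      moreover have "bij_betw (\<lambda>x. H' (H x)) (PQ Q) (PQ Q)" using bij_betw_trans[OF H(2) H'(2)] by (simp add: comp_def)
      moreover have "\<forall>r\<in>arrs Q - K. H' (H (ar Q r)) = ar Q r"
      proof
        fix r assume r: "r \<in> arrs Q - K"
        then have "r \<in> arrs Q - {a,b}" "r \<in> arrs Q - (K - {a,b})" using abK by auto
        then show "H' (H (ar Q r)) = ar Q r" using Hr Hr' by (simp only: Ball_def)
      qed
      ultimately show ?thesis using hom_comp[OF H(1) H'(1)] P by blast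
    qed
  qed
qed


section \<open>Existence\<close>

lemma valid_free:
  "valid Q B (v,c,L) \<Longrightarrow> \<forall>x\<in>set L. fst x \<notin> N \<Longrightarrow> valid (Q\<lparr>arrs := arrs Q - N\<rparr>) B (v,c,L)"
proof (induction L arbitrary: v c)
  case (Cons x L)
  then show ?case by (cases x) simp
qed simp

lemma fr_PA:
  assumes U: "U \<in> PQ Q" shows "fr N U \<in> PQ (Q\<lparr>arrs := arrs Q - N\<rparr>)"
proof -
  have "fr N U p = 0" if "\<not> valid (Q\<lparr>arrs := arrs Q - N\<rparr>) B p" for p
  proof (cases "\<forall>x\<in>set (snd (snd p)). fst x \<notin> N")
    case True
    obtain v c L where p: "p = (v,c,L)" by (cases p)
    have "\<not> valid Q B p" using valid_free[of Q v c L N] True that unfolding p by auto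
    then show ?thesis using PA_out[OF U] by (simp add: fr_def)
  next
    case False
    then show ?thesis unfolding fr_def by (rule if_not_P)
  qed
  moreover have "fr N U p \<in> F" for p using PA_F[OF U, of p] by (simp add: fr_def)
  ultimately show ?thesis unfolding PA_def by blast
qed

lemma sub_arrs_update: "M \<subseteq> arrs Q \<Longrightarrow> sub (Q\<lparr>arrs := M\<rparr>) Q"
  by (simp add: sub_def)

text \<open>Substitute \<open>a + h a\<close> for the paired arrows. Expanding \<open>q\<close>
  gives \<open>q\<close>, cross terms, and the products of the \<open>h\<close>; up to rotation the
  cross terms are the sum of \<open>a\<close> times \<open>h\<close> of the partner of
  \<open>a\<close>. The remainder to be absorbed is therefore \<open>T h\<close>, and
  \<open>Rt_CY\<close> splits it into the terms free of \<open>N\<close> and a sum of exactly this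
  shape. Since \<open>f\<close> contains no paired arrow it is fixed, so the isomorphism leads from
  \<open>q + f\<close> to the given potential.\<close>

lemma higher_order:
  assumes Q: "wq Q" and p: "prs Q K Y z" and S3: "is_potential Q F B S3" "fil 3 S3"
  defines "N \<equiv> Y \<union> z ` Y"
  shows "\<exists>H f. is_hom Q Q H \<and> bij_betw H (PQ Q) (PQ Q) \<and> is_potential (Q\<lparr>arrs := arrs Q - N\<rparr>) F B f \<and> fil 3 f \<and>
    H (qf Q Y z + f) - (qf Q Y z + S3) \<in> CY Q"
proof -
  note Qf = wq_finite[OF Q] and SP = potential_PA[OF S3(1)]
  have Y: "Y \<subseteq> arrs Q" "z ` Y \<subseteq> arrs Q" "inj_on z Y" "Y \<inter> z ` Y = {}"
    and o: "\<And>y. y \<in> Y \<Longrightarrow> tgt Q (z y) = src Q y \<and> src Q (z y) = tgt Q y" using p unfolding prs_def by auto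
  have N: "N \<subseteq> arrs Q" using Y N_def by auto
  have Yf: "finite Y" using Y(1) Qf by (rule finite_subset)
  \<comment> \<open>The partner of a paired arrow.\<close>
  define bar where "bar a = (if a \<in> Y then z a else the_inv_into Y z a)" for a
  have b1: "bar y = z y" if "y \<in> Y" for y using that bar_def by simp
  have b2: "bar (z y) = y" if "y \<in> Y" for y
  proof -
    have "z y \<notin> Y" using that Y(4) by blast
    then show ?thesis using that Y(3) by (simp add: bar_def the_inv_into_f_f)
  qed
  have bN: "bar a \<in> N \<and> bar (bar a) = a \<and> src Q (bar a) = tgt Q a \<and> tgt Q (bar a) = src Q a" if a: "a \<in> N" for a
  proof -
    consider "a \<in> Y" | y where "y \<in> Y" "a = z y" using a N_def by blast
    then show ?thesis by cases (use b1 b2 o N_def in auto)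
  qed
  \<comment> \<open>What the cross terms and \<open>f\<close> together have to represent: the given
    higher part minus the quadratic contribution of \<open>h\<close>.\<close>
  define T where "T h = S3 - (\<Sum>y\<in>Y. h y \<star>\<^bsub>Q\<^esub> h (z y))" for h :: "nat \<Rightarrow> ('v,'e) pelt"
  define \<Psi> where "\<Psi> h a = (if a \<in> N then Rt Q N (bar a) (T h) else 0)" for h :: "nat \<Rightarrow> ('v,'e) pelt" and a
  define I where "I h \<longleftrightarrow> (\<forall>a\<in>N. h a \<in> Cor Q (tgt Q a) (src Q a) \<and> fil 2 (h a)) \<and> (\<forall>a. a \<notin> N \<longrightarrow> h a = 0)" for h :: "nat \<Rightarrow> ('v,'e) pelt"
  have IC: "h a \<in> Cor Q (tgt Q a) (src Q a)" and I2: "fil 2 (h a)" if "I h" for h a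
    using that unfolding I_def by (cases "a \<in> N"; simp)+
  have TP: "T h \<in> PQ Q" and T3: "fil 3 (T h)" if h: "I h" for h
  proof -
    show "T h \<in> PQ Q" unfolding T_def
      by (intro PA_diff SP PA_sum PA_mult[OF Qf] Cor_PA[OF IC[OF h]])
    show "fil 3 (T h)" unfolding T_def
      by (intro fil_diff S3(2) fil_sum fil_mult'[OF I2[OF h] I2[OF h]]) simp
  qed
  have "\<exists>h. I h \<and> \<Psi> h = h"
  proof (rule fixpoint_exists)
    show "I (\<lambda>_. 0)" by (simp add: I_def)
  next
    fix h assume h: "I h"
    show "I (\<Psi> h)"
      unfolding I_def
    proof (intro conjI ballI allI impI)
      fix a assume a: "a \<in> N"
      have e: "\<Psi> h a = Rt Q N (bar a) (T h)" unfolding \<Psi>_def by (rule if_P[OF a])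
      show "\<Psi> h a \<in> Cor Q (tgt Q a) (src Q a)"
        unfolding e using Rt_Cor[OF Qf TP[OF h], of N "bar a"] bN[OF a] by simp
      show "fil 2 (\<Psi> h a)" unfolding e
        by (rule Rt_fil) (use T3[OF h] in \<open>simp only: numeral_3_eq_3 numeral_2_eq_2\<close>)
    next
      fix a assume "a \<notin> N"
      then show "\<Psi> h a = 0" unfolding \<Psi>_def by (rule if_not_P)
    qed
  next
    fix h k n i assume h: "I h" and k: "I k" and d: "\<And>i. fil n (h i - k i)"
    show "fil (Suc n) (\<Psi> h i - \<Psi> k i)"
    proof (cases "i \<in> N")
      case True
      \<comment> \<open>Both factors have order 2, so a difference of order \<open>n\<close> in
        \<open>h\<close> becomes one of order \<open>n + 2\<close> in the products.
        \<open>Rt\<close> loses one degree, and a net gain of one remains.\<close>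
      have "fil (Suc (Suc n)) (h u \<star>\<^bsub>Q\<^esub> h w - k u \<star>\<^bsub>Q\<^esub> k w)" for u w
      proof -
        have "fil (Suc (Suc n)) ((h u - k u) \<star>\<^bsub>Q\<^esub> h w + k u \<star>\<^bsub>Q\<^esub> (h w - k w))"
          by (rule fil_add[OF fil_mult'[OF d I2[OF h]] fil_mult'[OF I2[OF k] d]]) simp_all
        then show ?thesis unfolding mult_diff_left mult_diff_right diff_add_diff .
      qed
      then have "fil (Suc (Suc n)) (- (\<Sum>y\<in>Y. h y \<star>\<^bsub>Q\<^esub> h (z y) - k y \<star>\<^bsub>Q\<^esub> k (z y)))"
        by (intro fil_uminus fil_sum)
      then have "fil (Suc (Suc n)) (T h - T k)" unfolding T_def sum_subtractf by (simp only: minus_diff_eq diff_diff_swap diff_self diff_0 add_0)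
      from Rt_fil[OF this, of Q N "bar i"] show ?thesis
        unfolding Rt_diff \<Psi>_def if_P[OF True] .
    next
      case False
      show ?thesis unfolding \<Psi>_def if_not_P[OF False] by simp
    qed
  next
    fix x :: "nat \<Rightarrow> ('v,'e) pelt" assume L: "\<And>n. \<exists>y. I y \<and> (\<forall>i. fil n (x i - y i))"
    show "I x"
      unfolding I_def
    proof (intro conjI ballI allI impI)
      fix a assume a: "a \<in> N"
      show "x a \<in> Cor Q (tgt Q a) (src Q a)"
      proof (rule Cor_limit)
        fix n
        obtain y where "I y" "\<forall>i. fil n (x i - y i)" using L by blast
        then show "\<exists>u\<in>Cor Q (tgt Q a) (src Q a). fil n (x a - u)" using IC by blast
      qed
      obtain y where y: "I y" "\<forall>i. fil 2 (x i - y i)" using L by blast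
      have "fil 2 (x a - y a + y a)" by (rule fil_add[OF y(2)[rule_format] I2[OF y(1)]])
      then show "fil 2 (x a)" by (simp only: diff_add_cancel)
    next
      fix a assume a: "a \<notin> N"
      show "x a = 0"
      proof (rule fil_all_eq)
        fix n
        obtain y where y: "I y" "\<forall>i. fil n (x i - y i)" using L by blast
        have "y a = 0" using y(1) a unfolding I_def by blast
        then show "fil n (x a - 0)" using y(2) by metis
      qed
    qed
  qed
  then obtain h where h: "I h" and fix_h: "\<Psi> h = h" by blast
  have Rh: "Rt Q N a (T h) = h (bar a)" if a: "a \<in> N" for a
  proof -
    have "\<Psi> h (bar a) = Rt Q N a (T h)" unfolding \<Psi>_def using bN[OF a] by simp
    then show ?thesis unfolding fix_h by (rule sym)
  qed
  let ?U = "T h" and ?Qr = "Q\<lparr>arrs := arrs Q - N\<rparr>"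
  have cyc: "endv Q p = fst p" if n: "?U p \<noteq> 0" for p
  proof -
    have "S3 p \<noteq> 0 \<or> (\<Sum>y\<in>Y. (h y \<star>\<^bsub>Q\<^esub> h (z y)) p) \<noteq> 0" using n unfolding T_def pw by auto
    then show ?thesis
    proof
      assume "S3 p \<noteq> 0"
      then show ?thesis using potential_cyclic[OF S3(1)] by blast
    next
      assume "(\<Sum>y\<in>Y. (h y \<star>\<^bsub>Q\<^esub> h (z y)) p) \<noteq> 0"
      then obtain y where y: "y \<in> Y" "(h y \<star>\<^bsub>Q\<^esub> h (z y)) p \<noteq> 0" by (rule sum.not_neutral_contains_not_neutral)
      have "h (z y) \<in> Cor Q (src Q y) (tgt Q y)" using IC[OF h, of "z y"] o[OF y(1)] by simp
      from Cor_supp[OF Cor_mult[OF Qf IC[OF h] this] y(2)] show ?thesis by simp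
    qed
  qed
  let ?f = "fr N ?U"
  have f3: "fil 3 ?f" by (rule filI) (simp add: fr_def filD[OF T3[OF h]])
  have fpot: "is_potential ?Qr F B ?f"
    unfolding potential_iff
  proof (intro conjI allI impI)
    show "?f \<in> PQ ?Qr" by (rule fr_PA[OF TP[OF h]])
    show "fil (Suc 0) ?f" by (rule fil_mono[OF f3]) simp
    fix p assume "?f p \<noteq> 0"
    then have "?U p \<noteq> 0" by (rule contrapos_nn) (simp add: fr_def)
    moreover have "endv ?Qr p = endv Q p" unfolding endv_def by (cases p) simp
    ultimately show "endv ?Qr p = fst p" using cyc by (simp only:)
  qed
  have sr: "sub ?Qr Q" by (rule sub_arrs_update) auto
  have wr: "wq ?Qr" by (rule sub_wq[OF sr Q])
  define g where "g a = (if a \<in> N then ar Q a + h a else ar Q a)" for a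
  have gC: "g a \<in> Cor Q (tgt Q a) (src Q a)" if "a \<in> arrs Q" for a
    unfolding g_def using Cor_add[OF ar_Cor[OF that] IC[OF h]] ar_Cor[OF that] by simp
  let ?H = "ev Q Q g"
  have H: "is_hom Q Q ?H" by (rule ev_hom[OF Q Qf gC])
  have Hg: "?H (ar Q a) = g a" if "a \<in> arrs Q" for a by (rule ev_ar[OF Q Qf gC that])
  have HN: "?H (ar Q a) = ar Q a + h a" if "a \<in> N" for a using Hg[of a] N that by (auto simp: g_def)
  have bij: "bij_betw ?H (PQ Q) (PQ Q)"
  proof (rule unitri_bij[OF H Q])
    fix a assume a: "a \<in> arrs Q"
    show "fil 2 (?H (ar Q a) - ar Q a)"
    proof (cases "a \<in> N")
      case True
      show ?thesis unfolding HN[OF True] using I2[OF h] by simp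
    next
      case False
      then show ?thesis unfolding Hg[OF a] by (simp add: g_def)
    qed
  qed
  have Hf: "?H ?f = ?f"
  proof (rule hom_ext[OF hom_restrict[OF H sr Qf] incl_hom[OF sr Qf] wr Q _ potential_PA[OF fpot]])
    fix a assume a: "a \<in> arrs ?Qr"
    then show "?H (ar ?Qr a) = ar ?Qr a" unfolding ar_sub[OF sr a] using Hg[of a] by (simp add: g_def)
  qed
  have YN: "y \<in> N" "z y \<in> N" if "y \<in> Y" for y using that N_def by auto
  have yP: "ar Q y \<in> PQ Q" if "y \<in> N" for y using that N by auto
  have Hq: "?H (qf Q Y z) = (\<Sum>y\<in>Y. (ar Q y + h y) \<star>\<^bsub>Q\<^esub> (ar Q (z y) + h (z y)))"
  proof -
    have "?H (qf Q Y z) = (\<Sum>y\<in>Y. ?H (ar Q y \<star>\<^bsub>Q\<^esub> ar Q (z y)))"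
      unfolding qf_def by (rule hom_sum[OF H]) (intro PA_mult[OF Qf] yP YN)
    then show ?thesis
      by (simp only: hom_mult[OF H yP[OF YN(1)] yP[OF YN(2)]] HN[OF YN(1)] HN[OF YN(2)] cong: sum.cong)
  qed
  have E1: "?U - (?f + (\<Sum>a\<in>N. ar Q a \<star>\<^bsub>Q\<^esub> h (bar a))) \<in> CY Q"
  proof -
    have "(\<Sum>a\<in>N. ar Q a \<star>\<^bsub>Q\<^esub> Rt Q N a ?U) = (\<Sum>a\<in>N. ar Q a \<star>\<^bsub>Q\<^esub> h (bar a))"
      by (intro sum.cong refl) (simp only: Rh)
    moreover have "?U - (?f + (\<Sum>a\<in>N. ar Q a \<star>\<^bsub>Q\<^esub> Rt Q N a ?U)) \<in> CY Q"
      by (rule Rt_CY[OF Q TP[OF h] _ N]) (rule cyc)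
    ultimately show ?thesis by (simp only:)
  qed
  have sN: "(\<Sum>a\<in>N. ar Q a \<star>\<^bsub>Q\<^esub> h (bar a)) = (\<Sum>y\<in>Y. ar Q y \<star>\<^bsub>Q\<^esub> h (z y)) + (\<Sum>y\<in>Y. ar Q (z y) \<star>\<^bsub>Q\<^esub> h y)"
    unfolding N_def sum.union_disjoint[OF Yf finite_imageI[OF Yf] Y(4)] sum.reindex[OF Y(3)] comp_def
    by (intro arg_cong2[where f = "(+)"] sum.cong refl) (simp_all only: b1 b2)
  \<comment> \<open>Expanding \<open>q\<close> leaves \<open>h y\<close> in front of
    \<open>ar Q (z y)\<close>, whereas the rotated form has the arrow in front.\<close>
  have E2: "(\<Sum>y\<in>Y. cmt Q (ar Q (z y)) (h y)) \<in> CY Q"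
  proof (rule CY_sum)
    fix y assume y: "y \<in> Y"
    have "ar Q (z y) \<in> Cor Q (src Q y) (tgt Q y)" using ar_Cor[of "z y" Q] o[OF y] Y(2) y by auto
    then show "cmt Q (ar Q (z y)) (h y) \<in> CY Q" by (rule cmt_CY[OF Q _ fil_ar IC[OF h]])
  qed
  let ?q = "qf Q Y z" and ?SA = "\<Sum>y\<in>Y. ar Q y \<star>\<^bsub>Q\<^esub> h (z y)" and ?SB = "\<Sum>y\<in>Y. h y \<star>\<^bsub>Q\<^esub> ar Q (z y)"
    and ?SC = "\<Sum>y\<in>Y. h y \<star>\<^bsub>Q\<^esub> h (z y)" and ?SD = "\<Sum>y\<in>Y. ar Q (z y) \<star>\<^bsub>Q\<^esub> h y"
  have grp: "q + SB + (SA + SC) + f - (q + s) = - (s - SC - (f + (SA + SD))) - (SD - SB)"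
    for q SA SB SC SD s f :: "('v,'e) pelt" by (simp add: algebra_simps)
  have "?H (?q + ?f) = ?H ?q + ?H ?f"
    by (rule hom_add[OF H _ PA_sub[OF sr potential_PA[OF fpot]]])
      (unfold qf_def, intro PA_sum PA_mult[OF Qf] yP YN)
  also have "\<dots> = ?q + ?SB + (?SA + ?SC) + ?f"
    unfolding Hq Hf unfolding qf_def mult_add_left mult_add_right sum.distrib ..
  finally have "?H (?q + ?f) - (?q + S3) = ?q + ?SB + (?SA + ?SC) + ?f - (?q + S3)" by (rule arg_cong)
  also have "\<dots> = - (S3 - ?SC - (?f + (?SA + ?SD))) - (?SD - ?SB)" by (rule grp)
  also have "\<dots> = - (?U - (?f + (\<Sum>a\<in>N. ar Q a \<star>\<^bsub>Q\<^esub> h (bar a)))) - (\<Sum>y\<in>Y. cmt Q (ar Q (z y)) (h y))"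
    unfolding sN cmt_def sum_subtractf by (simp only: T_def)
  finally have "?H (?q + ?f) - (?q + S3) = - (?U - (?f + (\<Sum>a\<in>N. ar Q a \<star>\<^bsub>Q\<^esub> h (bar a)))) - (\<Sum>y\<in>Y. cmt Q (ar Q (z y)) (h y))" .
  moreover have "\<dots> \<in> CY Q" by (rule CY_diff[OF CY_uminus[OF E1] E2])
  ultimately have "?H (qf Q Y z + ?f) - (qf Q Y z + S3) \<in> CY Q" by (simp only:)
  then show ?thesis using H bij fpot f3 by blast
qed

section \<open>A criterion for triviality, and the splitting\<close>

lemma potential_zero: "is_potential Q F B 0"
  unfolding potential_iff by (simp add: pw)

lemma potential_sum: "(\<And>i. i \<in> I \<Longrightarrow> is_potential Q F B (f i)) \<Longrightarrow> is_potential Q F B (\<Sum>i\<in>I. f i)"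
  by (induction I rule: infinite_finite_induct) (simp_all add: potential_zero potential_add)

lemma inR_homg: "inR x \<longleftrightarrow> homg 0 x"
  unfolding inR_def homg_def ..

lemma bimod_sum_list:
  assumes Q: "finite (arrs Q)" and M: "\<And>m. m \<in> M \<Longrightarrow> m \<in> PQ Q \<and> homg (Suc 0) m"
  shows "set l \<subseteq> {r\<in>PQ Q. inR r} \<times> M \<times> {r\<in>PQ Q. inR r} \<Longrightarrow>
    sum_list (map (\<lambda>(r, x, r'). (r \<star>\<^bsub>Q\<^esub> x) \<star>\<^bsub>Q\<^esub> r') l) \<in> PQ Q \<and>
    homg (Suc 0) (sum_list (map (\<lambda>(r, x, r'). (r \<star>\<^bsub>Q\<^esub> x) \<star>\<^bsub>Q\<^esub> r') l))"
proof (induction l)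
  case (Cons t l)
  obtain r x r' where t: "t = (r,x,r')" by (cases t)
  have m: "r \<in> PQ Q" "homg 0 r" "x \<in> PQ Q" "homg (Suc 0) x" "r' \<in> PQ Q" "homg 0 r'"
    using Cons.prems M[of x] unfolding t inR_homg by auto
  have "(r \<star>\<^bsub>Q\<^esub> x) \<star>\<^bsub>Q\<^esub> r' \<in> PQ Q" by (intro PA_mult[OF Q] m)
  moreover have "homg (Suc 0) ((r \<star>\<^bsub>Q\<^esub> x) \<star>\<^bsub>Q\<^esub> r')"
    using homg_mult[OF homg_mult[OF m(2,4)] m(6)] by (simp only: add_0 add_0_right)
  ultimately show ?case using Cons.IH Cons.prems PA_add homg_add unfolding t list.map sum_list.Cons prod.case by simp
qed simp

lemma deg1_expand:
  assumes Q: "finite (arrs Q)" and x: "x \<in> PQ Q" "homg (Suc 0) x"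
  shows "x = (\<Sum>p\<in>paths_len Q B (Suc 0). sc (x p) (delta p))"
proof
  fix r :: "('v,'e) bpath"
  have "(\<Sum>p\<in>paths_len Q B (Suc 0). sc (x p) (delta p)) r = (\<Sum>p\<in>paths_len Q B (Suc 0). if r = p then x p else 0)"
    unfolding pw by (rule sum.cong) (simp_all add: delta_apply)
  also have "\<dots> = (if r \<in> paths_len Q B (Suc 0) then x r else 0)" by (rule sum.delta'[OF finite_paths_len[OF Q]])
  also have "\<dots> = x r" using PA_out[OF x(1), of r] homgD[OF x(2), of r] by (auto simp: paths_len_def)
  finally show "x r = (\<Sum>p\<in>paths_len Q B (Suc 0). sc (x p) (delta p)) r" ..
qed

text \<open>If every unit row occurs in the matrix, then every arrow is itself a cyclic derivative,
  and the bimodule generated by the arrows is the whole arrow span.\<close>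

lemma trivialI:
  assumes Q: "wq Q" and S: "is_potential Q F B S" "homg 2 S"
    and r: "\<And>b. b \<in> arrs Q \<Longrightarrow> \<exists>a\<in>arrs Q. \<forall>e\<in>arrs Q. hat Q S a e = (if e = b then 1 else 0)"
  shows "is_trivial Q F B S"
proof -
  note Qf = wq_finite[OF Q]
  have d: "\<forall>p. plen p \<noteq> 2 \<longrightarrow> S p = 0" using S(2) unfolding homg_def .
  let ?M = "{cder Q F B a S | a. a \<in> arrs Q}" and ?R = "{r\<in>PQ Q. inR r}"
  have cP: "cder Q F B a S \<in> PQ Q" for a by (rule cder_PA[OF Q S(1) d])
  have ch: "homg (Suc 0) (cder Q F B a S)" for a
  proof (rule homgI)
    fix p :: "('v,'e) bpath" assume "plen p \<noteq> Suc 0"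
    then have "S q = 0" if "q \<in> paths_len Q B (plen p + 1)" for q using d[rule_format, of q] that by (simp add: paths_len_def)
    then show "cder Q F B a S p = 0" unfolding cder_def by (simp add: sum.neutral)
  qed
  have M: "m \<in> PQ Q \<and> homg (Suc 0) m" if "m \<in> ?M" for m using that cP ch by blast
  have arM: "ar Q b \<in> ?M" if b: "b \<in> arrs Q" for b
  proof -
    obtain a where a: "a \<in> arrs Q" "\<forall>e\<in>arrs Q. hat Q S a e = (if e = b then 1 else 0)" using r[OF b] by blast
    have "cder Q F B a S = ar Q b"
      by (rule homg1_eqI[OF Q cP ch ar_PA[OF b] homg_ar]) (simp add: h1_cder[OF Q S(1) d a(1)] h1_ar[OF b] a(2))
    then show ?thesis using a(1) by (metis (mono_tags, lifting) mem_Collect_eq)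
  qed
  have 1: "bimod_gen Q F B ?M \<subseteq> {x\<in>PQ Q. \<forall>p. plen p \<noteq> 1 \<longrightarrow> x p = 0}"
  proof
    fix x assume "x \<in> bimod_gen Q F B ?M"
    from bimod_genD[OF this] obtain l where l: "x = sum_list (map (\<lambda>(r, x, r'). (r \<star>\<^bsub>Q\<^esub> x) \<star>\<^bsub>Q\<^esub> r') l)"
      "set l \<subseteq> ?R \<times> ?M \<times> ?R" by (elim exE conjE)
    from bimod_sum_list[OF Qf M l(2)] have "x \<in> PQ Q" "homg (Suc 0) x" unfolding l(1) by blast+
    then show "x \<in> {x\<in>PQ Q. \<forall>p. plen p \<noteq> 1 \<longrightarrow> x p = 0}" unfolding homg_def by simp
  qed
  have 2: "{x\<in>PQ Q. \<forall>p. plen p \<noteq> 1 \<longrightarrow> x p = 0} \<subseteq> bimod_gen Q F B ?M"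
  proof
    fix x assume "x \<in> {x\<in>PQ Q. \<forall>p. plen p \<noteq> 1 \<longrightarrow> x p = 0}"
    then have x: "x \<in> PQ Q" "homg (Suc 0) x" unfolding homg_def by auto
    let ?A = "paths_len Q B (Suc 0)"
    let ?m = "\<lambda>(r, x, r'). (r \<star>\<^bsub>Q\<^esub> x) \<star>\<^bsub>Q\<^esub> r'"
    have "\<forall>p\<in>?A. \<exists>t. t \<in> ?R \<times> ?M \<times> ?R \<and> ?m t = sc (x p) (delta p)"
    proof
      fix p assume p: "p \<in> ?A"
      obtain v c L where pe: "p = (v,c,L)" by (cases p)
      then obtain a c' where L: "L = [(a,c')]" using p by (cases L) (auto simp: paths_len_def)
      have v: "valid Q B (v,c,[(a,c')])" using p pe L by (simp add: paths_len_def)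
      then have a: "a \<in> arrs Q" and c: "c \<in> Fi v" "c' \<in> Fi (src Q a)" and c'B: "c' \<in> B (src Q a)" by auto
      have w: "x p * c \<in> Fi v" using F_Fi[OF PA_F[OF x(1)]] c by simp
      have "delta p = re v c \<star>\<^bsub>Q\<^esub> ar Q a \<star>\<^bsub>Q\<^esub> re (src Q a) c'"
        using delta_Cons[OF Qf v] delta_Nil[OF c'B] pe L by simp
      also have "\<dots> = (re v c \<star>\<^bsub>Q\<^esub> ar Q a) \<star>\<^bsub>Q\<^esub> re (src Q a) c'"
        by (rule mult_assoc[OF Qf ar_PA[OF a] re_PA[OF c(2)], symmetric])
      finally have "(re v (x p * c) \<star>\<^bsub>Q\<^esub> ar Q a) \<star>\<^bsub>Q\<^esub> re (src Q a) c' = sc (x p) (delta p)"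
        by (simp only: re_sc[OF c(1) PA_F[OF x(1)]] mult_sc_left)
      moreover have "re v (x p * c) \<in> ?R" "re (src Q a) c' \<in> ?R" using w c by simp_all
      ultimately show "\<exists>t. t \<in> ?R \<times> ?M \<times> ?R \<and> ?m t = sc (x p) (delta p)"
        using arM[OF a] by (intro exI[of _ "(re v (x p * c), ar Q a, re (src Q a) c')"] conjI SigmaI) (simp_all only: prod.case)
    qed
    from bchoice[OF this] obtain t where t: "\<forall>p\<in>?A. t p \<in> ?R \<times> ?M \<times> ?R \<and> ?m (t p) = sc (x p) (delta p)" by (elim exE)
    obtain xs where xs: "set xs = ?A" "distinct xs" using finite_distinct_list[OF finite_paths_len[OF Qf]] by blast
    have "sum_list (map ?m (map t xs)) = (\<Sum>p\<in>?A. ?m (t p))"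
      unfolding map_map comp_def sum_list_distinct_conv_sum_set[OF xs(2)] xs(1) ..
    also have "\<dots> = (\<Sum>p\<in>?A. sc (x p) (delta p))" by (rule sum.cong[OF refl]) (use t in blast)
    also have "\<dots> = x" by (rule deg1_expand[OF Qf x, symmetric])
    finally have "x = sum_list (map ?m (map t xs))" ..
    moreover have "set (map t xs) \<subseteq> ?R \<times> ?M \<times> ?R" unfolding set_map xs(1) using t by (intro image_subsetI) blast
    ultimately show "x \<in> bimod_gen Q F B ?M" unfolding bimod_gen_def by (intro CollectI exI[of _ "map t xs"] conjI)
  qed
  show ?thesis unfolding is_trivial_def using d equalityI[OF 1 2] by blast
qed

text \<open>The matrix of \<open>q\<close> is the permutation matrix of the involution exchanging
  \<open>y\<close> and \<open>z y\<close>; disjointness of \<open>Y\<close> and its image leaves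
  only one summand of \<open>hat\<close> at each such position.\<close>

lemma hat_qf:
  assumes Q: "wq Q" and p: "prs Q K Y z" and y0: "y0 \<in> Y" and e: "e \<in> arrs Q"
  shows "tgt Q e = src Q y0 \<Longrightarrow> tgt Q y0 = src Q e \<Longrightarrow> hat Q (qf Q Y z) y0 e = (if e = z y0 then 1 else 0)"
    and "tgt Q e = src Q (z y0) \<Longrightarrow> tgt Q (z y0) = src Q e \<Longrightarrow> hat Q (qf Q Y z) (z y0) e = (if e = y0 then 1 else 0)"
proof -
  note Qf = wq_finite[OF Q]
  have Y: "Y \<subseteq> arrs Q" "z ` Y \<subseteq> arrs Q" "inj_on z Y" "Y \<inter> z ` Y = {}" using p unfolding prs_def by auto
  have Yf: "finite Y" using Y(1) Qf by (rule finite_subset)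
  have hhq: "hh Q (qf Q Y z) a b = (\<Sum>y\<in>Y. if a = y \<and> b = z y then 1 else 0)"
    if "a \<in> arrs Q" "b \<in> arrs Q" "tgt Q b = src Q a" for a b
    unfolding qf_def hh_sum
  proof (rule sum.cong[OF refl])
    fix y assume "y \<in> Y"
    then have "y \<in> arrs Q" "z y \<in> arrs Q" using Y by auto
    then show "hh Q (ar Q y \<star>\<^bsub>Q\<^esub> ar Q (z y)) a b = (if a = y \<and> b = z y then 1 else 0)"
      unfolding hh_mult[OF Qf fil_ar fil_ar that(1,2)] using that h1_ar by simp
  qed
  have y0A: "y0 \<in> arrs Q" "z y0 \<in> arrs Q" using Y y0 by auto
  have n1: "y0 \<noteq> z y" and n2: "z y0 \<noteq> y" if "y \<in> Y" for y using Y(4) y0 that by auto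
  show "hat Q (qf Q Y z) y0 e = (if e = z y0 then 1 else 0)" if "tgt Q e = src Q y0" "tgt Q y0 = src Q e"
  proof -
    have "(\<Sum>y\<in>Y. if y0 = y \<and> e = z y then 1 else 0) = (\<Sum>y\<in>Y. if y0 = y then (if e = z y then 1 else 0 :: 'e) else 0)"
      by (rule sum.cong) auto
    moreover have "(\<Sum>y\<in>Y. if e = y \<and> y0 = z y then 1 else 0) = (0 :: 'e)" using n1 by (intro sum.neutral) auto
    ultimately show ?thesis
      unfolding hat_def hhq[OF y0A(1) e that(1)] hhq[OF e y0A(1) that(2)] using y0 by (simp add: sum.delta'[OF Yf])
  qed
  show "hat Q (qf Q Y z) (z y0) e = (if e = y0 then 1 else 0)" if "tgt Q e = src Q (z y0)" "tgt Q (z y0) = src Q e"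
  proof -
    have "(\<Sum>y\<in>Y. if e = y \<and> z y0 = z y then 1 else 0) = (\<Sum>y\<in>Y. if y0 = y then (if e = y then 1 else 0 :: 'e) else 0)"
      using inj_onD[OF Y(3) _ y0] by (intro sum.cong) auto
    moreover have "(\<Sum>y\<in>Y. if z y0 = y \<and> e = z y then 1 else 0) = (0 :: 'e)" using n2 by (intro sum.neutral) auto
    ultimately show ?thesis
      unfolding hat_def hhq[OF y0A(2) e that(1)] hhq[OF e y0A(2) that(2)] using y0 by (simp add: sum.delta'[OF Yf])
  qed
qed

text \<open>The degree-2 part is normalised first, which transports the higher part to
  \<open>?S3\<close>; \<open>higher_order\<close> then confines the latter to the unpaired arrows.
  The paired arrows form the trivial quiver and the others the reduced one.\<close>

lemma existence:
  assumes SP: "is_SP Q F Fi B S"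
  shows "\<exists>Qt St Qr Sr. arrs Qt \<inter> arrs Qr = {} \<and> is_SP Qt F Fi B St \<and> is_trivial Qt F B St \<and>
    is_SP Qr F Fi B Sr \<and> is_reduced Sr \<and> right_equiv F Fi B Q S (dsumQ Qt Qr) (St + Sr)"
proof -
  have Q: "wq Q" and S: "is_potential Q F B S" using SP_potential[OF SP] by auto
  note Qf = wq_finite[OF Q] and S_PA = potential_PA[OF S]
  let ?S2 = "part 2 S"
  have S2: "is_potential Q F B ?S2" "homg 2 ?S2"
  proof -
    have "fil (Suc 0) ?S2" by (rule fil_mono[OF homg_fil[OF homg_part]]) simp
    moreover have "endv Q p = fst p" if "?S2 p \<noteq> 0" for p
      using that potential_cyclic[OF S, of p] by (auto simp: part_def split: if_splits)
    ultimately show "is_potential Q F B ?S2" unfolding potential_iff using part_PA[OF S_PA] by blast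
  qed (rule homg_part)
  have R: "is_potential Q F B (S - ?S2)" "fil 3 (S - ?S2)"
    using potential_diff[OF S S2(1)] fil_part[OF potential_fil2[OF Q S]] by (simp_all add: numeral_3_eq_3 numeral_2_eq_2)
  have "hat Q ?S2 a b \<noteq> 0 \<Longrightarrow> a \<in> arrs Q \<and> b \<in> arrs Q" for a b using hat_potential[OF S2(1) sub_refl] by blast
  with quad_normal[OF Q Qf] S2 obtain H Y z where H: "is_hom Q Q H" "bij_betw H (PQ Q) (PQ Q)"
    and p: "prs Q (arrs Q) Y z" and D: "H ?S2 - qf Q Y z \<in> CY Q" by blast
  let ?q = "qf Q Y z" and ?S3 = "H (S - ?S2)"
  define N where "N = Y \<union> z ` Y"
  have S3: "is_potential Q F B ?S3" "fil 3 ?S3"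
    using hom_potential[OF H(1) Q Q R(1)] hom_fil[OF H(1) Q Q potential_PA[OF R(1)] R(2)] .
  obtain \<theta> f where th: "is_hom Q Q \<theta>" "bij_betw \<theta> (PQ Q) (PQ Q)" and f: "is_potential (Q\<lparr>arrs := arrs Q - N\<rparr>) F B f" "fil 3 f"
    and E: "\<theta> (?q + f) - (?q + ?S3) \<in> CY Q"
    using higher_order[OF Q p S3] unfolding N_def[symmetric] by blast
  let ?Qt = "Q\<lparr>arrs := N\<rparr>" and ?Qr = "Q\<lparr>arrs := arrs Q - N\<rparr>"
  have Y: "Y \<subseteq> arrs Q" "z ` Y \<subseteq> arrs Q" and o: "\<And>y. y \<in> Y \<Longrightarrow> tgt Q (z y) = src Q y \<and> src Q (z y) = tgt Q y"
    using p unfolding prs_def by auto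
  have NQ: "N \<subseteq> arrs Q" using Y N_def by simp
  have s: "sub ?Qt Q" "sub ?Qr Q" using sub_arrs_update[OF NQ] sub_arrs_update[of "arrs Q - N" Q] by auto
  have w: "wq ?Qt" "wq ?Qr" using sub_wq[OF s(1) Q] sub_wq[OF s(2) Q] .
  have dQ: "dsumQ ?Qt ?Qr = Q" using NQ by (cases Q) (auto simp: dsumQ_def)
  have pt: "prs ?Qt N Y z" using p unfolding prs_def N_def by auto
  have YN: "y \<in> N" "z y \<in> N" if "y \<in> Y" for y using that N_def by auto
  have qe: "qf ?Qt Y z = ?q"
    unfolding qf_def
  proof (rule sum.cong[OF refl])
    fix y assume y: "y \<in> Y"
    have a: "y \<in> arrs ?Qt" "z y \<in> arrs ?Qt" using YN[OF y] by simp_all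
    show "ar ?Qt y \<star>\<^bsub>?Qt\<^esub> ar ?Qt (z y) = ar Q y \<star>\<^bsub>Q\<^esub> ar Q (z y)"
      unfolding mult_sub[OF s(1) Qf ar_PA[OF a(1)] ar_PA[OF a(2)]] unfolding ar_sub[OF s(1) a(1)] ar_sub[OF s(1) a(2)] ..
  qed
  have c2: "is_potential ?Qt F B (ar ?Qt y \<star>\<^bsub>?Qt\<^esub> ar ?Qt (z y)) \<and> homg 2 (ar ?Qt y \<star>\<^bsub>?Qt\<^esub> ar ?Qt (z y))" if y: "y \<in> Y" for y
    by (rule cyc2_potential[OF w(1)]) (use YN[OF y] o[OF y] in simp_all)
  have q: "is_potential ?Qt F B ?q" "homg 2 ?q"
  proof -
    have "is_potential ?Qt F B (qf ?Qt Y z)" unfolding qf_def by (rule potential_sum) (rule conjunct1[OF c2])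
    moreover have "homg 2 (qf ?Qt Y z)" unfolding qf_def by (rule homg_sum) (rule conjunct2[OF c2])
    ultimately show "is_potential ?Qt F B ?q" "homg 2 ?q" unfolding qe .
  qed
  \<comment> \<open>Expanded in basis paths, \<open>?q\<close> and \<open>f\<close> may contain
    cyclically equivalent terms, so both are brought into the form that \<open>is_SP\<close>
    demands.\<close>
  obtain St where St: "is_SP ?Qt F Fi B St" "?q - St \<in> CY ?Qt" "\<And>r. St r \<noteq> 0 \<Longrightarrow> \<exists>p. plen p = plen r \<and> ?q p \<noteq> 0"
    using SP_normal_form[OF w(1) q(1)] by blast
  obtain Sr where Sr: "is_SP ?Qr F Fi B Sr" "f - Sr \<in> CY ?Qr" "\<And>r. Sr r \<noteq> 0 \<Longrightarrow> \<exists>p. plen p = plen r \<and> f p \<noteq> 0"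
    using SP_normal_form[OF w(2) f(1)] by blast
  have Stp: "is_potential ?Qt F B St" and Srp: "is_potential ?Qr F B Sr" using SP_potential St(1) Sr(1) by blast+
  have St2: "homg 2 St"
  proof (rule homgI, rule ccontr)
    fix r :: "('v,'e) bpath" assume r: "plen r \<noteq> 2" "St r \<noteq> 0"
    from St(3)[OF r(2)] obtain p :: "('v,'e) bpath" where "plen p = plen r" "?q p \<noteq> 0" by blast
    then show False using homgD[OF q(2), of p] r(1) by simp
  qed
  have red: "is_reduced Sr"
    unfolding is_reduced_def
  proof (intro allI impI, rule ccontr)
    fix r :: "('v,'e) bpath" assume r: "plen r = 2" "Sr r \<noteq> 0"
    from Sr(3)[OF r(2)] obtain p :: "('v,'e) bpath" where "plen p = plen r" "f p \<noteq> 0" by blast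
    then show False using filD[OF f(2), of p] r(1) by simp
  qed
  have hS: "hat ?Qt St a e = hat ?Qt ?q a e" if "a \<in> arrs ?Qt" "e \<in> arrs ?Qt" "tgt ?Qt e = src ?Qt a" "tgt ?Qt a = src ?Qt e" for a e
    using hat_CY[OF w(1) St(2) that] unfolding hat_diff by simp
  have triv: "is_trivial ?Qt F B St"
  proof (rule trivialI[OF w(1) Stp St2])
    fix b assume b: "b \<in> arrs ?Qt"
    \<comment> \<open>The derivative that returns \<open>b\<close> is the one with respect to the
      partner of \<open>b\<close>.\<close>
    have "\<exists>a\<in>N. src Q a = tgt Q b \<and> tgt Q a = src Q b \<and> (\<forall>e\<in>arrs ?Qt. tgt ?Qt e = src ?Qt a \<longrightarrow> tgt ?Qt a = src ?Qt e \<longrightarrow> hat ?Qt ?q a e = (if e = b then 1 else 0))"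
    proof -
      consider "b \<in> Y" | y where "y \<in> Y" "b = z y" using b N_def by auto
      then show ?thesis
      proof cases
        case 1
        show ?thesis
          by (rule bexI[of _ "z b"]) (use hat_qf(2)[OF w(1) pt 1] qe o[OF 1] YN[OF 1] in auto)
      next
        case 2
        show ?thesis
          by (rule bexI[of _ y]) (use hat_qf(1)[OF w(1) pt 2(1)] qe o[OF 2(1)] YN[OF 2(1)] 2(2) in auto)
      qed
    qed
    then obtain a where a: "a \<in> N" "src Q a = tgt Q b" "tgt Q a = src Q b"
      and ha: "\<forall>e\<in>arrs ?Qt. tgt ?Qt e = src ?Qt a \<longrightarrow> tgt ?Qt a = src ?Qt e \<longrightarrow> hat ?Qt ?q a e = (if e = b then 1 else 0)" by blast
    have aA: "a \<in> arrs ?Qt" using a by simp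
    have "hat ?Qt St a e = (if e = b then 1 else 0)" if e: "e \<in> arrs ?Qt" for e
    proof (cases "tgt ?Qt e = src ?Qt a \<and> tgt ?Qt a = src ?Qt e")
      case True
      then show ?thesis using hS[OF aA e] ha e by simp
    next
      case False
      have "hat ?Qt St a e = 0" using hat_potential[OF Stp sub_refl] False by blast
      moreover have "e \<noteq> b" using False a by auto
      ultimately show ?thesis by simp
    qed
    then show "\<exists>a\<in>arrs ?Qt. \<forall>e\<in>arrs ?Qt. hat ?Qt St a e = (if e = b then 1 else 0)" using aA by blast
  qed
  have P: "?q \<in> PQ Q" "f \<in> PQ Q" "?S3 \<in> PQ Q" "St \<in> PQ Q" "Sr \<in> PQ Q"
    using PA_sub[OF s(1) potential_PA[OF q(1)]] PA_sub[OF s(2) potential_PA[OF f(1)]] potential_PA[OF S3(1)]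
      PA_sub[OF s(1) potential_PA[OF Stp]] PA_sub[OF s(2) potential_PA[OF Srp]] .
  have r1: "right_equiv F Fi B Q S Q (?q + ?S3)"
  proof -
    have "H S = H ?S2 + ?S3" unfolding hom_diff[OF H(1) S_PA potential_PA[OF S2(1)]] by simp
    then have "H S - (?q + ?S3) = H ?S2 - ?q" by simp
    then have "H S - (?q + ?S3) \<in> CY Q" using D by (simp only:)
    then show ?thesis unfolding right_equiv_iff using H by blast
  qed
  have r2: "right_equiv F Fi B Q (?q + f) Q (?q + ?S3)" unfolding right_equiv_iff using th E by blast
  have r3: "right_equiv F Fi B Q (?q + f) Q (St + Sr)"
  proof -
    have "(?q - St) + (f - Sr) \<in> CY Q" by (rule CY_add[OF CY_sub[OF s(1) Q St(2)] CY_sub[OF s(2) Q Sr(2)]])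
    then have "(?q + f) - (St + Sr) \<in> CY Q" by (simp only: add_diff_add)
    then show ?thesis unfolding right_equiv_iff using hom_id bij_betw_id[unfolded id_def] by blast
  qed
  \<comment> \<open>\<open>r2\<close> leads from the normal form to the potential obtained from
    \<open>S\<close>, so it enters inverted.\<close>
  have "right_equiv F Fi B Q S Q (St + Sr)"
    by (rule right_equiv_trans[OF Q Q Q S_PA PA_add[OF P(1,3)] r1
          right_equiv_trans[OF Q Q Q PA_add[OF P(1,3)] PA_add[OF P(1,2)]
            right_equiv_sym[OF Q Q PA_add[OF P(1,2)] PA_add[OF P(1,3)] r2] r3]])
  then have "right_equiv F Fi B Q S (dsumQ ?Qt ?Qr) (St + Sr)" unfolding dQ .
  moreover have "arrs ?Qt \<inter> arrs ?Qr = {}" by auto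
  ultimately show ?thesis using St(1) triv Sr(1) red by blast
qed

end

theorem mainTheorem9:
  fixes F :: "'e::field set" and d :: "'v::finite \<Rightarrow> nat"
    and Fi B :: "'v \<Rightarrow> 'e set" and Q :: "'v wquiver" and S :: "('v,'e) pelt"
  assumes "sp_setup F d Fi B" and "is_SP Q F Fi B S"
  shows "(\<exists>Qt St Qr Sr. arrs Qt \<inter> arrs Qr = {} \<and>
            is_SP Qt F Fi B St \<and> is_trivial Qt F B St \<and>
            is_SP Qr F Fi B Sr \<and> is_reduced Sr \<and>
            right_equiv F Fi B Q S (dsumQ Qt Qr) (St + Sr))
       \<and> (\<forall>Q' S' Qt St Qr Sr Qt' St' Qr' Sr'.
            is_SP Q' F Fi B S' \<and> right_equiv F Fi B Q S Q' S' \<and>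
            arrs Qt \<inter> arrs Qr = {} \<and> is_SP Qt F Fi B St \<and> is_trivial Qt F B St \<and>
            is_SP Qr F Fi B Sr \<and> is_reduced Sr \<and>
            right_equiv F Fi B Q S (dsumQ Qt Qr) (St + Sr) \<and>
            arrs Qt' \<inter> arrs Qr' = {} \<and> is_SP Qt' F Fi B St' \<and> is_trivial Qt' F B St' \<and>
            is_SP Qr' F Fi B Sr' \<and> is_reduced Sr' \<and>
            right_equiv F Fi B Q' S' (dsumQ Qt' Qr') (St' + Sr')
          \<longrightarrow> right_equiv F Fi B Qt St Qt' St' \<and> right_equiv F Fi B Qr Sr Qr' Sr')"
proof -
  interpret sp_data F d Fi B by (rule sp_data.intro[OF assms(1)])
  have w: "wq R" and pot: "is_potential R F B U" if "is_SP R F Fi B U" for R U using SP_potential[OF that] by auto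
  have D: "wq (dsumQ R R') \<and> U + U' \<in> PQ (dsumQ R R')"
    if "arrs R \<inter> arrs R' = {}" "is_SP R F Fi B U" "is_SP R' F Fi B U'" for R R' U U'
    using wq_dsum[OF w[OF that(2)] w[OF that(3)]] PA_sub[OF sub_dsum1 potential_PA[OF pot[OF that(2)]]]
      PA_sub[OF sub_dsum2[OF that(1)] potential_PA[OF pot[OF that(3)]]] by blast
  note wQ = w[OF assms(2)] and SQ = potential_PA[OF pot[OF assms(2)]]
  show ?thesis
  proof (rule conjI[OF existence[OF assms(2)]], intro allI impI, elim conjE)
    fix Q' Qt Qr Qt' Qr' :: "'v wquiver" and S' St Sr St' Sr' :: "('v,'e) pelt"
    assume S': "is_SP Q' F Fi B S'" "right_equiv F Fi B Q S Q' S'"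
      and 1: "arrs Qt \<inter> arrs Qr = {}" "is_SP Qt F Fi B St" "is_trivial Qt F B St" "is_SP Qr F Fi B Sr" "is_reduced Sr"
        "right_equiv F Fi B Q S (dsumQ Qt Qr) (St + Sr)"
      and 2: "arrs Qt' \<inter> arrs Qr' = {}" "is_SP Qt' F Fi B St'" "is_trivial Qt' F B St'" "is_SP Qr' F Fi B Sr'" "is_reduced Sr'"
        "right_equiv F Fi B Q' S' (dsumQ Qt' Qr') (St' + Sr')"
    note D1 = D[OF 1(1,2,4)] and D2 = D[OF 2(1,2,4)]
    note d = conjunct1[OF D1] conjunct2[OF D1] conjunct1[OF D2]
    note w' = w[OF S'(1)] and SQ' = potential_PA[OF pot[OF S'(1)]]
    have "right_equiv F Fi B (dsumQ Qt Qr) (St + Sr) (dsumQ Qt' Qr') (St' + Sr')"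
      by (rule right_equiv_trans[OF d(1) wQ d(3) d(2) SQ right_equiv_sym[OF wQ d(1) SQ d(2) 1(6)]
            right_equiv_trans[OF wQ w' d(3) SQ SQ' S'(2) 2(6)]])
    then show "right_equiv F Fi B Qt St Qt' St' \<and> right_equiv F Fi B Qr Sr Qr' Sr'"
      by (rule uniqueness[OF 1(1) 2(1) 1(2,3) 2(2,3) 1(4,5) 2(4,5)])
  qed
qed

end
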